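(* There exists a constant $\beta>0$ independent of $k$ and $h$ such that for all $\boldsymbol\sigma_h\in\boldsymbol\Sigma_h$, $$\sup_{\boldsymbol 0\ne\boldsymbol\tau_h\in\boldsymbol\Sigma_h}\frac{\mathcal B_h^+(\boldsymbol\sigma_h,\boldsymbol\tau_h)}{\|\boldsymbol\tau_h\|_{\boldsymbol\Sigma_h}}=\sup_{\boldsymbol 0\ne\boldsymbol\tau_h\in\boldsymbol\Sigma_h}\frac{\mathcal B_h^+(\boldsymbol\tau_h,\boldsymbol\sigma_h)}{\|\boldsymbol\tau_h\|_{\boldsymbol\Sigma_h}}\ \ge\ \beta\,\|\boldsymbol\sigma_h\|_{\boldsymbol\Sigma_h}.$$
   Context: $\Omega\subset\mathbb R^3$ is a bounded simply-connected Lipschitz polyhedron with connected boundary $\Gamma$; $k>0$ is the wavenumber; functions are real-valued; $(\cdot,\cdot)$, $\|\cdot\|_0$ are the $L^2(\Omega)$ inner product and norm. Mesh: $\mathcal T_h$ is a shape-regular (conforming) partition of $\Omega$ into simplexes $T$ of diameter $h_T$ (constants may depend on shape-regularity), $h=\max_T h_T$; $\mathcal F_h$ is the set of faces $F$ (diameter $h_F$), $\mathcal F_h^I$ the interior ones. $\mathfrak h$ is the mesh-size function, equal to $h_T$ in the interior of $T$ and to $h_F$ on faces $F$. On $\partial T$, $\boldsymbol n$ is the unit outward normal of $T$. $\langle u,v\rangle_{\partial\mathcal T_h}=\sum_T\int_{\partial T}uv$, $\|v\|_{0,\partial\mathcal T_h}^2=\sum_T\|v\|^2_{0,\partial T}$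 and $\|v\|_{0,\mathcal F_h^I}^2=\sum_{F\in\mathcal F_h^I}\|v\|_{0,F}^2$. On $F=\partial T\cap\partial T'\in\mathcal F_h^I$ the normal jump is $[\![\boldsymbol n\cdot\boldsymbol v]\!]=\boldsymbol n_T\cdot(\boldsymbol v|_T-\boldsymbol v|_{T'})$. $\nabla_h\times$, $\nabla_h\cdot$, $\nabla_h$ are the elementwise operators. Spaces: fix integers $\ell\ge1$, $m\in\{\ell-1,\ell\}$; $\mathbb P_j$ denotes polynomials of degree $\le j$. $\boldsymbol R_h$, $\boldsymbol U_h$: piecewise $[\mathbb P_m(T)]^3$, resp. $[\mathbb P_\ell(T)]^3$, vector fields; $\widehat{\boldsymbol U}_h=\{\widehat{\boldsymbol v}_h\in[L^2(\mathcal F_h)]^3:\widehat{\boldsymbol v}_h|_F\in[\mathbb P_\ell(F)]^3,\ \widehat{\boldsymbol v}_h\cdot\boldsymbol n=0\text{ on }\mathcal F_h,\ \boldsymbol n\times\widehat{\boldsymbol v}_h|_\Gamma=\boldsymbol 0\}$; $M_h$: piecewise $\mathbb P_{\ell+1}(T)$; $\widehat M_h=\{\widehat q_h\in L^2(\mathcal F_h):\widehat q_h|_F\in\mathbb P_{\ell+1}(F),\ \widehat q_h|_\Gamma=0\}$. $\boldsymbol\Sigma_h=\boldsymbol R_h\times\boldsymbol U_h\times\widehat{\boldsymbol U}_h\times M_h\times\widehat M_h$. For $\boldsymbol\sigma=(\boldsymbol r,\boldsymbol u,\widehat{\boldsymbol u},p,\widehat p)$ and $\boldsymbol\tau=(\boldsymbol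 s,\boldsymbol v,\widehat{\boldsymbol v},q,\widehat q)$, $$\begin{aligned}\mathcal B_h^+(\boldsymbol\sigma,\boldsymbol\tau)=&(\boldsymbol r,\boldsymbol s)-(\nabla_h\times\boldsymbol u,\boldsymbol s)+\langle\boldsymbol n\times(\boldsymbol u-\widehat{\boldsymbol u}),\boldsymbol s\rangle_{\partial\mathcal T_h}-(\nabla_h\times\boldsymbol v,\boldsymbol r)+\langle\boldsymbol n\times(\boldsymbol v-\widehat{\boldsymbol v}),\boldsymbol r\rangle_{\partial\mathcal T_h}\\&-(k^2+1)\big((\boldsymbol v,\nabla_hp)-\langle\boldsymbol n\cdot\boldsymbol v,p-\widehat p\rangle_{\partial\mathcal T_h}\big)-(k^2+1)\big((\boldsymbol u,\nabla_hq)-\langle\boldsymbol n\cdot\boldsymbol u,q-\widehat q\rangle_{\partial\mathcal T_h}\big)-k^2(\boldsymbol u,\boldsymbol v)\\&-\langle\mathfrak h^{-1}\boldsymbol n\times(\boldsymbol u-\widehat{\boldsymbol u}),\boldsymbol n\times(\boldsymbol v-\widehat{\boldsymbol v})\rangle_{\partial\mathcal T_h}+(k^2+1)\langle\mathfrak h^{-1}(p-\widehat p),q-\widehat q\rangle_{\partial\mathcal T_h},\end{aligned}$$ $$\begin{aligned}\|\boldsymbol\tau\|_{\boldsymbol\Sigma_h}^2=&\|\boldsymbol s\|_0^2+\|\nabla_h\times\boldsymbol v\|_0^2+\|\mathfrak h^{-1/2}\boldsymbol n\times(\boldsymbol v-\widehat{\boldsymbol v})\|_{0,\partial\mathcal T_h}^2+k^2\|\boldsymbol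 v\|_0^2\\&+(k^2+1)\Big(\|\mathfrak h\nabla_h\cdot\boldsymbol v\|_0^2+\|\mathfrak h^{1/2}[\![\boldsymbol n\cdot\boldsymbol v]\!]\|_{0,\mathcal F_h^I}^2+\|\nabla_hq\|_0^2+\|\mathfrak h^{-1/2}(q-\widehat q)\|_{0,\partial\mathcal T_h}^2\Big).\end{aligned}$$ *)

theory Defs
  imports "HOL-Analysis.Analysis"
begin

section \<open>Domain and mesh\<close>

text \<open>
  Near each boundary point the domain is the strict epigraph, in some direction \<open>e\<close>, of a Lipschitz
  function on the plane orthogonal to \<open>e\<close>.  A polyhedron is not assumed to be convex, so
  the library's \<open>polyhedron\<close> does not apply; its closure is a finite union of polytopes.
\<close>

definition lipschitz_domain :: "(real^3) set \<Rightarrow> bool" where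
  "lipschitz_domain \<Omega> \<longleftrightarrow> open \<Omega> \<and>
     (\<forall>z\<in>frontier \<Omega>. \<exists>U e L \<phi>. open U \<and> z \<in> U \<and> norm e = 1 \<and>
        L-lipschitz_on {y. y \<bullet> e = 0} (\<phi> :: real^3 \<Rightarrow> real) \<and>
        \<Omega> \<inter> U = {x \<in> U. \<phi> (x - (x \<bullet> e) *\<^sub>R e) < x \<bullet> e})"

definition lipschitz_polyhedron :: "(real^3) set \<Rightarrow> bool" where
  "lipschitz_polyhedron \<Omega> \<longleftrightarrow> \<Omega> \<noteq> {} \<and> lipschitz_domain \<Omega> \<and>
     (\<exists>P. finite P \<and> (\<forall>p\<in>P. polytope p) \<and> closure \<Omega> = \<Union>P)"

text \<open>Conformity is contained in \<open>triangulation\<close>: two elements meet in a common face, possibly empty.\<close>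

definition simplicial_mesh :: "(real^3) set \<Rightarrow> (real^3) set set \<Rightarrow> bool" where
  "simplicial_mesh \<Omega> \<T> \<longleftrightarrow> triangulation \<T> \<and> (\<forall>T\<in>\<T>. 3 simplex T) \<and> \<Union>\<T> = closure \<Omega>"

definition shape_regular :: "real \<Rightarrow> (real^3) set set \<Rightarrow> bool" where
  "shape_regular \<kappa> \<T> \<longleftrightarrow> (\<forall>T\<in>\<T>. \<exists>c r. 0 < r \<and> cball c r \<subseteq> T \<and> diameter T \<le> \<kappa> * r)"

definition mesh_faces :: "(real^3) set set \<Rightarrow> (real^3) set set" where
  "mesh_faces \<T> = {F. \<exists>T\<in>\<T>. F facet_of T}"

definition interior_faces :: "(real^3) set set \<Rightarrow> (real^3) set set" where
  "interior_faces \<T> = {F. \<exists>T\<in>\<T>. \<exists>T'\<in>\<T>. T \<noteq> T' \<and> F facet_of T \<and> F facet_of T'}"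

definition outward_normal :: "(real^3) set \<Rightarrow> (real^3) set \<Rightarrow> real^3" where
  "outward_normal T F = (THE n. norm n = 1 \<and> (\<forall>x\<in>F. \<forall>y\<in>T. n \<bullet> (y - x) \<le> 0))"


section \<open>Polynomials and discrete spaces\<close>

text \<open>Total degree at most \<open>j\<close>; \<open>\<alpha>\<close> ranges over multi-indices.\<close>

definition polys :: "nat \<Rightarrow> (real^3 \<Rightarrow> real) set" where
  "polys j = {f. \<exists>c :: (3 \<Rightarrow> nat) \<Rightarrow> real.
     f = (\<lambda>x. \<Sum>\<alpha> | (\<Sum>i\<in>UNIV. \<alpha> i) \<le> j. c \<alpha> * (\<Prod>i\<in>UNIV. (x $ i) ^ \<alpha> i))}"

definition vpolys :: "nat \<Rightarrow> (real^3 \<Rightarrow> real^3) set" where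
  "vpolys j = {f. \<forall>i. (\<lambda>x. f x $ i) \<in> polys j}"

text \<open>
  A broken field is a family \<open>v T\<close> indexed by the elements.  The polynomial \<open>v T\<close> on
  \<open>T\<close> is identified with its unique polynomial extension to the whole space, so that traces on the
  faces of \<open>T\<close> and derivatives are those of \<open>v T\<close>.  A face polynomial has no unique extension, so a
  field on the skeleton is a family \<open>w F\<close> of polynomials restricted to \<open>F\<close> and set to 0 off \<open>F\<close>.
  Entries at sets that are not elements (or faces) are 0.  Hence every discrete function has exactly
  one representative, and it is the zero function iff the representative is identically 0.
\<close>

type_synonym 'a family = "(real^3) set \<Rightarrow> real^3 \<Rightarrow> 'a"

definition broken_space :: "(real^3 \<Rightarrow> 'a) set \<Rightarrow> (real^3) set set \<Rightarrow> 'a::zero family set" where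
  "broken_space P \<T> = {v. (\<forall>T\<in>\<T>. v T \<in> P) \<and> (\<forall>T. T \<notin> \<T> \<longrightarrow> v T = (\<lambda>_. 0))}"

definition skeleton_space :: "(real^3 \<Rightarrow> 'a) set \<Rightarrow> (real^3) set set \<Rightarrow> 'a::zero family set" where
  "skeleton_space P \<T> =
     {w. (\<forall>F\<in>mesh_faces \<T>. \<exists>g\<in>P. w F = (\<lambda>x. if x \<in> F then g x else 0)) \<and>
         (\<forall>F. F \<notin> mesh_faces \<T> \<longrightarrow> w F = (\<lambda>_. 0))}"

definition Uhat_space :: "nat \<Rightarrow> (real^3) set \<Rightarrow> (real^3) set set \<Rightarrow> (real^3) family set" where
  "Uhat_space l \<Omega> \<T> =
     {w \<in> skeleton_space (vpolys l) \<T>.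
        \<forall>T\<in>\<T>. \<forall>F. F facet_of T \<longrightarrow>
          (\<forall>x\<in>F. w F x \<bullet> outward_normal T F = 0) \<and>
          (F \<subseteq> frontier \<Omega> \<longrightarrow> (\<forall>x\<in>F. cross3 (outward_normal T F) (w F x) = 0))}"

definition Mhat_space :: "nat \<Rightarrow> (real^3) set \<Rightarrow> (real^3) set set \<Rightarrow> real family set" where
  "Mhat_space l \<Omega> \<T> =
     {w \<in> skeleton_space (polys (l + 1)) \<T>.
        \<forall>F\<in>mesh_faces \<T>. F \<subseteq> frontier \<Omega> \<longrightarrow> (\<forall>x\<in>F. w F x = 0)}"

type_synonym dofs =
  "(real^3) family \<times> (real^3) family \<times> (real^3) family \<times> real family \<times> real family"

definition Sigma_h :: "nat \<Rightarrow> nat \<Rightarrow> (real^3) set \<Rightarrow> (real^3) set set \<Rightarrow> dofs set" where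
  "Sigma_h l m \<Omega> \<T> =
     broken_space (vpolys m) \<T> \<times> broken_space (vpolys l) \<T> \<times> Uhat_space l \<Omega> \<T> \<times>
     broken_space (polys (l + 1)) \<T> \<times> Mhat_space l \<Omega> \<T>"

definition zero_h :: dofs where
  "zero_h = (\<lambda>_ _. 0, \<lambda>_ _. 0, \<lambda>_ _. 0, \<lambda>_ _. 0, \<lambda>_ _. 0)"


section \<open>Differential operators\<close>

definition partial :: "3 \<Rightarrow> (real^3 \<Rightarrow> real) \<Rightarrow> real^3 \<Rightarrow> real" where
  "partial i f x = frechet_derivative f (at x) (axis i 1)"

definition grad :: "(real^3 \<Rightarrow> real) \<Rightarrow> real^3 \<Rightarrow> real^3" where
  "grad f x = (\<chi> i. partial i f x)"

definition divergence :: "(real^3 \<Rightarrow> real^3) \<Rightarrow> real^3 \<Rightarrow> real" where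
  "divergence v x = (\<Sum>i\<in>UNIV. partial i (\<lambda>y. v y $ i) x)"

definition curl :: "(real^3 \<Rightarrow> real^3) \<Rightarrow> real^3 \<Rightarrow> real^3" where
  "curl v x = vector
     [partial 2 (\<lambda>y. v y $ 3) x - partial 3 (\<lambda>y. v y $ 2) x,
      partial 3 (\<lambda>y. v y $ 1) x - partial 1 (\<lambda>y. v y $ 3) x,
      partial 1 (\<lambda>y. v y $ 2) x - partial 2 (\<lambda>y. v y $ 1) x]"


section \<open>Integrals, bilinear form and norm\<close>

text \<open>
  Surface integral over the triangle \<open>F\<close>, by the affine parametrization over the reference triangle;
  \<open>norm (cross3 (b - a) (c - a))\<close> is its area element.  The vertices of \<open>F\<close> are unique up to
  order, and reordering them changes the parametrization by an affine map of determinant 1 or -1, so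
  the value does not depend on the choice.
\<close>

definition face_integral :: "(real^3) set \<Rightarrow> (real^3 \<Rightarrow> real) \<Rightarrow> real" where
  "face_integral F g =
     (let (a, b, c) = (SOME (a, b, c). F = convex hull {a, b, c}) in
        norm (cross3 (b - a) (c - a)) *
        (LINT st : {(s, t). 0 \<le> s \<and> 0 \<le> t \<and> s + t \<le> 1} | lborel.
           g (a + fst st *\<^sub>R (b - a) + snd st *\<^sub>R (c - a))))"

definition L2_inner :: "(real^3) set set \<Rightarrow> 'a::real_inner family \<Rightarrow> 'a family \<Rightarrow> real" where
  "L2_inner \<T> f g = (\<Sum>T\<in>\<T>. LINT x : T | lborel. f T x \<bullet> g T x)"

text \<open>Integrands on the element boundaries depend on the element \<open>T\<close>, its face \<open>F\<close> and the point.\<close>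

definition bdry_inner ::
  "(real^3) set set \<Rightarrow> ((real^3) set \<Rightarrow> 'a::real_inner family) \<Rightarrow> ((real^3) set \<Rightarrow> 'a family) \<Rightarrow> real" where
  "bdry_inner \<T> f g =
     (\<Sum>T\<in>\<T>. \<Sum>F | F facet_of T. face_integral F (\<lambda>x. f T F x \<bullet> g T F x))"

text \<open>Symmetric in the two neighbours, since their normals are opposite.\<close>

definition normal_jump :: "(real^3) set set \<Rightarrow> (real^3) family \<Rightarrow> real family" where
  "normal_jump \<T> v F x =
     (let (T, T') = (SOME (T, T'). T \<in> \<T> \<and> T' \<in> \<T> \<and> T \<noteq> T' \<and> F facet_of T \<and> F facet_of T') in
        outward_normal T F \<bullet> (v T x - v T' x))"

abbreviation tangential_gap ::
  "(real^3) family \<Rightarrow> (real^3) family \<Rightarrow> (real^3) set \<Rightarrow> (real^3) family" where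
  "tangential_gap u uF \<equiv> (\<lambda>T F x. cross3 (outward_normal T F) (u T x - uF F x))"

text \<open>The mesh-size function is \<open>diameter T\<close> inside an element \<open>T\<close> and \<open>diameter F\<close> on a face \<open>F\<close>.\<close>

definition B_plus :: "real \<Rightarrow> (real^3) set set \<Rightarrow> dofs \<Rightarrow> dofs \<Rightarrow> real" where
  "B_plus k \<T> = (\<lambda>(r, u, uF, p, pF) (s, v, vF, q, qF).
       L2_inner \<T> r s
     - L2_inner \<T> (\<lambda>T. curl (u T)) s
     + bdry_inner \<T> (tangential_gap u uF) (\<lambda>T F x. s T x)
     - L2_inner \<T> (\<lambda>T. curl (v T)) r
     + bdry_inner \<T> (tangential_gap v vF) (\<lambda>T F x. r T x)
     - (k\<^sup>2 + 1) * (L2_inner \<T> v (\<lambda>T. grad (p T))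
         - bdry_inner \<T> (\<lambda>T F x. outward_normal T F \<bullet> v T x) (\<lambda>T F x. p T x - pF F x))
     - (k\<^sup>2 + 1) * (L2_inner \<T> u (\<lambda>T. grad (q T))
         - bdry_inner \<T> (\<lambda>T F x. outward_normal T F \<bullet> u T x) (\<lambda>T F x. q T x - qF F x))
     - k\<^sup>2 * L2_inner \<T> u v
     - bdry_inner \<T> (\<lambda>T F x. inverse (diameter F) *\<^sub>R tangential_gap u uF T F x) (tangential_gap v vF)
     + (k\<^sup>2 + 1) *
         bdry_inner \<T> (\<lambda>T F x. inverse (diameter F) * (p T x - pF F x)) (\<lambda>T F x. q T x - qF F x))"

abbreviation L2_sq :: "(real^3) set set \<Rightarrow> 'a::real_inner family \<Rightarrow> real" where
  "L2_sq \<T> f \<equiv> L2_inner \<T> f f"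

abbreviation bdry_sq :: "(real^3) set set \<Rightarrow> ((real^3) set \<Rightarrow> 'a::real_inner family) \<Rightarrow> real" where
  "bdry_sq \<T> f \<equiv> bdry_inner \<T> f f"

definition Sigma_norm :: "real \<Rightarrow> (real^3) set set \<Rightarrow> dofs \<Rightarrow> real" where
  "Sigma_norm k \<T> = (\<lambda>(s, v, vF, q, qF). sqrt (
       L2_sq \<T> s
     + L2_sq \<T> (\<lambda>T. curl (v T))
     + bdry_sq \<T> (\<lambda>T F x. inverse (sqrt (diameter F)) *\<^sub>R tangential_gap v vF T F x)
     + k\<^sup>2 * L2_sq \<T> v
     + (k\<^sup>2 + 1) *
        ( L2_sq \<T> (\<lambda>T x. diameter T * divergence (v T) x)
        + (\<Sum>F\<in>interior_faces \<T>.
             face_integral F (\<lambda>x. (sqrt (diameter F) * normal_jump \<T> v F x)\<^sup>2))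
        + L2_sq \<T> (\<lambda>T. grad (q T))
        + bdry_sq \<T> (\<lambda>T F x. inverse (sqrt (diameter F)) * (q T x - qF F x)))))"

end

theory Submission
  imports Defs "HOL-Library.Multiset"
begin

text \<open>
  Since the bilinear form is symmetric, it is enough to bound it below on four test functions.  Changing the sign of
  \<open>(u, uF)\<close> controls \<open>r\<close>, \<open>u\<close> and both face gaps; testing with \<open>- curl u\<close> controls the curl; testing with
  the weighted divergence of \<open>u\<close> and, on interior faces, its weighted normal jump controls these two
  quantities through integration by parts.  Finally \<open>p\<close> is replaced by a nearby continuous piecewise polynomial that
  vanishes on the boundary; minus its gradient is an admissible, curl-free test field without tangential gap, and the
  distance to \<open>p\<close> is controlled by \<open>p - pF\<close>, so the gradient of \<open>p\<close> is controlled as well.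

  All mesh-independent constants come from one fact: the Bernstein basis of a simplex has, up to the scaling by
  the volume of the simplex, the same positive definite Gram matrix for every simplex.
\<close>

text \<open>The proof is indirect. If the supremum stayed below \<open>\<beta>\<close> times the
  norm, each test would give a quadratic inequality for the square root of one group of terms of the
  norm. Apart from the quantity to be bounded, the errors of the curl, divergence and gradient tests
  involve only what the sign change already controls, so they can be absorbed. The factors
  \<open>k\<^sup>2 + 1\<close> of form and norm match in every inequality, and
  \<open>k \<le> sqrt (k\<^sup>2 + 1)\<close> handles the zero order term; this is why no constant
  depends on \<open>k\<close>. The broken gradient of \<open>p\<close> would be a poor test field:
  its tangential part jumps across faces, the norm weighs this gap by a negative power of the mesh
  size, and an inverse estimate in terms of \<open>p - pF\<close> would lose a power. For a
  continuous function the tangential parts of the gradients match, so the gap can be made 0 and only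
  a gradient distance has to be paid. That distance is estimated coefficient by coefficient along
  chains of elements inside a vertex star. A volume argument bounds the number of elements of a
  star, hence the length of a chain, by a power of \<open>\<kappa>\<close>.\<close>

lemma finite_multi_indices: "finite {\<alpha> :: 3 \<Rightarrow> nat. (\<Sum>i\<in>UNIV. \<alpha> i) \<le> j}"
proof (rule finite_subset)
  have "\<alpha> i \<le> sum \<alpha> UNIV" for \<alpha> :: "3 \<Rightarrow> nat" and i
    by (rule member_le_sum) auto
  then show "{\<alpha> :: 3 \<Rightarrow> nat. (\<Sum>i\<in>UNIV. \<alpha> i) \<le> j} \<subseteq> PiE UNIV (\<lambda>_. {..j})"
    by (auto simp: PiE_def intro: order_trans)
qed (simp add: finite_PiE)

lemma polys_zero: "(\<lambda>_. 0) \<in> polys j"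
  unfolding polys_def by (auto intro!: exI[of _ "\<lambda>_. 0"])

lemma polys_add: "f \<in> polys j \<Longrightarrow> g \<in> polys j \<Longrightarrow> (\<lambda>x. f x + g x) \<in> polys j"
  unfolding polys_def
  apply clarsimp
  subgoal for c d
    by (rule exI[of _ "\<lambda>\<alpha>. c \<alpha> + d \<alpha>"]) (simp add: sum.distrib algebra_simps)
  done

lemma polys_cmult: "f \<in> polys j \<Longrightarrow> (\<lambda>x. a * f x) \<in> polys j"
  unfolding polys_def
  apply clarsimp
  subgoal for c
    by (rule exI[of _ "\<lambda>\<alpha>. a * c \<alpha>"]) (simp add: sum_distrib_left mult.assoc)
  done

lemma polys_uminus: "f \<in> polys j \<Longrightarrow> (\<lambda>x. - f x) \<in> polys j"
  using polys_cmult[of f j "-1"] by simp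

lemma polys_diff: "f \<in> polys j \<Longrightarrow> g \<in> polys j \<Longrightarrow> (\<lambda>x. f x - g x) \<in> polys j"
  using polys_add[OF _ polys_uminus, of f j g] by simp

lemma polys_sum: "(\<And>i. i \<in> I \<Longrightarrow> f i \<in> polys j) \<Longrightarrow> (\<lambda>x. \<Sum>i\<in>I. f i x) \<in> polys j"
  by (induction I rule: infinite_finite_induct) (auto intro: polys_zero polys_add)

lemma polys_monom:
  assumes "(\<Sum>i\<in>UNIV. \<alpha> i) \<le> j"
  shows "(\<lambda>x. \<Prod>i\<in>UNIV. (x $ i) ^ \<alpha> i) \<in> polys j"
proof -
  have "(\<Sum>\<beta> | (\<Sum>i\<in>UNIV. \<beta> i) \<le> j. (if \<beta> = \<alpha> then 1 else 0) * (\<Prod>i\<in>UNIV. (x $ i) ^ \<beta> i))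
      = (\<Prod>i\<in>UNIV. (x $ i) ^ \<alpha> i)" for x :: "real^3"
  proof -
    have "(\<Sum>\<beta> | (\<Sum>i\<in>UNIV. \<beta> i) \<le> j. (if \<beta> = \<alpha> then 1 else 0) * (\<Prod>i\<in>UNIV. (x $ i) ^ \<beta> i))
      = (\<Sum>\<beta> | (\<Sum>i\<in>UNIV. \<beta> i) \<le> j. if \<beta> = \<alpha> then (\<Prod>i\<in>UNIV. (x $ i) ^ \<beta> i) else 0)"
      by (rule sum.cong) auto
    also have "\<dots> = (\<Prod>i\<in>UNIV. (x $ i) ^ \<alpha> i)"
      using assms by (subst sum.delta) (auto simp: finite_multi_indices)
    finally show ?thesis .
  qed
  then show ?thesis
    unfolding polys_def by (auto intro!: exI[of _ "\<lambda>\<beta>. if \<beta> = \<alpha> then 1 else 0"])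
qed

text \<open>The predicate is accompanied by membership in \<open>polys j\<close>, so that the sum
  and scalar steps may use continuity and differentiability of polynomials.\<close>

lemma polys_induct [consumes 1, case_names monom zero add cmult]:
  assumes "f \<in> polys j"
    and monom: "\<And>\<alpha>. (\<Sum>i\<in>UNIV. \<alpha> i) \<le> j \<Longrightarrow> P (\<lambda>x. \<Prod>i\<in>UNIV. (x $ i) ^ \<alpha> i)"
    and zero: "P (\<lambda>_. 0)"
    and add: "\<And>f g. f \<in> polys j \<Longrightarrow> g \<in> polys j \<Longrightarrow> P f \<Longrightarrow> P g \<Longrightarrow> P (\<lambda>x. f x + g x)"
    and cmult: "\<And>f a. f \<in> polys j \<Longrightarrow> P f \<Longrightarrow> P (\<lambda>x. a * f x)"
  shows "P f"
proof -
  obtain c where c: "f = (\<lambda>x. \<Sum>\<alpha> | (\<Sum>i\<in>UNIV. \<alpha> i) \<le> j. c \<alpha> * (\<Prod>i\<in>UNIV. (x $ i) ^ \<alpha> i))"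
    using assms(1) unfolding polys_def by auto
  have "A \<subseteq> {\<alpha>. (\<Sum>i\<in>UNIV. \<alpha> i) \<le> j} \<Longrightarrow>
      (\<lambda>x. \<Sum>\<alpha>\<in>A. c \<alpha> * (\<Prod>i\<in>UNIV. (x $ i) ^ \<alpha> i)) \<in> polys j \<and>
      P (\<lambda>x. \<Sum>\<alpha>\<in>A. c \<alpha> * (\<Prod>i\<in>UNIV. (x $ i) ^ \<alpha> i))" if "finite A" for A
    using that
    by (induction A rule: finite_induct)
      (auto intro!: zero add cmult monom polys_zero polys_add polys_cmult polys_monom)
  from this[OF finite_multi_indices] show ?thesis
    unfolding c by blast
qed

lemma polys_mono:
  assumes "i \<le> j" shows "polys i \<subseteq> polys j"
proof
  fix f assume "f \<in> polys i"
  then show "f \<in> polys j"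
    by (induction rule: polys_induct)
      (use assms in \<open>auto intro: polys_monom polys_zero polys_add polys_cmult order_trans\<close>)
qed

lemma polys_mult:
  assumes "f \<in> polys i" "g \<in> polys j"
  shows "(\<lambda>x. f x * g x) \<in> polys (i + j)"
  using assms(1)
proof (induction rule: polys_induct)
  case (monom \<alpha>)
  show ?case
    using assms(2)
  proof (induction rule: polys_induct)
    case (monom \<beta>)
    then show ?case
      using polys_monom[of "\<lambda>k. \<alpha> k + \<beta> k" "i + j"] \<open>sum \<alpha> UNIV \<le> i\<close>
      by (simp add: power_add prod.distrib sum.distrib)
  next
    case (cmult f a)
    then show ?case
      using polys_cmult[of "\<lambda>x. (\<Prod>i\<in>UNIV. x $ i ^ \<alpha> i) * f x" "i+j" a]
      by (simp add: mult.left_commute)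
  qed (auto simp: distrib_left intro: polys_zero polys_add)
next
  case (cmult f a)
  then show ?case
    using polys_cmult[of "\<lambda>x. f x * g x" "i+j" a] by (simp add: mult.assoc)
qed (auto simp: distrib_right intro: polys_zero polys_add)

lemma polys_const: "(\<lambda>_. a) \<in> polys j"
  using polys_cmult[OF polys_monom[of "\<lambda>_. 0" j], of a] by simp

lemma polys_coord: "(\<lambda>x. x $ i) \<in> polys 1"
proof -
  have "(\<Prod>k\<in>UNIV. (x $ k) ^ (if k = i then 1 else 0)) = x $ i" for x :: "real^3"
    using prod.delta[of UNIV i "\<lambda>k. x $ k"] by (simp add: if_distrib cong: if_cong)
  then show ?thesis
    using polys_monom[of "\<lambda>k. if k = i then 1 else 0" 1] by (simp cong: if_cong)
qed

lemma polys_inner: "(\<lambda>x. g \<bullet> x) \<in> polys 1"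
  unfolding inner_vec_def inner_real_def by (intro polys_sum polys_cmult polys_coord)

lemma continuous_on_polys: "f \<in> polys j \<Longrightarrow> continuous_on S f"
proof (induction rule: polys_induct)
  case (monom \<alpha>) then show ?case by (intro continuous_intros)
qed (auto intro!: continuous_intros)

section \<open>Gradients and partial derivatives of polynomials\<close>

lemma grad_inner: "grad f x \<bullet> h = frechet_derivative f (at x) h" if "f differentiable at x"
proof -
  have lin: "linear (frechet_derivative f (at x))"
    using that by (rule linear_frechet_derivative)
  have "frechet_derivative f (at x) h = frechet_derivative f (at x) (\<Sum>i\<in>UNIV. h $ i *\<^sub>R axis i 1)"
    using basis_expansion[of h] by (simp add: scalar_mult_eq_scaleR)
  also have "\<dots> = grad f x \<bullet> h"
    using lin by (simp add: linear_sum linear_scale inner_vec_def grad_def partial_def mult.commute)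
  finally show ?thesis by simp
qed

lemma has_derivative_grad: "f differentiable at x \<Longrightarrow> (f has_derivative (\<lambda>h. grad f x \<bullet> h)) (at x)"
  by (simp add: grad_inner frechet_derivative_works[symmetric])

text \<open>By uniqueness of the derivative, every gradient rule below reduces to a derivative
  rule.\<close>

lemma grad_eqI:
  assumes "(f has_derivative (\<lambda>h. g \<bullet> h)) (at x)" shows "grad f x = g"
proof -
  have "f differentiable at x" using assms by (rule differentiableI)
  then have "frechet_derivative f (at x) = (\<lambda>h. g \<bullet> h)"
    using assms by (metis frechet_derivative_at)
  then show ?thesis
    by (simp add: grad_def partial_def vec_eq_iff inner_axis)
qed

lemma grad_nth: "grad f x $ i = partial i f x"
  by (simp add: grad_def)

lemma differentiable_polys: "f \<in> polys j \<Longrightarrow> f differentiable at x"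
proof (induction rule: polys_induct)
  case (monom \<alpha>)
  have "((\<lambda>x::real^3. \<Prod>i\<in>UNIV. x $ i ^ \<alpha> i)
     has_derivative (\<lambda>y. \<Sum>i\<in>UNIV. (\<alpha> i * x $ i ^ (\<alpha> i - 1) * y $ i) * (\<Prod>j\<in>UNIV - {i}. x $ j ^ \<alpha> j))) (at x)"
    by (rule has_derivative_prod)
      (auto intro!: derivative_eq_intros bounded_linear_imp_has_derivative bounded_linear_vec_nth
         simp: algebra_simps)
  then show ?case by (rule differentiableI)
qed (auto intro: differentiable_add differentiable_mult)

lemma grad_add:
  "f differentiable at x \<Longrightarrow> g differentiable at x \<Longrightarrow> grad (\<lambda>x. f x + g x) x = grad f x + grad g x"
  by (rule grad_eqI) (auto intro!: derivative_eq_intros has_derivative_grad simp: inner_add_left)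

lemma grad_cmult: "f differentiable at x \<Longrightarrow> grad (\<lambda>x. a * f x) x = a *\<^sub>R grad f x"
  by (rule grad_eqI) (auto intro!: derivative_eq_intros has_derivative_grad)

lemma grad_mult:
  "f differentiable at x \<Longrightarrow> g differentiable at x \<Longrightarrow>
     grad (\<lambda>x. f x * g x) x = f x *\<^sub>R grad g x + g x *\<^sub>R grad f x"
  by (rule grad_eqI) (auto intro!: derivative_eq_intros has_derivative_grad simp: inner_add_left)

lemma grad_uminus: "f differentiable at x \<Longrightarrow> grad (\<lambda>x. - f x) x = - grad f x"
  using grad_cmult[of f x "-1"] by simp

lemma grad_diff:
  "f differentiable at x \<Longrightarrow> g differentiable at x \<Longrightarrow> grad (\<lambda>x. f x - g x) x = grad f x - grad g x"
  by (rule grad_eqI) (auto intro!: derivative_eq_intros has_derivative_grad simp: inner_diff_left)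

lemma grad_const: "grad (\<lambda>_. a) x = 0"
  by (rule grad_eqI) auto

lemma grad_affine: "grad (\<lambda>x. a + g \<bullet> (x - v)) x = g"
  by (rule grad_eqI) (auto intro!: derivative_eq_intros)

lemma grad_coord: "grad (\<lambda>x. x $ i) x = axis i 1"
  by (rule grad_eqI)
    (auto simp: inner_axis' intro!: bounded_linear_imp_has_derivative bounded_linear_vec_nth)

lemma polys_partial:
  assumes "f \<in> polys j" shows "partial i f \<in> polys (j - 1)"
proof -
  have *: "(\<lambda>x. grad f x $ i) \<in> polys (j - 1)"
    using assms
  proof (induction rule: polys_induct)
    case (monom \<alpha>)
    have "((\<lambda>x::real^3. \<Prod>i\<in>UNIV. x $ i ^ \<alpha> i) has_derivative
      (\<lambda>y. (\<chi> i. (\<alpha> i * x $ i ^ (\<alpha> i - 1)) * (\<Prod>j\<in>UNIV - {i}. x $ j ^ \<alpha> j)) \<bullet> y)) (at x)" for x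
      unfolding inner_vec_def
      by (rule has_derivative_eq_rhs, rule has_derivative_prod)
        (auto intro!: derivative_eq_intros bounded_linear_imp_has_derivative bounded_linear_vec_nth sum.cong
         simp: algebra_simps)
    from grad_eqI[OF this] have g: "grad (\<lambda>x::real^3. \<Prod>i\<in>UNIV. x $ i ^ \<alpha> i) x $ i
        = (\<alpha> i * x $ i ^ (\<alpha> i - 1)) * (\<Prod>j\<in>UNIV - {i}. x $ j ^ \<alpha> j)" for x
      by simp
    \<comment> \<open>With \<open>\<alpha> i = 0\<close> the derivative vanishes. This is the only
      branch that occurs for \<open>j = 0\<close>, where the truncated bound \<open>j - 1\<close> is
      again 0.\<close>
    show ?case
    proof (cases "\<alpha> i = 0")
      case True then show ?thesis by (simp add: g polys_zero)
    next
      case False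
      let ?\<beta> = "\<alpha>(i := \<alpha> i - 1)"
      have "x $ i ^ (\<alpha> i - 1) * (\<Prod>j\<in>UNIV - {i}. x $ j ^ \<alpha> j) = (\<Prod>j\<in>UNIV. x $ j ^ ?\<beta> j)" for x :: "real^3"
        by (subst prod.remove[of UNIV i]) (auto intro: prod.cong)
      moreover have "sum ?\<beta> UNIV \<le> j - 1"
      proof -
        have "sum ?\<beta> UNIV = ?\<beta> i + sum ?\<beta> (UNIV - {i})" by (subst sum.remove[of UNIV i]) auto
        also have "sum ?\<beta> (UNIV - {i}) = sum \<alpha> (UNIV - {i})" by (rule sum.cong) auto
        moreover have "sum \<alpha> UNIV = \<alpha> i + sum \<alpha> (UNIV - {i})" by (subst sum.remove[of UNIV i]) auto
        ultimately show ?thesis using monom False by simp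
      qed
      ultimately show ?thesis
        using polys_cmult[OF polys_monom[of ?\<beta> "j - 1"], of "\<alpha> i"] by (simp add: g mult.assoc)
    qed
  qed (auto simp: grad_const grad_add grad_cmult differentiable_polys
      intro: polys_zero polys_add polys_cmult)
  then show ?thesis by (simp add: grad_nth[abs_def])
qed

lemma vpolysD: "f \<in> vpolys j \<Longrightarrow> (\<lambda>x. f x $ i) \<in> polys j"
  by (simp add: vpolys_def)

lemma continuous_on_vpolys: "f \<in> vpolys j \<Longrightarrow> continuous_on S f"
  by (subst continuous_on_componentwise[OF]) 
    (auto simp: Basis_vec_def inner_axis intro: continuous_on_polys vpolysD)

lemma vpolys_mono: "i \<le> j \<Longrightarrow> vpolys i \<subseteq> vpolys j"
  using polys_mono by (auto simp: vpolys_def)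

lemma vpolys_zero: "(\<lambda>_. 0) \<in> vpolys j"
  by (auto simp: vpolys_def polys_zero)

lemma vpolys_uminus: "f \<in> vpolys j \<Longrightarrow> (\<lambda>x. - f x) \<in> vpolys j"
  by (auto simp: vpolys_def polys_uminus)

lemma vpolys_diff: "f \<in> vpolys j \<Longrightarrow> g \<in> vpolys j \<Longrightarrow> (\<lambda>x. f x - g x) \<in> vpolys j"
  by (auto simp: vpolys_def polys_diff)

lemma vpolys_grad: "f \<in> polys j \<Longrightarrow> grad f \<in> vpolys (j - 1)"
  using polys_partial[of f j] by (simp add: vpolys_def grad_nth eta_contract_eq)

lemma vpolys_scale: "f \<in> polys i \<Longrightarrow> g \<in> vpolys j \<Longrightarrow> (\<lambda>x. f x *\<^sub>R g x) \<in> vpolys (i + j)"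
  by (auto simp: vpolys_def polys_mult)

lemma polys_inner_const: "g \<in> vpolys j \<Longrightarrow> (\<lambda>x. n \<bullet> g x) \<in> polys j"
  unfolding inner_vec_def by (auto intro!: polys_sum polys_cmult simp: inner_real_def vpolys_def)

lemma vpolys_const_scale: "g \<in> polys j \<Longrightarrow> (\<lambda>x. g x *\<^sub>R n) \<in> vpolys j"
  using polys_cmult[of g j "n $ i" for i] by (simp add: vpolys_def mult.commute)

lemma vpolys_curl:
  assumes "f \<in> vpolys j" shows "curl f \<in> vpolys (j - 1)"
proof -
  have "(\<lambda>x. partial a (\<lambda>y. f y $ b) x) \<in> polys (j - 1)" for a b
    using polys_partial[OF vpolysD[OF assms]] by (simp add: eta_contract_eq)
  then show ?thesis
    by (auto simp: vpolys_def forall_3 curl_def intro!: polys_diff)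
qed

lemma polys_divergence: "f \<in> vpolys j \<Longrightarrow> divergence f \<in> polys (j - 1)"
  unfolding divergence_def[abs_def] using polys_partial[OF vpolysD]
  by (auto intro!: polys_sum simp: eta_contract_eq)

section \<open>Multi-indices as multisets\<close>

text \<open>As multisets of vertices, multi-indices belong to a subsimplex as soon as their support
  does, without any renumbering, and two elements with a common facet literally share the
  multi-indices of that facet.\<close>

definition mi :: "'a set \<Rightarrow> nat \<Rightarrow> 'a multiset set" where
  "mi S n = {\<alpha>. set_mset \<alpha> \<subseteq> S \<and> size \<alpha> = n}"

lemma mi_0: "mi S 0 = {{#}}"
  by (auto simp: mi_def)

lemma mi_empty: "mi {} n = (if n = 0 then {{#}} else {})"
  by (auto simp: mi_def)

lemma finite_mi: "finite S \<Longrightarrow> finite (mi S n)"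
proof (induction n)
  case 0 then show ?case by (simp add: mi_0)
next
  case (Suc n)
  have "mi S (Suc n) \<subseteq> (\<Union>s\<in>S. add_mset s ` mi S n)"
  proof
    fix \<alpha> assume \<alpha>: "\<alpha> \<in> mi S (Suc n)"
    then obtain s \<beta> where "\<alpha> = add_mset s \<beta>"
      by (auto simp: mi_def dest: size_eq_Suc_imp_eq_union)
    with \<alpha> show "\<alpha> \<in> (\<Union>s\<in>S. add_mset s ` mi S n)"
      by (auto simp: mi_def)
  qed
  then show ?case by (rule finite_subset) (use Suc in auto)
qed

text \<open>Grouping by the multiplicity \<open>k\<close> of the new element turns a homogeneous sum
  over \<open>insert s S\<close> into a polynomial in the variable of \<open>s\<close>, with
  coefficients homogeneous in the variables of \<open>S\<close>. This is the step for an induction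
  on the number of variables.\<close>

lemma sum_mi_insert:
  fixes f :: "'a multiset \<Rightarrow> real"
  assumes "finite S" "s \<notin> S"
  shows "(\<Sum>\<alpha>\<in>mi (insert s S) n. f \<alpha>) = (\<Sum>k\<le>n. \<Sum>\<beta>\<in>mi S (n - k). f (\<beta> + replicate_mset k s))"
proof -
  let ?J = "SIGMA k:{..n}. mi S (n - k)"
  have "bij_betw (\<lambda>(k, \<beta>). \<beta> + replicate_mset k s) ?J (mi (insert s S) n)"
  proof (rule bij_betw_byWitness[where f' = "\<lambda>\<alpha>. (count \<alpha> s, filter_mset (\<lambda>x. x \<noteq> s) \<alpha>)"])
    have *: "count \<beta> s = 0" "filter_mset (\<lambda>x. x \<noteq> s) \<beta> = \<beta>" if "set_mset \<beta> \<subseteq> S" for \<beta>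
      using that assms(2) by (auto simp: count_eq_zero_iff filter_mset_eq_conv)
    show "\<forall>p\<in>?J. (\<lambda>\<alpha>. (count \<alpha> s, filter_mset (\<lambda>x. x \<noteq> s) \<alpha>)) ((\<lambda>(k, \<beta>). \<beta> + replicate_mset k s) p) = p"
      by (auto simp: mi_def *)
    have **: "filter_mset (\<lambda>x. x \<noteq> s) \<alpha> + replicate_mset (count \<alpha> s) s = \<alpha>" for \<alpha>
      by (rule multiset_eqI) auto
    then show "\<forall>\<alpha>\<in>mi (insert s S) n.
      (\<lambda>(k, \<beta>). \<beta> + replicate_mset k s) (count \<alpha> s, filter_mset (\<lambda>x. x \<noteq> s) \<alpha>) = \<alpha>"
      by simp
    show "(\<lambda>(k, \<beta>). \<beta> + replicate_mset k s) ` ?J \<subseteq> mi (insert s S) n"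
      by (auto simp: mi_def split: if_splits)
    show "(\<lambda>\<alpha>. (count \<alpha> s, filter_mset (\<lambda>x. x \<noteq> s) \<alpha>)) ` mi (insert s S) n \<subseteq> ?J"
    proof clarsimp
      fix \<alpha> assume \<alpha>: "\<alpha> \<in> mi (insert s S) n"
      have "size (filter_mset (\<lambda>x. x \<noteq> s) \<alpha>) + count \<alpha> s = size \<alpha>"
        by (subst (3) **[of \<alpha>, symmetric]) simp
      then show "count \<alpha> s \<le> n \<and> filter_mset (\<lambda>x. x \<noteq> s) \<alpha> \<in> mi S (n - count \<alpha> s)"
        using \<alpha> by (auto simp: mi_def)
    qed
  qed
  then have "(\<Sum>\<alpha>\<in>mi (insert s S) n. f \<alpha>) = (\<Sum>(k,\<beta>)\<in>?J. f (\<beta> + replicate_mset k s))"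
    by (subst sum.reindex_bij_betw[symmetric]) (auto simp: case_prod_unfold)
  also have "\<dots> = (\<Sum>k\<le>n. \<Sum>\<beta>\<in>mi S (n - k). f (\<beta> + replicate_mset k s))"
    by (subst sum.Sigma) (auto simp: finite_mi assms(1))
  finally show ?thesis .
qed

text \<open>Induction on the number of variables: with the others fixed and positive, the sum is a
  polynomial in the remaining variable that vanishes on a half-line. So its coefficients vanish, and
  these are sums of the same kind in fewer variables.\<close>

lemma mi_coeffs_zero_orthant:
  fixes c :: "'a multiset \<Rightarrow> real"
  assumes "finite S"
    and "\<And>y. (\<And>v. v \<in> S \<Longrightarrow> 0 < y v) \<Longrightarrow> (\<Sum>\<alpha>\<in>mi S n. c \<alpha> * (\<Prod>v\<in>#\<alpha>. y v)) = 0"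
    and "\<alpha> \<in> mi S n"
  shows "c \<alpha> = 0"
  using assms
proof (induction S arbitrary: n c \<alpha> rule: finite_induct)
  case empty
  then show ?case by (auto simp: mi_empty split: if_splits)
next
  case (insert s S)
  have inner: "(\<Sum>\<beta>\<in>mi S (n - k). c (\<beta> + replicate_mset k s) * (\<Prod>v\<in>#\<beta>. y v)) = 0"
    if y: "\<And>v. v \<in> S \<Longrightarrow> 0 < y v" and k: "k \<le> n" for y k
  proof -
    let ?e = "\<lambda>k. \<Sum>\<beta>\<in>mi S (n - k). c (\<beta> + replicate_mset k s) * (\<Prod>v\<in>#\<beta>. y v)"
    have "(\<Sum>k\<le>n. ?e k * t ^ k) = 0" if "0 < t" for t
    proof -
      have "0 = (\<Sum>\<alpha>\<in>mi (insert s S) n. c \<alpha> * (\<Prod>v\<in>#\<alpha>. (y(s := t)) v))"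
        by (rule insert.prems(1)[symmetric]) (use y that in auto)
      also have "\<dots> = (\<Sum>k\<le>n. \<Sum>\<beta>\<in>mi S (n - k). c (\<beta> + replicate_mset k s) * (\<Prod>v\<in>#\<beta>. y v) * t ^ k)"
        unfolding sum_mi_insert[OF insert.hyps]
      proof (intro sum.cong refl)
        fix k \<beta> assume "\<beta> \<in> mi S (n - k)"
        then have "image_mset (y(s := t)) \<beta> = image_mset y \<beta>"
          using insert.hyps by (intro image_mset_cong) (auto simp: mi_def)
        then show "c (\<beta> + replicate_mset k s) * (\<Prod>v\<in>#\<beta> + replicate_mset k s. (y(s := t)) v)
            = c (\<beta> + replicate_mset k s) * (\<Prod>v\<in>#\<beta>. y v) * t ^ k"
          by (simp del: fun_upd_apply) simp
      qed
      finally show ?thesis by (simp add: sum_distrib_right)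
    qed
    then have "{0<..} \<subseteq> {t. (\<Sum>k\<le>n. ?e k * t ^ k) = 0}" by auto
    moreover have "infinite {0 :: real <..}" by (rule infinite_Ioi)
    ultimately have "infinite {t. (\<Sum>k\<le>n. ?e k * t ^ k) = 0}"
      using finite_subset by blast
    then show ?thesis
      using polyfun_finite_roots[of ?e n] k by blast
  qed
  have "\<alpha> \<in> (\<Union>k\<le>n. (\<lambda>\<beta>. \<beta> + replicate_mset k s) ` mi S (n - k))"
  proof -
    have **: "filter_mset (\<lambda>x. x \<noteq> s) \<alpha> + replicate_mset (count \<alpha> s) s = \<alpha>"
      by (rule multiset_eqI) auto
    have "size (filter_mset (\<lambda>x. x \<noteq> s) \<alpha>) + count \<alpha> s = size \<alpha>"
      by (subst (3) **[symmetric]) simp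
    then show ?thesis
      using insert.prems(2) ** by (auto simp: mi_def intro!: bexI[of _ "count \<alpha> s"] image_eqI[of _ _ "filter_mset (\<lambda>x. x \<noteq> s) \<alpha>"])
  qed
  then obtain k \<beta> where "k \<le> n" "\<beta> \<in> mi S (n - k)" "\<alpha> = \<beta> + replicate_mset k s" by auto
  then show ?case
    using insert.IH[where n = "n - k" and c = "\<lambda>\<beta>. c (\<beta> + replicate_mset k s)" and \<alpha> = \<beta>] inner[of _ k]
    by blast
qed

text \<open>Homogeneity carries the zeros from the open unit simplex to the positive orthant. In
  barycentric coordinates this is the linear independence of the Bernstein monomials on the interior
  of a simplex.\<close>

lemma mi_coeffs_zero:
  fixes c :: "'a multiset \<Rightarrow> real"
  assumes "finite S" "S \<noteq> {}"
    and zero: "\<And>y. (\<And>v. v \<in> S \<Longrightarrow> 0 < y v) \<Longrightarrow> sum y S = 1 \<Longrightarrow> (\<Sum>\<alpha>\<in>mi S n. c \<alpha> * (\<Prod>v\<in>#\<alpha>. y v)) = 0"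
    and "\<alpha> \<in> mi S n"
  shows "c \<alpha> = 0"
proof (rule mi_coeffs_zero_orthant[OF assms(1) _ assms(4)])
  fix y :: "'a \<Rightarrow> real" assume y: "\<And>v. v \<in> S \<Longrightarrow> 0 < y v"
  define \<sigma> where "\<sigma> = sum y S"
  have \<sigma>: "0 < \<sigma>" unfolding \<sigma>_def using assms y by (intro sum_pos) auto
  have hom: "(\<Prod>v\<in>#\<alpha>. \<sigma> * z v) = \<sigma> ^ size \<alpha> * (\<Prod>v\<in>#\<alpha>. z v)" for \<alpha> :: "'a multiset" and z
    by (induction \<alpha>) (auto simp: algebra_simps)
  have "0 = (\<Sum>\<alpha>\<in>mi S n. c \<alpha> * (\<Prod>v\<in>#\<alpha>. y v / \<sigma>))"
    using zero[of "\<lambda>v. y v / \<sigma>"] y \<sigma> by (simp add: \<sigma>_def sum_divide_distrib[symmetric])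
  moreover have "(\<Sum>\<alpha>\<in>mi S n. c \<alpha> * (\<Prod>v\<in>#\<alpha>. y v)) = \<sigma> ^ n * (\<Sum>\<alpha>\<in>mi S n. c \<alpha> * (\<Prod>v\<in>#\<alpha>. y v / \<sigma>))"
    unfolding sum_distrib_left
  proof (intro sum.cong refl)
    fix \<alpha> assume "\<alpha> \<in> mi S n"
    then show "c \<alpha> * (\<Prod>v\<in>#\<alpha>. y v) = \<sigma> ^ n * (c \<alpha> * (\<Prod>v\<in>#\<alpha>. y v / \<sigma>))"
      using hom[of "\<lambda>v. y v / \<sigma>" \<alpha>] \<sigma> by (simp add: mi_def)
  qed
  ultimately show "(\<Sum>\<alpha>\<in>mi S n. c \<alpha> * (\<Prod>v\<in>#\<alpha>. y v)) = 0" by simp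
qed

text \<open>The constant is the minimum of the form over the unit sphere of coefficient vectors;
  homogeneity of degree two extends the bound to all vectors.\<close>

lemma quadratic_form_lower_bound:
  fixes M :: "'i \<Rightarrow> 'i \<Rightarrow> real"
  assumes fin: "finite I"
    and pos: "\<And>c. (\<exists>i\<in>I. c i \<noteq> 0) \<Longrightarrow> 0 < (\<Sum>i\<in>I. \<Sum>j\<in>I. c i * c j * M i j)"
  shows "\<exists>\<mu>>0. \<forall>c. \<mu> * (\<Sum>i\<in>I. (c i)\<^sup>2) \<le> (\<Sum>i\<in>I. \<Sum>j\<in>I. c i * c j * M i j)"
proof -
  define Q where "Q c = (\<Sum>i\<in>I. \<Sum>j\<in>I. c i * c j * M i j)" for c
  \<comment> \<open>Coefficients are functions on the whole type. Fixing them to 0 off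
    \<open>I\<close> makes the sphere compact in the product topology; on \<open>I\<close> a unit
    vector has its entries in [-1, 1] anyway.\<close>
  define B where "B = PiE UNIV (\<lambda>i. if i \<in> I then {-1..1::real} else {0})"
  define K where "K = B \<inter> {c. (\<Sum>i\<in>I. (c i)\<^sup>2) = 1}"
  have "compactin (product_topology (\<lambda>i. euclidean) UNIV) B"
    unfolding B_def by (subst compactin_PiE) auto
  then have "compact B" by (simp add: euclidean_product_topology)
  moreover have "closed {c :: 'i \<Rightarrow> real. (\<Sum>i\<in>I. (c i)\<^sup>2) = 1}"
    by (intro closed_Collect_eq continuous_intros continuous_on_product_coordinates)
  ultimately have cK: "compact K" unfolding K_def by (rule compact_Int_closed)
  have cQ: "continuous_on K Q"
    unfolding Q_def by (intro continuous_intros continuous_on_subset[OF continuous_on_product_coordinates]) auto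
  show ?thesis
  proof (cases "K = {}")
    case False
    obtain c0 where c0: "c0 \<in> K" "\<And>c. c \<in> K \<Longrightarrow> Q c0 \<le> Q c"
      using continuous_attains_inf[OF cK False cQ] by auto
    have "\<exists>i\<in>I. c0 i \<noteq> 0"
      using c0(1) by (force simp: K_def intro: ccontr)
    then have pos0: "0 < Q c0" unfolding Q_def by (rule pos)
    have "Q c0 * (\<Sum>i\<in>I. (c i)\<^sup>2) \<le> Q c" for c
    proof (cases "(\<Sum>i\<in>I. (c i)\<^sup>2) = 0")
      case True
      then have "\<forall>i\<in>I. c i = 0" using fin by (simp add: sum_nonneg_eq_0_iff)
      then show ?thesis by (simp add: True Q_def)
    next
      case False
      define s where "s = (\<Sum>i\<in>I. (c i)\<^sup>2)"
      have s: "0 < s" using False unfolding s_def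
        by (metis less_eq_real_def sum_nonneg zero_le_power2)
      define d where "d i = (if i \<in> I then c i / sqrt s else 0)" for i
      have d1: "(\<Sum>i\<in>I. (d i)\<^sup>2) = 1"
        using s by (simp add: d_def power_divide sum_divide_distrib[symmetric]) (simp add: s_def)
      have "(d i)\<^sup>2 \<le> 1" if "i \<in> I" for i
        unfolding d1[symmetric] using that fin by (intro member_le_sum) auto
      then have "-1 \<le> d i \<and> d i \<le> 1" if "i \<in> I" for i
        using that by (simp add: abs_square_le_1 abs_le_iff)
      moreover have "d i = 0" if "i \<notin> I" for i using that by (simp add: d_def)
      ultimately have "d \<in> K" using d1
        by (auto simp: K_def B_def)
      then have "Q c0 \<le> Q d" by (rule c0)
      also have "Q d = Q c / s"
        unfolding Q_def sum_divide_distrib using s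
        by (intro sum.cong refl) (simp add: d_def)
      finally show ?thesis using s by (simp add: pos_le_divide_eq s_def)
    qed
    then show ?thesis using pos0 unfolding Q_def by blast
  next
    \<comment> \<open>The sphere is empty only if \<open>I\<close> is, and then all sums are
      0.\<close>
    case True
    have "\<forall>i\<in>I. c i = 0" for c :: "'i \<Rightarrow> real"
    proof (rule ccontr)
      assume "\<not> (\<forall>i\<in>I. c i = 0)"
      then obtain i where i: "i \<in> I" by auto
      have "(\<Sum>j\<in>I. (if j = i then 1 else 0 :: real)\<^sup>2) = (\<Sum>j\<in>I. if j = i then 1 else 0)"
        by (rule sum.cong) auto
      then have "(\<lambda>j. if j = i then 1 else 0) \<in> K"
        using i fin by (auto simp: K_def B_def)
      with True show False by auto
    qed
    then have "(\<Sum>i\<in>I. (c i)\<^sup>2) = 0" "(\<Sum>i\<in>I. \<Sum>j\<in>I. c i * c j * M i j) = 0" for c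
      by (simp_all add: sum.neutral)
    then show ?thesis by (intro exI[of _ 1]) simp
  qed
qed

section \<open>Positive linear functionals\<close>

text \<open>Common interface of volume and surface integrals. Linearity is demanded for continuous
  functions only, since a nonintegrable function has integral 0; the last clause makes values off
  \<open>K\<close> irrelevant, so polynomials may be mixed with functions cut off at a face.\<close>

definition pos_lin :: "'a::topological_space set \<Rightarrow> (('a \<Rightarrow> real) \<Rightarrow> real) \<Rightarrow> bool" where
  "pos_lin K \<Phi> \<longleftrightarrow>
     (\<forall>f g. continuous_on K f \<longrightarrow> continuous_on K g \<longrightarrow> \<Phi> (\<lambda>x. f x + g x) = \<Phi> f + \<Phi> g) \<and>
     (\<forall>a f. continuous_on K f \<longrightarrow> \<Phi> (\<lambda>x. a * f x) = a * \<Phi> f) \<and>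
     (\<forall>f. continuous_on K f \<longrightarrow> (\<forall>x\<in>K. 0 \<le> f x) \<longrightarrow> 0 \<le> \<Phi> f) \<and>
     (\<forall>f g. (\<forall>x\<in>K. f x = g x) \<longrightarrow> \<Phi> f = \<Phi> g)"

context
  fixes K :: "'a::topological_space set" and \<Phi>
  assumes pl: "pos_lin K \<Phi>"
begin

lemma pos_lin_add: "continuous_on K f \<Longrightarrow> continuous_on K g \<Longrightarrow> \<Phi> (\<lambda>x. f x + g x) = \<Phi> f + \<Phi> g"
  and pos_lin_cmult: "continuous_on K f \<Longrightarrow> \<Phi> (\<lambda>x. a * f x) = a * \<Phi> f"
  and pos_lin_nonneg: "continuous_on K f \<Longrightarrow> (\<And>x. x \<in> K \<Longrightarrow> 0 \<le> f x) \<Longrightarrow> 0 \<le> \<Phi> f"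
  and pos_lin_cong: "(\<And>x. x \<in> K \<Longrightarrow> f x = g x) \<Longrightarrow> \<Phi> f = \<Phi> g"
  using pl unfolding pos_lin_def by blast+

lemma pos_lin_zero: "\<Phi> (\<lambda>x. 0) = 0"
  using pos_lin_cmult[of "\<lambda>_. 0" 0] by simp

lemma pos_lin_diff: "continuous_on K f \<Longrightarrow> continuous_on K g \<Longrightarrow> \<Phi> (\<lambda>x. f x - g x) = \<Phi> f - \<Phi> g"
  using pos_lin_add[of f "\<lambda>x. (-1) * g x"] pos_lin_cmult[of g "-1"] by (simp add: continuous_on_minus)

lemma pos_lin_mono:
  "continuous_on K f \<Longrightarrow> continuous_on K g \<Longrightarrow> (\<And>x. x \<in> K \<Longrightarrow> f x \<le> g x) \<Longrightarrow> \<Phi> f \<le> \<Phi> g"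
  using pos_lin_nonneg[of "\<lambda>x. g x - f x"] pos_lin_diff[of g f] by (simp add: continuous_on_diff)

lemma pos_lin_sum:
  "(\<And>i. i \<in> I \<Longrightarrow> continuous_on K (f i)) \<Longrightarrow> \<Phi> (\<lambda>x. \<Sum>i\<in>I. f i x) = (\<Sum>i\<in>I. \<Phi> (f i))"
proof (induction I rule: infinite_finite_induct)
  case (insert i I)
  then show ?case
    using pos_lin_add[of "f i" "\<lambda>x. \<Sum>i\<in>I. f i x"] by (simp add: continuous_on_sum)
qed (auto simp: pos_lin_zero)

end

text \<open>The discriminant criterion behind Cauchy-Schwarz. The leading coefficient may vanish,
  because the inner products below are only semidefinite.\<close>

lemma quadratic_nonneg_imp_discriminant:
  fixes a b c :: real
  assumes "\<And>t. 0 \<le> a + 2 * t * b + t\<^sup>2 * c" shows "b\<^sup>2 \<le> a * c"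
proof (cases "c = 0")
  case True
  have "b = 0"
  proof (rule ccontr)
    assume "b \<noteq> 0"
    \<comment> \<open>At this \<open>t\<close> the expression has the value -1.\<close>
    then show False
      using assms[of "(- a - 1) / (2 * b)"] True by (simp add: field_simps)
  qed
  then show ?thesis using True by simp
next
  case False
  have "0 \<le> c"
  proof (rule ccontr)
    assume "\<not> 0 \<le> c"
    then have c: "c < 0" by simp
    \<comment> \<open>So large that the quadratic term outweighs the others: the value is then at
      most \<open>t * c\<close>, which is negative.\<close>
    define t where "t = 1 + \<bar>a\<bar> / (- c) + 2 * \<bar>b\<bar> / (- c)"
    have "0 \<le> \<bar>a\<bar> / (- c)" "0 \<le> 2 * \<bar>b\<bar> / (- c)"
      by (rule divide_nonneg_nonneg; use c in simp)+
    then have t1: "1 \<le> t" unfolding t_def by linarith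
    have tc: "t * (- c) = - c + \<bar>a\<bar> + 2 * \<bar>b\<bar>" using c by (simp add: t_def field_simps)
    have "2 * t * b \<le> t * (2 * \<bar>b\<bar>)" using t1 by (simp add: mult_left_mono)
    moreover have "a \<le> t * \<bar>a\<bar>" using t1 mult_right_mono[of 1 t "\<bar>a\<bar>"] by simp
    moreover have "t\<^sup>2 * c = - t * (t * (-c))" by (simp add: power2_eq_square)
    ultimately have "a + 2 * t * b + t\<^sup>2 * c \<le> t * c"
      unfolding tc by (simp add: algebra_simps)
    also have "\<dots> < 0" using t1 c by (simp add: mult_pos_neg)
    finally show False using assms[of t] by simp
  qed
  then have "0 < c" using False by simp
  \<comment> \<open>\<open>- b / c\<close> is the minimiser of the quadratic.\<close>
  then show ?thesis
    using assms[of "- b / c"] by (simp add: power2_eq_square field_simps)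
qed

text \<open>Sums of positive functionals applied to pointwise inner products. One instance is the
  product over elements, the other the product over element boundaries, indexed by pairs of an
  element and a facet.\<close>

locale inner_family =
  fixes I :: "'i set" and K :: "'i \<Rightarrow> 'a::topological_space set" and \<Phi> :: "'i \<Rightarrow> ('a \<Rightarrow> real) \<Rightarrow> real"
  assumes pl: "i \<in> I \<Longrightarrow> pos_lin (K i) (\<Phi> i)"
begin

definition fi :: "('i \<Rightarrow> 'a \<Rightarrow> 'b::real_inner) \<Rightarrow> ('i \<Rightarrow> 'a \<Rightarrow> 'b) \<Rightarrow> real" where
  "fi f g = (\<Sum>i\<in>I. \<Phi> i (\<lambda>x. f i x \<bullet> g i x))"

definition cf :: "('i \<Rightarrow> 'a \<Rightarrow> 'b::real_normed_vector) \<Rightarrow> bool" where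
  "cf f \<longleftrightarrow> (\<forall>i\<in>I. continuous_on (K i) (f i))"

lemma fi_commute: "fi f g = fi g f"
  by (simp add: fi_def inner_commute)

lemma fi_add: "cf f \<Longrightarrow> cf f' \<Longrightarrow> cf g \<Longrightarrow> fi (\<lambda>i x. f i x + f' i x) g = fi f g + fi f' g"
  unfolding fi_def sum.distrib[symmetric] inner_add_left
  by (intro sum.cong refl pos_lin_add[OF pl]) (auto simp: cf_def intro!: continuous_on_inner)

lemma fi_scale: "cf f \<Longrightarrow> cf g \<Longrightarrow> fi (\<lambda>i x. a *\<^sub>R f i x) g = a * fi f g"
  unfolding fi_def sum_distrib_left inner_scaleR_left
  by (intro sum.cong refl pos_lin_cmult[OF pl]) (auto simp: cf_def intro!: continuous_on_inner)

lemma fi_uminus: "cf f \<Longrightarrow> cf g \<Longrightarrow> fi (\<lambda>i x. - f i x) g = - fi f g"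
  using fi_scale[of f g "-1"] by simp

lemma cf_scale: "cf f \<Longrightarrow> cf (\<lambda>i x. a *\<^sub>R f i x)"
  and cf_add: "cf f \<Longrightarrow> cf g \<Longrightarrow> cf (\<lambda>i x. f i x + g i x)"
  and cf_diff: "cf f \<Longrightarrow> cf g \<Longrightarrow> cf (\<lambda>i x. f i x - g i x)"
  and cf_uminus: "cf f \<Longrightarrow> cf (\<lambda>i x. - f i x)"
  by (auto simp: cf_def intro!: continuous_intros)

lemma fi_diff: "cf f \<Longrightarrow> cf f' \<Longrightarrow> cf g \<Longrightarrow> fi (\<lambda>i x. f i x - f' i x) g = fi f g - fi f' g"
  using fi_add[of f "\<lambda>i x. - f' i x" g] by (simp add: fi_uminus cf_uminus)

lemma fi_add_right: "cf f \<Longrightarrow> cf f' \<Longrightarrow> cf g \<Longrightarrow> fi g (\<lambda>i x. f i x + f' i x) = fi g f + fi g f'"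
  by (simp add: fi_commute[of g] fi_add)

lemma fi_diff_right: "cf f \<Longrightarrow> cf f' \<Longrightarrow> cf g \<Longrightarrow> fi g (\<lambda>i x. f i x - f' i x) = fi g f - fi g f'"
  by (simp add: fi_commute[of g] fi_diff)

lemma fi_scale_right: "cf f \<Longrightarrow> cf g \<Longrightarrow> fi f (\<lambda>i x. a *\<^sub>R g i x) = a * fi f g"
  by (metis fi_commute fi_scale)

lemma fi_uminus_right: "cf f \<Longrightarrow> cf g \<Longrightarrow> fi f (\<lambda>i x. - g i x) = - fi f g"
  by (metis fi_commute fi_uminus)

lemma fi_nonneg: "cf f \<Longrightarrow> 0 \<le> fi f f"
  unfolding fi_def by (intro sum_nonneg pos_lin_nonneg[OF pl]) (auto simp: cf_def intro!: continuous_on_inner)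

lemma fi_zero_left: "(\<And>i x. i \<in> I \<Longrightarrow> x \<in> K i \<Longrightarrow> f i x = 0) \<Longrightarrow> fi f g = 0"
  unfolding fi_def
proof (intro sum.neutral ballI)
  fix i assume *: "\<And>i x. i \<in> I \<Longrightarrow> x \<in> K i \<Longrightarrow> f i x = 0" "i \<in> I"
  then have "\<Phi> i (\<lambda>x. f i x \<bullet> g i x) = \<Phi> i (\<lambda>x. 0)"
    by (intro pos_lin_cong[OF pl]) auto
  then show "\<Phi> i (\<lambda>x. f i x \<bullet> g i x) = 0"
    using pos_lin_zero[OF pl[OF *(2)]] by simp
qed

lemma fi_zero_right: "(\<And>i x. i \<in> I \<Longrightarrow> x \<in> K i \<Longrightarrow> g i x = 0) \<Longrightarrow> fi f g = 0"
  using fi_zero_left[of g f] by (simp add: fi_commute)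

lemma fi_cong:
  "(\<And>i x. i \<in> I \<Longrightarrow> x \<in> K i \<Longrightarrow> f i x = f' i x) \<Longrightarrow> (\<And>i x. i \<in> I \<Longrightarrow> x \<in> K i \<Longrightarrow> g i x = g' i x) \<Longrightarrow>
     fi f g = fi f' g'"
  unfolding fi_def by (intro sum.cong refl pos_lin_cong[OF pl]) auto

lemma fi_le_fi:
  fixes f :: "'i \<Rightarrow> 'a \<Rightarrow> 'b::real_inner" and g :: "'i \<Rightarrow> 'a \<Rightarrow> 'c::real_inner"
  assumes "cf f" "cf g" "\<And>i x. i \<in> I \<Longrightarrow> x \<in> K i \<Longrightarrow> f i x \<bullet> f i x \<le> g i x \<bullet> g i x"
  shows "fi f f \<le> fi g g"
  unfolding fi_def
  by (intro sum_mono pos_lin_mono[OF pl]) (use assms in \<open>auto simp: cf_def intro!: continuous_on_inner\<close>)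

lemma fi_Cauchy_Schwarz:
  assumes "cf f" "cf g" shows "(fi f g)\<^sup>2 \<le> fi f f * fi g g"
proof (rule quadratic_nonneg_imp_discriminant)
  fix t :: real
  have "0 \<le> fi (\<lambda>i x. f i x + t *\<^sub>R g i x) (\<lambda>i x. f i x + t *\<^sub>R g i x)"
    by (intro fi_nonneg cf_add cf_scale assms)
  also have "\<dots> = fi f f + t * fi f g + t * (fi g f + t * fi g g)"
    using assms by (simp add: fi_add fi_add_right fi_scale fi_scale_right cf_scale cf_add algebra_simps)
  also have "\<dots> = fi f f + 2 * t * fi f g + t\<^sup>2 * fi g g"
    by (simp add: fi_commute[of g f] power2_eq_square algebra_simps)
  finally show "0 \<le> fi f f + 2 * t * fi f g + t\<^sup>2 * fi g g" .
qed

lemma fi_abs_le: "cf f \<Longrightarrow> cf g \<Longrightarrow> \<bar>fi f g\<bar> \<le> sqrt (fi f f) * sqrt (fi g g)"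
  using real_sqrt_le_mono[OF fi_Cauchy_Schwarz[of f g]] by (simp add: real_sqrt_mult)

text \<open>Parallelogram law: the defect of the inequality is the square of the difference.\<close>

lemma fi_add_le:
  assumes "cf f" "cf g"
  shows "fi (\<lambda>i x. f i x + g i x) (\<lambda>i x. f i x + g i x) \<le> 2 * fi f f + 2 * fi g g"
proof -
  have "0 \<le> fi (\<lambda>i x. f i x - g i x) (\<lambda>i x. f i x - g i x)"
    by (intro fi_nonneg cf_diff assms)
  then show ?thesis
    using assms by (simp add: fi_add fi_add_right fi_diff fi_diff_right cf_add cf_diff fi_commute[of g f])
qed

end

section \<open>Lebesgue integrals over compact sets as positive functionals\<close>

lemma pos_lin_set_integral:
  fixes K :: "'a::euclidean_space set"
  assumes "compact K" shows "pos_lin K (\<lambda>f. LINT x:K|lborel. f x)"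
proof -
  have int: "set_integrable lborel K f" if "continuous_on K f" for f :: "'a \<Rightarrow> real"
    using borel_integrable_compact[OF assms that] by (simp add: set_integrable_def)
  show ?thesis
    unfolding pos_lin_def
  proof (intro conjI allI impI)
    fix f g :: "'a \<Rightarrow> real" assume "\<forall>x\<in>K. f x = g x"
    then show "(LINT x:K|lborel. f x) = (LINT x:K|lborel. g x)"
      unfolding set_lebesgue_integral_def by (intro Bochner_Integration.integral_cong) (auto simp: indicator_def)
  next
    fix f :: "'a \<Rightarrow> real" assume "\<forall>x\<in>K. 0 \<le> f x"
    then show "0 \<le> (LINT x:K|lborel. f x)"
      unfolding set_lebesgue_integral_def by (intro integral_nonneg_AE AE_I2) (auto simp: indicator_def)
  qed (auto simp: int)
qed

text \<open>The part of \<open>U\<close> where \<open>f\<close> does not vanish is open by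
  continuity and null because the integral is 0, hence empty.\<close>

lemma set_integral_zero_open:
  fixes f :: "'a::euclidean_space \<Rightarrow> real"
  assumes K: "compact K" and f: "continuous_on K f" and nn: "\<And>x. x \<in> K \<Longrightarrow> 0 \<le> f x"
    and U: "open U" "U \<subseteq> K" and zero: "(LINT x:K|lborel. f x) = 0" and x: "x \<in> U"
  shows "f x = 0"
proof (rule ccontr)
  assume "f x \<noteq> 0"
  let ?N = "U \<inter> f -` (- {0})"
  have "open ?N"
    using continuous_on_subset[OF f U(2)] U(1) by (intro continuous_open_preimage) auto
  moreover have "x \<in> ?N" using \<open>f x \<noteq> 0\<close> x by simp
  ultimately have "\<not> negligible ?N" using open_not_negligible by blast
  have "integrable lborel (\<lambda>x. indicator K x *\<^sub>R f x)"
    by (rule borel_integrable_compact[OF K f])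
  moreover have "AE x in lborel. 0 \<le> indicator K x *\<^sub>R f x"
    using nn by (intro AE_I2) (auto simp: indicator_def)
  ultimately have "AE x in lborel. indicator K x *\<^sub>R f x = 0"
    using zero unfolding set_lebesgue_integral_def by (simp add: integral_nonneg_eq_0_iff_AE)
  then have "AE x in lborel. x \<notin> ?N"
    by eventually_elim (use U in \<open>auto simp: indicator_def split: if_splits\<close>)
  moreover have "?N \<in> sets lborel" using \<open>open ?N\<close> by simp
  ultimately have "?N \<in> null_sets lborel" using AE_iff_null_sets[of ?N lborel] by blast
  then have "negligible ?N"
    unfolding negligible_iff_null_sets using null_sets_completionI by blast
  then show False using \<open>\<not> negligible ?N\<close> by simp
qed

section \<open>Barycentric coordinates\<close>

text \<open>Extreme points give a canonical vertex set: the vertices of a facet form a subset of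
  those of the element, and they are the same from both sides of a shared facet.\<close>

definition verts :: "(real^3) set \<Rightarrow> (real^3) set" where
  "verts T = {x. x extreme_point_of T}"

lemma verts_convex_hull: "\<not> affine_dependent S \<Longrightarrow> verts (convex hull S) = S" for S :: "(real^3) set"
  by (simp add: verts_def extreme_point_of_convex_hull_affine_independent)

lemma
  assumes "3 simplex T"
  shows finite_verts: "finite (verts T)" and card_verts: "card (verts T) = 4"
    and affine_independent_verts: "\<not> affine_dependent (verts T)"
    and convex_hull_verts: "convex hull (verts T) = T"
proof -
  obtain C :: "(real^3) set" where C: "\<not> affine_dependent C" "int (card C) = 3 + 1" "T = convex hull C"
    using assms by (auto simp: simplex_def)
  have "verts T = C" using C verts_convex_hull by simp
  then show "finite (verts T)" "card (verts T) = 4" "\<not> affine_dependent (verts T)" "convex hull (verts T) = T"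
    using C aff_independent_finite by auto
qed

lemma affine_hull_verts: "3 simplex T \<Longrightarrow> affine hull (verts T) = UNIV" for T :: "(real^3) set"
  using affine_independent_span_eq[of "verts T"] by (simp add: affine_independent_verts card_verts)

text \<open>Gradient of the barycentric coordinate at \<open>v\<close>, which falls from 1 to 0
  along every edge leaving \<open>v\<close>; for a tetrahedron the three edges determine it.\<close>

definition bgrad :: "(real^3) set \<Rightarrow> real^3 \<Rightarrow> real^3" where
  "bgrad T v = (SOME g. \<forall>w\<in>verts T - {v}. g \<bullet> (w - v) = -1)"

text \<open>The barycentric coordinate at \<open>v\<close> as an affine function on the whole space,
  so that it can be differentiated and compared on the affine hull of a facet.\<close>

definition lam :: "(real^3) set \<Rightarrow> real^3 \<Rightarrow> real^3 \<Rightarrow> real" where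
  "lam T v x = 1 + bgrad T v \<bullet> (x - v)"

text \<open>Bernstein polynomials without their multinomial factors, which would only rescale the
  coefficients.\<close>

definition bmon :: "(real^3) set \<Rightarrow> (real^3) multiset \<Rightarrow> real^3 \<Rightarrow> real" where
  "bmon T \<alpha> x = (\<Prod>v\<in>#\<alpha>. lam T v x)"

lemma bmon_empty: "bmon T {#} x = 1"
  and bmon_add_mset: "bmon T (add_mset v \<alpha>) x = lam T v x * bmon T \<alpha> x"
  and bmon_union: "bmon T (\<alpha> + \<beta>) x = bmon T \<alpha> x * bmon T \<beta> x"
  by (simp_all add: bmon_def)

lemma lam_polys: "lam T v \<in> polys 1"
proof -
  have "lam T v = (\<lambda>x. (1 - bgrad T v \<bullet> v) + bgrad T v \<bullet> x)"
    by (auto simp: lam_def inner_diff_right)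
  then show ?thesis by (simp only: polys_add[OF polys_const polys_inner])
qed

lemma continuous_lam: "continuous_on S (lam T v)"
  by (rule continuous_on_polys[OF lam_polys])

lemma bmon_polys: "bmon T \<alpha> \<in> polys (size \<alpha>)"
proof (induction \<alpha>)
  case empty show ?case using polys_const[of 1 0] by (simp add: bmon_empty[abs_def])
next
  case (add v \<alpha>)
  show ?case using polys_mult[OF lam_polys add, of T v] by (simp add: bmon_add_mset[abs_def])
qed

lemma bsum_polys: "(\<lambda>x. \<Sum>\<alpha>\<in>mi S n. c \<alpha> * bmon T \<alpha> x) \<in> polys n"
  by (intro polys_sum polys_cmult) (auto simp: mi_def bmon_polys)

lemma open_lam_pos: "finite S \<Longrightarrow> open {x. \<forall>w\<in>S. 0 < lam T w x}"
  unfolding Collect_ball_eq by (intro open_INT ballI open_Collect_less continuous_lam continuous_on_const)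

lemma lam_diff: "lam T v x - lam T v y = bgrad T v \<bullet> (x - y)"
  by (simp add: lam_def inner_diff_right)

lemma lam_affine:
  assumes "(\<Sum>i\<in>I. u i) = 1"
  shows "lam T v (\<Sum>i\<in>I. u i *\<^sub>R y i) = (\<Sum>i\<in>I. u i * lam T v (y i))"
proof -
  have "(\<Sum>i\<in>I. u i * lam T v (y i)) = (\<Sum>i\<in>I. u i * (1 - bgrad T v \<bullet> v) + bgrad T v \<bullet> (u i *\<^sub>R y i))"
    by (simp add: lam_def inner_diff_right algebra_simps)
  also have "\<dots> = (1 - bgrad T v \<bullet> v) + bgrad T v \<bullet> (\<Sum>i\<in>I. u i *\<^sub>R y i)"
    by (simp add: sum.distrib sum_distrib_right[symmetric] assms inner_sum_right)
  finally show ?thesis by (simp add: lam_def inner_diff_right)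
qed

context
  fixes T :: "(real^3) set"
  assumes T: "3 simplex T"
begin

text \<open>The edge vectors at \<open>v\<close> are independent, so some linear functional is -1 on
  each of them; its adjoint applied to 1 is the representing vector.\<close>

lemma bgrad_works:
  assumes v: "v \<in> verts T" and w: "w \<in> verts T" "w \<noteq> v"
  shows "bgrad T v \<bullet> (w - v) = -1"
proof -
  let ?B = "(\<lambda>x. x - v) ` (verts T - {v})"
  have "independent ?B"
    using affine_independent_verts[OF T] v affine_dependent_iff_dependent[of v "verts T - {v}"]
    by (simp add: insert_absorb)
  then obtain f :: "real^3 \<Rightarrow> real" where f: "linear f" "\<And>x. x \<in> ?B \<Longrightarrow> f x = -1"
    using linear_independent_extend[of ?B "\<lambda>_. -1"] by blast
  have "\<forall>w\<in>verts T - {v}. adjoint f 1 \<bullet> (w - v) = -1"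
    using f adjoint_works[OF f(1), of _ 1] by (auto simp: inner_commute)
  then have "\<forall>w\<in>verts T - {v}. bgrad T v \<bullet> (w - v) = -1"
    unfolding bgrad_def by (rule someI)
  then show ?thesis using w by auto
qed

lemma lam_vert: "v \<in> verts T \<Longrightarrow> w \<in> verts T \<Longrightarrow> lam T v w = (if v = w then 1 else 0)"
  using bgrad_works[of v w] by (auto simp: lam_def)

text \<open>An affine function commutes with affine combinations, so the values at the vertices show
  that barycentric coordinates recover the coefficients of such a combination.\<close>

lemma lam_comb:
  assumes "S \<subseteq> verts T" "w \<in> verts T" "sum u S = 1"
  shows "lam T w (\<Sum>v\<in>S. u v *\<^sub>R v) = (if w \<in> S then u w else 0)"
proof -
  have "finite S" using assms(1) finite_verts[OF T] by (rule finite_subset)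
  have "lam T w (\<Sum>v\<in>S. u v *\<^sub>R v) = (\<Sum>v\<in>S. u v * lam T w v)"
    by (rule lam_affine[OF assms(3)])
  also have "\<dots> = (\<Sum>v\<in>S. if v = w then u v else 0)"
    using assms lam_vert by (intro sum.cong) auto
  finally show ?thesis using \<open>finite S\<close> by simp
qed

lemma sum_lam: "(\<Sum>v\<in>verts T. lam T v x) = 1"
  and sum_lam_vert: "(\<Sum>v\<in>verts T. lam T v x *\<^sub>R v) = x"
proof -
  have "x \<in> affine hull (verts T)" using affine_hull_verts[OF T] by simp
  then obtain u where u: "sum u (verts T) = 1" "(\<Sum>v\<in>verts T. u v *\<^sub>R v) = x"
    unfolding affine_hull_finite[OF finite_verts[OF T]] by blast
  have "lam T v x = u v" if "v \<in> verts T" for v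
    using lam_comb[OF _ that u(1)] u(2) that by simp
  then show "(\<Sum>v\<in>verts T. lam T v x) = 1" "(\<Sum>v\<in>verts T. lam T v x *\<^sub>R v) = x"
    using u by simp_all
qed

lemma convex_hull_lam:
  assumes "S \<subseteq> verts T"
  shows "x \<in> convex hull S \<longleftrightarrow> (\<forall>v\<in>verts T. 0 \<le> lam T v x) \<and> (\<forall>v\<in>verts T - S. lam T v x = 0)"
proof
  have fS: "finite S" using assms finite_verts[OF T] by (rule finite_subset)
  {
    assume "x \<in> convex hull S"
    then obtain u where u: "\<forall>v\<in>S. 0 \<le> u v" "sum u S = 1" "(\<Sum>v\<in>S. u v *\<^sub>R v) = x"
      unfolding convex_hull_finite[OF fS] by blast
    show "(\<forall>v\<in>verts T. 0 \<le> lam T v x) \<and> (\<forall>v\<in>verts T - S. lam T v x = 0)"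
      using lam_comb[OF assms _ u(2)] u by auto
  next
    assume *: "(\<forall>v\<in>verts T. 0 \<le> lam T v x) \<and> (\<forall>v\<in>verts T - S. lam T v x = 0)"
    have "sum (\<lambda>v. lam T v x) S = (\<Sum>v\<in>verts T. lam T v x)"
      using * assms finite_verts[OF T] by (intro sum.mono_neutral_left) auto
    moreover have "(\<Sum>v\<in>S. lam T v x *\<^sub>R v) = (\<Sum>v\<in>verts T. lam T v x *\<^sub>R v)"
      using * assms finite_verts[OF T] by (intro sum.mono_neutral_left) auto
    ultimately show "x \<in> convex hull S"
      unfolding convex_hull_finite[OF fS]
      using * assms by (auto simp: sum_lam sum_lam_vert intro!: exI[of _ "\<lambda>v. lam T v x"])
  }
qed

lemma mem_simplex_lam: "x \<in> T \<longleftrightarrow> (\<forall>v\<in>verts T. 0 \<le> lam T v x)"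
  using convex_hull_lam[of "verts T"] convex_hull_verts[OF T] by simp

lemma lam_le_1: "x \<in> T \<Longrightarrow> v \<in> verts T \<Longrightarrow> lam T v x \<le> 1"
  using member_le_sum[of v "verts T" "\<lambda>v. lam T v x"] finite_verts[OF T]
  by (simp add: sum_lam mem_simplex_lam)

lemma compact_simplex3: "compact T"
  using convex_hull_verts[OF T] finite_verts[OF T] finite_imp_compact_convex_hull[of "verts T"] by simp

lemma facet_iff: "F facet_of T \<longleftrightarrow> (\<exists>v\<in>verts T. F = convex hull (verts T - {v}))"
proof -
  have "2 \<le> card (verts T)" using card_verts[OF T] by simp
  then show ?thesis
    using facet_of_convex_hull_affine_independent_alt[OF affine_independent_verts[OF T], of F]
    by (simp add: convex_hull_verts[OF T] Bex_def)
qed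

lemma finite_facets: "finite {F. F facet_of T}"
proof -
  have "{F. F facet_of T} = (\<lambda>v. convex hull (verts T - {v})) ` verts T" by (auto simp: facet_iff)
  then show ?thesis using finite_verts[OF T] by simp
qed

lemma verts_facet: "v \<in> verts T \<Longrightarrow> verts (convex hull (verts T - {v})) = verts T - {v}"
  using affine_independent_verts[OF T] affine_independent_subset[of "verts T" "verts T - {v}"]
  by (intro verts_convex_hull) auto

lemma facetE:
  assumes "F facet_of T"
  obtains v where "v \<in> verts T" "F = convex hull (verts T - {v})" "verts F = verts T - {v}"
  using assms verts_facet by (auto simp: facet_iff)

lemma lam_facet:
  assumes "v \<in> verts T" "x \<in> affine hull (verts T - {v})" shows "lam T v x = 0"
proof -
  have "finite (verts T - {v})" using finite_verts[OF T] by simp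
  from assms(2)[unfolded affine_hull_finite[OF this]]
  show ?thesis using lam_comb[of "verts T - {v}" v] assms(1) by auto
qed

text \<open>In the expansion of \<open>h\<close> as the sum of
  \<open>lam T w (a + h) *\<^sub>R (w - a)\<close> over the vertices, the inner product with
  \<open>n\<close> sees only \<open>v\<close>. All statements on normals come from here: the outward
  normal, the opposite normals of neighbours, the area of a facet, and gradients of functions
  vanishing on a facet.\<close>

lemma orthogonal_facet_parallel:
  assumes v: "v \<in> verts T" and a: "a \<in> verts T - {v}"
    and orth: "\<And>w. w \<in> verts T - {v} \<Longrightarrow> n \<bullet> (w - a) = 0"
  shows "n = (n \<bullet> (v - a)) *\<^sub>R bgrad T v"
proof -
  have "n \<bullet> h = ((n \<bullet> (v - a)) *\<^sub>R bgrad T v) \<bullet> h" for h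
  proof -
    define z where "z = a + h"
    have "h = (\<Sum>w\<in>verts T. lam T w z *\<^sub>R w) - (\<Sum>w\<in>verts T. lam T w z) *\<^sub>R a"
      by (simp add: sum_lam sum_lam_vert z_def)
    also have "\<dots> = (\<Sum>w\<in>verts T. lam T w z *\<^sub>R (w - a))"
      by (simp add: scaleR_right_diff_distrib sum_subtractf scaleR_sum_left)
    finally have "n \<bullet> h = (\<Sum>w\<in>verts T. lam T w z * (n \<bullet> (w - a)))"
      by (simp add: inner_sum_right)
    also have "\<dots> = lam T v z * (n \<bullet> (v - a))"
      using finite_verts[OF T] v orth by (subst sum.remove[of _ v]) auto
    also have "lam T v z = bgrad T v \<bullet> h"
      using lam_diff[of T v z a] lam_vert[of v a] v a by (auto simp: z_def)
    finally show ?thesis by simp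
  qed
  then show ?thesis by (metis vector_eq_rdot)
qed

lemma bgrad_nonzero: 
  assumes "v \<in> verts T" shows "bgrad T v \<noteq> 0"
proof -
  have "verts T - {v} \<noteq> {}"
    using card_verts[OF T] card_mono[of "{v}" "verts T"] by auto
  then show ?thesis using bgrad_works[OF assms] by force
qed

text \<open>Facet vertices may be inserted in both roles of the inequality, so any candidate is
  orthogonal to the facet and hence a multiple of \<open>bgrad T v\<close>; the vertex
  \<open>v\<close> fixes the sign and the norm fixes the length. This justifies the definite
  description.\<close>

lemma outward_normal_eq:
  assumes v: "v \<in> verts T" and F: "F = convex hull (verts T - {v})"
  shows "outward_normal T F = - (1 / norm (bgrad T v)) *\<^sub>R bgrad T v"
  unfolding outward_normal_def
proof (rule the_equality)
  let ?g = "bgrad T v"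
  have g: "?g \<noteq> 0" by (rule bgrad_nonzero[OF v])
  have z: "lam T v x = 0" if "x \<in> F" for x
    using that convex_hull_lam[of "verts T - {v}" x] v F by auto
  have "- (1 / norm ?g) *\<^sub>R ?g \<bullet> (y - x) \<le> 0" if "x \<in> F" "y \<in> T" for x y
  proof -
    have "0 \<le> ?g \<bullet> (y - x)"
      using z[OF that(1)] that(2) v lam_diff[of T v y x] by (auto simp: mem_simplex_lam)
    then show ?thesis by simp
  qed
  then show "norm (- (1 / norm ?g) *\<^sub>R ?g) = 1 \<and> (\<forall>x\<in>F. \<forall>y\<in>T. - (1 / norm ?g) *\<^sub>R ?g \<bullet> (y - x) \<le> 0)"
    using g by simp
next
  let ?g = "bgrad T v"
  have g: "?g \<noteq> 0" by (rule bgrad_nonzero[OF v])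
  fix n :: "real^3" assume n: "norm n = 1 \<and> (\<forall>x\<in>F. \<forall>y\<in>T. n \<bullet> (y - x) \<le> 0)"
  have VF: "verts T - {v} \<subseteq> F" unfolding F by (rule hull_subset)
  have FT: "F \<subseteq> T"
  proof
    fix x assume "x \<in> F"
    then show "x \<in> T"
      using convex_hull_lam[of "verts T - {v}" x] v F by (auto simp: mem_simplex_lam)
  qed
  have "verts T - {v} \<noteq> {}"
    using card_verts[OF T] card_mono[of "{v}" "verts T"] by auto
  then obtain a where a: "a \<in> verts T - {v}" by blast
  have "n \<bullet> (w - a) = 0" if "w \<in> verts T - {v}" for w
  proof -
    have "n \<bullet> (w - a) \<le> 0" "n \<bullet> (a - w) \<le> 0" using n VF FT a that by blast+
    then show ?thesis by (simp add: inner_diff_right)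
  qed
  from orthogonal_facet_parallel[OF v a this] have e: "n = (n \<bullet> (v - a)) *\<^sub>R ?g" .
  define c where "c = n \<bullet> (v - a)"
  have nc: "n = c *\<^sub>R ?g" using e by (simp add: c_def)
  have "v \<in> T" using v convex_hull_verts[OF T] hull_subset[of "verts T" convex] by blast
  then have "c \<le> 0" unfolding c_def using n VF a by blast
  moreover have "\<bar>c\<bar> * norm ?g = 1" using n nc by (metis norm_scaleR)
  ultimately have "c = - (1 / norm ?g)" using g by (simp add: field_simps)
  then show "n = - (1 / norm ?g) *\<^sub>R ?g" using nc by simp
qed

lemma norm_outward_normal: 
  assumes "F facet_of T" shows "norm (outward_normal T F) = 1"
proof -
  obtain v where "v \<in> verts T" "F = convex hull (verts T - {v})" by (rule facetE[OF assms])
  then show ?thesis using bgrad_nonzero by (simp add: outward_normal_eq)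
qed

lemma facet_subset: "F facet_of T \<Longrightarrow> F \<subseteq> T"
  by (simp add: facet_of_def face_of_imp_subset)

lemma interior_simplex_lam: "{x. \<forall>v\<in>verts T. 0 < lam T v x} \<subseteq> interior T"
proof (rule interior_maximal)
  show "open {x. \<forall>v\<in>verts T. 0 < lam T v x}"
    by (rule open_lam_pos[OF finite_verts[OF T]])
qed (auto simp: mem_simplex_lam less_imp_le)

text \<open>Functions of this form are closed under linear combinations, and products add the
  degrees. Coordinates have degree 1, and so has the constant 1, because the barycentric coordinates
  add up to it; powers of this 1 lift a monomial of lower degree to degree exactly
  \<open>n\<close>.\<close>

lemma polys_bmon_rep:
  assumes "p \<in> polys n"
  shows "\<exists>c. \<forall>x. p x = (\<Sum>\<alpha>\<in>mi (verts T) n. c \<alpha> * bmon T \<alpha> x)"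
proof -
  define H where "H n = {f. \<exists>c. \<forall>x. f x = (\<Sum>\<alpha>\<in>mi (verts T) n. c \<alpha> * bmon T \<alpha> x)}" for n
  have H0: "(\<lambda>_. 0) \<in> H n" for n
    unfolding H_def by (auto intro!: exI[of _ "\<lambda>_. 0"])
  have Hadd: "(\<lambda>x. f x + g x) \<in> H n" if "f \<in> H n" "g \<in> H n" for f g n
  proof -
    from that obtain c d where
      "\<forall>x. f x = (\<Sum>\<alpha>\<in>mi (verts T) n. c \<alpha> * bmon T \<alpha> x)"
      "\<forall>x. g x = (\<Sum>\<alpha>\<in>mi (verts T) n. d \<alpha> * bmon T \<alpha> x)" unfolding H_def by blast
    then show ?thesis unfolding H_def
      by (auto simp: sum.distrib[symmetric] distrib_right[symmetric] intro!: exI[of _ "\<lambda>\<alpha>. c \<alpha> + d \<alpha>"])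
  qed
  have Hcm: "(\<lambda>x. a * f x) \<in> H n" if "f \<in> H n" for f a n
  proof -
    from that obtain c where
      "\<forall>x. f x = (\<Sum>\<alpha>\<in>mi (verts T) n. c \<alpha> * bmon T \<alpha> x)" unfolding H_def by blast
    then show ?thesis unfolding H_def
      by (auto simp: sum_distrib_left mult.assoc intro!: exI[of _ "\<lambda>\<alpha>. a * c \<alpha>"])
  qed
  have Hsum: "(\<lambda>x. \<Sum>i\<in>I. f i x) \<in> H n" if "\<And>i. i \<in> I \<Longrightarrow> f i \<in> H n" for I :: "'b set" and f n
    using that by (induction I rule: infinite_finite_induct) (auto intro: H0 Hadd)
  have Hmon: "bmon T \<alpha> \<in> H n" if "\<alpha> \<in> mi (verts T) n" for \<alpha> n
  proof -
    have "(\<Sum>\<beta>\<in>mi (verts T) n. (if \<beta> = \<alpha> then 1 else 0) * bmon T \<beta> x) = bmon T \<alpha> x" for x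
    proof -
      have "(\<Sum>\<beta>\<in>mi (verts T) n. (if \<beta> = \<alpha> then 1 else 0) * bmon T \<beta> x)
         = (\<Sum>\<beta>\<in>mi (verts T) n. if \<beta> = \<alpha> then bmon T \<beta> x else 0)"
        by (rule sum.cong) auto
      also have "\<dots> = bmon T \<alpha> x"
        using that finite_mi[OF finite_verts[OF T]] by (subst sum.delta) auto
      finally show ?thesis .
    qed
    then show ?thesis unfolding H_def by (auto intro!: exI[of _ "\<lambda>\<beta>. if \<beta> = \<alpha> then 1 else 0"])
  qed
  have Hmul: "(\<lambda>x. f x * g x) \<in> H (i + j)" if "f \<in> H i" "g \<in> H j" for f g i j
  proof -
    from that obtain c d where
      cd: "\<And>x. f x = (\<Sum>\<alpha>\<in>mi (verts T) i. c \<alpha> * bmon T \<alpha> x)"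
      "\<And>x. g x = (\<Sum>\<alpha>\<in>mi (verts T) j. d \<alpha> * bmon T \<alpha> x)" unfolding H_def by blast
    have "(\<lambda>x. f x * g x) = (\<lambda>x. \<Sum>\<alpha>\<in>mi (verts T) i. \<Sum>\<beta>\<in>mi (verts T) j. (c \<alpha> * d \<beta>) * bmon T (\<alpha> + \<beta>) x)"
      by (auto simp: cd sum_product bmon_union algebra_simps)
    also have "\<dots> \<in> H (i + j)"
      by (intro Hsum Hcm Hmon) (auto simp: mi_def)
    finally show ?thesis .
  qed
  have Hlam: "lam T v \<in> H 1" if "v \<in> verts T" for v
    using Hmon[of "{#v#}" 1] that by (simp add: mi_def bmon_def[abs_def] eta_contract_eq)
  have H1: "(\<lambda>_. 1) \<in> H 1"
    using Hsum[of "verts T" "lam T" 1] Hlam by (simp add: sum_lam)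
  have Hx: "(\<lambda>x. x $ i) \<in> H 1" for i
  proof -
    have "(\<lambda>x. \<Sum>v\<in>verts T. v $ i * lam T v x) \<in> H 1" by (intro Hsum Hcm Hlam)
    moreover have "(\<Sum>v\<in>verts T. v $ i * lam T v x) = x $ i" for x
      using arg_cong[OF sum_lam_vert[of x], of "\<lambda>y. y $ i"] by (simp add: mult.commute)
    ultimately show ?thesis by simp
  qed
  have Hpow: "(\<lambda>x. f x ^ k) \<in> H k" if "f \<in> H 1" for f k
  proof (induction k)
    case 0
    show ?case using Hmon[of "{#}" 0] by (simp add: mi_def bmon_empty[abs_def])
  next
    case (Suc k)
    show ?case using Hmul[OF that Suc] by simp
  qed
  have Hprod: "(\<lambda>x. \<Prod>i\<in>A. x $ i ^ \<alpha> i) \<in> H (\<Sum>i\<in>A. \<alpha> i)" for A :: "3 set" and \<alpha>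
  proof (induction A rule: infinite_finite_induct)
    case (insert i A)
    then show ?case using Hmul[OF Hpow[OF Hx] insert.IH, of i "\<alpha> i"] by simp
  qed (use Hpow[OF H1, of 0] in simp_all)
  have "p \<in> H n" using assms
  proof (induction rule: polys_induct)
    case (monom \<alpha>)
    then show ?case
      using Hmul[OF Hprod[of \<alpha> UNIV] Hpow[OF H1, of "n - sum \<alpha> UNIV"]] by simp
  qed (auto intro: H0 Hadd Hcm)
  then show ?thesis by (simp add: H_def)
qed

end

text \<open>On the affine hull of common vertices both simplices read off the coefficients of the
  same affine combination. Conformity of the reconstruction rests on this.\<close>

lemma lam_shared:
  assumes "3 simplex T" "3 simplex T'" "S \<subseteq> verts T" "S \<subseteq> verts T'" "w \<in> S" "x \<in> affine hull S"
  shows "lam T w x = lam T' w x"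
proof -
  have "finite S" using finite_subset[OF assms(3) finite_verts[OF assms(1)]] .
  from assms(6)[unfolded affine_hull_finite[OF this]]
  obtain u where u: "sum u S = 1" "x = (\<Sum>v\<in>S. u v *\<^sub>R v)" by auto
  show ?thesis
    unfolding u(2) using lam_comb[OF assms(1,3) _ u(1)] lam_comb[OF assms(2,4) _ u(1)] assms(3,4,5)
    by (simp add: subset_iff)
qed

lemma bmon_shared:
  assumes "3 simplex T" "3 simplex T'" "S \<subseteq> verts T" "S \<subseteq> verts T'" "set_mset \<alpha> \<subseteq> S" "x \<in> affine hull S"
  shows "bmon T \<alpha> x = bmon T' \<alpha> x"
  unfolding bmon_def
  using lam_shared[OF assms(1-4) _ assms(6)] assms(5)
  by (intro arg_cong[where f = prod_mset] image_mset_cong) auto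

text \<open>Hence only multi-indices supported on a facet contribute to the trace on its
  plane.\<close>

lemma bmon_facet_zero:
  assumes "3 simplex T" "v \<in> verts T" "x \<in> affine hull (verts T - {v})" "v \<in># \<alpha>"
  shows "bmon T \<alpha> x = 0"
  using lam_facet[OF assms(1-3)] multi_member_split[OF assms(4)] by (auto simp: bmon_def)

section \<open>Neighbouring elements\<close>

context
  fixes T T' F :: "(real^3) set"
  assumes T: "3 simplex T" and T': "3 simplex T'" and ne: "T \<noteq> T'"
    and F: "F facet_of T" and F': "F facet_of T'"
    and face: "T \<inter> T' face_of T" "T \<inter> T' face_of T'"
begin

text \<open>The coordinates opposite to the common facet both vanish on its plane, so they are
  proportional; the factor is negative because the elements lie on different sides.\<close>

lemma neighbours_lam:
  obtains v v' c where "v \<in> verts T" "v' \<in> verts T'" "verts F = verts T - {v}" "verts F = verts T' - {v'}"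
    "F = convex hull (verts F)" "c < 0" "bgrad T' v' = c *\<^sub>R bgrad T v" "\<And>x. lam T' v' x = c * lam T v x"
proof -
  obtain v where v: "v \<in> verts T" "F = convex hull (verts T - {v})" "verts F = verts T - {v}"
    by (rule facetE[OF T F])
  obtain v' where v': "v' \<in> verts T'" "F = convex hull (verts T' - {v'})" "verts F = verts T' - {v'}"
    by (rule facetE[OF T' F'])
  have c3: "card (verts F) = 3" using v(1,3) card_verts[OF T] finite_verts[OF T] by simp
  have vT: "verts T = insert v (verts F)" "v \<notin> verts F" using v(1,3) by auto
  have vT': "verts T' = insert v' (verts F)" "v' \<notin> verts F" using v'(1,3) by auto
  from c3 obtain a where a: "a \<in> verts F" by (metis card.empty ex_in_conv zero_neq_numeral)
  define c where "c = bgrad T' v' \<bullet> (v - a)"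
  have "bgrad T' v' \<bullet> (w - a) = 0" if "w \<in> verts F" for w
  proof -
    have "v' \<noteq> w" "v' \<noteq> a" "w \<in> verts T'" "a \<in> verts T'" using vT' a that by auto
    then show ?thesis using lam_diff[of T' v' w a] by (simp add: lam_vert[OF T' v'(1)])
  qed
  then have gc: "bgrad T' v' = c *\<^sub>R bgrad T v"
    unfolding c_def by (intro orthogonal_facet_parallel[OF T v(1)]) (use a vT in auto)
  then have "c \<noteq> 0" using bgrad_nonzero[OF T' v'(1)] by auto
  have lc: "lam T' v' x = c * lam T v x" for x
  proof -
    have "v' \<noteq> a" "v \<noteq> a" "a \<in> verts T" "a \<in> verts T'" using vT vT' a by auto
    then show ?thesis
      using lam_diff[of T' v' x a] lam_diff[of T v x a] gc
      by (simp add: lam_vert[OF T' v'(1)] lam_vert[OF T v(1)])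
  qed
  \<comment> \<open>For positive \<open>c\<close>, a point slightly off the centroid of the facet
    would be interior to both elements. A face that meets the interior is the whole simplex, so the
    common face would equal both elements.\<close>
  have "c < 0"
  proof (rule ccontr)
    assume "\<not> c < 0"
    then have c: "0 < c" using \<open>c \<noteq> 0\<close> by simp
    define x0 where "x0 = (\<Sum>w\<in>verts F. (1/3) *\<^sub>R w)"
    have s1: "sum (\<lambda>_. 1/3::real) (verts F) = 1" by (simp add: c3)
    have l0: "lam T w x0 = (if w \<in> verts F then 1/3 else 0)" if "w \<in> verts T" for w
      unfolding x0_def by (rule lam_comb[OF T _ that s1]) (use vT in auto)
    have l0': "lam T' w x0 = (if w \<in> verts F then 1/3 else 0)" if "w \<in> verts T'" for w
      unfolding x0_def by (rule lam_comb[OF T' _ that s1]) (use vT' in auto)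
    let ?x = "\<lambda>e. x0 + e *\<^sub>R bgrad T v"
    have tend: "((\<lambda>e. lam U w (?x e)) \<longlongrightarrow> lam U w (?x 0)) (at_right 0)" for U w
      unfolding lam_def
      by (rule tendsto_add tendsto_diff tendsto_inner tendsto_scaleR tendsto_const tendsto_ident_at)+
    have ev: "\<forall>\<^sub>F e in at_right 0. 0 < lam U w (?x e)" if "0 < lam U w x0" for U w
      using order_tendstoD(1)[OF tend] that by simp
    have "\<forall>\<^sub>F e in at_right 0. \<forall>w\<in>verts F. 0 < lam T w (?x e) \<and> 0 < lam T' w (?x e)"
      using vT vT' finite_verts[OF T] l0 l0'
      by (intro eventually_ball_finite) (auto intro!: eventually_conj ev)
    moreover have "\<forall>\<^sub>F e in at_right 0. (0::real) < e" by (simp add: eventually_at_right_less)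
    ultimately have "\<forall>\<^sub>F e in at_right 0. (\<forall>w\<in>verts F. 0 < lam T w (?x e) \<and> 0 < lam T' w (?x e)) \<and> 0 < e"
      by (rule eventually_conj)
    then obtain e where e: "0 < e" "\<forall>w\<in>verts F. 0 < lam T w (?x e) \<and> 0 < lam T' w (?x e)"
      using eventually_happens'[OF trivial_limit_at_right_real] by blast
    have "lam T v (?x e) = e * (bgrad T v \<bullet> bgrad T v)"
      using lam_diff[of T v "?x e" x0] l0[OF v(1)] vT by simp
    then have lv: "0 < lam T v (?x e)" using e bgrad_nonzero[OF T v(1)] by simp
    have "?x e \<in> interior T"
      by (rule subsetD[OF interior_simplex_lam[OF T]]) (use e lv vT in auto)
    moreover have "?x e \<in> interior T'"
    proof -
      have "0 < lam T' v' (?x e)" using lc lv c by simp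
      then show ?thesis by (intro subsetD[OF interior_simplex_lam[OF T']]) (use e vT' in auto)
    qed
    moreover have "?x e \<in> T \<inter> T'" using calculation interior_subset by blast
    ultimately have "T \<inter> T' = T" "T \<inter> T' = T'"
      using face_of_disjoint_interior[OF face(1)] face_of_disjoint_interior[OF face(2)] by blast+
    then show False using ne by simp
  qed
  show ?thesis
    by (rule that[OF v(1) v'(1) v(3) v'(3) _ \<open>c < 0\<close> gc lc], subst v(3), rule v(2))
qed

lemma outward_normal_neighbour: "outward_normal T' F = - outward_normal T F"
proof -
  obtain v v' c where *: "v \<in> verts T" "v' \<in> verts T'" "verts F = verts T - {v}" "verts F = verts T' - {v'}"
    "F = convex hull (verts F)" "c < 0" "bgrad T' v' = c *\<^sub>R bgrad T v"
    by (rule neighbours_lam) blast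
  then have "F = convex hull (verts T - {v})" "F = convex hull (verts T' - {v'})" by metis+
  then show ?thesis
    using outward_normal_eq[OF T *(1)] outward_normal_eq[OF T' *(2)] *(6,7) by simp
qed

text \<open>Near the centroid of the facet the coordinates at its vertices are positive in both
  elements. Since the two opposite coordinates have opposite signs, each such point lies in one of
  the elements.\<close>

lemma shared_facet_interior: "\<exists>x\<in>F. x \<in> interior (T \<union> T')"
proof -
  obtain v v' c where *: "v \<in> verts T" "v' \<in> verts T'" "verts F = verts T - {v}" "verts F = verts T' - {v'}"
    "F = convex hull (verts F)" "c < 0" "\<And>x. lam T' v' x = c * lam T v x"
    by (rule neighbours_lam) blast
  have c3: "card (verts F) = 3" using *(1,3) card_verts[OF T] finite_verts[OF T] by simp
  define x0 where "x0 = (\<Sum>w\<in>verts F. (1/3) *\<^sub>R w)"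
  have s1: "sum (\<lambda>_. 1/3::real) (verts F) = 1" by (simp add: c3)
  have fF: "finite (verts F)" using *(3) finite_verts[OF T] by simp
  have vT: "verts T = insert v (verts F)" and vT': "verts T' = insert v' (verts F)" using *(1-4) by auto
  let ?N = "{x. \<forall>w\<in>verts F. 0 < lam T w x} \<inter> {x. \<forall>w\<in>verts F. 0 < lam T' w x}"
  have "open ?N"
    using fF by (intro open_Int open_lam_pos)
  moreover have "?N \<subseteq> T \<union> T'"
  proof
    fix x assume x: "x \<in> ?N"
    show "x \<in> T \<union> T'"
    proof (cases "0 \<le> lam T v x")
      case True
      then have "x \<in> T" using x vT by (simp add: mem_simplex_lam[OF T] less_imp_le)
      then show ?thesis by simp
    next
      case False
      then have "0 \<le> lam T' v' x" using *(6,7) by (simp add: mult_nonpos_nonpos)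
      then have "x \<in> T'" using x vT' by (simp add: mem_simplex_lam[OF T'] less_imp_le)
      then show ?thesis by simp
    qed
  qed
  moreover have "0 < lam T w x0" "0 < lam T' w x0" if "w \<in> verts F" for w
  proof -
    have "verts F \<subseteq> verts T" "verts F \<subseteq> verts T'" "w \<in> verts T" "w \<in> verts T'" using that vT vT' by auto
    then have "lam T w x0 = 1/3" "lam T' w x0 = 1/3"
      unfolding x0_def using lam_comb[OF T _ _ s1] lam_comb[OF T' _ _ s1] that by simp_all
    then show "0 < lam T w x0" "0 < lam T' w x0" by simp_all
  qed
  then have "x0 \<in> ?N" by simp
  moreover have "x0 \<in> F"
    by (subst *(5), unfold x0_def, rule convex_sum)
      (use fF s1 in \<open>auto simp: hull_inc\<close>)
  ultimately show ?thesis by (meson interior_maximal subsetD)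
qed

text \<open>A strict epigraph leaves no slits: directly below a frontier point some open set misses
  the domain, so a frontier point is never interior to the closure, whereas a shared facet has a
  point interior to the union of its elements. Consequently face functions supported on interior
  faces satisfy the boundary condition.\<close>

lemma interior_facet_not_frontier:
  assumes "lipschitz_domain \<Omega>" "T \<union> T' \<subseteq> closure \<Omega>"
  shows "\<not> F \<subseteq> frontier \<Omega>"
proof
  assume "F \<subseteq> frontier \<Omega>"
  then obtain z where z: "z \<in> frontier \<Omega>" "z \<in> interior (closure \<Omega>)"
    using shared_facet_interior interior_mono[OF assms(2)] by blast
  from assms(1) have op: "open \<Omega>" by (simp add: lipschitz_domain_def)
  from assms(1)[unfolded lipschitz_domain_def, THEN conjunct2, THEN bspec, OF z(1)] obtain U e L and \<phi> :: "real^3 \<Rightarrow> real" where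
    U: "open U" "z \<in> U" and e: "norm e = 1" and L: "L-lipschitz_on {y. y \<bullet> e = 0} \<phi>"
    and \<Omega>: "\<Omega> \<inter> U = {x \<in> U. \<phi> (x - (x \<bullet> e) *\<^sub>R e) < x \<bullet> e}"
    by (elim exE conjE) (rule that)
  have ee: "e \<bullet> e = 1" using e by (simp add: dot_square_norm)
  have "z \<notin> \<Omega>" using z(1) op by (simp add: frontier_def interior_open)
  then have "z \<notin> {x \<in> U. \<phi> (x - (x \<bullet> e) *\<^sub>R e) < x \<bullet> e}" unfolding \<Omega>[symmetric] by blast
  then have z\<phi>: "z \<bullet> e \<le> \<phi> (z - (z \<bullet> e) *\<^sub>R e)" using U(2) by (simp add: not_less)
  \<comment> \<open>For small \<open>t\<close> the points below \<open>z\<close> stay in the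
    interior of the closure, but they are strictly below the graph, where a neighbourhood contains
    no point of the domain.\<close>
  have tend: "((\<lambda>t::real. z - t *\<^sub>R e) \<longlongrightarrow> z - 0 *\<^sub>R e) (at_right 0)"
    by (rule tendsto_diff tendsto_scaleR tendsto_const tendsto_ident_at)+
  have "open (U \<inter> interior (closure \<Omega>))" using U by auto
  then have "\<forall>\<^sub>F t in at_right (0::real). z - t *\<^sub>R e \<in> U \<inter> interior (closure \<Omega>)"
    by (rule topological_tendstoD[OF tend]) (use U z in simp)
  moreover have "\<forall>\<^sub>F t in at_right 0. (0::real) < t" by (simp add: eventually_at_right_less)
  ultimately have "\<forall>\<^sub>F t in at_right (0::real). z - t *\<^sub>R e \<in> U \<inter> interior (closure \<Omega>) \<and> 0 < t"
    by (rule eventually_conj)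
  then obtain t :: real where "0 < t" "z - t *\<^sub>R e \<in> U \<inter> interior (closure \<Omega>)"
    using eventually_happens'[OF trivial_limit_at_right_real] by blast
  then have t: "0 < t" "z - t *\<^sub>R e \<in> U" "z - t *\<^sub>R e \<in> closure \<Omega>"
    using interior_subset[of "closure \<Omega>"] by auto
  have cont: "continuous_on UNIV (\<lambda>x::real^3. \<phi> (x - (x \<bullet> e) *\<^sub>R e))"
    by (rule continuous_on_compose2[OF lipschitz_on_continuous_on[OF L]])
      (auto intro!: continuous_intros simp: inner_diff_left ee)
  have "open (U \<inter> {x. x \<bullet> e < \<phi> (x - (x \<bullet> e) *\<^sub>R e)})"
    by (intro open_Int U open_Collect_less continuous_on_inner continuous_on_id continuous_on_const cont)
  moreover have "z - t *\<^sub>R e \<in> U \<inter> {x. x \<bullet> e < \<phi> (x - (x \<bullet> e) *\<^sub>R e)}"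
  proof -
    have te: "(z - t *\<^sub>R e) \<bullet> e = z \<bullet> e - t"
      by (simp add: inner_diff_left ee)
    have pe: "z - t *\<^sub>R e - (z \<bullet> e - t) *\<^sub>R e = z - (z \<bullet> e) *\<^sub>R e"
      by (simp add: scaleR_left_diff_distrib)
    have "(z - t *\<^sub>R e) \<bullet> e < \<phi> (z - t *\<^sub>R e - ((z - t *\<^sub>R e) \<bullet> e) *\<^sub>R e)"
      unfolding te pe using t(1) z\<phi> by linarith
    then show ?thesis using t(2) by blast
  qed
  ultimately have "U \<inter> {x. x \<bullet> e < \<phi> (x - (x \<bullet> e) *\<^sub>R e)} \<inter> \<Omega> \<noteq> {}"
    using t(3) open_Int_closure_eq_empty[of "U \<inter> {x. x \<bullet> e < \<phi> (x - (x \<bullet> e) *\<^sub>R e)}" \<Omega>] by blast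
  then obtain y where y: "y \<in> \<Omega>" "y \<in> U" "y \<bullet> e < \<phi> (y - (y \<bullet> e) *\<^sub>R e)"
    by blast
  then have "y \<in> {x \<in> U. \<phi> (x - (x \<bullet> e) *\<^sub>R e) < x \<bullet> e}"
    unfolding \<Omega>[symmetric] by (intro IntI)
  with y(3) show False by simp
qed

end

section \<open>Reference simplices\<close>

text \<open>Literally the parameter set in \<open>face_integral\<close>.\<close>

definition R2 :: "(real \<times> real) set" where
  "R2 = {(s, t). 0 \<le> s \<and> 0 \<le> t \<and> s + t \<le> 1}"

text \<open>The first coordinate is split off from a pair: integrating over it first leaves
  \<open>R2\<close>, the parameter triangle of the facets.\<close>

definition R3 :: "(real \<times> real \<times> real) set" where
  "R3 = {(s, t, r). 0 \<le> s \<and> 0 \<le> t \<and> 0 \<le> r \<and> s + t + r \<le> 1}"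

lemma compact_R2: "compact R2"
proof -
  have "R2 = {p. 0 \<le> fst p} \<inter> {p. 0 \<le> snd p} \<inter> {p. fst p + snd p \<le> 1}"
    by (auto simp: R2_def)
  moreover have "closed \<dots>"
    by (intro closed_Int closed_Collect_le continuous_intros)
  moreover have "R2 \<subseteq> cbox (0,0) (1,1)"
    by (auto simp: R2_def)
  ultimately show ?thesis
    by (metis compact_eq_bounded_closed bounded_cbox bounded_subset)
qed

lemma compact_R3: "compact R3"
proof -
  have "R3 = {p. 0 \<le> fst p} \<inter> {p. 0 \<le> fst (snd p)} \<inter> {p. 0 \<le> snd (snd p)} \<inter>
      {p. fst p + fst (snd p) + snd (snd p) \<le> 1}"
    by (auto simp: R3_def)
  moreover have "closed \<dots>"
    by (intro closed_Int closed_Collect_le continuous_intros)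
  moreover have "R3 \<subseteq> cbox (0,0,0) (1,1,1)"
    by (auto simp: R3_def)
  ultimately show ?thesis
    by (metis compact_eq_bounded_closed bounded_cbox bounded_subset)
qed

definition I2 :: "(real \<times> real \<Rightarrow> real) \<Rightarrow> real" where
  "I2 f = (LINT p:R2|lborel. f p)"

definition I3 :: "(real \<times> real \<times> real \<Rightarrow> real) \<Rightarrow> real" where
  "I3 f = (LINT p:R3|lborel. f p)"

lemma pos_lin_I2: "pos_lin R2 I2"
  unfolding I2_def[abs_def] by (rule pos_lin_set_integral[OF compact_R2])

lemma pos_lin_I3: "pos_lin R3 I3"
  unfolding I3_def[abs_def] by (rule pos_lin_set_integral[OF compact_R3])

text \<open>The integral is a quadratic form in the coefficients, given by the Gram matrix of the
  Bernstein monomials. If it is 0, the polynomial vanishes on \<open>U\<close>, whose barycentric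
  coordinates exhaust the open simplex, and all coefficients vanish; so the matrix is positive
  definite.\<close>

lemma reference_lower_bound:
  fixes y :: "'e::euclidean_space \<Rightarrow> nat \<Rightarrow> real"
  assumes K: "compact K" and U: "open U" "U \<subseteq> K" and S: "finite S" "S \<noteq> {}"
    and y: "\<And>i. i \<in> S \<Longrightarrow> continuous_on K (\<lambda>p. y p i)"
    and surj: "\<And>z. (\<And>i. i \<in> S \<Longrightarrow> 0 < z i) \<Longrightarrow> sum z S = 1 \<Longrightarrow> \<exists>p\<in>U. \<forall>i\<in>S. y p i = z i"
  shows "\<exists>\<mu>>0. \<forall>c. \<mu> * (\<Sum>\<beta>\<in>mi S n. (c \<beta>)\<^sup>2) \<le> (LINT p:K|lborel. (\<Sum>\<beta>\<in>mi S n. c \<beta> * (\<Prod>i\<in>#\<beta>. y p i))\<^sup>2)"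
proof -
  define \<Phi> where "\<Phi> f = (LINT p:K|lborel. f p)" for f :: "'e \<Rightarrow> real"
  have pl: "pos_lin K \<Phi>" unfolding \<Phi>_def[abs_def] by (rule pos_lin_set_integral[OF K])
  define e where "e \<beta> p = (\<Prod>i\<in>#\<beta>. y p i)" for \<beta> p
  have ce: "continuous_on K (e \<beta>)" if "set_mset \<beta> \<subseteq> S" for \<beta>
    using that
  proof (induction \<beta>)
    case (add i \<beta>)
    then have "continuous_on K (\<lambda>p. y p i * e \<beta> p)" by (auto intro!: continuous_on_mult y)
    then show ?case by (simp add: e_def)
  qed (simp add: e_def)
  have ce': "continuous_on K (e \<beta>)" if "\<beta> \<in> mi S n" for \<beta> using that ce by (auto simp: mi_def)
  have fin: "finite (mi S n)" by (rule finite_mi[OF S(1)])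
  have eq: "\<Phi> (\<lambda>p. (\<Sum>\<beta>\<in>mi S n. c \<beta> * e \<beta> p)\<^sup>2) =
      (\<Sum>\<beta>\<in>mi S n. \<Sum>\<gamma>\<in>mi S n. c \<beta> * c \<gamma> * \<Phi> (\<lambda>p. e \<beta> p * e \<gamma> p))" for c
  proof -
    have "(\<lambda>p. (\<Sum>\<beta>\<in>mi S n. c \<beta> * e \<beta> p)\<^sup>2) = (\<lambda>p. \<Sum>\<beta>\<in>mi S n. \<Sum>\<gamma>\<in>mi S n. (c \<beta> * c \<gamma>) * (e \<beta> p * e \<gamma> p))"
      by (auto simp: power2_eq_square sum_product algebra_simps)
    then have "\<Phi> (\<lambda>p. (\<Sum>\<beta>\<in>mi S n. c \<beta> * e \<beta> p)\<^sup>2) = \<Phi> (\<lambda>p. \<Sum>\<beta>\<in>mi S n. \<Sum>\<gamma>\<in>mi S n. (c \<beta> * c \<gamma>) * (e \<beta> p * e \<gamma> p))"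
      by simp
    also have "\<dots> = (\<Sum>\<beta>\<in>mi S n. \<Phi> (\<lambda>p. \<Sum>\<gamma>\<in>mi S n. (c \<beta> * c \<gamma>) * (e \<beta> p * e \<gamma> p)))"
      by (rule pos_lin_sum[OF pl]) (intro continuous_intros ce')
    also have "\<dots> = (\<Sum>\<beta>\<in>mi S n. \<Sum>\<gamma>\<in>mi S n. \<Phi> (\<lambda>p. (c \<beta> * c \<gamma>) * (e \<beta> p * e \<gamma> p)))"
      by (intro sum.cong refl pos_lin_sum[OF pl]) (intro continuous_intros ce')
    also have "\<dots> = (\<Sum>\<beta>\<in>mi S n. \<Sum>\<gamma>\<in>mi S n. c \<beta> * c \<gamma> * \<Phi> (\<lambda>p. e \<beta> p * e \<gamma> p))"
      by (intro sum.cong refl pos_lin_cmult[OF pl]) (intro continuous_intros ce')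
    finally show ?thesis .
  qed
  have pos: "0 < (\<Sum>\<beta>\<in>mi S n. \<Sum>\<gamma>\<in>mi S n. c \<beta> * c \<gamma> * \<Phi> (\<lambda>p. e \<beta> p * e \<gamma> p))"
    if c: "\<exists>\<beta>\<in>mi S n. c \<beta> \<noteq> 0" for c
  proof -
    let ?f = "\<lambda>p. (\<Sum>\<beta>\<in>mi S n. c \<beta> * e \<beta> p)\<^sup>2"
    have cf: "continuous_on K ?f" by (intro continuous_intros ce')
    have "0 \<le> \<Phi> ?f" by (rule pos_lin_nonneg[OF pl cf]) simp
    moreover have "\<Phi> ?f \<noteq> 0"
    proof
      assume z: "\<Phi> ?f = 0"
      have z: "?f p = 0" if "p \<in> U" for p
        by (rule set_integral_zero_open[OF K cf _ U z[unfolded \<Phi>_def] that]) simp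
      have "c \<beta> = 0" if "\<beta> \<in> mi S n" for \<beta>
      proof (rule mi_coeffs_zero[OF S _ that])
        fix w :: "nat \<Rightarrow> real" assume w: "\<And>v. v \<in> S \<Longrightarrow> 0 < w v" "sum w S = 1"
        obtain p where p: "p \<in> U" "\<forall>i\<in>S. y p i = w i" using surj[OF w] by auto
        have "(\<Sum>\<alpha>\<in>mi S n. c \<alpha> * (\<Prod>v\<in>#\<alpha>. w v)) = (\<Sum>\<alpha>\<in>mi S n. c \<alpha> * e \<alpha> p)"
          unfolding e_def
          by (intro sum.cong refl arg_cong2[where f = "(*)"] arg_cong[where f = prod_mset] image_mset_cong)
            (use p in \<open>auto simp: mi_def\<close>)
        then show "(\<Sum>\<alpha>\<in>mi S n. c \<alpha> * (\<Prod>v\<in>#\<alpha>. w v)) = 0" using z[OF p(1)] by simp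
      qed
      then show False using c by auto
    qed
    ultimately show ?thesis unfolding eq by simp
  qed
  from quadratic_form_lower_bound[OF fin, of "\<lambda>\<beta> \<gamma>. \<Phi> (\<lambda>p. e \<beta> p * e \<gamma> p)"] pos
  show ?thesis unfolding eq[symmetric] by (auto simp: \<Phi>_def e_def)
qed

text \<open>Barycentric coordinates of the reference triangle, with index 0 for the origin;
  \<open>bc3\<close> does the same for the tetrahedron.\<close>

definition bc2 :: "real \<times> real \<Rightarrow> nat \<Rightarrow> real" where
  "bc2 p i = (if i = 0 then 1 - fst p - snd p else if i = 1 then fst p else snd p)"

definition bc3 :: "real \<times> real \<times> real \<Rightarrow> nat \<Rightarrow> real" where
  "bc3 p i = (if i = 0 then 1 - fst p - fst (snd p) - snd (snd p) else if i = 1 then fst p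
     else if i = 2 then fst (snd p) else snd (snd p))"

lemma I2_lower_bound:
  "\<exists>\<mu>>0. \<forall>c. \<mu> * (\<Sum>\<beta>\<in>mi {..<3} n. (c \<beta>)\<^sup>2) \<le> I2 (\<lambda>p. (\<Sum>\<beta>\<in>mi {..<3} n. c \<beta> * (\<Prod>i\<in>#\<beta>. bc2 p i))\<^sup>2)"
  unfolding I2_def
proof (rule reference_lower_bound[OF compact_R2])
  let ?U = "{p. 0 < fst p} \<inter> {p. 0 < snd p} \<inter> {p::real\<times>real. fst p + snd p < 1}"
  show "open ?U" by (intro open_Int open_Collect_less continuous_intros)
  show "?U \<subseteq> R2" by (auto simp: R2_def)
  show "continuous_on R2 (\<lambda>p. bc2 p i)" for i
    unfolding bc2_def by (cases "i = 0"; cases "i = 1") (auto intro!: continuous_intros)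
  show "\<exists>p\<in>?U. \<forall>i\<in>{..<3}. bc2 p i = z i"
    if "\<And>i. i \<in> {..<3} \<Longrightarrow> 0 < z i" "sum z {..<3} = 1" for z :: "nat \<Rightarrow> real"
  proof (rule bexI[of _ "(z 1, z 2)"])
    have s: "z 0 + z 1 + z 2 = 1" using that(2) by (simp add: eval_nat_numeral)
    have "0 < z 0" "0 < z 1" "0 < z 2" using that(1) by auto
    with s show "(z 1, z 2) \<in> ?U" by auto
    show "\<forall>i\<in>{..<3}. bc2 (z 1, z 2) i = z i"
    proof
      fix i :: nat assume "i \<in> {..<3}"
      then have "i = 0 \<or> i = 1 \<or> i = 2" by auto
      then show "bc2 (z 1, z 2) i = z i" using s by (auto simp: bc2_def)
    qed
  qed
qed (auto simp: lessThan_empty_iff)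

lemma I3_lower_bound:
  "\<exists>\<mu>>0. \<forall>c. \<mu> * (\<Sum>\<beta>\<in>mi {..<4} n. (c \<beta>)\<^sup>2) \<le> I3 (\<lambda>p. (\<Sum>\<beta>\<in>mi {..<4} n. c \<beta> * (\<Prod>i\<in>#\<beta>. bc3 p i))\<^sup>2)"
  unfolding I3_def
proof (rule reference_lower_bound[OF compact_R3])
  let ?U = "{p. 0 < fst p} \<inter> {p. 0 < fst (snd p)} \<inter> {p. 0 < snd (snd p)} \<inter> {p::real\<times>real\<times>real. fst p + fst (snd p) + snd (snd p) < 1}"
  show "open ?U" by (intro open_Int open_Collect_less continuous_intros)
  show "?U \<subseteq> R3" by (auto simp: R3_def)
  show "continuous_on R3 (\<lambda>p. bc3 p i)" for i
    unfolding bc3_def by (cases "i = 0"; cases "i = 1"; cases "i = 2") (auto intro!: continuous_intros)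
  show "\<exists>p\<in>?U. \<forall>i\<in>{..<4}. bc3 p i = z i"
    if "\<And>i. i \<in> {..<4} \<Longrightarrow> 0 < z i" "sum z {..<4} = 1" for z :: "nat \<Rightarrow> real"
  proof (rule bexI[of _ "(z 1, z 2, z 3)"])
    have s: "z 0 + z 1 + z 2 + z 3 = 1" using that(2) by (simp add: eval_nat_numeral)
    have "0 < z 0" "0 < z 1" "0 < z 2" "0 < z 3" using that(1) by auto
    with s show "(z 1, z 2, z 3) \<in> ?U" by auto
    show "\<forall>i\<in>{..<4}. bc3 (z 1, z 2, z 3) i = z i"
    proof
      fix i :: nat assume "i \<in> {..<4}"
      then have "i = 0 \<or> i = 1 \<or> i = 2 \<or> i = 3" by auto
      then show "bc3 (z 1, z 2, z 3) i = z i" using s by (auto simp: bc3_def)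
    qed
  qed
qed (auto simp: lessThan_empty_iff)

section \<open>Integrals over tetrahedra and triangles\<close>

text \<open>Both measures agree on boxes. Vectors serve the linear change of variables and products
  serve Fubini; this identity mediates between them.\<close>

lemma lborel_vec3: "(lborel :: (real^3) measure) = distr lborel borel (\<lambda>(s, t, r). vector [s, t, r])"
proof (rule lborel_eqI)
  let ?\<phi> = "\<lambda>(s, t, r). vector [s, t, r] :: real^3"
  have cont: "continuous_on UNIV ?\<phi>"
    by (subst continuous_on_componentwise)
      (auto simp: Basis_vec_def inner_axis case_prod_unfold exhaust_3 forall_3
        intro!: continuous_intros split: )
  have meas: "?\<phi> \<in> lborel \<rightarrow>\<^sub>M borel"
    using borel_measurable_continuous_onI[OF cont] by simp
  fix l u :: "real^3"
  assume lu: "\<And>b. b \<in> Basis \<Longrightarrow> l \<bullet> b \<le> u \<bullet> b"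
  have lu': "l $ i \<le> u $ i" for i
    using lu[of "axis i 1"] by (simp add: inner_axis)
  have B3: "(Basis :: (real\<times>real\<times>real) set) = {(1,0,0), (0,1,0), (0,0,1)}"
    by (auto simp: Basis_prod_def zero_prod_def)
  have "?\<phi> -` box l u = box (l$1, l$2, l$3) (u$1, u$2, u$3)"
    by (auto simp: mem_box_cart forall_3 mem_box B3)
  then have "emeasure (distr lborel borel ?\<phi>) (box l u) = emeasure lborel (box (l$1, l$2, l$3) (u$1, u$2, u$3))"
    using meas by (subst emeasure_distr) auto
  also have "\<dots> = ennreal (\<Prod>b\<in>Basis. ((u$1, u$2, u$3) - (l$1, l$2, l$3)) \<bullet> b)"
    by (rule emeasure_lborel_box) (use lu' in \<open>auto simp: B3\<close>)
  also have "\<dots> = ennreal ((u$1 - l$1) * (u$2 - l$2) * (u$3 - l$3))"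
    by (simp add: B3 mult.assoc)
  also have "(u$1 - l$1) * (u$2 - l$2) * (u$3 - l$3) = (\<Prod>b\<in>Basis. (u - l) \<bullet> b)"
  proof -
    have B: "(Basis :: (real^3) set) = (\<lambda>i. axis i 1) ` UNIV" by (auto simp: Basis_vec_def)
    have inj: "inj (\<lambda>i. axis i 1 :: real^3)" by (auto simp: inj_on_def axis_eq_axis)
    have "(\<Prod>b\<in>Basis. (u - l) \<bullet> b) = (\<Prod>i\<in>UNIV. (u - l) \<bullet> axis i 1)"
      unfolding B by (subst prod.reindex[OF inj]) simp
    also have "\<dots> = (u$1 - l$1) * (u$2 - l$2) * (u$3 - l$3)"
      unfolding UNIV_3 by (simp add: inner_axis mult.assoc)
    finally show ?thesis by simp
  qed
  finally show "emeasure (distr lborel borel ?\<phi>) (box l u) = ennreal (\<Prod>b\<in>Basis. (u - l) \<bullet> b)" .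
qed simp

text \<open>Absolute determinant of the edge vectors, six times the volume of the
  tetrahedron.\<close>

definition vol3 :: "real^3 \<Rightarrow> real^3 \<Rightarrow> real^3 \<Rightarrow> real^3 \<Rightarrow> real" where
  "vol3 a b c d = \<bar>(b - a) \<bullet> cross3 (c - a) (d - a)\<bar>"

lemma vol3_swap: "vol3 a b c d = vol3 b a c d" "vol3 a b c d = vol3 a c b d" "vol3 a b c d = vol3 a b d c"
proof -
  have *: "\<bar>x\<bar> = \<bar>y\<bar>" if "x = - y" for x y :: real using that by simp
  show "vol3 a b c d = vol3 b a c d" "vol3 a b c d = vol3 a c b d" "vol3 a b c d = vol3 a b d c"
    unfolding vol3_def by (rule *, simp add: cross3_def inner_vec_def sum_3 algebra_simps)+
qed

lemma convex_hull_4: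
  fixes a :: "real^3"
  shows "convex hull {a, b, c, d} = (\<lambda>(s, t, r). a + s *\<^sub>R (b - a) + t *\<^sub>R (c - a) + r *\<^sub>R (d - a)) ` R3"
proof -
  have eq: "convex hull {a, b, c, d} =
     {y. \<exists>u v w x. 0 \<le> u \<and> 0 \<le> v \<and> 0 \<le> w \<and> 0 \<le> x \<and> u + v + w + x = 1 \<and> y = u *\<^sub>R a + v *\<^sub>R b + w *\<^sub>R c + x *\<^sub>R d}"
  proof (intro set_eqI iffI)
    fix y assume "y \<in> convex hull {a, b, c, d}"
    then obtain u v z where u: "0 \<le> u" "0 \<le> v" "u + v = 1" "z \<in> convex hull {b, c, d}" "y = u *\<^sub>R a + v *\<^sub>R z"
      by (subst (asm) convex_hull_insert) auto
    from u(4) obtain p q r where pqr: "0 \<le> p" "0 \<le> q" "0 \<le> r" "p + q + r = 1" "z = p *\<^sub>R b + q *\<^sub>R c + r *\<^sub>R d"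
      unfolding convex_hull_3 by blast
    have "u + v * p + v * q + v * r = u + v * (p + q + r)" by (simp add: algebra_simps)
    then have "u + v * p + v * q + v * r = 1" using pqr(4) u(3) by simp
    then show "y \<in> {y. \<exists>u v w x. 0 \<le> u \<and> 0 \<le> v \<and> 0 \<le> w \<and> 0 \<le> x \<and> u + v + w + x = 1 \<and> y = u *\<^sub>R a + v *\<^sub>R b + w *\<^sub>R c + x *\<^sub>R d}"
      using u pqr by (intro CollectI exI[of _ u] exI[of _ "v * p"] exI[of _ "v * q"] exI[of _ "v * r"])
        (auto simp: scaleR_add_right)
  next
    fix y assume "y \<in> {y. \<exists>u v w x. 0 \<le> u \<and> 0 \<le> v \<and> 0 \<le> w \<and> 0 \<le> x \<and> u + v + w + x = 1 \<and> y = u *\<^sub>R a + v *\<^sub>R b + w *\<^sub>R c + x *\<^sub>R d}"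
    then obtain u v w x where *: "0 \<le> u" "0 \<le> v" "0 \<le> w" "0 \<le> x" "u + v + w + x = 1" "y = u *\<^sub>R a + v *\<^sub>R b + w *\<^sub>R c + x *\<^sub>R d"
      by blast
    define z where "z i = (if i = (0::nat) then a else if i = 1 then b else if i = 2 then c else d)" for i
    define k where "k i = (if i = (0::nat) then u else if i = 1 then v else if i = 2 then w else x)" for i
    have "(\<Sum>i<4. k i *\<^sub>R z i) \<in> convex hull {a, b, c, d}"
      by (rule convex_sum) (use * in \<open>auto simp: k_def z_def hull_inc eval_nat_numeral\<close>)
    then show "y \<in> convex hull {a, b, c, d}"
      using * by (simp add: k_def z_def eval_nat_numeral)
  qed
  show ?thesis
    unfolding eq
  proof (intro set_eqI iffI)
    fix y assume "y \<in> {y. \<exists>u v w x. 0 \<le> u \<and> 0 \<le> v \<and> 0 \<le> w \<and> 0 \<le> x \<and> u + v + w + x = 1 \<and> y = u *\<^sub>R a + v *\<^sub>R b + w *\<^sub>R c + x *\<^sub>R d}"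
    then obtain u v w x where *: "0 \<le> u" "0 \<le> v" "0 \<le> w" "0 \<le> x" "u + v + w + x = 1" "y = u *\<^sub>R a + v *\<^sub>R b + w *\<^sub>R c + x *\<^sub>R d"
      by blast
    have u: "u = 1 - v - w - x" using * by simp
    have "y = a + v *\<^sub>R (b - a) + w *\<^sub>R (c - a) + x *\<^sub>R (d - a)"
      unfolding *(6) u by (simp add: algebra_simps)
    then show "y \<in> (\<lambda>(s, t, r). a + s *\<^sub>R (b - a) + t *\<^sub>R (c - a) + r *\<^sub>R (d - a)) ` R3"
      using * by (intro image_eqI[of _ _ "(v, w, x)"]) (auto simp: R3_def)
  next
    fix y assume "y \<in> (\<lambda>(s, t, r). a + s *\<^sub>R (b - a) + t *\<^sub>R (c - a) + r *\<^sub>R (d - a)) ` R3"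
    then obtain s t r where "(s, t, r) \<in> R3" "y = a + s *\<^sub>R (b - a) + t *\<^sub>R (c - a) + r *\<^sub>R (d - a)" by auto
    then show "y \<in> {y. \<exists>u v w x. 0 \<le> u \<and> 0 \<le> v \<and> 0 \<le> w \<and> 0 \<le> x \<and> u + v + w + x = 1 \<and> y = u *\<^sub>R a + v *\<^sub>R b + w *\<^sub>R c + x *\<^sub>R d}"
      by (intro CollectI exI[of _ "1-s-t-r"] exI[of _ s] exI[of _ t] exI[of _ r]) (auto simp: R3_def algebra_simps)
  qed
qed

text \<open>The translation by \<open>a\<close>, the linear map with the edges as columns, and the
  identification of vectors with triples are undone one after the other; only the linear map
  contributes a factor.\<close>

lemma tetrahedron_integral:
  fixes f :: "real^3 \<Rightarrow> real"
  assumes f: "continuous_on (convex hull {a, b, c, d}) f" and D: "vol3 a b c d \<noteq> 0"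
  shows "(LINT x:convex hull {a, b, c, d}|lborel. f x) =
    vol3 a b c d * I3 (\<lambda>(s, t, r). f (a + s *\<^sub>R (b - a) + t *\<^sub>R (c - a) + r *\<^sub>R (d - a)))"
proof -
  let ?T = "convex hull {a, b, c, d}"
  define A where "A x = x$1 *\<^sub>R (b - a) + x$2 *\<^sub>R (c - a) + x$3 *\<^sub>R (d - a)" for x :: "real^3"
  define \<phi> where "\<phi> = (\<lambda>(s, t, r). vector [s, t, r] :: real^3)"
  define S where "S = \<phi> ` R3"
  have linA: "linear A"
    by (rule linearI) (simp_all add: A_def algebra_simps)
  have det: "\<bar>det (matrix A)\<bar> = vol3 a b c d"
  proof -
    have "matrix A = transpose (vector [b - a, c - a, d - a])"
      by (simp add: matrix_def A_def axis_def vec_eq_iff transpose_def forall_3)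
    then show ?thesis by (simp add: det_transpose vol3_def dot_cross_det)
  qed
  have A\<phi>: "a + A (\<phi> p) = (\<lambda>(s, t, r). a + s *\<^sub>R (b - a) + t *\<^sub>R (c - a) + r *\<^sub>R (d - a)) p" for p
    by (cases p) (simp add: A_def \<phi>_def add.assoc)
  have T: "?T = (\<lambda>x. a + A x) ` S"
    unfolding convex_hull_4 S_def image_image A\<phi> ..
  have cont\<phi>: "continuous_on X \<phi>" for X
    unfolding \<phi>_def
    by (subst continuous_on_componentwise)
      (auto simp: Basis_vec_def inner_axis case_prod_unfold exhaust_3 forall_3 intro!: continuous_intros)
  have cS: "compact S" unfolding S_def by (rule compact_continuous_image[OF cont\<phi> compact_R3])
  have contA: "continuous_on X A" for X unfolding A_def by (intro continuous_intros)
  have cAS: "compact (A ` S)" by (rule compact_continuous_image[OF contA cS])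
  have fa: "continuous_on (A ` S) (\<lambda>x. f (a + x))"
    by (rule continuous_on_compose2[OF f]) (auto intro!: continuous_intros simp: T)
  have f\<phi>: "continuous_on S (\<lambda>x. f (a + A x))"
    by (rule continuous_on_compose2[OF f]) (auto intro!: continuous_intros contA simp: T)
  have cT: "compact ?T" by (simp add: finite_imp_compact_convex_hull)
  have "(LINT x:?T|lborel. f x) = (\<integral>x. indicator ?T x *\<^sub>R f x \<partial>distr lborel borel ((+) a))"
    by (simp add: lborel_distr_plus set_lebesgue_integral_def)
  also have "\<dots> = (\<integral>x. indicator ?T (a + x) *\<^sub>R f (a + x) \<partial>lborel)"
    by (rule integral_distr)
      (use borel_integrable_compact[OF cT f] in \<open>auto dest: borel_measurable_integrable\<close>)
  also have "\<dots> = (LINT x:A ` S|lborel. f (a + x))"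
    unfolding set_lebesgue_integral_def
    by (rule Bochner_Integration.integral_cong) (auto simp: T indicator_def image_iff)
  also have "\<dots> = integral (A ` S) (\<lambda>x. f (a + x))"
    by (rule set_borel_integral_eq_integral(2))
      (use borel_integrable_compact[OF cAS fa] in \<open>simp add: set_integrable_def\<close>)
  also have "\<dots> = \<bar>det (matrix A)\<bar> * integral S (\<lambda>x. f (a + A x))"
  proof -
    \<comment> \<open>The change of variables is applied to vector valued integrands, hence the
      detour through \<open>real^1\<close>.\<close>
    let ?g = "\<lambda>x. vec (f (a + x)) :: real^1"
    have ai: "F absolutely_integrable_on X" if "compact X" "continuous_on X F"
      for X and F :: "real^3 \<Rightarrow> real^1"
      using borel_integrable_compact[OF that] unfolding set_integrable_def
      by (simp add: integrable_completion borel_measurable_integrable)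
    have i1: "?g absolutely_integrable_on A ` S"
      unfolding vec_def by (intro ai cAS continuous_on_vec_lambda fa) 
    have i2: "(?g \<circ> A) absolutely_integrable_on S"
      unfolding vec_def o_def by (intro ai cS continuous_on_vec_lambda f\<phi>)
    have "integral (A ` S) ?g = \<bar>det (matrix A)\<bar> *\<^sub>R integral S (?g \<circ> A)"
      by (rule integral_change_of_variables_linear[OF linA]) (use i1 in blast)
    then have "integral (A ` S) ?g $ 1 = \<bar>det (matrix A)\<bar> * (integral S (?g \<circ> A) $ 1)" by simp
    then show ?thesis
      using i1 i2
      by (simp add: integral_component_eq_cart[symmetric] set_lebesgue_integral_eq_integral(1) o_def)
  qed
  also have "integral S (\<lambda>x. f (a + A x)) = (LINT x:S|lborel. f (a + A x))"
    by (rule set_borel_integral_eq_integral(2)[symmetric])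
      (use borel_integrable_compact[OF cS f\<phi>] in \<open>simp add: set_integrable_def\<close>)
  also have "\<dots> = (\<integral>x. indicator S x *\<^sub>R f (a + A x) \<partial>distr lborel borel \<phi>)"
    unfolding set_lebesgue_integral_def lborel_vec3 \<phi>_def ..
  also have "\<dots> = (\<integral>p. indicator S (\<phi> p) *\<^sub>R f (a + A (\<phi> p)) \<partial>lborel)"
    by (rule integral_distr)
      (use borel_integrable_compact[OF cS f\<phi>] borel_measurable_continuous_onI[OF cont\<phi>]
        in \<open>auto dest: borel_measurable_integrable\<close>)
  also have "\<dots> = (LINT p:R3|lborel. f (a + A (\<phi> p)))"
  proof -
    have "inj \<phi>"
    proof (rule injI)
      fix p q assume "\<phi> p = \<phi> q"
      then have "\<phi> p $ 1 = \<phi> q $ 1" "\<phi> p $ 2 = \<phi> q $ 2" "\<phi> p $ 3 = \<phi> q $ 3" by simp_all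
      then show "p = q" by (cases p; cases q) (simp add: \<phi>_def)
    qed
    then have "indicator S (\<phi> p) = (indicator R3 p :: real)" for p
      by (auto simp: S_def indicator_def inj_image_mem_iff)
    then show ?thesis unfolding set_lebesgue_integral_def by simp
  qed
  finally show ?thesis
    unfolding det A\<phi> I3_def by (simp add: case_prod_unfold)
qed

text \<open>Surface integral with the area element divided out; the fundamental theorem along an
  edge direction produces differences of exactly these.\<close>

definition J2 :: "real^3 \<Rightarrow> real^3 \<Rightarrow> real^3 \<Rightarrow> (real^3 \<Rightarrow> real) \<Rightarrow> real" where
  "J2 a b c g = I2 (\<lambda>p. g (a + fst p *\<^sub>R (b - a) + snd p *\<^sub>R (c - a)))"

lemma triangle_param: "convex hull {a, b, c} = (\<lambda>p. a + fst p *\<^sub>R (b - a) + snd p *\<^sub>R (c - a)) ` R2"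
  for a :: "real^3"
proof (intro set_eqI iffI)
  fix y assume "y \<in> convex hull {a, b, c}"
  then obtain u v where "y = a + u *\<^sub>R (b - a) + v *\<^sub>R (c - a)" "0 \<le> u" "0 \<le> v" "u + v \<le> 1"
    unfolding convex_hull_3_alt by blast
  then show "y \<in> (\<lambda>p. a + fst p *\<^sub>R (b - a) + snd p *\<^sub>R (c - a)) ` R2"
    by (intro image_eqI[of _ _ "(u, v)"]) (auto simp: R2_def)
next
  fix y assume "y \<in> (\<lambda>p. a + fst p *\<^sub>R (b - a) + snd p *\<^sub>R (c - a)) ` R2"
  then show "y \<in> convex hull {a, b, c}"
    unfolding convex_hull_3_alt R2_def by fastforce
qed

lemma continuous_on_triangle_param:
  fixes a :: "real^3"
  assumes "continuous_on (convex hull {a, b, c}) g"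
  shows "continuous_on R2 (\<lambda>p. g (a + fst p *\<^sub>R (b - a) + snd p *\<^sub>R (c - a)))"
proof (rule continuous_on_compose2[OF assms])
  show "continuous_on R2 (\<lambda>p. a + fst p *\<^sub>R (b - a) + snd p *\<^sub>R (c - a))"
    by (intro continuous_intros)
qed (simp add: triangle_param)

lemma I2_swap:
  assumes f: "continuous_on R2 f" shows "I2 (\<lambda>p. f (snd p, fst p)) = I2 f"
proof -
  have "(\<lambda>(x, y). indicator R2 (y, x) *\<^sub>R f (y, x)) = (\<lambda>p::real\<times>real. indicator R2 p *\<^sub>R f (snd p, fst p))"
    by (auto simp: R2_def indicator_def add.commute)
  moreover have "integrable (lborel \<Otimes>\<^sub>M lborel) (\<lambda>p. indicator R2 p *\<^sub>R f p)"
    using borel_integrable_compact[OF compact_R2 f] by (simp add: lborel_prod)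
  ultimately show ?thesis
    unfolding I2_def set_lebesgue_integral_def
    using lborel_pair.integral_product_swap[of "\<lambda>p. indicator R2 p *\<^sub>R f p"]
    by (simp add: lborel_prod)
qed

text \<open>On each line of constant second coordinate this is the reflection of an interval.
  Together with \<open>I2_swap\<close> it generates all permutations of the three vertices.\<close>

lemma I2_flip:
  assumes f: "continuous_on R2 f" shows "I2 (\<lambda>p. f (1 - fst p - snd p, snd p)) = I2 f"
proof -
  have f': "continuous_on R2 (\<lambda>p. f (1 - fst p - snd p, snd p))"
    by (rule continuous_on_compose2[OF f]) (auto simp: R2_def intro!: continuous_intros)
  let ?g = "\<lambda>p. indicator R2 p *\<^sub>R f p" and ?g' = "\<lambda>p. indicator R2 p *\<^sub>R f (1 - fst p - snd p, snd p)"
  have i: "integrable (lborel \<Otimes>\<^sub>M lborel) ?g" "integrable (lborel \<Otimes>\<^sub>M lborel) ?g'"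
    using borel_integrable_compact[OF compact_R2 f] borel_integrable_compact[OF compact_R2 f']
    by (simp_all add: lborel_prod)
  have "I2 (\<lambda>p. f (1 - fst p - snd p, snd p)) = (\<integral>t. (\<integral>s. ?g' (s, t) \<partial>lborel) \<partial>lborel)"
    unfolding I2_def set_lebesgue_integral_def
    using lborel_pair.integral_snd[of "\<lambda>s t. ?g' (s, t)"] i(2) by (simp add: lborel_prod case_prod_unfold)
  also have "\<dots> = (\<integral>t. (\<integral>s. ?g (s, t) \<partial>lborel) \<partial>lborel)"
  proof (rule Bochner_Integration.integral_cong[OF refl])
    fix t :: real
    have "(\<integral>s. ?g (s, t) \<partial>lborel) = (\<integral>s. ?g ((1 - t) + (-1) * s, t) \<partial>lborel)"
      by (subst lborel_integral_real_affine[of "-1" _ "1 - t"]) auto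
    also have "\<dots> = (\<integral>s. ?g' (s, t) \<partial>lborel)"
      by (rule Bochner_Integration.integral_cong) (auto simp: R2_def indicator_def algebra_simps)
    finally show "(\<integral>s. ?g' (s, t) \<partial>lborel) = (\<integral>s. ?g (s, t) \<partial>lborel)" by simp
  qed
  also have "\<dots> = I2 f"
    unfolding I2_def set_lebesgue_integral_def
    using lborel_pair.integral_snd[of "\<lambda>s t. ?g (s, t)"] i(1) by (simp add: lborel_prod case_prod_unfold)
  finally show ?thesis .
qed

lemma J2_swap:
  assumes g: "continuous_on (convex hull {a, b, c}) g"
  shows "J2 a b c g = J2 a c b g" "J2 a b c g = J2 b a c g"
proof -
  have "convex hull {a, b, c} = convex hull {a, c, b}" by (simp add: insert_commute)
  with g have g': "continuous_on (convex hull {a, c, b}) g" by simp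
  show "J2 a b c g = J2 a c b g"
    unfolding J2_def using I2_swap[OF continuous_on_triangle_param[OF g']]
    by (simp add: add_ac)
  have "convex hull {a, b, c} = convex hull {b, a, c}" by (simp add: insert_commute)
  with g have g': "continuous_on (convex hull {b, a, c}) g" by simp
  have "b + (1 - s - t) *\<^sub>R (a - b) + t *\<^sub>R (c - b) = a + s *\<^sub>R (b - a) + t *\<^sub>R (c - a)" for s t
    by (simp add: algebra_simps)
  then show "J2 a b c g = J2 b a c g"
    unfolding J2_def using I2_flip[OF continuous_on_triangle_param[OF g']]
    by simp
qed

lemma norm_cross3_swap:
  "norm (cross3 (b - a) (c - a)) = norm (cross3 (c - a) (b - a))"
  "norm (cross3 (b - a) (c - a)) = norm (cross3 (a - b) (c - b))"
proof -
  have *: "norm x = norm y" if "x = - y" for x y :: "real^3" using that by simp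
  show "norm (cross3 (b - a) (c - a)) = norm (cross3 (c - a) (b - a))"
    by (rule *) (rule cross_skew)
  show "norm (cross3 (b - a) (c - a)) = norm (cross3 (a - b) (c - b))"
    by (rule *) (simp add: cross3_def vec_eq_iff forall_3 algebra_simps)
qed

text \<open>The vertices are the extreme points of \<open>F\<close>, so whatever triple the choice
  operator selects is one of their six orders, and area element and parametrised integral are
  invariant under each of them.\<close>

lemma face_integral_eq:
  assumes F: "F = convex hull {a, b, c}" and ind: "\<not> affine_dependent {a, b, c}"
    and dist: "a \<noteq> b" "a \<noteq> c" "b \<noteq> c" and g: "continuous_on F g"
  shows "face_integral F g = norm (cross3 (b - a) (c - a)) * J2 a b c g"
proof -
  define P where "P = (\<lambda>(a, b, c). F = convex hull {a, b, c})"
  obtain a' b' c' where abc': "(SOME t. P t) = (a', b', c')" by (metis prod_cases3)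
  have "P (SOME t. P t)" by (rule someI[of P "(a, b, c)"]) (simp add: P_def F)
  then have "P (a', b', c')" unfolding abc' .
  then have F': "F = convex hull {a', b', c'}" by (simp add: P_def)
  have "{a, b, c} \<subseteq> {a', b', c'}"
  proof
    fix x assume "x \<in> {a, b, c}"
    then have "x extreme_point_of (convex hull {a', b', c'})"
      using extreme_point_of_convex_hull_affine_independent[OF ind] F F' by simp
    then show "x \<in> {a', b', c'}" by (rule extreme_point_of_convex_hull)
  qed
  then have perm: "(a', b', c') \<in> {(a,b,c), (a,c,b), (b,a,c), (b,c,a), (c,a,b), (c,b,a)}"
    using dist by auto
  have "face_integral F g = norm (cross3 (b' - a') (c' - a')) * J2 a' b' c' g"
    using abc' unfolding face_integral_def P_def J2_def I2_def R2_def by simp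
  also have "\<dots> = norm (cross3 (b - a) (c - a)) * J2 a b c g"
  proof -
    have *: "convex hull {a, c, b} = F" "convex hull {b, a, c} = F" "convex hull {b, c, a} = F"
      "convex hull {c, a, b} = F" "convex hull {c, b, a} = F" "convex hull {a, b, c} = F"
      unfolding F by (simp_all add: insert_commute)
    have J: "J2 a c b g = J2 a b c g" "J2 b a c g = J2 a b c g" "J2 b c a g = J2 a b c g"
      "J2 c a b g = J2 a b c g" "J2 c b a g = J2 a b c g"
      using J2_swap[of a b c g, unfolded *, OF g] J2_swap[of a c b g, unfolded *, OF g]
        J2_swap[of b a c g, unfolded *, OF g] J2_swap[of b c a g, unfolded *, OF g]
      by metis+
    have N: "norm (cross3 (c - a) (b - a)) = norm (cross3 (b - a) (c - a))"
      "norm (cross3 (a - b) (c - b)) = norm (cross3 (b - a) (c - a))"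
      "norm (cross3 (c - b) (a - b)) = norm (cross3 (b - a) (c - a))"
      "norm (cross3 (a - c) (b - c)) = norm (cross3 (b - a) (c - a))"
      "norm (cross3 (b - c) (a - c)) = norm (cross3 (b - a) (c - a))"
      using norm_cross3_swap[of b a c] norm_cross3_swap[of c a b] norm_cross3_swap[of a b c]
        norm_cross3_swap[of c b a] norm_cross3_swap[of a c b] norm_cross3_swap[of b c a] by metis+
    from perm consider "(a', b', c') = (a,b,c)" | "(a', b', c') = (a,c,b)" | "(a', b', c') = (b,a,c)"
      | "(a', b', c') = (b,c,a)" | "(a', b', c') = (c,a,b)" | "(a', b', c') = (c,b,a)" by blast
    then show ?thesis by cases (simp_all add: J N)
  qed
  finally show ?thesis .
qed

definition tint :: "(real^3) set \<Rightarrow> (real^3 \<Rightarrow> real) \<Rightarrow> real" where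
  "tint T f = (LINT x:T|lborel. f x)"

definition fct :: "(real^3) set \<Rightarrow> real^3 \<Rightarrow> (real^3) set" where
  "fct T v = convex hull (verts T - {v})"

text \<open>By Lagrange's identity the squares of the two sides differ by
  \<open>(x \<bullet> y)\<^sup>2\<close>.\<close>

lemma norm_cross3_le: "norm (cross3 x y) \<le> norm x * norm y"
proof -
  have "(norm (cross3 x y))\<^sup>2 = (norm x * norm y)\<^sup>2 - (x \<bullet> y)\<^sup>2"
    by (simp add: power2_norm_eq_inner dot_cross power_mult_distrib) (simp add: power2_eq_square inner_commute)
  then have "(norm (cross3 x y))\<^sup>2 \<le> (norm x * norm y)\<^sup>2" by simp
  then show ?thesis by (rule power2_le_imp_le) simp
qed

lemma pos_lin_pullback:
  assumes pl: "pos_lin K \<Phi>" and h: "continuous_on K h" "h ` K \<subseteq> K'" and a: "0 \<le> a"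
  shows "pos_lin K' (\<lambda>g. a * \<Phi> (\<lambda>p. g (h p)))"
proof -
  have c: "continuous_on K (\<lambda>p. g (h p))" if "continuous_on K' g" for g :: "'b \<Rightarrow> real"
    by (rule continuous_on_compose2[OF that h])
  show ?thesis
    unfolding pos_lin_def
  proof (intro conjI allI impI)
    fix f g :: "'b \<Rightarrow> real" assume "\<forall>x\<in>K'. f x = g x"
    then show "a * \<Phi> (\<lambda>p. f (h p)) = a * \<Phi> (\<lambda>p. g (h p))"
      using h(2) by (intro arg_cong[where f = "(*) a"] pos_lin_cong[OF pl]) auto
  next
    fix f :: "'b \<Rightarrow> real" assume "continuous_on K' f" "\<forall>x\<in>K'. 0 \<le> f x"
    then show "0 \<le> a * \<Phi> (\<lambda>p. f (h p))"
      using h(2) a c by (intro mult_nonneg_nonneg pos_lin_nonneg[OF pl]) auto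
  next
    fix f g :: "'b \<Rightarrow> real" assume "continuous_on K' f" "continuous_on K' g"
    then show "a * \<Phi> (\<lambda>p. f (h p) + g (h p)) = a * \<Phi> (\<lambda>p. f (h p)) + a * \<Phi> (\<lambda>p. g (h p))"
      by (simp add: pos_lin_add[OF pl] c distrib_left)
  next
    fix f :: "'b \<Rightarrow> real" and k assume "continuous_on K' f"
    then show "a * \<Phi> (\<lambda>p. k * f (h p)) = k * (a * \<Phi> (\<lambda>p. f (h p)))"
      by (simp add: pos_lin_cmult[OF pl] c)
  qed
qed

text \<open>Whichever triple is selected, the integral is a nonnegative multiple of a pullback of
  \<open>I2\<close>.\<close>

lemma pos_lin_face_integral:
  assumes "F = convex hull {a, b, c}" shows "pos_lin F (face_integral F)"
proof -
  define P where "P = (\<lambda>(a, b, c). F = convex hull {a, b, c})"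
  obtain a' b' c' where abc': "(SOME t. P t) = (a', b', c')" by (metis prod_cases3)
  have "P (SOME t. P t)" by (rule someI[of P "(a, b, c)"]) (simp add: P_def assms)
  then have "P (a', b', c')" unfolding abc' .
  then have F': "F = convex hull {a', b', c'}" by (simp add: P_def)
  have "face_integral F = (\<lambda>g. norm (cross3 (b' - a') (c' - a')) * I2 (\<lambda>p. g (a' + fst p *\<^sub>R (b' - a') + snd p *\<^sub>R (c' - a'))))"
    using abc' unfolding face_integral_def P_def I2_def R2_def by (intro ext) simp
  moreover have "pos_lin F \<dots>"
    by (rule pos_lin_pullback[OF pos_lin_I2]) (auto simp: F' triangle_param intro!: continuous_intros)
  ultimately show ?thesis by simp
qed

lemma four_verts:
  assumes T: "3 simplex T" and v: "v \<in> verts T"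
  obtains a b c where "verts T = {v, a, b, c}" "distinct [v, a, b, c]"
proof -
  have "card (verts T - {v}) = 3" using card_verts[OF T] finite_verts[OF T] v by simp
  then obtain a b c where "verts T - {v} = {a, b, c}" "a \<noteq> b" "b \<noteq> c" "a \<noteq> c"
    by (auto simp: card_3_iff)
  moreover from this have "verts T = {v, a, b, c}" "v \<noteq> a" "v \<noteq> b" "v \<noteq> c" using v by auto
  ultimately show ?thesis using that by simp
qed

lemma four_verts':
  assumes T: "3 simplex T" and v: "v \<in> verts T" "w \<in> verts T" "v \<noteq> w"
  obtains b c where "verts T = {v, w, b, c}" "distinct [v, w, b, c]"
proof -
  obtain x y z where *: "verts T = {v, x, y, z}" "distinct [v, x, y, z]" by (rule four_verts[OF T v(1)])
  then consider "w = x" | "w = y" | "w = z" using v by auto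
  then show ?thesis
  proof cases
    case 1 then show ?thesis using * that[of y z] by auto
  next
    case 2
    then have "verts T = {v, w, x, z}" "distinct [v, w, x, z]" using * by auto
    then show ?thesis by (rule that)
  next
    case 3
    then have "verts T = {v, w, x, y}" "distinct [v, w, x, y]" using * by auto
    then show ?thesis by (rule that)
  qed
qed

context
  fixes T :: "(real^3) set"
  assumes T: "3 simplex T"
begin

lemma pos_lin_tint: "pos_lin T (tint T)"
  unfolding tint_def[abs_def] by (rule pos_lin_set_integral[OF compact_simplex3[OF T]])

lemma facets_fct: "{F. F facet_of T} = fct T ` verts T"
  by (auto simp: facet_iff[OF T] fct_def)

lemma fct_facet: "v \<in> verts T \<Longrightarrow> fct T v facet_of T"
  using facets_fct by blast

text \<open>Facets correspond to their opposite vertices; the correspondence is injective because a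
  facet determines its own vertices.\<close>

lemma sum_facets: "(\<Sum>F | F facet_of T. h F) = (\<Sum>v\<in>verts T. h (fct T v))"
proof -
  have "inj_on (fct T) (verts T)"
  proof (rule inj_onI)
    fix v w assume "v \<in> verts T" "w \<in> verts T" "fct T v = fct T w"
    then have "verts T - {v} = verts T - {w}" using verts_facet[OF T] unfolding fct_def by metis
    then show "v = w" using \<open>v \<in> verts T\<close> \<open>w \<in> verts T\<close> by blast
  qed
  then show ?thesis unfolding facets_fct by (simp add: sum.reindex)
qed

lemma pos_lin_facet:
  assumes "F facet_of T" shows "pos_lin F (face_integral F)"
proof -
  from assms facets_fct obtain v where v: "v \<in> verts T" "F = fct T v" by auto
  obtain a b c where "verts T = {v, a, b, c}" "distinct [v, a, b, c]" by (rule four_verts[OF T v(1)])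
  then have "F = convex hull {a, b, c}" using v by (auto simp: fct_def insert_Diff_if)
  then show ?thesis by (rule pos_lin_face_integral)
qed

context
  fixes a b c d
  assumes V: "verts T = {a, b, c, d}" and dist: "distinct [a, b, c, d]"
begin

lemma T_hull: "T = convex hull {a, b, c, d}"
  using convex_hull_verts[OF T] V by simp

text \<open>The three gradients form the dual basis of the edges at \<open>a\<close>, so the two
  matrices are inverse up to transposition. In this way bounds on gradients become bounds on the
  volume.\<close>

lemma bgrad_det: "\<bar>bgrad T b \<bullet> cross3 (bgrad T c) (bgrad T d)\<bar> * vol3 a b c d = 1"
proof -
  let ?G = "vector [bgrad T b, bgrad T c, bgrad T d] :: real^3^3"
  let ?A = "vector [b - a, c - a, d - a] :: real^3^3"
  have g: "bgrad T x \<bullet> (y - a) = (if x = y then 1 else 0)" if "x \<in> {b, c, d}" "y \<in> {b, c, d}" for x y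
    using lam_diff[of T x y a] lam_vert[OF T, of x y] lam_vert[OF T, of x a] that V dist by auto
  have ip: "(\<Sum>k\<in>UNIV. x $ k * y $ k) = x \<bullet> y" for x y :: "real^3"
    by (simp add: inner_vec_def)
  have "b \<noteq> c" "c \<noteq> b" "b \<noteq> d" "d \<noteq> b" "c \<noteq> d" "d \<noteq> c" using dist by auto
  then have "?G ** transpose ?A = mat 1"
    by (simp add: vec_eq_iff forall_3 matrix_matrix_mult_def mat_def transpose_def ip g
        del: vector_minus_component)
  then have "det (?G ** transpose ?A) = 1" by (simp only: det_I)
  then have "det ?G * det ?A = 1" by (simp only: det_mul det_transpose)
  then have "\<bar>det ?G\<bar> * \<bar>det ?A\<bar> = 1" by (metis abs_mult abs_one)
  then show ?thesis unfolding vol3_def dot_cross_det .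
qed

lemma vol3_pos: "0 < vol3 a b c d"
  using bgrad_det by (metis abs_ge_zero mult_zero_right vol3_def zero_neq_one order_le_less)

lemma tint_eq:
  "continuous_on T f \<Longrightarrow> tint T f = vol3 a b c d * I3 (\<lambda>(s, t, r). f (a + s *\<^sub>R (b - a) + t *\<^sub>R (c - a) + r *\<^sub>R (d - a)))"
  unfolding tint_def using tetrahedron_integral[of a b c d f] vol3_pos T_hull by simp

lemma fct_eq: "fct T a = convex hull {b, c, d}"
  using V dist by (auto simp: fct_def insert_Diff_if)

text \<open>Base times height: the reciprocal of \<open>norm (bgrad T a)\<close> is the height of
  \<open>a\<close> over the opposite facet.\<close>

lemma norm_cross_facet: "norm (cross3 (c - b) (d - b)) = norm (bgrad T a) * vol3 a b c d"
proof -
  let ?N = "cross3 (c - b) (d - b)"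
  have "?N = (?N \<bullet> (a - b)) *\<^sub>R bgrad T a"
    by (rule orthogonal_facet_parallel[OF T])
      (use V dist in \<open>auto simp: dot_cross_self inner_commute\<close>)
  then have "norm ?N = \<bar>?N \<bullet> (a - b)\<bar> * norm (bgrad T a)" by (metis norm_scaleR)
  then show ?thesis
    unfolding vol3_swap(1)[of a b] by (simp add: vol3_def inner_commute)
qed

lemma face_integral_fct:
  assumes "continuous_on (fct T a) f"
  shows "face_integral (fct T a) f = norm (bgrad T a) * vol3 a b c d * J2 b c d f"
proof -
  have "\<not> affine_dependent {b, c, d}"
    by (rule affine_independent_subset[OF affine_independent_verts[OF T]]) (use V in auto)
  then show ?thesis
    using face_integral_eq[OF fct_eq _ _ _ _ assms] dist norm_cross_facet by simp
qed

text \<open>Fubini and the fundamental theorem on the lines parallel to the edge from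
  \<open>a\<close> to \<open>b\<close>. Such a line enters through the facet opposite
  \<open>b\<close> and leaves through the facet opposite \<open>a\<close>.\<close>

lemma I3_directional_derivative:
  assumes f: "f \<in> polys j"
  shows "I3 (\<lambda>(s, t, r). grad f (a + s *\<^sub>R (b - a) + t *\<^sub>R (c - a) + r *\<^sub>R (d - a)) \<bullet> (b - a)) = J2 b c d f - J2 a c d f"
proof -
  let ?pt = "\<lambda>s q. a + s *\<^sub>R (b - a) + fst q *\<^sub>R (c - a) + snd q *\<^sub>R (d - a)"
  let ?g = "\<lambda>s q. grad f (?pt s q) \<bullet> (b - a)"
  have cg: "continuous_on X (\<lambda>p. grad f (h p) \<bullet> (b - a))" if "continuous_on X h" for X and h :: "'z::topological_space \<Rightarrow> real^3"
    by (intro continuous_on_inner continuous_on_const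
        continuous_on_compose2[OF continuous_on_vpolys[OF vpolys_grad[OF f], of UNIV] that]) auto
  have "continuous_on R3 (\<lambda>p. ?g (fst p) (snd p))"
    by (intro cg continuous_intros)
  then have "integrable lborel (\<lambda>p. indicator R3 p *\<^sub>R ?g (fst p) (snd p))"
    by (rule borel_integrable_compact[OF compact_R3])
  then have i: "integrable (lborel \<Otimes>\<^sub>M lborel) (\<lambda>(s, q). indicator R3 (s, q) *\<^sub>R ?g s q)"
    by (simp add: lborel_prod case_prod_unfold)
  have "I3 (\<lambda>(s, t, r). grad f (a + s *\<^sub>R (b - a) + t *\<^sub>R (c - a) + r *\<^sub>R (d - a)) \<bullet> (b - a))
      = (\<integral>q. (\<integral>s. indicator R3 (s, q) *\<^sub>R ?g s q \<partial>lborel) \<partial>lborel)"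
    unfolding I3_def set_lebesgue_integral_def
    using lborel_pair.integral_snd[OF i] by (simp add: lborel_prod case_prod_unfold)
  also have "\<dots> = (\<integral>q. indicator R2 q *\<^sub>R (f (?pt (1 - fst q - snd q) q) - f (?pt 0 q)) \<partial>lborel)"
  proof (rule Bochner_Integration.integral_cong[OF refl])
    fix q :: "real \<times> real"
    show "(\<integral>s. indicator R3 (s, q) *\<^sub>R ?g s q \<partial>lborel) = indicator R2 q *\<^sub>R (f (?pt (1 - fst q - snd q) q) - f (?pt 0 q))"
    proof (cases "q \<in> R2")
      case True
      have "(\<integral>s. indicator R3 (s, q) *\<^sub>R ?g s q \<partial>lborel) = (\<integral>s. indicator {0..1 - fst q - snd q} s *\<^sub>R ?g s q \<partial>lborel)"
        by (rule Bochner_Integration.integral_cong[OF refl]) (use True in \<open>auto simp: R2_def R3_def indicator_def\<close>)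
      also have "\<dots> = f (?pt (1 - fst q - snd q) q) - f (?pt 0 q)"
      proof (rule integral_FTC_atLeastAtMost)
        show "0 \<le> 1 - fst q - snd q" using True by (auto simp: R2_def)
        show "continuous_on {0..1 - fst q - snd q} (\<lambda>s. ?g s q)" by (intro cg continuous_intros)
        fix s :: real
        have "((\<lambda>s. ?pt s q) has_derivative (\<lambda>h. h *\<^sub>R (b - a))) (at s within {0..1 - fst q - snd q})"
          by (auto intro!: derivative_eq_intros)
        from has_derivative_compose[OF this has_derivative_grad[OF differentiable_polys[OF f]]]
        show "((\<lambda>s. f (?pt s q)) has_vector_derivative ?g s q) (at s within {0..1 - fst q - snd q})"
          by (simp add: has_vector_derivative_def mult.commute)
      qed
      finally show ?thesis using True by simp
    next
      case False
      then have "indicator R3 (s, q) = (0::real)" for s by (auto simp: R2_def R3_def indicator_def)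
      then show ?thesis using False by simp
    qed
  qed
  also have "\<dots> = I2 (\<lambda>q. f (?pt (1 - fst q - snd q) q) - f (?pt 0 q))"
    by (simp add: I2_def set_lebesgue_integral_def)
  also have "\<dots> = I2 (\<lambda>q. f (?pt (1 - fst q - snd q) q)) - I2 (\<lambda>q. f (?pt 0 q))"
    by (intro pos_lin_diff[OF pos_lin_I2] continuous_on_compose2[OF continuous_on_polys[OF f, of UNIV]] continuous_intros) auto
  also have "\<dots> = J2 b c d f - J2 a c d f"
  proof -
    have "?pt (1 - fst q - snd q) q = b + fst q *\<^sub>R (c - b) + snd q *\<^sub>R (d - b)" for q
      by (simp add: algebra_simps)
    then show ?thesis by (simp add: J2_def)
  qed
  finally show ?thesis .
qed

end

text \<open>The facets opposite the other two vertices contain the edge, so their normals are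
  orthogonal to it. For the facets opposite \<open>a\<close> and \<open>b\<close> the normal
  component is plus or minus \<open>1 / norm (bgrad T v)\<close>, which cancels the gradient factor
  in \<open>face_integral_fct\<close>.\<close>

lemma divergence_edge:
  assumes f: "f \<in> polys j" and ab: "a \<in> verts T" "b \<in> verts T" "a \<noteq> b"
  shows "tint T (\<lambda>x. grad f x \<bullet> (b - a)) = (\<Sum>F | F facet_of T. face_integral F f * (outward_normal T F \<bullet> (b - a)))"
proof -
  obtain c d where V: "verts T = {a, b, c, d}" and dist: "distinct [a, b, c, d]"
    by (rule four_verts'[OF T ab])
  have V': "verts T = {b, a, c, d}" and dist': "distinct [b, a, c, d]" using V dist by auto
  have n: "outward_normal T (fct T v) \<bullet> (b - a) = (if v = a then 1 / norm (bgrad T v) else if v = b then - 1 / norm (bgrad T v) else 0)"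
    if v: "v \<in> verts T" for v
    using outward_normal_eq[OF T v fct_def] lam_diff[of T v b a] lam_vert[OF T v ab(1)] lam_vert[OF T v ab(2)] ab(3)
    by (auto simp: divide_simps)
  have "(\<Sum>F | F facet_of T. face_integral F f * (outward_normal T F \<bullet> (b - a)))
      = (\<Sum>v\<in>verts T. face_integral (fct T v) f * (outward_normal T (fct T v) \<bullet> (b - a)))"
    by (rule sum_facets)
  also have "\<dots> = face_integral (fct T a) f / norm (bgrad T a) - face_integral (fct T b) f / norm (bgrad T b)"
  proof -
    have "b \<noteq> a" "c \<noteq> a" "d \<noteq> a" "c \<noteq> b" "d \<noteq> b" "c \<noteq> d" using dist by auto
    moreover have "outward_normal T (fct T a) \<bullet> (b - a) = 1 / norm (bgrad T a)"
      "outward_normal T (fct T b) \<bullet> (b - a) = - 1 / norm (bgrad T b)"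
      "outward_normal T (fct T c) \<bullet> (b - a) = 0" "outward_normal T (fct T d) \<bullet> (b - a) = 0"
      using n[of a] n[of b] n[of c] n[of d] calculation by (simp_all add: V)
    ultimately show ?thesis unfolding V by simp
  qed
  also have "\<dots> = vol3 a b c d * J2 b c d f - vol3 a b c d * J2 a c d f"
    unfolding face_integral_fct[OF V dist continuous_on_polys[OF f]] face_integral_fct[OF V' dist' continuous_on_polys[OF f]]
      vol3_swap(1)[of b a c d]
    using bgrad_nonzero[OF T ab(1)] bgrad_nonzero[OF T ab(2)] by simp
  also have "\<dots> = vol3 a b c d * I3 (\<lambda>(s, t, r). grad f (a + s *\<^sub>R (b - a) + t *\<^sub>R (c - a) + r *\<^sub>R (d - a)) \<bullet> (b - a))"
    by (simp add: I3_directional_derivative[OF V dist f] right_diff_distrib)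
  also have "\<dots> = tint T (\<lambda>x. grad f x \<bullet> (b - a))"
    by (rule tint_eq[OF V dist, symmetric])
      (intro continuous_intros continuous_on_vpolys[OF vpolys_grad[OF f]])
  finally show ?thesis by simp
qed

text \<open>Both sides are linear in the direction, and the edges at one vertex span the
  space.\<close>

lemma divergence_direction:
  assumes f: "f \<in> polys j"
  shows "tint T (\<lambda>x. grad f x \<bullet> e) = (\<Sum>F | F facet_of T. face_integral F f * (outward_normal T F \<bullet> e))"
proof -
  obtain a where a: "a \<in> verts T" using card_verts[OF T] by fastforce
  \<comment> \<open>These are the coefficients of \<open>e\<close> in the edges at \<open>a\<close>;
    the summand for \<open>w = a\<close> is 0.\<close>
  define k where "k w = bgrad T w \<bullet> e" for w
  have k: "k w = lam T w (a + e) - lam T w a" for w by (simp add: k_def lam_diff)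
  have e: "e = (\<Sum>w\<in>verts T. k w *\<^sub>R (w - a))"
  proof -
    have "(\<Sum>w\<in>verts T. k w *\<^sub>R (w - a)) = (\<Sum>w\<in>verts T. k w *\<^sub>R w) - (\<Sum>w\<in>verts T. k w) *\<^sub>R a"
      by (simp add: scaleR_right_diff_distrib sum_subtractf scaleR_sum_left)
    then show ?thesis
      by (simp add: k scaleR_left_diff_distrib sum_subtractf sum_lam[OF T] sum_lam_vert[OF T])
  qed
  have c: "continuous_on T (\<lambda>x. grad f x \<bullet> u)" for u
    by (intro continuous_intros continuous_on_vpolys[OF vpolys_grad[OF f]])
  have "tint T (\<lambda>x. grad f x \<bullet> e) = tint T (\<lambda>x. \<Sum>w\<in>verts T. k w * (grad f x \<bullet> (w - a)))"
    by (subst e) (simp add: inner_sum_right)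
  also have "\<dots> = (\<Sum>w\<in>verts T. k w * tint T (\<lambda>x. grad f x \<bullet> (w - a)))"
    by (subst pos_lin_sum[OF pos_lin_tint]) (auto intro!: sum.cong pos_lin_cmult[OF pos_lin_tint] c continuous_on_mult)
  also have "\<dots> = (\<Sum>w\<in>verts T. k w * (\<Sum>F | F facet_of T. face_integral F f * (outward_normal T F \<bullet> (w - a))))"
  proof (intro sum.cong refl arg_cong2[where f = "(*)"])
    fix w assume w: "w \<in> verts T"
    show "tint T (\<lambda>x. grad f x \<bullet> (w - a)) = (\<Sum>F | F facet_of T. face_integral F f * (outward_normal T F \<bullet> (w - a)))"
    proof (cases "w = a")
      case True then show ?thesis using pos_lin_zero[OF pos_lin_tint] by simp
    next
      case False
      then show ?thesis using divergence_edge[OF f a w] by simp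
    qed
  qed
  also have "\<dots> = (\<Sum>w\<in>verts T. \<Sum>F | F facet_of T. face_integral F f * (outward_normal T F \<bullet> k w *\<^sub>R (w - a)))"
    by (simp add: sum_distrib_left algebra_simps)
  also have "\<dots> = (\<Sum>F | F facet_of T. \<Sum>w\<in>verts T. face_integral F f * (outward_normal T F \<bullet> k w *\<^sub>R (w - a)))"
    by (rule sum.swap)
  also have "\<dots> = (\<Sum>F | F facet_of T. face_integral F f * (outward_normal T F \<bullet> e))"
    by (subst e) (simp only: inner_sum_right sum_distrib_left)
  finally show ?thesis .
qed

lemma divergence_theorem:
  assumes w: "w \<in> vpolys j"
  shows "tint T (divergence w) = (\<Sum>F | F facet_of T. face_integral F (\<lambda>x. outward_normal T F \<bullet> w x))"
proof -
  have g: "(\<lambda>x. w x $ i) \<in> polys j" for i using w by (rule vpolysD)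
  have "tint T (divergence w) = tint T (\<lambda>x. \<Sum>i\<in>UNIV. grad (\<lambda>y. w y $ i) x \<bullet> axis i 1)"
    by (simp add: divergence_def[abs_def] inner_axis grad_nth)
  also have "\<dots> = (\<Sum>i\<in>UNIV. tint T (\<lambda>x. grad (\<lambda>y. w y $ i) x \<bullet> axis i 1))"
    by (intro pos_lin_sum[OF pos_lin_tint] continuous_intros continuous_on_vpolys[OF vpolys_grad[OF g]])
  also have "\<dots> = (\<Sum>i\<in>UNIV. \<Sum>F | F facet_of T. face_integral F (\<lambda>x. w x $ i) * (outward_normal T F $ i))"
    by (simp only: divergence_direction[OF g]) (simp add: inner_axis)
  also have "\<dots> = (\<Sum>F | F facet_of T. \<Sum>i\<in>UNIV. outward_normal T F $ i * face_integral F (\<lambda>x. w x $ i))"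
    by (subst sum.swap) (simp add: mult.commute)
  also have "\<dots> = (\<Sum>F | F facet_of T. face_integral F (\<lambda>x. outward_normal T F \<bullet> w x))"
  proof (rule sum.cong[OF refl])
    fix F assume "F \<in> {F. F facet_of T}"
    then have pl: "pos_lin F (face_integral F)" using pos_lin_facet by simp
    show "(\<Sum>i\<in>UNIV. outward_normal T F $ i * face_integral F (\<lambda>x. w x $ i)) = face_integral F (\<lambda>x. outward_normal T F \<bullet> w x)"
      unfolding inner_vec_def inner_real_def
      by (subst pos_lin_sum[OF pl]) (auto intro!: sum.cong pos_lin_cmult[OF pl, symmetric] continuous_on_mult continuous_on_polys[OF g])
  qed
  finally show ?thesis .
qed

text \<open>Divergence theorem for the polynomial field \<open>q x *\<^sub>R u x\<close> and the
  product rule.\<close>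

lemma integration_by_parts:
  assumes u: "u \<in> vpolys i" and q: "q \<in> polys j"
  shows "tint T (\<lambda>x. u x \<bullet> grad q x) =
    (\<Sum>F | F facet_of T. face_integral F (\<lambda>x. (outward_normal T F \<bullet> u x) * q x)) - tint T (\<lambda>x. divergence u x * q x)"
proof -
  have uq: "(\<lambda>x. q x *\<^sub>R u x) \<in> vpolys (j + i)" by (rule vpolys_scale[OF q u])
  have div: "divergence (\<lambda>x. q x *\<^sub>R u x) x = u x \<bullet> grad q x + divergence u x * q x" for x
  proof -
    have "partial k (\<lambda>y. (q y *\<^sub>R u y) $ k) x = q x * partial k (\<lambda>y. u y $ k) x + u x $ k * partial k q x" for k
      using arg_cong[OF grad_mult[OF differentiable_polys[OF q, of x] differentiable_polys[OF vpolysD[OF u, of k], of x]], of "\<lambda>z. z $ k"]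
      by (simp add: grad_nth[symmetric])
    then show ?thesis
      by (simp add: divergence_def inner_vec_def grad_nth sum.distrib sum_distrib_left mult.commute)
  qed
  have c: "continuous_on T (\<lambda>x. u x \<bullet> grad q x)" "continuous_on T (\<lambda>x. divergence u x * q x)"
    by (intro continuous_intros continuous_on_vpolys[OF vpolys_grad[OF q]] continuous_on_vpolys[OF u]
        continuous_on_polys[OF q] continuous_on_polys[OF polys_divergence[OF u]])+
  have "tint T (\<lambda>x. u x \<bullet> grad q x) + tint T (\<lambda>x. divergence u x * q x) = tint T (divergence (\<lambda>x. q x *\<^sub>R u x))"
    unfolding div[abs_def] by (rule pos_lin_add[OF pos_lin_tint c, symmetric])
  also have "\<dots> = (\<Sum>F | F facet_of T. face_integral F (\<lambda>x. (outward_normal T F \<bullet> u x) * q x))"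
    unfolding divergence_theorem[OF uq] by (simp add: mult.commute)
  finally show ?thesis by simp
qed

end

section \<open>Shape-regular tetrahedra\<close>

text \<open>Shape regularity of a single element, so that the local estimates can be stated without
  a mesh.\<close>

definition reg :: "real \<Rightarrow> (real^3) set \<Rightarrow> bool" where
  "reg \<kappa> T \<longleftrightarrow> 3 simplex T \<and> (\<exists>c r. 0 < r \<and> cball c r \<subseteq> T \<and> diameter T \<le> \<kappa> * r)"

lemma I2_one_le: "I2 (\<lambda>_. 1) \<le> 1"
proof -
  have "I2 (\<lambda>_. 1) = measure lborel R2"
    using compact_R2 by (simp add: I2_def set_lebesgue_integral_def borel_compact)
  also have "\<dots> \<le> measure lborel (cbox (0,0) (1,1) :: (real\<times>real) set)"
    by (rule measure_mono_fmeasurable) (auto simp: borel_compact[OF compact_R2], auto simp: R2_def)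
  also have "\<dots> = 1"
    by (simp add: content_Pair)
  finally show ?thesis .
qed

lemma I3_one_le: "I3 (\<lambda>_. 1) \<le> 1"
proof -
  have "I3 (\<lambda>_. 1) = measure lborel R3"
    using compact_R3 by (simp add: I3_def set_lebesgue_integral_def borel_compact)
  also have "\<dots> \<le> measure lborel (cbox (0,0,0) (1,1,1) :: (real\<times>real\<times>real) set)"
    by (rule measure_mono_fmeasurable) (auto simp: borel_compact[OF compact_R3], auto simp: R3_def)
  also have "\<dots> = 1"
    by (simp add: content_Pair)
  finally show ?thesis .
qed

text \<open>Transports sums over multi-indices from the labels of the reference simplex to the
  vertices of an element.\<close>

lemma sum_mi_reindex:
  fixes g :: "'a multiset \<Rightarrow> real"
  assumes e: "bij_betw e S S'"
  shows "(\<Sum>\<alpha>\<in>mi S' n. g \<alpha>) = (\<Sum>\<beta>\<in>mi S n. g (image_mset e \<beta>))"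
proof -
  have "bij_betw (image_mset e) (mi S n) (mi S' n)"
  proof (rule bij_betw_byWitness[where f' = "image_mset (inv_into S e)"])
    show "\<forall>\<beta>\<in>mi S n. image_mset (inv_into S e) (image_mset e \<beta>) = \<beta>"
    proof
      fix \<beta> assume "\<beta> \<in> mi S n"
      then have "image_mset (inv_into S e \<circ> e) \<beta> = image_mset id \<beta>"
        using e by (intro image_mset_cong) (auto simp: mi_def bij_betw_def)
      then show "image_mset (inv_into S e) (image_mset e \<beta>) = \<beta>" by (simp add: multiset.map_comp)
    qed
    show "\<forall>\<alpha>\<in>mi S' n. image_mset e (image_mset (inv_into S e) \<alpha>) = \<alpha>"
    proof
      fix \<alpha> assume "\<alpha> \<in> mi S' n"
      then have "image_mset (e \<circ> inv_into S e) \<alpha> = image_mset id \<alpha>"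
        using e by (intro image_mset_cong) (auto simp: mi_def bij_betw_def f_inv_into_f)
      then show "image_mset e (image_mset (inv_into S e) \<alpha>) = \<alpha>" by (simp add: multiset.map_comp)
    qed
    show "image_mset e ` mi S n \<subseteq> mi S' n"
      using bij_betw_apply[OF e] by (auto simp: mi_def subset_iff)
    show "image_mset (inv_into S e) ` mi S' n \<subseteq> mi S n"
      using e by (auto simp: mi_def bij_betw_def intro!: inv_into_into)
  qed
  then show ?thesis by (subst sum.reindex_bij_betw[symmetric]) auto
qed

definition Nmi :: "nat \<Rightarrow> real" where
  "Nmi n = card (mi {..<4::nat} n)"

lemma card_mi:
  assumes "finite S" "card S = 4" shows "real (card (mi S n)) = Nmi n"
proof -
  obtain e where "bij_betw e {..<4::nat} S"
    using ex_bij_betw_nat_finite[OF assms(1)] assms(2) by (auto simp: atLeast0LessThan)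
  from sum_mi_reindex[OF this, of "\<lambda>_. 1" n] show ?thesis by (simp add: Nmi_def)
qed

lemma Nmi_pos: "0 < Nmi n"
proof -
  have "replicate_mset n (0::nat) \<in> mi {..<4} n" by (auto simp: mi_def)
  then show ?thesis unfolding Nmi_def using finite_mi[of "{..<4::nat}" n] card_gt_0_iff by auto
qed

lemma reg_simplex: "reg \<kappa> T \<Longrightarrow> 3 simplex T"
  by (simp add: reg_def)

context
  fixes \<kappa> :: real and T :: "(real^3) set"
  assumes R: "reg \<kappa> T"
begin

lemma T_simplex: "3 simplex T" by (rule reg_simplex[OF R])

lemma T_bounded: "bounded T" by (rule compact_imp_bounded[OF compact_simplex3[OF T_simplex]])

lemma reg_ball:
  obtains c r where "0 < r" "cball c r \<subseteq> T" "diameter T \<le> \<kappa> * r" "2 * r \<le> diameter T"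
proof -
  obtain c r where cr: "0 < r" "cball c r \<subseteq> T" "diameter T \<le> \<kappa> * r" using R by (auto simp: reg_def)
  have "diameter (cball c r) \<le> diameter T" by (rule diameter_subset[OF cr(2) T_bounded])
  then have "2 * r \<le> diameter T" using cr(1) by simp
  with cr that show ?thesis by blast
qed

text \<open>The ball inside the element has diameter \<open>2 * r\<close>, which forces
  \<open>\<kappa>\<close> to be at least 2. Later estimates use this to round up to higher powers of
  \<open>\<kappa>\<close>.\<close>

lemma diameter_pos: "0 < diameter T" and kappa_ge_2: "2 \<le> \<kappa>"
proof -
  obtain c r where cr: "0 < r" "diameter T \<le> \<kappa> * r" "2 * r \<le> diameter T" by (rule reg_ball)
  then show "0 < diameter T" by simp
  have "2 * r \<le> \<kappa> * r" using cr by linarith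
  then show "2 \<le> \<kappa>" using cr(1) by simp
qed

lemma norm_diff_le: "x \<in> T \<Longrightarrow> y \<in> T \<Longrightarrow> norm (x - y) \<le> diameter T"
  using diameter_bounded_bound[OF T_bounded] by (simp add: dist_norm)

lemma verts_subset: "verts T \<subseteq> T"
  using convex_hull_verts[OF T_simplex] hull_subset[of "verts T" convex] by simp

text \<open>A barycentric coordinate takes values in [0, 1] on the element. Moving from the centre
  of the inner ball by its radius \<open>r\<close> along the gradient raises it by
  \<open>r * norm (bgrad T v)\<close>, so the gradient is at most \<open>1 / r\<close>.\<close>

lemma norm_bgrad_le:
  assumes v: "v \<in> verts T" shows "norm (bgrad T v) \<le> \<kappa> / diameter T"
proof -
  let ?g = "bgrad T v"
  obtain c r where cr: "0 < r" "cball c r \<subseteq> T" "diameter T \<le> \<kappa> * r" by (rule reg_ball)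
  have g: "?g \<noteq> 0" by (rule bgrad_nonzero[OF T_simplex v])
  let ?x = "c + (r / norm ?g) *\<^sub>R ?g"
  have "?x \<in> T" "c \<in> T" using cr g by (auto simp: dist_norm subset_iff)
  then have "lam T v ?x - lam T v c \<le> 1"
    using lam_le_1[OF T_simplex, of ?x v] v mem_simplex_lam[OF T_simplex, of c] by fastforce
  moreover have "lam T v ?x - lam T v c = r * norm ?g"
    using g by (simp add: lam_diff dot_square_norm power2_eq_square)
  ultimately have "r * norm ?g \<le> 1" by simp
  have "diameter T * norm ?g \<le> (\<kappa> * r) * norm ?g" using cr(3) by (rule mult_right_mono) simp
  also have "\<dots> \<le> \<kappa> * 1"
    unfolding mult.assoc by (rule mult_left_mono) (use \<open>r * norm ?g \<le> 1\<close> kappa_ge_2 in auto)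
  finally show ?thesis using diameter_pos by (simp add: pos_le_divide_eq mult.commute)
qed

text \<open>The coordinate falls by 1 along an edge, and the edge is no longer than the
  diameter.\<close>

lemma norm_bgrad_ge:
  assumes v: "v \<in> verts T" shows "1 / diameter T \<le> norm (bgrad T v)"
proof -
  obtain a b c where V: "verts T = {v, a, b, c}" "distinct [v, a, b, c]" by (rule four_verts[OF T_simplex v])
  then have "bgrad T v \<bullet> (a - v) = -1" by (intro bgrad_works[OF T_simplex v]) auto
  then have "1 \<le> norm (bgrad T v) * norm (a - v)"
    using Cauchy_Schwarz_ineq2[of "bgrad T v" "a - v"] by simp
  also have "\<dots> \<le> norm (bgrad T v) * diameter T"
    using V verts_subset by (intro mult_left_mono norm_diff_le) auto
  finally show ?thesis using diameter_pos by (simp add: divide_le_eq mult.commute)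
qed

lemma vol3_le:
  assumes "a \<in> T" "b \<in> T" "c \<in> T" "d \<in> T" shows "vol3 a b c d \<le> diameter T ^ 3"
proof -
  have "vol3 a b c d \<le> norm (b - a) * norm (cross3 (c - a) (d - a))"
    unfolding vol3_def by (rule Cauchy_Schwarz_ineq2)
  also have "\<dots> \<le> diameter T * (diameter T * diameter T)"
    using assms diameter_pos
    by (intro mult_mono norm_diff_le order_trans[OF norm_cross3_le]) auto
  finally show ?thesis by (simp add: power3_eq_cube mult.assoc)
qed

text \<open>By the duality \<open>bgrad_det\<close>, the upper bound for three gradients is a lower
  bound for the volume.\<close>

lemma vol3_ge:
  assumes V: "verts T = {a, b, c, d}" "distinct [a, b, c, d]"
  shows "(diameter T / \<kappa>) ^ 3 \<le> vol3 a b c d"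
proof -
  let ?x = "\<bar>bgrad T b \<bullet> cross3 (bgrad T c) (bgrad T d)\<bar>"
  have "?x \<le> norm (bgrad T b) * norm (cross3 (bgrad T c) (bgrad T d))" by (rule Cauchy_Schwarz_ineq2)
  also have "\<dots> \<le> (\<kappa> / diameter T) * ((\<kappa> / diameter T) * (\<kappa> / diameter T))"
    using V kappa_ge_2 diameter_pos
    by (intro mult_mono norm_bgrad_le order_trans[OF norm_cross3_le]) auto
  finally have "?x \<le> (\<kappa> / diameter T) ^ 3" by (simp add: power3_eq_cube mult.assoc)
  then have "?x * vol3 a b c d \<le> (\<kappa> / diameter T) ^ 3 * vol3 a b c d"
    by (rule mult_right_mono) (simp add: vol3_def)
  then have "1 \<le> (\<kappa> / diameter T) ^ 3 * vol3 a b c d"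
    using bgrad_det[OF T_simplex V] by simp
  then show ?thesis
    using diameter_pos kappa_ge_2 by (simp add: power_divide divide_simps mult.commute)
qed

lemma fct_subset: "v \<in> verts T \<Longrightarrow> fct T v \<subseteq> T"
  using facet_subset[OF T_simplex fct_facet[OF T_simplex]] .

lemma facet_fct:
  assumes "F facet_of T" obtains v where "v \<in> verts T" "F = fct T v"
  using assms facets_fct[OF T_simplex] by blast

text \<open>The area element of the facet is at least the product of the lower bounds for gradient
  and volume, and at most the squared diameter of the facet.\<close>

lemma diameter_facet:
  assumes F: "F facet_of T"
  shows "diameter F \<le> diameter T" "diameter T \<le> \<kappa>\<^sup>2 * diameter F" "0 < diameter F"
proof -
  obtain v where v: "v \<in> verts T" "F = fct T v" by (rule facet_fct[OF F])
  obtain a b c where V: "verts T = {v, a, b, c}" "distinct [v, a, b, c]" by (rule four_verts[OF T_simplex v(1)])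
  let ?h = "diameter T"
  have FT: "F \<subseteq> T" using v fct_subset by simp
  show "diameter F \<le> ?h" by (rule diameter_subset[OF FT T_bounded])
  have bF: "bounded F" using T_bounded FT by (rule bounded_subset)
  have F0: "0 \<le> diameter F" by (rule diameter_ge_0[OF bF])
  have inF: "a \<in> F" "b \<in> F" "c \<in> F"
    using v(2) fct_eq[OF T_simplex V] by (auto simp: hull_inc)
  have "(1 / ?h) * (?h / \<kappa>) ^ 3 \<le> norm (bgrad T v) * vol3 v a b c"
    using diameter_pos kappa_ge_2 by (intro mult_mono norm_bgrad_ge vol3_ge v V) auto
  also have "\<dots> = norm (cross3 (b - a) (c - a))" by (rule norm_cross_facet[OF T_simplex V, symmetric])
  also have "\<dots> \<le> norm (b - a) * norm (c - a)" by (rule norm_cross3_le)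
  also have "\<dots> \<le> diameter F * diameter F"
    using diameter_bounded_bound[OF bF] inF F0 by (intro mult_mono) (auto simp: dist_norm)
  finally have "(1 / ?h) * (?h / \<kappa>) ^ 3 \<le> (diameter F)\<^sup>2" by (simp add: power2_eq_square)
  then have "?h\<^sup>2 \<le> \<kappa> ^ 3 * (diameter F)\<^sup>2"
    using diameter_pos kappa_ge_2 by (simp add: power_divide divide_simps power2_eq_square power3_eq_cube mult_ac)
  \<comment> \<open>The exponent 3 is rounded up to 4 to make the right-hand side a square.\<close>
  also have "\<dots> \<le> \<kappa> ^ 4 * (diameter F)\<^sup>2"
    using kappa_ge_2 by (intro mult_right_mono power_increasing) auto
  also have "\<dots> = (\<kappa>\<^sup>2 * diameter F)\<^sup>2" by (simp add: power_mult_distrib)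
  finally show le: "?h \<le> \<kappa>\<^sup>2 * diameter F"
    by (rule power2_le_imp_le) (use F0 in simp)
  then show "0 < diameter F" using diameter_pos F0 by (cases "diameter F = 0") auto
qed

lemma tint_le:
  assumes f: "continuous_on T f" and M: "\<And>x. x \<in> T \<Longrightarrow> f x \<le> M" "0 \<le> M"
  shows "tint T f \<le> M * diameter T ^ 3"
proof -
  obtain a where a: "a \<in> verts T" using card_verts[OF T_simplex] by fastforce
  obtain b c d where V: "verts T = {a, b, c, d}" "distinct [a, b, c, d]" by (rule four_verts[OF T_simplex a])
  have "tint T f \<le> tint T (\<lambda>_. M)"
    by (intro pos_lin_mono[OF pos_lin_tint[OF T_simplex]] f M continuous_on_const)
  also have "\<dots> = M * tint T (\<lambda>_. 1)"
    using pos_lin_cmult[OF pos_lin_tint[OF T_simplex], of "\<lambda>_. 1" M] by simp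
  also have "tint T (\<lambda>_. 1) = vol3 a b c d * I3 (\<lambda>_. 1)"
    by (subst tint_eq[OF T_simplex V]) (simp_all add: case_prod_unfold)
  also have "M * (vol3 a b c d * I3 (\<lambda>_. 1)) \<le> M * (diameter T ^ 3 * 1)"
    using V verts_subset diameter_pos M(2)
    by (intro mult_left_mono mult_mono vol3_le I3_one_le pos_lin_nonneg[OF pos_lin_I3]) auto
  finally show ?thesis by simp
qed

lemma face_integral_le:
  assumes F: "F facet_of T" and f: "continuous_on F f" and M: "\<And>x. x \<in> F \<Longrightarrow> f x \<le> M" "0 \<le> M"
  shows "face_integral F f \<le> M * (diameter T)\<^sup>2"
proof -
  obtain v where v: "v \<in> verts T" "F = fct T v" by (rule facet_fct[OF F])
  obtain a b c where V: "verts T = {v, a, b, c}" "distinct [v, a, b, c]" by (rule four_verts[OF T_simplex v(1)])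
  have "face_integral F f \<le> face_integral F (\<lambda>_. M)"
    by (intro pos_lin_mono[OF pos_lin_facet[OF T_simplex F]] f M continuous_on_const)
  also have "\<dots> = M * face_integral F (\<lambda>_. 1)"
    using pos_lin_cmult[OF pos_lin_facet[OF T_simplex F], of "\<lambda>_. 1" M] by simp
  also have "face_integral F (\<lambda>_. 1) = norm (cross3 (b - a) (c - a)) * I2 (\<lambda>_. 1)"
    unfolding v(2) by (subst face_integral_fct[OF T_simplex V]) (simp_all add: J2_def norm_cross_facet[OF T_simplex V])
  also have "norm (cross3 (b - a) (c - a)) * I2 (\<lambda>_. 1) \<le> (diameter T * diameter T) * 1"
    using V verts_subset diameter_pos
    by (intro mult_mono order_trans[OF norm_cross3_le] norm_diff_le I2_one_le pos_lin_nonneg[OF pos_lin_I2]) auto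
  finally show ?thesis using M(2) by (simp add: power2_eq_square mult_left_mono)
qed

lemma bmon_bounds: "x \<in> T \<Longrightarrow> set_mset \<alpha> \<subseteq> verts T \<Longrightarrow> 0 \<le> bmon T \<alpha> x \<and> bmon T \<alpha> x \<le> 1"
proof (induction \<alpha>)
  case (add v \<alpha>)
  then have "0 \<le> lam T v x" "lam T v x \<le> 1"
    using mem_simplex_lam[OF T_simplex] lam_le_1[OF T_simplex] by auto
  with add show ?case by (auto simp: bmon_add_mset mult_le_one)
qed (simp add: bmon_empty)

lemma grad_bmon_le:
  "x \<in> T \<Longrightarrow> set_mset \<alpha> \<subseteq> verts T \<Longrightarrow> norm (grad (bmon T \<alpha>) x) \<le> size \<alpha> * (\<kappa> / diameter T)"
proof (induction \<alpha>)
  case empty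
  then show ?case by (simp add: bmon_empty[abs_def] grad_const)
next
  case (add v \<alpha>)
  have lam: "lam T v x \<in> {0..1}" "norm (bgrad T v) \<le> \<kappa> / diameter T"
    using add.prems mem_simplex_lam[OF T_simplex] lam_le_1[OF T_simplex] norm_bgrad_le by auto
  have "grad (bmon T (add_mset v \<alpha>)) x = lam T v x *\<^sub>R grad (bmon T \<alpha>) x + bmon T \<alpha> x *\<^sub>R grad (lam T v) x"
    unfolding bmon_add_mset[abs_def]
    by (rule grad_mult[OF differentiable_polys[OF lam_polys] differentiable_polys[OF bmon_polys]])
  also have "grad (lam T v) x = bgrad T v"
    unfolding lam_def[abs_def] by (rule grad_affine)
  finally have "norm (grad (bmon T (add_mset v \<alpha>)) x)
      \<le> \<bar>lam T v x\<bar> * norm (grad (bmon T \<alpha>) x) + \<bar>bmon T \<alpha> x\<bar> * norm (bgrad T v)"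
    by (metis norm_scaleR norm_triangle_ineq)
  also have "\<dots> \<le> 1 * (size \<alpha> * (\<kappa> / diameter T)) + 1 * (\<kappa> / diameter T)"
    using lam add bmon_bounds[of x \<alpha>] diameter_pos kappa_ge_2 by (intro add_mono mult_mono) auto
  finally show ?case by (simp add: algebra_simps add_divide_distrib)
qed

text \<open>On the element each Bernstein monomial lies in [0, 1]; the rest is Cauchy-Schwarz over
  the \<open>Nmi n\<close> coefficients.\<close>

lemma bsum_sq_le:
  assumes x: "x \<in> T"
  shows "(\<Sum>\<alpha>\<in>mi (verts T) n. c \<alpha> * bmon T \<alpha> x)\<^sup>2 \<le> Nmi n * (\<Sum>\<alpha>\<in>mi (verts T) n. (c \<alpha>)\<^sup>2)"
proof -
  have "(\<Sum>\<alpha>\<in>mi (verts T) n. c \<alpha> * bmon T \<alpha> x)\<^sup>2 \<le> (\<Sum>\<alpha>\<in>mi (verts T) n. (c \<alpha> * bmon T \<alpha> x)\<^sup>2) * card (mi (verts T) n)"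
    by (rule sum_squared_le_sum_of_squares)
  also have "\<dots> = Nmi n * (\<Sum>\<alpha>\<in>mi (verts T) n. (c \<alpha> * bmon T \<alpha> x)\<^sup>2)"
    by (simp add: card_mi finite_verts card_verts T_simplex)
  also have "\<dots> \<le> Nmi n * (\<Sum>\<alpha>\<in>mi (verts T) n. (c \<alpha>)\<^sup>2)"
  proof (intro mult_left_mono sum_mono)
    fix \<alpha> assume "\<alpha> \<in> mi (verts T) n"
    then have "(bmon T \<alpha> x)\<^sup>2 \<le> 1"
      using bmon_bounds[OF x, of \<alpha>] by (auto simp: mi_def abs_square_le_1)
    then show "(c \<alpha> * bmon T \<alpha> x)\<^sup>2 \<le> (c \<alpha>)\<^sup>2"
      by (simp add: power_mult_distrib mult_left_le)
  qed (use Nmi_pos[of n] in simp)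
  finally show ?thesis .
qed

lemma grad_bsum_sq_le:
  fixes n :: nat and c :: "(real^3) multiset \<Rightarrow> real"
  assumes x: "x \<in> T"
  defines "p \<equiv> \<lambda>x. \<Sum>\<alpha>\<in>mi (verts T) n. c \<alpha> * bmon T \<alpha> x"
  shows "grad p x \<bullet> grad p x \<le> Nmi n * (n * (\<kappa> / diameter T))\<^sup>2 * (\<Sum>\<alpha>\<in>mi (verts T) n. (c \<alpha>)\<^sup>2)"
proof -
  let ?B = "n * (\<kappa> / diameter T)"
  have B: "0 \<le> ?B" using diameter_pos kappa_ge_2 by simp
  have fin: "finite (mi (verts T) n)" by (rule finite_mi[OF finite_verts[OF T_simplex]])
  have "grad p x = (\<Sum>\<alpha>\<in>mi (verts T) n. c \<alpha> *\<^sub>R grad (bmon T \<alpha>) x)"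
  proof -
    have "(p has_derivative (\<lambda>h. \<Sum>\<alpha>\<in>mi (verts T) n. c \<alpha> * (grad (bmon T \<alpha>) x \<bullet> h))) (at x)"
      unfolding p_def
      by (intro has_derivative_sum has_derivative_mult_right has_derivative_grad differentiable_polys[OF bmon_polys])
    then show ?thesis by (intro grad_eqI) (simp add: inner_sum_left)
  qed
  moreover have "norm (c \<alpha> *\<^sub>R grad (bmon T \<alpha>) x) \<le> \<bar>c \<alpha>\<bar> * ?B" if "\<alpha> \<in> mi (verts T) n" for \<alpha>
    unfolding norm_scaleR using grad_bmon_le[OF x, of \<alpha>] that by (intro mult_left_mono) (auto simp: mi_def)
  ultimately have "norm (grad p x) \<le> (\<Sum>\<alpha>\<in>mi (verts T) n. \<bar>c \<alpha>\<bar> * ?B)"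
    by (simp add: sum_norm_le)
  then have "(norm (grad p x))\<^sup>2 \<le> (\<Sum>\<alpha>\<in>mi (verts T) n. \<bar>c \<alpha>\<bar> * ?B)\<^sup>2"
    by (rule power_mono) simp
  also have "\<dots> \<le> (\<Sum>\<alpha>\<in>mi (verts T) n. (\<bar>c \<alpha>\<bar> * ?B)\<^sup>2) * card (mi (verts T) n)"
    by (rule sum_squared_le_sum_of_squares)
  also have "\<dots> = Nmi n * ?B\<^sup>2 * (\<Sum>\<alpha>\<in>mi (verts T) n. (c \<alpha>)\<^sup>2)"
    unfolding power_mult_distrib power2_abs sum_distrib_right[symmetric]
    by (simp add: card_mi finite_verts card_verts T_simplex)
  finally show ?thesis by (simp add: power2_norm_eq_inner)
qed

text \<open>The squared gradients cost two negative powers of the diameter and the volume gives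
  three positive ones, so one power remains.\<close>

lemma tint_grad_bsum_le:
  fixes n :: nat
  defines "p \<equiv> \<lambda>c x. \<Sum>\<alpha>\<in>mi (verts T) n. c \<alpha> * bmon T \<alpha> x"
  shows "tint T (\<lambda>x. grad (p c) x \<bullet> grad (p c) x) \<le> (Nmi n * (n * \<kappa>)\<^sup>2) * diameter T * (\<Sum>\<alpha>\<in>mi (verts T) n. (c \<alpha>)\<^sup>2)"
proof -
  let ?S = "\<Sum>\<alpha>\<in>mi (verts T) n. (c \<alpha>)\<^sup>2"
  have P: "p c \<in> polys n" unfolding p_def by (rule bsum_polys)
  have "tint T (\<lambda>x. grad (p c) x \<bullet> grad (p c) x) \<le> (Nmi n * (n * (\<kappa> / diameter T))\<^sup>2 * ?S) * diameter T ^ 3"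
  proof (rule tint_le)
    show "continuous_on T (\<lambda>x. grad (p c) x \<bullet> grad (p c) x)"
      by (intro continuous_intros continuous_on_vpolys[OF vpolys_grad[OF P]])
    show "grad (p c) x \<bullet> grad (p c) x \<le> Nmi n * (n * (\<kappa> / diameter T))\<^sup>2 * ?S" if "x \<in> T" for x
      unfolding p_def by (rule grad_bsum_sq_le[OF that])
    show "0 \<le> Nmi n * (n * (\<kappa> / diameter T))\<^sup>2 * ?S"
      using Nmi_pos[of n] by (intro mult_nonneg_nonneg sum_nonneg) auto
  qed
  also have "\<dots> = (Nmi n * (n * \<kappa>)\<^sup>2) * diameter T * ?S"
    using diameter_pos by (simp add: power_mult_distrib power_divide power2_eq_square power3_eq_cube)
  finally show ?thesis .
qed

lemma face_integral_bsum_le: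
  assumes F: "F facet_of T"
  shows "face_integral F (\<lambda>x. (\<Sum>\<alpha>\<in>mi (verts T) n. c \<alpha> * bmon T \<alpha> x)\<^sup>2)
    \<le> Nmi n * (\<Sum>\<alpha>\<in>mi (verts T) n. (c \<alpha>)\<^sup>2) * (diameter T)\<^sup>2"
  using facet_subset[OF T_simplex F] Nmi_pos[of n]
  by (intro face_integral_le[OF F] bsum_sq_le continuous_intros continuous_on_polys[OF bmon_polys] mult_nonneg_nonneg sum_nonneg)
    auto

lemma bsum_facet:
  assumes v: "v \<in> verts T" and x: "x \<in> affine hull (verts T - {v})"
  shows "(\<Sum>\<alpha>\<in>mi (verts T) n. c \<alpha> * bmon T \<alpha> x) = (\<Sum>\<alpha>\<in>mi (verts T - {v}) n. c \<alpha> * bmon T \<alpha> x)"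
proof (rule sum.mono_neutral_right)
  show "\<forall>\<alpha>\<in>mi (verts T) n - mi (verts T - {v}) n. c \<alpha> * bmon T \<alpha> x = 0"
    using bmon_facet_zero[OF T_simplex v x] by (auto simp: mi_def)
qed (auto simp: mi_def intro: finite_mi[OF finite_verts[OF T_simplex], unfolded mi_def])

lemma affine_hull_facet_subset: "fct T v \<subseteq> affine hull (verts T - {v})"
  unfolding fct_def by (rule convex_hull_subset_affine_hull)

end

text \<open>In Bernstein coefficients the Gram matrix is that of the reference simplex times
  \<open>vol3\<close>. Hence \<open>\<mu>\<close> depends on the degree alone, and the shape enters
  only through the lower bound for the volume.\<close>

lemma tint_bsum_ge:
  "\<exists>\<mu>>0. \<forall>\<kappa> T c. reg \<kappa> T \<longrightarrow>
     \<mu> * (diameter T / \<kappa>) ^ 3 * (\<Sum>\<alpha>\<in>mi (verts T) n. (c \<alpha>)\<^sup>2) \<le> tint T (\<lambda>x. (\<Sum>\<alpha>\<in>mi (verts T) n. c \<alpha> * bmon T \<alpha> x)\<^sup>2)"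
proof -
  from I3_lower_bound[of n] obtain \<mu> where \<mu>: "0 < \<mu>"
    "\<And>c. \<mu> * (\<Sum>\<beta>\<in>mi {..<4} n. (c \<beta>)\<^sup>2) \<le> I3 (\<lambda>p. (\<Sum>\<beta>\<in>mi {..<4} n. c \<beta> * (\<Prod>i\<in>#\<beta>. bc3 p i))\<^sup>2)"
    by blast
  show ?thesis
  proof (intro exI[of _ \<mu>] conjI allI impI \<mu>(1))
    fix \<kappa> T and c :: "(real^3) multiset \<Rightarrow> real" assume R: "reg \<kappa> T"
    have T: "3 simplex T" by (rule reg_simplex[OF R])
    obtain v0 where v0: "v0 \<in> verts T" using card_verts[OF T] by fastforce
    obtain v1 v2 v3 where V: "verts T = {v0, v1, v2, v3}" "distinct [v0, v1, v2, v3]" by (rule four_verts[OF T v0])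
    define e where "e = (!) [v0, v1, v2, v3]"
    have e: "bij_betw e {..<4} (verts T)"
      unfolding e_def by (rule bij_betw_nth) (use V in auto)
    \<comment> \<open>The affine map from the reference simplex preserves barycentric coordinates,
      so the coefficients are carried over unchanged.\<close>
    define pt where "pt = (\<lambda>(s, t, r). v0 + s *\<^sub>R (v1 - v0) + t *\<^sub>R (v2 - v0) + r *\<^sub>R (v3 - v0))"
    have lamp: "lam T (e i) (pt p) = bc3 p i" if "i < 4" for i p
    proof -
      have *: "lam T v (pt (s, t, r)) = (1 - s - t - r) * lam T v v0 + s * lam T v v1 + t * lam T v v2 + r * lam T v v3" for v s t r
        by (simp add: pt_def lam_def inner_diff_right inner_add_right algebra_simps)
      from that have "i = 0 \<or> i = 1 \<or> i = 2 \<or> i = 3" by auto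
      then show ?thesis
        using V by (cases p) (auto simp: * bc3_def e_def lam_vert[OF T])
    qed
    have sums: "(\<Sum>\<alpha>\<in>mi (verts T) n. c \<alpha> * bmon T \<alpha> (pt p)) = (\<Sum>\<beta>\<in>mi {..<4} n. c (image_mset e \<beta>) * (\<Prod>i\<in>#\<beta>. bc3 p i))" for p
      unfolding sum_mi_reindex[OF e] bmon_def multiset.map_comp o_def
      by (intro sum.cong refl arg_cong2[where f = "(*)"] arg_cong[where f = prod_mset] image_mset_cong lamp)
        (auto simp: mi_def)
    have "\<mu> * (\<Sum>\<alpha>\<in>mi (verts T) n. (c \<alpha>)\<^sup>2) = \<mu> * (\<Sum>\<beta>\<in>mi {..<4} n. (c (image_mset e \<beta>))\<^sup>2)"
      unfolding sum_mi_reindex[OF e] ..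
    also have "\<dots> \<le> I3 (\<lambda>p. (\<Sum>\<alpha>\<in>mi (verts T) n. c \<alpha> * bmon T \<alpha> (pt p))\<^sup>2)"
      unfolding sums by (rule \<mu>(2))
    finally have "vol3 v0 v1 v2 v3 * (\<mu> * (\<Sum>\<alpha>\<in>mi (verts T) n. (c \<alpha>)\<^sup>2))
       \<le> vol3 v0 v1 v2 v3 * I3 (\<lambda>p. (\<Sum>\<alpha>\<in>mi (verts T) n. c \<alpha> * bmon T \<alpha> (pt p))\<^sup>2)"
      by (rule mult_left_mono) (simp add: vol3_def)
    also have "\<dots> = tint T (\<lambda>x. (\<Sum>\<alpha>\<in>mi (verts T) n. c \<alpha> * bmon T \<alpha> x)\<^sup>2)"
      by (subst tint_eq[OF T V])
        (auto intro!: continuous_intros continuous_on_polys[OF bmon_polys] simp: pt_def case_prod_unfold)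
    finally have "vol3 v0 v1 v2 v3 * (\<mu> * (\<Sum>\<alpha>\<in>mi (verts T) n. (c \<alpha>)\<^sup>2))
       \<le> tint T (\<lambda>x. (\<Sum>\<alpha>\<in>mi (verts T) n. c \<alpha> * bmon T \<alpha> x)\<^sup>2)" .
    moreover have "(diameter T / \<kappa>) ^ 3 * (\<mu> * (\<Sum>\<alpha>\<in>mi (verts T) n. (c \<alpha>)\<^sup>2))
       \<le> vol3 v0 v1 v2 v3 * (\<mu> * (\<Sum>\<alpha>\<in>mi (verts T) n. (c \<alpha>)\<^sup>2))"
      using \<mu>(1) by (intro mult_right_mono vol3_ge[OF R V] mult_nonneg_nonneg sum_nonneg) auto
    ultimately show "\<mu> * (diameter T / \<kappa>) ^ 3 * (\<Sum>\<alpha>\<in>mi (verts T) n. (c \<alpha>)\<^sup>2) \<le> tint T (\<lambda>x. (\<Sum>\<alpha>\<in>mi (verts T) n. c \<alpha> * bmon T \<alpha> x)\<^sup>2)"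
      by (simp add: mult_ac)
  qed
qed

text \<open>The counterpart on a facet, from the reference triangle. The area factor is bounded
  below by \<open>(1 / diameter T) * (diameter T / \<kappa>) ^ 3\<close>, which is where
  \<open>\<kappa> ^ 3\<close> comes from.\<close>

lemma face_integral_bsum_ge:
  "\<exists>\<mu>>0. \<forall>\<kappa> T c v. reg \<kappa> T \<longrightarrow> v \<in> verts T \<longrightarrow>
     \<mu> * ((diameter T)\<^sup>2 / \<kappa> ^ 3) * (\<Sum>\<alpha>\<in>mi (verts T - {v}) n. (c \<alpha>)\<^sup>2) \<le> face_integral (fct T v) (\<lambda>x. (\<Sum>\<alpha>\<in>mi (verts T - {v}) n. c \<alpha> * bmon T \<alpha> x)\<^sup>2)"
proof -
  from I2_lower_bound[of n] obtain \<mu> where \<mu>: "0 < \<mu>"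
    "\<And>c. \<mu> * (\<Sum>\<beta>\<in>mi {..<3} n. (c \<beta>)\<^sup>2) \<le> I2 (\<lambda>p. (\<Sum>\<beta>\<in>mi {..<3} n. c \<beta> * (\<Prod>i\<in>#\<beta>. bc2 p i))\<^sup>2)"
    by blast
  show ?thesis
  proof (intro exI[of _ \<mu>] conjI allI impI \<mu>(1))
    fix \<kappa> T v and c :: "(real^3) multiset \<Rightarrow> real" assume R: "reg \<kappa> T" and v: "v \<in> verts T"
    have T: "3 simplex T" by (rule reg_simplex[OF R])
    obtain v0 v1 v2 where V: "verts T = {v, v0, v1, v2}" "distinct [v, v0, v1, v2]" by (rule four_verts[OF T v])
    define S where "S = verts T - {v}"
    have S: "S = {v0, v1, v2}" using V by (auto simp: S_def)
    define e where "e = (!) [v0, v1, v2]"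
    have e: "bij_betw e {..<3} S"
      unfolding e_def S by (rule bij_betw_nth) (use V in auto)
    define pt where "pt p = v0 + fst p *\<^sub>R (v1 - v0) + snd p *\<^sub>R (v2 - v0)" for p
    have lamp: "lam T (e i) (pt p) = bc2 p i" if "i < 3" for i p
    proof -
      have *: "lam T w (pt p) = (1 - fst p - snd p) * lam T w v0 + fst p * lam T w v1 + snd p * lam T w v2" for w
        by (simp add: pt_def lam_def inner_diff_right inner_add_right algebra_simps)
      from that have "i = 0 \<or> i = 1 \<or> i = 2" by auto
      then show ?thesis
        using V by (auto simp: * bc2_def e_def lam_vert[OF T])
    qed
    have sums: "(\<Sum>\<alpha>\<in>mi S n. c \<alpha> * bmon T \<alpha> (pt p)) = (\<Sum>\<beta>\<in>mi {..<3} n. c (image_mset e \<beta>) * (\<Prod>i\<in>#\<beta>. bc2 p i))" for p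
      unfolding sum_mi_reindex[OF e] bmon_def multiset.map_comp o_def
      by (intro sum.cong refl arg_cong2[where f = "(*)"] arg_cong[where f = prod_mset] image_mset_cong lamp)
        (auto simp: mi_def)
    have "\<mu> * (\<Sum>\<alpha>\<in>mi S n. (c \<alpha>)\<^sup>2) = \<mu> * (\<Sum>\<beta>\<in>mi {..<3} n. (c (image_mset e \<beta>))\<^sup>2)"
      unfolding sum_mi_reindex[OF e] ..
    also have "\<dots> \<le> I2 (\<lambda>p. (\<Sum>\<alpha>\<in>mi S n. c \<alpha> * bmon T \<alpha> (pt p))\<^sup>2)"
      unfolding sums by (rule \<mu>(2))
    finally have "(norm (bgrad T v) * vol3 v v0 v1 v2) * (\<mu> * (\<Sum>\<alpha>\<in>mi S n. (c \<alpha>)\<^sup>2))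
       \<le> (norm (bgrad T v) * vol3 v v0 v1 v2) * I2 (\<lambda>p. (\<Sum>\<alpha>\<in>mi S n. c \<alpha> * bmon T \<alpha> (pt p))\<^sup>2)"
      by (rule mult_left_mono) (simp add: vol3_def)
    also have "\<dots> = face_integral (fct T v) (\<lambda>x. (\<Sum>\<alpha>\<in>mi S n. c \<alpha> * bmon T \<alpha> x)\<^sup>2)"
      by (subst face_integral_fct[OF T V])
        (auto intro!: continuous_intros continuous_on_polys[OF bmon_polys] simp: pt_def J2_def)
    finally have up: "(norm (bgrad T v) * vol3 v v0 v1 v2) * (\<mu> * (\<Sum>\<alpha>\<in>mi S n. (c \<alpha>)\<^sup>2))
       \<le> face_integral (fct T v) (\<lambda>x. (\<Sum>\<alpha>\<in>mi S n. c \<alpha> * bmon T \<alpha> x)\<^sup>2)" .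
    have he: "(1 / diameter T) * (diameter T / \<kappa>) ^ 3 = (diameter T)\<^sup>2 / \<kappa> ^ 3"
      using diameter_pos[OF R] by (simp add: power_divide power2_eq_square power3_eq_cube)
    have "((1 / diameter T) * (diameter T / \<kappa>) ^ 3) * (\<mu> * (\<Sum>\<alpha>\<in>mi S n. (c \<alpha>)\<^sup>2))
       \<le> (norm (bgrad T v) * vol3 v v0 v1 v2) * (\<mu> * (\<Sum>\<alpha>\<in>mi S n. (c \<alpha>)\<^sup>2))"
      using \<mu>(1) diameter_pos[OF R] kappa_ge_2[OF R]
      by (intro mult_right_mono mult_mono vol3_ge[OF R V] norm_bgrad_ge[OF R v] mult_nonneg_nonneg sum_nonneg) auto
    from this[unfolded he] up
    have "(diameter T)\<^sup>2 / \<kappa> ^ 3 * (\<mu> * (\<Sum>\<alpha>\<in>mi S n. (c \<alpha>)\<^sup>2))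
       \<le> face_integral (fct T v) (\<lambda>x. (\<Sum>\<alpha>\<in>mi S n. c \<alpha> * bmon T \<alpha> x)\<^sup>2)"
      by (rule order_trans)
    then show "\<mu> * ((diameter T)\<^sup>2 / \<kappa> ^ 3) * (\<Sum>\<alpha>\<in>mi (verts T - {v}) n. (c \<alpha>)\<^sup>2)
      \<le> face_integral (fct T v) (\<lambda>x. (\<Sum>\<alpha>\<in>mi (verts T - {v}) n. c \<alpha> * bmon T \<alpha> x)\<^sup>2)"
      unfolding S_def[symmetric] by (simp add: mult_ac)
  qed
qed

text \<open>Both left sides are bounded above, and the integral on the right is bounded below, by
  constants times \<open>diameter T ^ 3\<close> and the sum of the squared Bernstein
  coefficients.\<close>

lemma inverse_estimate_polys:
  assumes "0 < \<kappa>"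
  shows "\<exists>C>0. \<forall>T p. reg \<kappa> T \<longrightarrow> p \<in> polys n \<longrightarrow>
    (\<forall>F. F facet_of T \<longrightarrow> diameter T * face_integral F (\<lambda>x. (p x)\<^sup>2) \<le> C * tint T (\<lambda>x. (p x)\<^sup>2)) \<and>
    (diameter T)\<^sup>2 * tint T (\<lambda>x. grad p x \<bullet> grad p x) \<le> C * tint T (\<lambda>x. (p x)\<^sup>2)"
proof -
  from tint_bsum_ge[of n] obtain \<mu> where \<mu>: "0 < \<mu>" "\<And>\<kappa> T c. reg \<kappa> T \<Longrightarrow>
     \<mu> * (diameter T / \<kappa>) ^ 3 * (\<Sum>\<alpha>\<in>mi (verts T) n. (c \<alpha>)\<^sup>2) \<le> tint T (\<lambda>x. (\<Sum>\<alpha>\<in>mi (verts T) n. c \<alpha> * bmon T \<alpha> x)\<^sup>2)"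
    by blast
  \<comment> \<open>Dominates the constants of the trace and of the gradient bound, so that one
    constant serves both.\<close>
  define A where "A = Nmi n * (1 + (n * \<kappa>)\<^sup>2)"
  have A: "Nmi n \<le> A" "Nmi n * (n * \<kappa>)\<^sup>2 \<le> A" "0 < A"
    using Nmi_pos[of n] by (auto simp: A_def algebra_simps add_pos_nonneg)
  show ?thesis
  proof (intro exI[of _ "A * \<kappa> ^ 3 / \<mu>"] conjI allI impI)
    show "0 < A * \<kappa> ^ 3 / \<mu>" using A \<mu>(1) assms by simp
  next
    fix T p assume R: "reg \<kappa> T" and p: "p \<in> polys n"
    obtain c where c: "\<And>x. p x = (\<Sum>\<alpha>\<in>mi (verts T) n. c \<alpha> * bmon T \<alpha> x)"
      using polys_bmon_rep[OF reg_simplex[OF R] p] by blast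
    have p_eq: "p = (\<lambda>x. \<Sum>\<alpha>\<in>mi (verts T) n. c \<alpha> * bmon T \<alpha> x)" using c by auto
    define S where "S = (\<Sum>\<alpha>\<in>mi (verts T) n. (c \<alpha>)\<^sup>2)"
    have S0: "0 \<le> S" unfolding S_def by (rule sum_nonneg) simp
    have h: "0 < diameter T" by (rule diameter_pos[OF R])
    have "\<mu> * (diameter T / \<kappa>) ^ 3 * S \<le> tint T (\<lambda>x. (p x)\<^sup>2)"
      unfolding S_def c by (rule \<mu>(2)[OF R])
    then have low: "A * (diameter T ^ 3 * S) \<le> A * \<kappa> ^ 3 / \<mu> * tint T (\<lambda>x. (p x)\<^sup>2)"
      using \<mu>(1) assms A(3) by (simp add: power_divide divide_simps mult_ac)
    show "diameter T * face_integral F (\<lambda>x. (p x)\<^sup>2) \<le> A * \<kappa> ^ 3 / \<mu> * tint T (\<lambda>x. (p x)\<^sup>2)" if F: "F facet_of T" for F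
    proof -
      have "diameter T * face_integral F (\<lambda>x. (p x)\<^sup>2) \<le> diameter T * (Nmi n * S * (diameter T)\<^sup>2)"
        unfolding S_def c using h by (intro mult_left_mono face_integral_bsum_le[OF R F]) simp
      also have "\<dots> = Nmi n * (diameter T ^ 3 * S)" by (simp add: power2_eq_square power3_eq_cube)
      also have "\<dots> \<le> A * (diameter T ^ 3 * S)" using A(1) S0 h by (intro mult_right_mono) auto
      finally show ?thesis using low by simp
    qed
    have "(diameter T)\<^sup>2 * tint T (\<lambda>x. grad p x \<bullet> grad p x) \<le> (diameter T)\<^sup>2 * ((Nmi n * (n * \<kappa>)\<^sup>2) * diameter T * S)"
      unfolding S_def p_eq by (intro mult_left_mono tint_grad_bsum_le[OF R]) simp
    also have "\<dots> = (Nmi n * (n * \<kappa>)\<^sup>2) * (diameter T ^ 3 * S)" by (simp add: power2_eq_square power3_eq_cube)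
    also have "\<dots> \<le> A * (diameter T ^ 3 * S)" using A(2) S0 h by (intro mult_right_mono) auto
    finally show "(diameter T)\<^sup>2 * tint T (\<lambda>x. grad p x \<bullet> grad p x) \<le> A * \<kappa> ^ 3 / \<mu> * tint T (\<lambda>x. (p x)\<^sup>2)"
      using low by simp
  qed
qed

section \<open>Vertex stars\<close>

definition mesh :: "real \<Rightarrow> (real^3) set set \<Rightarrow> bool" where
  "mesh \<kappa> \<T> \<longleftrightarrow> finite \<T> \<and> (\<forall>T\<in>\<T>. reg \<kappa> T) \<and> (\<forall>T\<in>\<T>. \<forall>T'\<in>\<T>. T \<inter> T' face_of T)"

definition star :: "(real^3) set set \<Rightarrow> real^3 \<Rightarrow> (real^3) set set" where
  "star \<T> v = {T \<in> \<T>. v \<in> verts T}"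

lemma mesh_faces_of: "mesh \<kappa> \<T> \<Longrightarrow> T \<in> \<T> \<Longrightarrow> T' \<in> \<T> \<Longrightarrow> T \<inter> T' face_of T \<and> T \<inter> T' face_of T'"
  unfolding mesh_def by (metis Int_commute)

lemma verts_facet_subset:
  assumes "3 simplex T" "F facet_of T" shows "verts F \<subseteq> verts T"
proof -
  obtain v where "verts F = verts T - {v}" by (rule facetE[OF assms])
  then show ?thesis by blast
qed

text \<open>A volume argument: shrunk towards \<open>v\<close> to the diameter \<open>\<rho>\<close>
  of the smallest element, each element of the star still contains a ball of radius
  \<open>\<rho> / \<kappa>\<close>. These balls are disjoint and lie in the ball of radius
  \<open>\<rho>\<close> about \<open>v\<close>.\<close>

lemma card_star_le:
  fixes \<kappa> :: real
  assumes M: "mesh \<kappa> \<T>" and k0: "0 < \<kappa>" shows "card (star \<T> v) \<le> \<kappa> ^ 3"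
proof (cases "star \<T> v = {}")
  case True
  then show ?thesis using k0 by simp
next
  case False
  let ?S = "star \<T> v"
  have fin: "finite ?S" using M by (simp add: star_def mesh_def)
  have R: "reg \<kappa> T" "T \<in> \<T>" "v \<in> verts T" if "T \<in> ?S" for T using that M by (auto simp: star_def mesh_def)
  obtain T0 where T0: "T0 \<in> ?S" using False by auto
  have k2: "2 \<le> \<kappa>" by (rule kappa_ge_2[OF R(1)[OF T0]])
  define \<rho> where "\<rho> = Min (diameter ` ?S)"
  have "\<rho> \<in> diameter ` ?S" unfolding \<rho>_def using fin False by (intro Min_in) auto
  then have \<rho>: "0 < \<rho>" using diameter_pos[OF R(1)] by auto
  have \<rho>_le: "\<rho> \<le> diameter T" if "T \<in> ?S" for T unfolding \<rho>_def using fin that by (intro Min_le) auto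
  have "\<exists>c. ball c (\<rho> / \<kappa>) \<subseteq> T \<inter> cball v \<rho>" if "T \<in> ?S" for T
  proof -
    have RT: "reg \<kappa> T" by (rule R(1)[OF that])
    have vT: "v \<in> T" using R(3)[OF that] verts_subset[OF RT] by blast
    let ?h = "diameter T"
    have h: "0 < ?h" by (rule diameter_pos[OF RT])
    obtain c r where cr: "0 < r" "cball c r \<subseteq> T" "?h \<le> \<kappa> * r" by (rule reg_ball[OF RT])
    \<comment> \<open>This ball lies in the image of \<open>cball c r\<close> under the homothety
      with centre \<open>v\<close> and factor \<open>\<rho> / ?h\<close>. The factor is at most 1,
      so convexity keeps the image inside \<open>T\<close>.\<close>
    have "ball (v + (\<rho> / ?h) *\<^sub>R (c - v)) (\<rho> / \<kappa>) \<subseteq> T \<inter> cball v \<rho>"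
    proof
      fix x assume x: "x \<in> ball (v + (\<rho> / ?h) *\<^sub>R (c - v)) (\<rho> / \<kappa>)"
      define y where "y = v + (?h / \<rho>) *\<^sub>R (x - v)"
      have xy: "x = v + (\<rho> / ?h) *\<^sub>R (y - v)" using \<rho> h by (simp add: y_def)
      have "c - y = (?h / \<rho>) *\<^sub>R ((v + (\<rho> / ?h) *\<^sub>R (c - v)) - x)"
        using \<rho> h by (simp add: y_def algebra_simps)
      then have "norm (c - y) = (?h / \<rho>) * norm ((v + (\<rho> / ?h) *\<^sub>R (c - v)) - x)"
        using \<rho> h by simp
      also have "\<dots> \<le> (?h / \<rho>) * (\<rho> / \<kappa>)"
        using x \<rho> h by (intro mult_left_mono) (auto simp: dist_norm)
      also have "\<dots> = ?h / \<kappa>" using \<rho> by simp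
      also have "\<dots> \<le> r" using cr(3) k2 by (simp add: divide_le_eq mult.commute)
      finally have "y \<in> T" using cr(2) by (auto simp: dist_norm)
      have t: "0 \<le> \<rho> / ?h" "\<rho> / ?h \<le> 1" using \<rho> h \<rho>_le[OF that] by auto
      have "x = (1 - \<rho> / ?h) *\<^sub>R v + (\<rho> / ?h) *\<^sub>R y" unfolding xy by (simp add: algebra_simps)
      moreover have "convex T" using convex_hull_verts[OF reg_simplex[OF RT]] convex_convex_hull by metis
      ultimately have "x \<in> T" using \<open>y \<in> T\<close> vT t by (simp add: convexD_alt)
      moreover have "norm (v - x) \<le> \<rho>"
      proof -
        have "v - x = (\<rho> / ?h) *\<^sub>R (v - y)" unfolding xy by (simp add: algebra_simps)
        then have "norm (v - x) = (\<rho> / ?h) * norm (v - y)" using t by (simp only: norm_scaleR abs_of_nonneg)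
        also have "\<dots> \<le> (\<rho> / ?h) * ?h" using t vT \<open>y \<in> T\<close> by (intro mult_left_mono norm_diff_le[OF RT])
        finally show ?thesis using h by simp
      qed
      ultimately show "x \<in> T \<inter> cball v \<rho>" by (simp add: dist_norm)
    qed
    then show ?thesis by blast
  qed
  then obtain c where c: "\<And>T. T \<in> ?S \<Longrightarrow> ball (c T) (\<rho> / \<kappa>) \<subseteq> T \<inter> cball v \<rho>" by metis
  \<comment> \<open>Overlapping interiors would make the common face equal to both elements.\<close>
  have disj: "disjoint_family_on (\<lambda>T. ball (c T) (\<rho> / \<kappa>)) ?S"
    unfolding disjoint_family_on_def
  proof (intro ballI impI)
    fix T T' assume T: "T \<in> ?S" "T' \<in> ?S" "T \<noteq> T'"
    have f: "T \<inter> T' face_of T" "T \<inter> T' face_of T'" using mesh_faces_of[OF M R(2)[OF T(1)] R(2)[OF T(2)]] by blast+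
    have "ball (c T) (\<rho> / \<kappa>) \<subseteq> interior T" "ball (c T') (\<rho> / \<kappa>) \<subseteq> interior T'"
      using c[OF T(1)] c[OF T(2)] by (intro interior_maximal open_ball; simp)+
    moreover have "interior T \<inter> interior T' = {}"
    proof (rule ccontr)
      assume "interior T \<inter> interior T' \<noteq> {}"
      then have "T \<inter> T' \<inter> interior T \<noteq> {}" "T \<inter> T' \<inter> interior T' \<noteq> {}"
        using interior_subset[of T] interior_subset[of T'] by blast+
      then have "T \<inter> T' = T" "T \<inter> T' = T'"
        using face_of_disjoint_interior[OF f(1)] face_of_disjoint_interior[OF f(2)] by blast+
      then show False using T(3) by simp
    qed
    ultimately show "ball (c T) (\<rho> / \<kappa>) \<inter> ball (c T') (\<rho> / \<kappa>) = {}" by blast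
  qed
  have "card ?S * measure lborel (ball (0::real^3) (\<rho> / \<kappa>)) = (\<Sum>T\<in>?S. measure lborel (ball (c T) (\<rho> / \<kappa>)))"
    using \<rho> k2 by (simp add: content_ball)
  also have "\<dots> = measure lborel (\<Union>T\<in>?S. ball (c T) (\<rho> / \<kappa>))"
    by (rule measure_finite_Union[symmetric, OF fin _ disj less_imp_neq[OF emeasure_lborel_ball_finite]]) auto
  also have "\<dots> \<le> measure lborel (cball v \<rho>)"
  proof (rule measure_mono_fmeasurable)
    show "(\<Union>T\<in>?S. ball (c T) (\<rho> / \<kappa>)) \<subseteq> cball v \<rho>" using c by blast
    show "(\<Union>T\<in>?S. ball (c T) (\<rho> / \<kappa>)) \<in> sets lborel"
      unfolding sets_lborel by (intro borel_open open_UN ballI open_ball)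
    show "cball v \<rho> \<in> fmeasurable lborel"
      using emeasure_lborel_cball_finite[of v \<rho>] by (auto simp: fmeasurable_def)
  qed
  also have "\<dots> = measure lborel (ball (0::real^3) (\<rho> / \<kappa>)) * \<kappa> ^ 3"
    using \<rho> k2 by (simp add: content_ball content_cball power_divide)
  finally have "card ?S * measure lborel (ball (0::real^3) (\<rho> / \<kappa>)) \<le> \<kappa> ^ 3 * measure lborel (ball (0::real^3) (\<rho> / \<kappa>))"
    by (simp add: mult.commute)
  moreover have "0 < measure lborel (ball (0::real^3) (\<rho> / \<kappa>))"
    using \<rho> k2 by (simp add: content_ball)
  ultimately show ?thesis by simp
qed

section \<open>Conforming reconstruction\<close>

lemma abs_le_sqrtI: "x\<^sup>2 \<le> y \<Longrightarrow> \<bar>x\<bar> \<le> sqrt y"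
  using real_sqrt_le_mono[of "x\<^sup>2" y] by (simp only: real_sqrt_abs)

text \<open>
  Instead of averaging at Lagrange nodes, Bernstein-type coefficients are made single-valued: elements are linked
  when they share a facet carrying the multi-index \<open>\<alpha>\<close>, and the coefficient of \<open>\<alpha>\<close> is constant on each class of
  linked elements.  Continuity across every facet is then automatic, whatever the topology of the mesh.
\<close>

definition link :: "(real^3) set set \<Rightarrow> (real^3) multiset \<Rightarrow> ((real^3) set \<times> (real^3) set) set" where
  "link \<T> \<alpha> = {(T, T'). T \<in> \<T> \<and> T' \<in> \<T> \<and> (\<exists>F. F facet_of T \<and> F facet_of T' \<and> set_mset \<alpha> \<subseteq> verts F)}"

definition conf_coeff ::
  "(real^3) set set \<Rightarrow> ((real^3) set \<Rightarrow> bool) \<Rightarrow> ((real^3) set \<Rightarrow> (real^3) multiset \<Rightarrow> real) \<Rightarrow>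
     (real^3) set \<Rightarrow> (real^3) multiset \<Rightarrow> real" where
  "conf_coeff \<T> bd c T \<alpha> =
     (if \<exists>T' F. (T, T') \<in> (link \<T> \<alpha>)\<^sup>* \<and> F facet_of T' \<and> bd F \<and> set_mset \<alpha> \<subseteq> verts F then 0
      else c (SOME T'. (T, T') \<in> (link \<T> \<alpha>)\<^sup>*) \<alpha>)"

lemma sym_link: "(T, T') \<in> link \<T> \<alpha> \<Longrightarrow> (T', T) \<in> link \<T> \<alpha>"
  by (auto simp: link_def)

text \<open>Links are symmetric, so linked elements reach the same elements, and the choice operator
  sees the same predicate for both.\<close>

lemma conf_coeff_link:
  assumes "(T, T') \<in> link \<T> \<alpha>" shows "conf_coeff \<T> bd c T \<alpha> = conf_coeff \<T> bd c T' \<alpha>"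
proof -
  have eq: "(T, T'') \<in> (link \<T> \<alpha>)\<^sup>* \<longleftrightarrow> (T', T'') \<in> (link \<T> \<alpha>)\<^sup>*" for T''
    using assms sym_link[OF assms] converse_rtrancl_into_rtrancl by metis
  show ?thesis unfolding conf_coeff_def eq ..
qed

text \<open>The class of an element contains the element itself, so one of its own boundary facets
  already forces the value 0.\<close>

lemma conf_coeff_boundary:
  "F facet_of T \<Longrightarrow> bd F \<Longrightarrow> set_mset \<alpha> \<subseteq> verts F \<Longrightarrow> conf_coeff \<T> bd c T \<alpha> = 0"
  by (auto simp: conf_coeff_def)

text \<open>\<open>c\<close> holds the Bernstein coefficients of \<open>p\<close>, \<open>bd\<close>
  is an abstract boundary predicate, and \<open>low\<close> is the facet lower bound with its
  constant \<open>\<mu>\<close> fixed independently of the mesh. Coefficients of different elements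
  can be compared only through the single valued \<open>pF\<close>.\<close>

locale jump_data =
  fixes \<kappa> \<mu> :: real and n :: nat and \<T> :: "(real^3) set set" and bd :: "(real^3) set \<Rightarrow> bool"
    and p pF :: "(real^3) set \<Rightarrow> real^3 \<Rightarrow> real" and c :: "(real^3) set \<Rightarrow> (real^3) multiset \<Rightarrow> real"
  assumes M: "mesh \<kappa> \<T>" and kappa: "0 < \<kappa>" and \<mu>: "0 < \<mu>" and n: "1 \<le> n"
    and low: "\<And>T c v. reg \<kappa> T \<Longrightarrow> v \<in> verts T \<Longrightarrow>
     \<mu> * ((diameter T)\<^sup>2 / \<kappa> ^ 3) * (\<Sum>\<alpha>\<in>mi (verts T - {v}) n. (c \<alpha>)\<^sup>2) \<le> face_integral (fct T v) (\<lambda>x. (\<Sum>\<alpha>\<in>mi (verts T - {v}) n. c \<alpha> * bmon T \<alpha> x)\<^sup>2)"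
    and p: "\<And>T x. T \<in> \<T> \<Longrightarrow> p T x = (\<Sum>\<alpha>\<in>mi (verts T) n. c T \<alpha> * bmon T \<alpha> x)"
    and pF: "\<And>T F. T \<in> \<T> \<Longrightarrow> F facet_of T \<Longrightarrow> continuous_on F (pF F)"
    and pF_bd: "\<And>T F x. T \<in> \<T> \<Longrightarrow> F facet_of T \<Longrightarrow> bd F \<Longrightarrow> x \<in> F \<Longrightarrow> pF F x = 0"
begin

definition gap :: "(real^3) set \<Rightarrow> real" where
  "gap T = (\<Sum>F | F facet_of T. face_integral F (\<lambda>x. (p T x - pF F x)\<^sup>2) / diameter F)"

definition C0 :: real where "C0 = 2 * \<kappa> ^ 3 / \<mu>"

lemma R: "T \<in> \<T> \<Longrightarrow> reg \<kappa> T"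
  using M by (simp add: mesh_def)

lemma T: "T \<in> \<T> \<Longrightarrow> 3 simplex T"
  by (rule reg_simplex[OF R])

lemma p_polys: "T \<in> \<T> \<Longrightarrow> p T \<in> polys n"
  using bsum_polys[of "c T" T "verts T" n] by (simp add: p[symmetric])

lemma cont_p: "T \<in> \<T> \<Longrightarrow> continuous_on X (p T)"
  by (rule continuous_on_polys[OF p_polys])

lemma face_gap:
  assumes "T \<in> \<T>" "F facet_of T"
  shows "face_integral F (\<lambda>x. (p T x - pF F x)\<^sup>2) \<le> diameter T * gap T" and "0 \<le> gap T"
proof -
  have nn: "0 \<le> face_integral G (\<lambda>x. (p T x - pF G x)\<^sup>2) / diameter G" if "G facet_of T" for G
    using that assms diameter_facet(3)[OF R] 
    by (intro divide_nonneg_pos pos_lin_nonneg[OF pos_lin_facet[OF T]] continuous_intros cont_p pF) auto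
  show "0 \<le> gap T" unfolding gap_def by (intro sum_nonneg) (use nn in auto)
  have "face_integral F (\<lambda>x. (p T x - pF F x)\<^sup>2) / diameter F \<le> gap T"
    unfolding gap_def using nn assms finite_facets[OF T] by (intro member_le_sum) auto
  then have "face_integral F (\<lambda>x. (p T x - pF F x)\<^sup>2) \<le> diameter F * gap T"
    using diameter_facet(3)[OF R assms(2)] assms(1) by (simp add: divide_le_eq mult.commute)
  also have "\<dots> \<le> diameter T * gap T"
    using diameter_facet(1)[OF R assms(2)] assms(1) \<open>0 \<le> gap T\<close> by (intro mult_right_mono) auto
  finally show "face_integral F (\<lambda>x. (p T x - pF F x)\<^sup>2) \<le> diameter T * gap T" .
qed

lemma C0_nonneg: "T \<in> \<T> \<Longrightarrow> 0 \<le> C0"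
  using \<mu> kappa_ge_2[OF R] by (fastforce simp: C0_def)

text \<open>The facet lower bound for a single coefficient. It is applied to the trace of
  \<open>p\<close> on a boundary facet and to the difference of two traces on a shared one, hence
  the general \<open>g\<close>.\<close>

lemma coeff_le_face_integral:
  assumes T': "T \<in> \<T>" and F: "F facet_of T" and \<alpha>: "\<alpha> \<in> mi (verts F) n"
    and g: "\<And>x. x \<in> F \<Longrightarrow> (\<Sum>\<alpha>\<in>mi (verts F) n. k \<alpha> * bmon T \<alpha> x) = g x"
    and bound: "face_integral F (\<lambda>x. (g x)\<^sup>2) \<le> 2 * diameter T * E"
  shows "(k \<alpha>)\<^sup>2 \<le> C0 * E / diameter T"
proof -
  let ?h = "diameter T"
  have h: "0 < ?h" by (rule diameter_pos[OF R[OF T']])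
  have k2: "2 \<le> \<kappa>" by (rule kappa_ge_2[OF R[OF T']])
  obtain v where v: "v \<in> verts T" "F = fct T v" by (rule facet_fct[OF R[OF T'] F])
  have vF: "verts F = verts T - {v}" unfolding v(2) fct_def by (rule verts_facet[OF T[OF T'] v(1)])
  have "\<mu> * (?h\<^sup>2 / \<kappa> ^ 3) * (k \<alpha>)\<^sup>2 \<le> \<mu> * (?h\<^sup>2 / \<kappa> ^ 3) * (\<Sum>\<alpha>\<in>mi (verts F) n. (k \<alpha>)\<^sup>2)"
    using \<alpha> \<mu> k2 finite_mi[of "verts F" n] finite_verts[OF T[OF T']] vF
    by (intro mult_left_mono member_le_sum) auto
  also have "\<dots> \<le> face_integral F (\<lambda>x. (\<Sum>\<alpha>\<in>mi (verts F) n. k \<alpha> * bmon T \<alpha> x)\<^sup>2)"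
    using low[OF R[OF T'] v(1), of k] unfolding vF v(2)[symmetric] .
  also have "\<dots> = face_integral F (\<lambda>x. (g x)\<^sup>2)"
    by (rule pos_lin_cong[OF pos_lin_facet[OF T[OF T'] F]]) (simp add: g)
  also have "\<dots> \<le> 2 * ?h * E" by (rule bound)
  finally have "\<mu> * (?h\<^sup>2 / \<kappa> ^ 3) * (k \<alpha>)\<^sup>2 \<le> 2 * ?h * E" .
  then show ?thesis
    using h k2 \<mu> by (simp add: C0_def divide_simps power2_eq_square mult_ac)
qed

text \<open>On a boundary facet \<open>pF\<close> vanishes, so the trace of \<open>p\<close> is
  itself the gap.\<close>

lemma coeff_boundary:
  assumes "T \<in> \<T>" "F facet_of T" "bd F" "\<alpha> \<in> mi (verts F) n"
  shows "(c T \<alpha>)\<^sup>2 \<le> C0 * gap T / diameter T"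
proof (rule coeff_le_face_integral[OF assms(1,2,4)])
  obtain v where v: "v \<in> verts T" "F = fct T v" by (rule facet_fct[OF R[OF assms(1)] assms(2)])
  have vF: "verts F = verts T - {v}" unfolding v(2) fct_def by (rule verts_facet[OF T[OF assms(1)] v(1)])
  show "(\<Sum>\<alpha>\<in>mi (verts F) n. c T \<alpha> * bmon T \<alpha> x) = p T x" if "x \<in> F" for x
    unfolding vF p[OF assms(1)]
    by (rule bsum_facet[OF R[OF assms(1)] v(1), symmetric])
      (use that affine_hull_facet_subset[OF R[OF assms(1)]] v in blast)
  have "face_integral F (\<lambda>x. (p T x)\<^sup>2) = face_integral F (\<lambda>x. (p T x - pF F x)\<^sup>2)"
    by (rule pos_lin_cong[OF pos_lin_facet[OF T[OF assms(1)] assms(2)]]) (simp add: pF_bd[OF assms(1-3)])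
  also have "\<dots> \<le> 2 * diameter T * gap T"
    using face_gap[OF assms(1,2)] diameter_pos[OF R[OF assms(1)]] mult_nonneg_nonneg[of "diameter T" "gap T"] by linarith
  finally show "face_integral F (\<lambda>x. (p T x)\<^sup>2) \<le> 2 * diameter T * gap T" .
qed

lemma link_diameter: 
  assumes "(T, T') \<in> link \<T> \<alpha>" shows "diameter T \<le> \<kappa>\<^sup>2 * diameter T'"
proof -
  from assms obtain F where F: "T \<in> \<T>" "T' \<in> \<T>" "F facet_of T" "F facet_of T'" by (auto simp: link_def)
  have "diameter T \<le> \<kappa>\<^sup>2 * diameter F" by (rule diameter_facet(2)[OF R[OF F(1)] F(3)])
  also have "\<dots> \<le> \<kappa>\<^sup>2 * diameter T'" by (intro mult_left_mono diameter_facet(1)[OF R[OF F(2)] F(4)]) simp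
  finally show ?thesis .
qed

text \<open>Since \<open>pF\<close> has one value on the common facet, the jump of \<open>p\<close>
  is the difference of the two gaps; the diameters of the neighbours differ at most by the factor
  \<open>\<kappa>\<^sup>2\<close>.\<close>

lemma coeff_link:
  assumes l: "(T, T') \<in> link \<T> \<alpha>" and sz: "size \<alpha> = n"
  shows "(c T \<alpha> - c T' \<alpha>)\<^sup>2 \<le> C0 * (\<kappa>\<^sup>2 * (gap T + gap T')) / diameter T"
proof -
  from l obtain F where F: "T \<in> \<T>" "T' \<in> \<T>" "F facet_of T" "F facet_of T'" "set_mset \<alpha> \<subseteq> verts F"
    by (auto simp: link_def)
  have \<alpha>: "\<alpha> \<in> mi (verts F) n" using F sz by (simp add: mi_def)
  show ?thesis
  proof (rule coeff_le_face_integral[OF F(1,3) \<alpha>])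
    obtain v where v: "v \<in> verts T" "F = fct T v" by (rule facet_fct[OF R[OF F(1)] F(3)])
    have vF: "verts F = verts T - {v}" unfolding v(2) fct_def by (rule verts_facet[OF T[OF F(1)] v(1)])
    obtain v' where v': "v' \<in> verts T'" "F = fct T' v'" by (rule facet_fct[OF R[OF F(2)] F(4)])
    have vF': "verts F = verts T' - {v'}" unfolding v'(2) fct_def by (rule verts_facet[OF T[OF F(2)] v'(1)])
    show "(\<Sum>\<alpha>\<in>mi (verts F) n. (c T \<alpha> - c T' \<alpha>) * bmon T \<alpha> x) = p T x - p T' x" if x: "x \<in> F" for x
    proof -
      have a: "x \<in> affine hull (verts T - {v})" "x \<in> affine hull (verts T' - {v'})"
        using x affine_hull_facet_subset[OF R[OF F(1)]] affine_hull_facet_subset[OF R[OF F(2)]] v v' by blast+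
      have "p T x - p T' x = (\<Sum>\<alpha>\<in>mi (verts F) n. c T \<alpha> * bmon T \<alpha> x) - (\<Sum>\<alpha>\<in>mi (verts F) n. c T' \<alpha> * bmon T' \<alpha> x)"
        unfolding p[OF F(1)] p[OF F(2)] bsum_facet[OF R[OF F(1)] v(1) a(1)] bsum_facet[OF R[OF F(2)] v'(1) a(2)]
          vF[symmetric] vF'[symmetric] ..
      also have "\<dots> = (\<Sum>\<alpha>\<in>mi (verts F) n. c T \<alpha> * bmon T \<alpha> x) - (\<Sum>\<alpha>\<in>mi (verts F) n. c T' \<alpha> * bmon T \<alpha> x)"
      proof -
        have "bmon T' \<alpha> x = bmon T \<alpha> x" if "\<alpha> \<in> mi (verts F) n" for \<alpha>
          by (rule bmon_shared[of T' T "verts F"]) (use that vF vF' a F T in \<open>auto simp: mi_def\<close>)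
        then show ?thesis by simp
      qed
      finally show ?thesis by (simp add: sum_subtractf left_diff_distrib)
    qed
    have pl: "pos_lin F (face_integral F)" by (rule pos_lin_facet[OF T[OF F(1)] F(3)])
    have cF: "continuous_on F (pF F)" by (rule pF[OF F(1,3)])
    have k2: "2 \<le> \<kappa>" by (rule kappa_ge_2[OF R[OF F(1)]])
    have "face_integral F (\<lambda>x. (p T x - p T' x)\<^sup>2)
       \<le> face_integral F (\<lambda>x. 2 * (p T x - pF F x)\<^sup>2 + 2 * (p T' x - pF F x)\<^sup>2)"
    proof (rule pos_lin_mono[OF pl])
      fix x
      have "0 \<le> ((p T x - pF F x) + (p T' x - pF F x))\<^sup>2" by simp
      then show "(p T x - p T' x)\<^sup>2 \<le> 2 * (p T x - pF F x)\<^sup>2 + 2 * (p T' x - pF F x)\<^sup>2"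
        by (simp add: power2_eq_square algebra_simps)
    qed (intro continuous_intros cont_p F cF)+
    also have "\<dots> = 2 * face_integral F (\<lambda>x. (p T x - pF F x)\<^sup>2) + 2 * face_integral F (\<lambda>x. (p T' x - pF F x)\<^sup>2)"
    proof -
      have cm: "face_integral F (\<lambda>x. 2 * (p S x - pF F x)\<^sup>2) = 2 * face_integral F (\<lambda>x. (p S x - pF F x)\<^sup>2)"
        if "S \<in> \<T>" for S
        by (rule pos_lin_cmult[OF pl]) (intro continuous_intros cont_p that cF)
      show ?thesis
        unfolding cm[OF F(1), symmetric] cm[OF F(2), symmetric]
        by (rule pos_lin_add[OF pl]) (intro continuous_intros cont_p F cF)+
    qed
    also have "\<dots> \<le> 2 * (diameter T * gap T) + 2 * (diameter T' * gap T')"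
      by (intro add_mono mult_left_mono face_gap F) auto
    also have "\<dots> \<le> 2 * (diameter T * (\<kappa>\<^sup>2 * gap T)) + 2 * ((\<kappa>\<^sup>2 * diameter T) * gap T')"
    proof (intro add_mono mult_left_mono mult_right_mono)
      have "1 \<le> \<kappa>\<^sup>2" using k2 by (simp add: one_le_power)
      then show "gap T \<le> \<kappa>\<^sup>2 * gap T" using face_gap(2)[OF F(1,3)] mult_right_mono[of 1 "\<kappa>\<^sup>2" "gap T"] by simp
    qed (use link_diameter[OF sym_link[OF l]] face_gap(2)[OF F(2,4)] diameter_pos[OF R[OF F(1)]] in auto)
    also have "\<dots> = 2 * diameter T * (\<kappa>\<^sup>2 * (gap T + gap T'))" by (simp add: algebra_simps)
    finally show "face_integral F (\<lambda>x. (p T x - p T' x)\<^sup>2) \<le> 2 * diameter T * (\<kappa>\<^sup>2 * (gap T + gap T'))" .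
  qed
qed

definition star_gap :: "real^3 \<Rightarrow> real" where "star_gap v = (\<Sum>T\<in>star \<T> v. gap T)"

lemma gap_nonneg: 
  assumes "T \<in> \<T>" shows "0 \<le> gap T"
proof -
  obtain v where v: "v \<in> verts T" using card_verts[OF T[OF assms]] by fastforce
  show ?thesis by (rule face_gap(2)[OF assms fct_facet[OF T[OF assms] v]])
qed

lemma finite_star: "finite (star \<T> v)"
  using M by (simp add: star_def mesh_def)

lemma gap_le_star_gap: "T \<in> star \<T> v \<Longrightarrow> gap T \<le> star_gap v"
  unfolding star_gap_def by (intro member_le_sum finite_star gap_nonneg) (auto simp: star_def)

lemma star_gap_nonneg: "0 \<le> star_gap v"
  unfolding star_gap_def by (intro sum_nonneg gap_nonneg) (auto simp: star_def)

text \<open>The shared facet carries all vertices of the multi-index, so a chain of links never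
  leaves the star of any of them. This keeps the estimate local.\<close>

lemma link_star: 
  assumes "(T, T') \<in> link \<T> \<alpha>" "v \<in># \<alpha>" shows "T \<in> star \<T> v" "T' \<in> star \<T> v"
proof -
  from assms(1) obtain F where F: "T \<in> \<T>" "T' \<in> \<T>" "F facet_of T" "F facet_of T'" "set_mset \<alpha> \<subseteq> verts F"
    unfolding link_def by blast
  have vF: "v \<in> verts F" using F(5) assms(2) by blast
  have "v \<in> verts T" "v \<in> verts T'"
    by (rule subsetD[OF verts_facet_subset[OF T[OF F(1)] F(3)] vF])
      (rule subsetD[OF verts_facet_subset[OF T[OF F(2)] F(4)] vF])
  then show "T \<in> star \<T> v" "T' \<in> star \<T> v" using F(1,2) by (simp_all add: star_def)
qed

text \<open>Telescoping along \<open>j\<close> links. Each link may change the diameter by the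
  factor \<open>\<kappa>\<^sup>2\<close>, which accounts for the powers.\<close>

lemma coeff_chain:
  assumes "(T, T') \<in> (link \<T> \<alpha>) ^^ j" "T \<in> \<T>" "size \<alpha> = n" "v \<in># \<alpha>"
  shows "T' \<in> \<T> \<and> diameter T \<le> (\<kappa>\<^sup>2) ^ j * diameter T' \<and>
    \<bar>c T \<alpha> - c T' \<alpha>\<bar> \<le> j * sqrt (C0 * ((\<kappa>\<^sup>2) ^ Suc j * (2 * star_gap v)) / diameter T)"
  using assms(1)
proof (induction j arbitrary: T')
  case 0
  then show ?case using assms(2) by simp
next
  case (Suc j)
  then obtain S where S: "(T, S) \<in> (link \<T> \<alpha>) ^^ j" "(S, T') \<in> link \<T> \<alpha>" by auto
  note IH = Suc.IH[OF S(1)]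
  have k2: "2 \<le> \<kappa>" and C0: "0 \<le> C0" by (rule kappa_ge_2[OF R[OF assms(2)]] C0_nonneg[OF assms(2)])+
  have "S \<in> \<T>" using IH by blast
  then have h: "0 < diameter T" "0 < diameter S" using diameter_pos[OF R] assms(2) by simp_all
  have T': "T' \<in> \<T>" using S(2) by (simp add: link_def)
  have kk: "1 \<le> \<kappa>\<^sup>2" using k2 by (simp add: one_le_power)
  have "diameter T \<le> (\<kappa>\<^sup>2) ^ j * diameter S" using IH by blast
  also have "\<dots> \<le> (\<kappa>\<^sup>2) ^ j * (\<kappa>\<^sup>2 * diameter T')"
    by (intro mult_left_mono link_diameter[OF S(2)]) simp
  finally have d: "diameter T \<le> (\<kappa>\<^sup>2) ^ Suc j * diameter T'" by (simp add: mult_ac)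
  have "gap S + gap T' \<le> 2 * star_gap v"
    using gap_le_star_gap[OF link_star(1)[OF S(2) assms(4)]] gap_le_star_gap[OF link_star(2)[OF S(2) assms(4)]]
    by linarith
  then have g: "C0 * (\<kappa>\<^sup>2 * (gap S + gap T')) / diameter S \<le> C0 * (\<kappa>\<^sup>2 * (2 * star_gap v)) / diameter S"
    using C0 h(2) by (intro divide_right_mono mult_left_mono) auto
  have "(c S \<alpha> - c T' \<alpha>)\<^sup>2 \<le> C0 * (\<kappa>\<^sup>2 * (gap S + gap T')) / diameter S"
    by (rule coeff_link[OF S(2) assms(3)])
  also have "\<dots> \<le> C0 * (\<kappa>\<^sup>2 * (2 * star_gap v)) / diameter S" by (rule g)
  also have "\<dots> \<le> C0 * (\<kappa>\<^sup>2 * (2 * star_gap v)) * ((\<kappa>\<^sup>2) ^ j / diameter T)"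
  proof -
    have "1 / diameter S \<le> (\<kappa>\<^sup>2) ^ j / diameter T"
      using IH h by (simp add: divide_simps mult.commute)
    then show ?thesis
      using C0 star_gap_nonneg[of v] mult_left_mono[of "1 / diameter S" "(\<kappa>\<^sup>2) ^ j / diameter T" "C0 * (\<kappa>\<^sup>2 * (2 * star_gap v))"] by simp
  qed
  also have "\<dots> = C0 * ((\<kappa>\<^sup>2) ^ Suc j * (2 * star_gap v)) / diameter T" by simp
  finally have "\<bar>c S \<alpha> - c T' \<alpha>\<bar> \<le> sqrt (C0 * ((\<kappa>\<^sup>2) ^ Suc j * (2 * star_gap v)) / diameter T)"
    by (rule abs_le_sqrtI)
  also have "\<dots> \<le> sqrt (C0 * ((\<kappa>\<^sup>2) ^ Suc (Suc j) * (2 * star_gap v)) / diameter T)" (is "_ \<le> ?B")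
    using C0 kk h star_gap_nonneg[of v]
    by (intro real_sqrt_le_mono divide_right_mono mult_left_mono mult_right_mono power_increasing) auto
  finally have 1: "\<bar>c S \<alpha> - c T' \<alpha>\<bar> \<le> ?B" .
  \<comment> \<open>The bound for the shorter chain is weakened to the exponent of the longer one,
    so that all summands become equal.\<close>
  have "j * sqrt (C0 * ((\<kappa>\<^sup>2) ^ Suc j * (2 * star_gap v)) / diameter T) \<le> j * ?B"
    using C0 kk h star_gap_nonneg[of v]
    by (intro mult_left_mono real_sqrt_le_mono divide_right_mono mult_left_mono mult_right_mono power_increasing) auto
  then have "\<bar>c T \<alpha> - c S \<alpha>\<bar> \<le> j * ?B" using IH by linarith
  with 1 have "\<bar>c T \<alpha> - c T' \<alpha>\<bar> \<le> Suc j * ?B" by (simp add: algebra_simps)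
  with d T' show ?case by blast
qed

text \<open>Bounds the length of a chain: a star has at most \<open>\<kappa> ^ 3\<close> elements,
  hence at most \<open>\<kappa> ^ 6\<close> ordered pairs of linked elements.\<close>

definition L :: nat where "L = nat \<lceil>\<kappa> ^ 6\<rceil>"

text \<open>Squares \<open>L + 1\<close> steps of the chain estimate; the additional step is the
  comparison with 0 at the boundary.\<close>

definition C1 :: real where "C1 = (L + 1)\<^sup>2 * (C0 * ((\<kappa>\<^sup>2) ^ Suc L * 2))"

text \<open>In a finite relation, reachability takes at most as many steps as there are pairs, and
  the links of \<open>\<alpha>\<close> all lie in the star of \<open>v\<close>.\<close>

lemma coeff_class:
  assumes "(T, T') \<in> (link \<T> \<alpha>)\<^sup>*" "T \<in> \<T>" "size \<alpha> = n" "v \<in># \<alpha>"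
  shows "T' \<in> \<T> \<and> diameter T \<le> (\<kappa>\<^sup>2) ^ L * diameter T' \<and>
    \<bar>c T \<alpha> - c T' \<alpha>\<bar> \<le> L * sqrt (C0 * ((\<kappa>\<^sup>2) ^ Suc L * (2 * star_gap v)) / diameter T)"
proof -
  have sub: "link \<T> \<alpha> \<subseteq> star \<T> v \<times> star \<T> v"
  proof (rule subrelI)
    fix S S' assume l: "(S, S') \<in> link \<T> \<alpha>"
    show "(S, S') \<in> star \<T> v \<times> star \<T> v"
      by (intro SigmaI link_star[OF l assms(4)])
  qed
  have fin: "finite (link \<T> \<alpha>)" by (rule finite_subset[OF sub]) (simp add: finite_star)
  obtain j where j: "j \<le> card (link \<T> \<alpha>)" "(T, T') \<in> (link \<T> \<alpha>) ^^ j"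
    using assms(1) unfolding rtrancl_finite_eq_relpow[OF fin] by blast
  have k2: "2 \<le> \<kappa>" and C0: "0 \<le> C0" and h: "0 < diameter T"
    by (rule kappa_ge_2[OF R[OF assms(2)]] C0_nonneg[OF assms(2)] diameter_pos[OF R[OF assms(2)]])+
  have "card (link \<T> \<alpha>) \<le> card (star \<T> v) * card (star \<T> v)"
    using card_mono[OF _ sub] finite_star by (simp add: card_cartesian_product)
  then have "real (card (link \<T> \<alpha>)) \<le> real (card (star \<T> v)) * real (card (star \<T> v))"
    by (metis of_nat_le_iff of_nat_mult)
  also have "\<dots> \<le> \<kappa> ^ 3 * \<kappa> ^ 3" using k2 by (intro mult_mono card_star_le[OF M kappa]) auto
  also have "\<dots> = \<kappa> ^ 6" by (simp add: power_add[symmetric])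
  finally have "j \<le> L" using j(1) unfolding L_def by linarith
  note ch = coeff_chain[OF j(2) assms(2-4)]
  have kk: "1 \<le> \<kappa>\<^sup>2" using k2 by (simp add: one_le_power)
  have "T' \<in> \<T>" using ch by blast
  then have h': "0 < diameter T'" by (rule diameter_pos[OF R])
  have "diameter T \<le> (\<kappa>\<^sup>2) ^ j * diameter T'" using ch by blast
  also have "\<dots> \<le> (\<kappa>\<^sup>2) ^ L * diameter T'"
    using kk h' \<open>j \<le> L\<close> by (intro mult_right_mono power_increasing) auto
  finally have d: "diameter T \<le> (\<kappa>\<^sup>2) ^ L * diameter T'" .
  have "\<bar>c T \<alpha> - c T' \<alpha>\<bar> \<le> j * sqrt (C0 * ((\<kappa>\<^sup>2) ^ Suc j * (2 * star_gap v)) / diameter T)" using ch by blast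
  also have "\<dots> \<le> L * sqrt (C0 * ((\<kappa>\<^sup>2) ^ Suc L * (2 * star_gap v)) / diameter T)"
    using C0 kk h star_gap_nonneg[of v] \<open>j \<le> L\<close>
    by (intro mult_mono real_sqrt_le_mono divide_right_mono mult_left_mono mult_right_mono power_increasing) auto
  finally show ?thesis using d ch by blast
qed

lemma coeff_conf:
  assumes T': "T \<in> \<T>" and \<alpha>: "\<alpha> \<in> mi (verts T) n" and v: "v \<in># \<alpha>"
  shows "(c T \<alpha> - conf_coeff \<T> bd c T \<alpha>)\<^sup>2 \<le> C1 * star_gap v / diameter T"
proof -
  have sz: "size \<alpha> = n" using \<alpha> by (simp add: mi_def)
  have k2: "2 \<le> \<kappa>" and C0: "0 \<le> C0" and h: "0 < diameter T"
    by (rule kappa_ge_2[OF R[OF T']] C0_nonneg[OF T'] diameter_pos[OF R[OF T']])+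
  have kk: "1 \<le> \<kappa>\<^sup>2" using k2 by (simp add: one_le_power)
  define B where "B = sqrt (C0 * ((\<kappa>\<^sup>2) ^ Suc L * (2 * star_gap v)) / diameter T)"
  have B0: "0 \<le> C0 * ((\<kappa>\<^sup>2) ^ Suc L * (2 * star_gap v)) / diameter T"
    using C0 h star_gap_nonneg[of v] by (intro divide_nonneg_pos mult_nonneg_nonneg) auto
  have "\<bar>c T \<alpha> - conf_coeff \<T> bd c T \<alpha>\<bar> \<le> (L + 1) * B"
  proof (cases "\<exists>T' F. (T, T') \<in> (link \<T> \<alpha>)\<^sup>* \<and> F facet_of T' \<and> bd F \<and> set_mset \<alpha> \<subseteq> verts F")
    case True
    \<comment> \<open>The class touches the boundary: at most \<open>L\<close> steps lead to
      \<open>S\<close>, where the coefficient itself is bounded by one more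
      \<open>B\<close>.\<close>
    then obtain S F where S: "(T, S) \<in> (link \<T> \<alpha>)\<^sup>*" "F facet_of S" "bd F" "set_mset \<alpha> \<subseteq> verts F" by blast
    note cl = coeff_class[OF S(1) T' sz v]
    have S': "S \<in> \<T>" using cl by blast
    have hS: "0 < diameter S" by (rule diameter_pos[OF R[OF S']])
    have "(c S \<alpha>)\<^sup>2 \<le> C0 * gap S / diameter S"
      by (rule coeff_boundary[OF S' S(2,3)]) (use S(4) sz in \<open>simp add: mi_def\<close>)
    also have "\<dots> \<le> C0 * star_gap v * (1 / diameter S)"
    proof -
      have "v \<in> verts S" using S(4) v verts_facet_subset[OF T[OF S'] S(2)] by blast
      then have "gap S \<le> star_gap v" using S' by (intro gap_le_star_gap) (simp add: star_def)
      then show ?thesis using C0 hS by (simp add: divide_right_mono mult_left_mono)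
    qed
    also have "\<dots> \<le> C0 * star_gap v * ((\<kappa>\<^sup>2) ^ L / diameter T)"
      using cl h hS C0 star_gap_nonneg[of v] by (intro mult_left_mono) (auto simp: divide_simps mult.commute)
    also have "\<dots> = C0 * ((\<kappa>\<^sup>2) ^ L * star_gap v) / diameter T" by simp
    also have "\<dots> \<le> C0 * ((\<kappa>\<^sup>2) ^ Suc L * (2 * star_gap v)) / diameter T"
      using C0 h kk star_gap_nonneg[of v]
      by (intro divide_right_mono mult_left_mono mult_mono power_increasing) auto
    finally have "\<bar>c S \<alpha>\<bar> \<le> B" unfolding B_def by (rule abs_le_sqrtI)
    moreover have "\<bar>c T \<alpha> - c S \<alpha>\<bar> \<le> L * B" using cl unfolding B_def by blast
    ultimately have "\<bar>c T \<alpha>\<bar> \<le> (L + 1) * B" by (simp add: algebra_simps)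
    moreover have "conf_coeff \<T> bd c T \<alpha> = 0" using True by (simp add: conf_coeff_def)
    ultimately show ?thesis by simp
  next
    case False
    define S where "S = (SOME T'. (T, T') \<in> (link \<T> \<alpha>)\<^sup>*)"
    have "(T, S) \<in> (link \<T> \<alpha>)\<^sup>*" unfolding S_def by (rule someI[of _ T]) simp
    then have "\<bar>c T \<alpha> - c S \<alpha>\<bar> \<le> L * B" using coeff_class[OF _ T' sz v] unfolding B_def by blast
    also have "\<dots> \<le> (L + 1) * B" using B0 by (intro mult_right_mono) (auto simp: B_def)
    finally have "\<bar>c T \<alpha> - c S \<alpha>\<bar> \<le> (L + 1) * B" .
    moreover have "c S \<alpha> = conf_coeff \<T> bd c T \<alpha>"
      unfolding conf_coeff_def S_def by (rule if_not_P[OF False, symmetric])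
    ultimately show ?thesis by simp
  qed
  then have "(c T \<alpha> - conf_coeff \<T> bd c T \<alpha>)\<^sup>2 \<le> ((L + 1) * B)\<^sup>2"
    by (rule abs_le_square_iff[THEN iffD1, OF order_trans[OF _ abs_ge_self]])
  also have "\<dots> = C1 * star_gap v / diameter T"
    using B0 by (simp add: C1_def B_def power_mult_distrib)
  finally show ?thesis .
qed

definition pc :: "(real^3) set \<Rightarrow> real^3 \<Rightarrow> real" where
  "pc T x = (\<Sum>\<alpha>\<in>mi (verts T) n. conf_coeff \<T> bd c T \<alpha> * bmon T \<alpha> x)"

lemma pc_polys: "pc T \<in> polys n"
  unfolding pc_def[abs_def] by (rule bsum_polys)

lemma pc_facet:
  assumes "T \<in> \<T>" "F facet_of T" "x \<in> affine hull (verts F)"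
  shows "pc T x = (\<Sum>\<alpha>\<in>mi (verts F) n. conf_coeff \<T> bd c T \<alpha> * bmon T \<alpha> x)"
proof -
  obtain v where v: "v \<in> verts T" "F = fct T v" by (rule facet_fct[OF R[OF assms(1)] assms(2)])
  have vF: "verts F = verts T - {v}" unfolding v(2) fct_def by (rule verts_facet[OF T[OF assms(1)] v(1)])
  show ?thesis unfolding pc_def vF by (rule bsum_facet[OF R[OF assms(1)] v(1)]) (use assms(3) vF in simp)
qed

text \<open>Multi-indices supported on the facet have equal coefficients because this very facet
  links the elements; the others vanish on its plane. Equality on the whole plane allows
  differentiation along the facet at each of its points.\<close>

lemma pc_conforming:
  assumes "T \<in> \<T>" "T' \<in> \<T>" "F facet_of T" "F facet_of T'" "x \<in> affine hull (verts F)"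
  shows "pc T x = pc T' x"
  unfolding pc_facet[OF assms(1,3,5)] pc_facet[OF assms(2,4,5)]
proof (intro sum.cong refl arg_cong2[where f = "(*)"])
  fix \<alpha> assume "\<alpha> \<in> mi (verts F) n"
  then have \<alpha>: "set_mset \<alpha> \<subseteq> verts F" by (simp add: mi_def)
  show "conf_coeff \<T> bd c T \<alpha> = conf_coeff \<T> bd c T' \<alpha>"
    by (rule conf_coeff_link) (use assms \<alpha> in \<open>auto simp: link_def\<close>)
  show "bmon T \<alpha> x = bmon T' \<alpha> x"
    by (rule bmon_shared[OF T[OF assms(1)] T[OF assms(2)] _ _ \<alpha> assms(5)])
      (rule verts_facet_subset[OF T[OF assms(1)] assms(3)], rule verts_facet_subset[OF T[OF assms(2)] assms(4)])
qed

lemma pc_boundary: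
  assumes "T \<in> \<T>" "F facet_of T" "bd F" "x \<in> affine hull (verts F)"
  shows "pc T x = 0"
  unfolding pc_facet[OF assms(1,2,4)]
  using conf_coeff_boundary[of F T bd, OF assms(2,3)] by (intro sum.neutral) (auto simp: mi_def)

lemma tint_grad_pc:
  assumes T': "T \<in> \<T>"
  shows "tint T (\<lambda>x. grad (\<lambda>x. p T x - pc T x) x \<bullet> grad (\<lambda>x. p T x - pc T x) x)
    \<le> (Nmi n * (n * \<kappa>)\<^sup>2 * Nmi n * C1) * (\<Sum>v\<in>verts T. star_gap v)"
proof -
  let ?d = "\<lambda>\<alpha>. c T \<alpha> - conf_coeff \<T> bd c T \<alpha>"
  let ?E = "\<Sum>v\<in>verts T. star_gap v"
  have h: "0 < diameter T" by (rule diameter_pos[OF R[OF T']])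
  have C1: "0 \<le> C1" using C0_nonneg[OF T'] by (simp add: C1_def)
  have eq: "(\<lambda>x. p T x - pc T x) = (\<lambda>x. \<Sum>\<alpha>\<in>mi (verts T) n. ?d \<alpha> * bmon T \<alpha> x)"
    by (simp add: p[OF T'] pc_def sum_subtractf left_diff_distrib fun_eq_iff)
  have "(\<Sum>\<alpha>\<in>mi (verts T) n. (?d \<alpha>)\<^sup>2) \<le> (\<Sum>\<alpha>\<in>mi (verts T) n. C1 * ?E / diameter T)"
  proof (rule sum_mono)
    fix \<alpha> assume \<alpha>: "\<alpha> \<in> mi (verts T) n"
    \<comment> \<open>Positive degree supplies a vertex whose star carries the estimate.\<close>
    then have "\<alpha> \<noteq> {#}" using n by (auto simp: mi_def)
    then obtain v where v: "v \<in># \<alpha>" by (meson multiset_nonemptyE)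
    then have "v \<in> verts T" using \<alpha> by (auto simp: mi_def)
    then have "star_gap v \<le> ?E"
      using finite_verts[OF T[OF T']] star_gap_nonneg by (intro member_le_sum) auto
    then have "C1 * star_gap v / diameter T \<le> C1 * ?E / diameter T"
      using C1 h by (intro divide_right_mono mult_left_mono) auto
    then show "(?d \<alpha>)\<^sup>2 \<le> C1 * ?E / diameter T" using coeff_conf[OF T' \<alpha> v] by linarith
  qed
  also have "\<dots> = Nmi n * (C1 * ?E / diameter T)"
    by (simp add: card_mi finite_verts card_verts T[OF T'])
  finally have S: "(\<Sum>\<alpha>\<in>mi (verts T) n. (?d \<alpha>)\<^sup>2) \<le> Nmi n * (C1 * ?E / diameter T)" .
  have "tint T (\<lambda>x. grad (\<lambda>x. p T x - pc T x) x \<bullet> grad (\<lambda>x. p T x - pc T x) x)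
     \<le> (Nmi n * (n * \<kappa>)\<^sup>2) * diameter T * (\<Sum>\<alpha>\<in>mi (verts T) n. (?d \<alpha>)\<^sup>2)"
    unfolding eq by (rule tint_grad_bsum_le[OF R[OF T']])
  also have "\<dots> \<le> (Nmi n * (n * \<kappa>)\<^sup>2) * diameter T * (Nmi n * (C1 * ?E / diameter T))"
    using h Nmi_pos[of n] by (intro mult_left_mono S) auto
  also have "\<dots> = (Nmi n * (n * \<kappa>)\<^sup>2 * Nmi n * C1) * ?E" using h by simp
  finally show ?thesis .
qed

text \<open>After exchanging the sums, the star gap of a vertex is counted once per element of its
  star, at most \<open>\<kappa> ^ 3\<close> times; the factor 4 counts the vertices of an
  element.\<close>

lemma sum_star_gap: "(\<Sum>T\<in>\<T>. \<Sum>v\<in>verts T. star_gap v) \<le> 4 * \<kappa> ^ 3 * (\<Sum>T\<in>\<T>. gap T)"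
proof -
  define V where "V = (\<Union>T\<in>\<T>. verts T)"
  have fT: "finite \<T>" using M by (simp add: mesh_def)
  have fV: "finite V" unfolding V_def using fT finite_verts[OF T] by blast
  have sw: "(\<Sum>T\<in>\<T>. \<Sum>v\<in>verts T. f T v) = (\<Sum>v\<in>V. \<Sum>T\<in>star \<T> v. f T v)" for f :: "(real^3) set \<Rightarrow> real^3 \<Rightarrow> real"
  proof -
    have "(\<Sum>T\<in>\<T>. \<Sum>v\<in>verts T. f T v) = (\<Sum>T\<in>\<T>. \<Sum>v | v \<in> V \<and> v \<in> verts T. f T v)"
      by (intro sum.cong refl) (auto simp: V_def)
    also have "\<dots> = (\<Sum>v\<in>V. \<Sum>T | T \<in> \<T> \<and> v \<in> verts T. f T v)"
      by (rule sum.swap_restrict[OF fT fV])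
    finally show ?thesis by (simp add: star_def)
  qed
  have "(\<Sum>T\<in>\<T>. \<Sum>v\<in>verts T. star_gap v) = (\<Sum>v\<in>V. card (star \<T> v) * star_gap v)"
    unfolding sw by simp
  also have "\<dots> \<le> (\<Sum>v\<in>V. \<kappa> ^ 3 * star_gap v)"
    by (intro sum_mono mult_right_mono card_star_le[OF M kappa] star_gap_nonneg)
  also have "\<dots> = \<kappa> ^ 3 * (\<Sum>v\<in>V. \<Sum>T\<in>star \<T> v. gap T)"
    by (simp add: star_gap_def sum_distrib_left)
  also have "(\<Sum>v\<in>V. \<Sum>T\<in>star \<T> v. gap T) = (\<Sum>T\<in>\<T>. \<Sum>v\<in>verts T. gap T)" by (rule sw[symmetric])
  also have "\<dots> = 4 * (\<Sum>T\<in>\<T>. gap T)" by (simp add: card_verts[OF T] sum_distrib_left)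
  finally show ?thesis by (simp add: mult_ac)
qed

lemma sum_tint_grad_pc:
  "(\<Sum>T\<in>\<T>. tint T (\<lambda>x. grad (\<lambda>x. p T x - pc T x) x \<bullet> grad (\<lambda>x. p T x - pc T x) x))
    \<le> (Nmi n * (n * \<kappa>)\<^sup>2 * Nmi n * C1) * (4 * \<kappa> ^ 3) * (\<Sum>T\<in>\<T>. gap T)"
proof (cases "\<T> = {}")
  case False
  then obtain T0 where "T0 \<in> \<T>" by auto
  then have C1: "0 \<le> C1" using C0_nonneg by (simp add: C1_def)
  have "(\<Sum>T\<in>\<T>. tint T (\<lambda>x. grad (\<lambda>x. p T x - pc T x) x \<bullet> grad (\<lambda>x. p T x - pc T x) x))
     \<le> (\<Sum>T\<in>\<T>. (Nmi n * (n * \<kappa>)\<^sup>2 * Nmi n * C1) * (\<Sum>v\<in>verts T. star_gap v))"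
    by (intro sum_mono tint_grad_pc)
  also have "\<dots> = (Nmi n * (n * \<kappa>)\<^sup>2 * Nmi n * C1) * (\<Sum>T\<in>\<T>. \<Sum>v\<in>verts T. star_gap v)"
    by (simp add: sum_distrib_left)
  also have "\<dots> \<le> (Nmi n * (n * \<kappa>)\<^sup>2 * Nmi n * C1) * (4 * \<kappa> ^ 3 * (\<Sum>T\<in>\<T>. gap T))"
    using C1 Nmi_pos[of n] by (intro mult_left_mono sum_star_gap) auto
  finally show ?thesis by (simp add: mult_ac)
qed simp

end

theorem conforming_reconstruction:
  assumes "0 < \<kappa>" "1 \<le> n"
  shows "\<exists>C>0. \<forall>\<T> bd p pF. mesh \<kappa> \<T> \<longrightarrow> (\<forall>T\<in>\<T>. p T \<in> polys n) \<longrightarrow>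
    (\<forall>T\<in>\<T>. \<forall>F. F facet_of T \<longrightarrow> continuous_on F (pF F) \<and> (bd F \<longrightarrow> (\<forall>x\<in>F. pF F x = 0))) \<longrightarrow>
    (\<exists>pc. (\<forall>T\<in>\<T>. pc T \<in> polys n) \<and>
      (\<forall>T\<in>\<T>. \<forall>T'\<in>\<T>. \<forall>F. F facet_of T \<longrightarrow> F facet_of T' \<longrightarrow> (\<forall>x\<in>affine hull (verts F). pc T x = pc T' x)) \<and>
      (\<forall>T\<in>\<T>. \<forall>F. F facet_of T \<longrightarrow> bd F \<longrightarrow> (\<forall>x\<in>affine hull (verts F). pc T x = 0)) \<and>
      (\<Sum>T\<in>\<T>. tint T (\<lambda>x. grad (\<lambda>x. p T x - pc T x) x \<bullet> grad (\<lambda>x. p T x - pc T x) x))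
        \<le> C * (\<Sum>T\<in>\<T>. \<Sum>F | F facet_of T. face_integral F (\<lambda>x. (p T x - pF F x)\<^sup>2) / diameter F))"
proof -
  from face_integral_bsum_ge[of n] obtain \<mu> where \<mu>: "0 < \<mu>"
    "\<And>\<kappa> T c v. reg \<kappa> T \<Longrightarrow> v \<in> verts T \<Longrightarrow>
     \<mu> * ((diameter T)\<^sup>2 / \<kappa> ^ 3) * (\<Sum>\<alpha>\<in>mi (verts T - {v}) n. (c \<alpha>)\<^sup>2) \<le> face_integral (fct T v) (\<lambda>x. (\<Sum>\<alpha>\<in>mi (verts T - {v}) n. c \<alpha> * bmon T \<alpha> x)\<^sup>2)"
    by blast
  \<comment> \<open>The constant of \<open>sum_tint_grad_pc\<close> with the locale constants
    written out, because it has to be fixed before the mesh.\<close>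
  define C where "C = (Nmi n * (n * \<kappa>)\<^sup>2 * Nmi n *
    ((nat \<lceil>\<kappa> ^ 6\<rceil> + 1)\<^sup>2 * ((2 * \<kappa> ^ 3 / \<mu>) * ((\<kappa>\<^sup>2) ^ Suc (nat \<lceil>\<kappa> ^ 6\<rceil>) * 2)))) * (4 * \<kappa> ^ 3)"
  have "0 < real ((nat \<lceil>\<kappa> ^ 6\<rceil> + 1)\<^sup>2)" by (simp only: of_nat_0_less_iff zero_less_power2) simp
  then have "0 < C"
    unfolding C_def
    by (intro mult_pos_pos divide_pos_pos zero_less_power Nmi_pos) (use assms \<mu>(1) in simp_all)
  then show ?thesis
  proof (intro exI[of _ C] conjI allI impI)
    fix \<T> bd and p pF :: "(real^3) set \<Rightarrow> real^3 \<Rightarrow> real"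
    assume M: "mesh \<kappa> \<T>" and p: "\<forall>T\<in>\<T>. p T \<in> polys n"
      and pF: "\<forall>T\<in>\<T>. \<forall>F. F facet_of T \<longrightarrow> continuous_on F (pF F) \<and> (bd F \<longrightarrow> (\<forall>x\<in>F. pF F x = 0))"
    have "\<forall>T\<in>\<T>. \<exists>c. \<forall>x. p T x = (\<Sum>\<alpha>\<in>mi (verts T) n. c \<alpha> * bmon T \<alpha> x)"
      using p M polys_bmon_rep reg_simplex unfolding mesh_def by blast
    then obtain c where c: "\<And>T x. T \<in> \<T> \<Longrightarrow> p T x = (\<Sum>\<alpha>\<in>mi (verts T) n. c T \<alpha> * bmon T \<alpha> x)"
      by metis
    interpret jump_data \<kappa> \<mu> n \<T> bd p pF c
      by unfold_locales (use M \<mu> assms c pF in blast)+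
    show "\<exists>pc. (\<forall>T\<in>\<T>. pc T \<in> polys n) \<and>
      (\<forall>T\<in>\<T>. \<forall>T'\<in>\<T>. \<forall>F. F facet_of T \<longrightarrow> F facet_of T' \<longrightarrow> (\<forall>x\<in>affine hull (verts F). pc T x = pc T' x)) \<and>
      (\<forall>T\<in>\<T>. \<forall>F. F facet_of T \<longrightarrow> bd F \<longrightarrow> (\<forall>x\<in>affine hull (verts F). pc T x = 0)) \<and>
      (\<Sum>T\<in>\<T>. tint T (\<lambda>x. grad (\<lambda>x. p T x - pc T x) x \<bullet> grad (\<lambda>x. p T x - pc T x) x))
        \<le> C * (\<Sum>T\<in>\<T>. \<Sum>F | F facet_of T. face_integral F (\<lambda>x. (p T x - pF F x)\<^sup>2) / diameter F)"
      using pc_polys pc_conforming pc_boundary sum_tint_grad_pc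
      unfolding gap_def C_def C1_def C0_def L_def
      by (intro exI[of _ pc]) blast
  qed
qed

section \<open>Calculus of discrete fields\<close>

lemma partial_add: "f differentiable at x \<Longrightarrow> g differentiable at x \<Longrightarrow>
    partial i (\<lambda>x. f x + g x) x = partial i f x + partial i g x"
  by (simp add: grad_nth[symmetric] grad_add)

lemma partial_mult: "f differentiable at x \<Longrightarrow> g differentiable at x \<Longrightarrow>
    partial i (\<lambda>x. f x * g x) x = f x * partial i g x + g x * partial i f x"
  by (simp add: grad_nth[symmetric] grad_mult)

lemma partial_uminus: "f differentiable at x \<Longrightarrow> partial i (\<lambda>x. - f x) x = - partial i f x"
  by (simp add: grad_nth[symmetric] grad_uminus)

lemma partial_const: "partial i (\<lambda>_. a) x = 0"
  by (simp add: grad_nth[symmetric] grad_const)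

text \<open>Commuting second derivatives are inherited by sums and, through the product rule, by
  products; constants and coordinates generate all polynomials.\<close>

lemma partial_partial_commute:
  assumes "f \<in> polys n" shows "partial i (partial j f) x = partial j (partial i f) x"
proof -
  define H where "H = {f. (\<exists>n. f \<in> polys n) \<and> (\<forall>i j. partial i (partial j f) = partial j (partial i f))}"
  have D: "f differentiable at x" "partial i f differentiable at x" if "f \<in> H" for f i x
    using that differentiable_polys polys_partial unfolding H_def by blast+
  have com: "partial i (partial j f) x = partial j (partial i f) x" if "f \<in> H" for f i j x
    using that unfolding H_def by (auto dest: fun_cong)
  have poly: "\<exists>n. f \<in> polys n" if "f \<in> H" for f using that unfolding H_def by blast
  have const: "(\<lambda>_. a) \<in> H" for a
    unfolding H_def using polys_const by (auto simp: fun_eq_iff partial_const[abs_def])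
  have coord: "(\<lambda>x. x $ k) \<in> H" for k
  proof -
    have "partial i (\<lambda>x. x $ k) = (\<lambda>_. axis k 1 $ i)" for i
      by (rule ext) (simp add: grad_nth[symmetric] grad_coord)
    then have "\<forall>i j. partial i (partial j (\<lambda>x. x $ k)) = partial j (partial i (\<lambda>x. x $ k))"
      by (simp add: partial_const[abs_def])
    then show ?thesis unfolding H_def using polys_coord by blast
  qed
  have mul: "(\<lambda>x. f x * g x) \<in> H" if "f \<in> H" "g \<in> H" for f g
  proof -
    have p: "partial i (\<lambda>x. f x * g x) = (\<lambda>x. f x * partial i g x + g x * partial i f x)" for i
      by (rule ext) (simp add: partial_mult D that)
    have "partial i (partial j (\<lambda>x. f x * g x)) = partial j (partial i (\<lambda>x. f x * g x))" for i j
      unfolding p using that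
      by (intro ext) (simp add: partial_add partial_mult D differentiable_mult com[of _ i j])
    moreover have "\<exists>n. (\<lambda>x. f x * g x) \<in> polys n" using poly[OF that(1)] poly[OF that(2)] polys_mult by blast
    ultimately show ?thesis unfolding H_def by blast
  qed
  have add: "(\<lambda>x. f x + g x) \<in> H" if "f \<in> H" "g \<in> H" for f g
  proof -
    have p: "partial i (\<lambda>x. f x + g x) = (\<lambda>x. partial i f x + partial i g x)" for i
      by (rule ext) (simp add: partial_add D that)
    have "partial i (partial j (\<lambda>x. f x + g x)) = partial j (partial i (\<lambda>x. f x + g x))" for i j
      unfolding p using that by (intro ext) (simp add: partial_add D com[of _ i j])
    moreover from poly[OF that(1)] poly[OF that(2)] obtain n1 n2 where "f \<in> polys n1" "g \<in> polys n2" by blast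
    then have "(\<lambda>x. f x + g x) \<in> polys (max n1 n2)"
      using polys_mono[of n1 "max n1 n2"] polys_mono[of n2 "max n1 n2"] by (intro polys_add) auto
    ultimately show ?thesis unfolding H_def by blast
  qed
  have pow: "(\<lambda>x. x $ k ^ e) \<in> H" for k e
    by (induction e) (auto intro: const mul coord)
  have prod: "(\<lambda>x. \<Prod>k\<in>A. x $ k ^ \<alpha> k) \<in> H" for A and \<alpha> :: "3 \<Rightarrow> nat"
    by (induction A rule: infinite_finite_induct) (auto intro: const mul pow)
  from assms have "f \<in> H"
    by (induction rule: polys_induct) (auto intro: const add mul prod)
  then show ?thesis by (rule com)
qed

lemma curl_grad:
  assumes "f \<in> polys n" shows "curl (\<lambda>x. - grad f x) x = 0"
proof -
  have "partial i (\<lambda>y. (- grad f y) $ j) x = - partial i (partial j f) x" for i j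
    using partial_uminus[OF differentiable_polys[OF polys_partial[OF assms]]] by (simp add: grad_nth)
  then show ?thesis
    using partial_partial_commute[OF assms]
    by (simp add: curl_def vec_eq_iff forall_3)
qed

lemma curl_uminus:
  assumes "f \<in> vpolys n" shows "curl (\<lambda>x. - f x) x = - curl f x"
  using differentiable_polys[OF vpolysD[OF assms]]
  by (simp add: curl_def vec_eq_iff forall_3 partial_uminus)

lemma divergence_uminus:
  assumes "f \<in> vpolys n" shows "divergence (\<lambda>x. - f x) x = - divergence f x"
  using differentiable_polys[OF vpolysD[OF assms]]
  by (simp add: divergence_def partial_uminus sum_negf)

lemma curl_zero: "curl (\<lambda>_. 0) x = 0"
  by (simp add: curl_def vec_eq_iff forall_3 partial_const)

lemma divergence_zero: "divergence (\<lambda>_. 0) x = 0"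
  by (simp add: divergence_def partial_const)

lemma divergence_sq_le: "(divergence v x)\<^sup>2 \<le> 3 * (\<Sum>i\<in>UNIV. grad (\<lambda>y. v y $ i) x \<bullet> grad (\<lambda>y. v y $ i) x)"
proof -
  have "(divergence v x)\<^sup>2 \<le> (\<Sum>i\<in>UNIV. (partial i (\<lambda>y. v y $ i) x)\<^sup>2) * card (UNIV :: 3 set)"
    unfolding divergence_def by (rule sum_squared_le_sum_of_squares)
  also have "\<dots> = 3 * (\<Sum>i\<in>UNIV. (grad (\<lambda>y. v y $ i) x $ i)\<^sup>2)" by (simp add: grad_nth)
  also have "\<dots> \<le> 3 * (\<Sum>i\<in>UNIV. grad (\<lambda>y. v y $ i) x \<bullet> grad (\<lambda>y. v y $ i) x)"
  proof (intro mult_left_mono sum_mono)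
    fix i
    show "(grad (\<lambda>y. v y $ i) x $ i)\<^sup>2 \<le> grad (\<lambda>y. v y $ i) x \<bullet> grad (\<lambda>y. v y $ i) x"
      unfolding power2_norm_eq_inner[symmetric] by (metis component_le_norm_cart power2_abs power_mono abs_ge_zero)
  qed simp
  finally show ?thesis .
qed

lemma cross3_parallel: "cross3 n (a *\<^sub>R n) = 0"
  by (simp add: cross_mult_right)

text \<open>Along every line in the plane of the facet \<open>w\<close> is 0, so its gradient is
  orthogonal to the edges of the facet and therefore normal. Assuming zeros on the whole plane also
  covers points on the relative boundary of \<open>F\<close>.\<close>

lemma cross3_grad_vanishing:
  assumes T: "3 simplex T" and F: "F facet_of T" and w: "w \<in> polys j"
    and zero: "\<And>x. x \<in> affine hull (verts F) \<Longrightarrow> w x = 0" and x: "x \<in> F"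
  shows "cross3 (outward_normal T F) (grad w x) = 0"
proof -
  obtain v where v: "v \<in> verts T" "F = convex hull (verts T - {v})" "verts F = verts T - {v}"
    by (rule facetE[OF T F])
  have xa: "x \<in> affine hull (verts F)"
    using x unfolding v(3) by (subst (asm) v(2)) (rule subsetD[OF convex_hull_subset_affine_hull])
  have "card (verts F) = 3" using v(1,3) card_verts[OF T] finite_verts[OF T] by simp
  then obtain a where a: "a \<in> verts F" by fastforce
  have "grad w x \<bullet> (b - a) = 0" if b: "b \<in> verts F" for b
  proof -
    have "x + t *\<^sub>R (b - a) \<in> affine hull (verts F)" for t
      using mem_affine_3_minus[OF affine_affine_hull xa hull_inc[OF b] hull_inc[OF a]] .
    then have z: "w (x + t *\<^sub>R (b - a)) = 0" for t by (rule zero)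
    have "((\<lambda>t. x + t *\<^sub>R (b - a)) has_derivative (\<lambda>h. h *\<^sub>R (b - a))) (at 0)"
      by (auto intro!: derivative_eq_intros)
    moreover have "(w has_derivative (\<lambda>h. grad w x \<bullet> h)) (at (x + 0 *\<^sub>R (b - a)))"
      using has_derivative_grad[OF differentiable_polys[OF w]] by simp
    ultimately have "((\<lambda>t. w (x + t *\<^sub>R (b - a))) has_derivative (\<lambda>h. grad w x \<bullet> (h *\<^sub>R (b - a)))) (at 0)"
      by (rule has_derivative_compose)
    then have "((\<lambda>t::real. 0::real) has_derivative (\<lambda>h. grad w x \<bullet> (h *\<^sub>R (b - a)))) (at 0)"
      by (simp add: z)
    then have "(\<lambda>h. grad w x \<bullet> (h *\<^sub>R (b - a))) = (\<lambda>h::real. 0)"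
      by (rule has_derivative_unique) simp
    from fun_cong[OF this, of 1] show ?thesis by simp
  qed
  then have "grad w x = (grad w x \<bullet> (v - a)) *\<^sub>R bgrad T v"
    by (intro orthogonal_facet_parallel[OF T v(1)]) (use a v(3) in auto)
  also have "bgrad T v = (- norm (bgrad T v)) *\<^sub>R outward_normal T F"
    unfolding outward_normal_eq[OF T v(1,2)] using bgrad_nonzero[OF T v(1)] by simp
  finally show ?thesis by (metis cross3_parallel scaleR_scaleR)
qed

section \<open>The discrete problem on a mesh\<close>

locale hdg =
  fixes \<Omega> :: "(real^3) set" and \<kappa> k :: real and l m :: nat and \<T> :: "(real^3) set set"
  assumes sm: "simplicial_mesh \<Omega> \<T>" and sr: "shape_regular \<kappa> \<T>" and lip: "lipschitz_domain \<Omega>"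
    and ne: "\<Omega> \<noteq> {}" and l: "1 \<le> l" and m: "m \<in> {l - 1, l}" and k: "0 < k"
begin

lemma M: "mesh \<kappa> \<T>"
proof -
  have "reg \<kappa> T" if "T \<in> \<T>" for T
    using sm sr that by (auto simp: reg_def simplicial_mesh_def shape_regular_def)
  then show ?thesis using sm by (auto simp: mesh_def simplicial_mesh_def triangulation_def)
qed

lemma R: "T \<in> \<T> \<Longrightarrow> reg \<kappa> T"
  using M by (simp add: mesh_def)

lemma T: "T \<in> \<T> \<Longrightarrow> 3 simplex T"
  by (rule reg_simplex[OF R])

lemma fin: "finite \<T>" using M by (simp add: mesh_def)

lemma nonempty: "\<T> \<noteq> {}"
  using sm ne closure_subset[of \<Omega>] by (auto simp: simplicial_mesh_def)

lemma kappa: "2 \<le> \<kappa>"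
  using nonempty kappa_ge_2[OF R] by blast

text \<open>Element boundaries as a disjoint union: an interior face occurs once for each element
  that it bounds.\<close>

definition BF :: "((real^3) set \<times> (real^3) set) set" where
  "BF = Sigma \<T> (\<lambda>T. {F. F facet_of T})"

sublocale V: inner_family \<T> "\<lambda>T. T" tint
  by unfold_locales (rule pos_lin_tint[OF T])

sublocale S: inner_family BF snd "\<lambda>i. face_integral (snd i)"
  by unfold_locales (auto simp: BF_def intro: pos_lin_facet[OF T])

lemma L2_fi: "L2_inner \<T> f g = V.fi f g"
  by (simp add: L2_inner_def V.fi_def tint_def)

lemma bd_fi: "bdry_inner \<T> f g = S.fi (\<lambda>i. f (fst i) (snd i)) (\<lambda>i. g (fst i) (snd i))"
  unfolding bdry_inner_def S.fi_def
  by (subst sum.Sigma) (auto simp: BF_def fin finite_facets[OF T] case_prod_unfold)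

definition cV :: "('b::real_inner) family \<Rightarrow> bool" where
  "cV f \<longleftrightarrow> (\<forall>T\<in>\<T>. continuous_on T (f T))"

definition cB :: "((real^3) set \<Rightarrow> ('b::real_inner) family) \<Rightarrow> bool" where
  "cB f \<longleftrightarrow> (\<forall>T\<in>\<T>. \<forall>F. F facet_of T \<longrightarrow> continuous_on F (f T F))"

lemma cf_V: "V.cf f = cV f"
  by (simp add: V.cf_def cV_def)

lemma cf_S: "S.cf (\<lambda>i. f (fst i) (snd i)) = cB f"
  unfolding S.cf_def cB_def by (auto simp: BF_def)

lemma L2_commute: "L2_inner \<T> f g = L2_inner \<T> g f"
  unfolding L2_fi by (rule V.fi_commute)

lemma bd_commute: "bdry_inner \<T> f g = bdry_inner \<T> g f"
  unfolding bd_fi by (rule S.fi_commute)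

lemma L2_cong:
  "(\<And>T x. T \<in> \<T> \<Longrightarrow> x \<in> T \<Longrightarrow> f T x = f' T x) \<Longrightarrow> (\<And>T x. T \<in> \<T> \<Longrightarrow> x \<in> T \<Longrightarrow> g T x = g' T x) \<Longrightarrow>
     L2_inner \<T> f g = L2_inner \<T> f' g'"
  unfolding L2_fi by (rule V.fi_cong)

lemma L2_uminus: "cV f \<Longrightarrow> cV g \<Longrightarrow> L2_inner \<T> (\<lambda>T x. - f T x) g = - L2_inner \<T> f g"
  unfolding L2_fi cf_V[symmetric] by (rule V.fi_uminus)

lemma L2_uminus_right: "cV f \<Longrightarrow> cV g \<Longrightarrow> L2_inner \<T> f (\<lambda>T x. - g T x) = - L2_inner \<T> f g"
  unfolding L2_fi cf_V[symmetric] by (rule V.fi_uminus_right)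

lemma bd_uminus: "cB f \<Longrightarrow> cB g \<Longrightarrow> bdry_inner \<T> (\<lambda>T F x. - f T F x) g = - bdry_inner \<T> f g"
  unfolding bd_fi cf_S[symmetric] by (rule S.fi_uminus)

lemma bd_uminus_right: "cB f \<Longrightarrow> cB g \<Longrightarrow> bdry_inner \<T> f (\<lambda>T F x. - g T F x) = - bdry_inner \<T> f g"
  unfolding bd_fi cf_S[symmetric] by (rule S.fi_uminus_right)

lemma L2_diff: "cV f \<Longrightarrow> cV f' \<Longrightarrow> cV g \<Longrightarrow> L2_inner \<T> (\<lambda>T x. f T x - f' T x) g = L2_inner \<T> f g - L2_inner \<T> f' g"
  unfolding L2_fi cf_V[symmetric] by (rule V.fi_diff)

lemma bd_diff_right: "cB f \<Longrightarrow> cB f' \<Longrightarrow> cB g \<Longrightarrow>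
    bdry_inner \<T> g (\<lambda>T F x. f T F x - f' T F x) = bdry_inner \<T> g f - bdry_inner \<T> g f'"
  unfolding bd_fi cf_S[symmetric] by (rule S.fi_diff_right)

lemma L2_nonneg: "cV f \<Longrightarrow> 0 \<le> L2_sq \<T> f"
  unfolding L2_fi cf_V[symmetric] by (rule V.fi_nonneg)

lemma bd_nonneg: "cB f \<Longrightarrow> 0 \<le> bdry_sq \<T> f"
  unfolding bd_fi cf_S[symmetric] by (rule S.fi_nonneg)

lemma L2_abs_le: "cV f \<Longrightarrow> cV g \<Longrightarrow> \<bar>L2_inner \<T> f g\<bar> \<le> sqrt (L2_sq \<T> f) * sqrt (L2_sq \<T> g)"
  unfolding L2_fi cf_V[symmetric] by (rule V.fi_abs_le)

lemma bd_abs_le: "cB f \<Longrightarrow> cB g \<Longrightarrow> \<bar>bdry_inner \<T> f g\<bar> \<le> sqrt (bdry_sq \<T> f) * sqrt (bdry_sq \<T> g)"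
  unfolding bd_fi cf_S[symmetric] by (rule S.fi_abs_le)

lemma L2_add_le: "cV f \<Longrightarrow> cV g \<Longrightarrow>
    L2_sq \<T> (\<lambda>T x. f T x + g T x) \<le> 2 * L2_sq \<T> f + 2 * L2_sq \<T> g"
  unfolding L2_fi cf_V[symmetric] by (rule V.fi_add_le)

lemma bd_add_le: "cB f \<Longrightarrow> cB g \<Longrightarrow>
    bdry_sq \<T> (\<lambda>T F x. f T F x + g T F x) \<le> 2 * bdry_sq \<T> f + 2 * bdry_sq \<T> g"
  unfolding bd_fi cf_S[symmetric] by (rule S.fi_add_le)

lemma bd_le:
  fixes f :: "(real^3) set \<Rightarrow> ('b::real_inner) family" and g :: "(real^3) set \<Rightarrow> ('c::real_inner) family"
  shows "cB f \<Longrightarrow> cB g \<Longrightarrow>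
   (\<And>T F x. T \<in> \<T> \<Longrightarrow> F facet_of T \<Longrightarrow> x \<in> F \<Longrightarrow> f T F x \<bullet> f T F x \<le> g T F x \<bullet> g T F x) \<Longrightarrow> bdry_sq \<T> f \<le> bdry_sq \<T> g"
  unfolding bd_fi cf_S[symmetric] by (rule S.fi_le_fi) (auto simp: BF_def)

lemma L2_zero_left: "(\<And>T x. T \<in> \<T> \<Longrightarrow> x \<in> T \<Longrightarrow> f T x = 0) \<Longrightarrow> L2_inner \<T> f g = 0"
  unfolding L2_fi by (rule V.fi_zero_left)

lemma L2_zero_right: "(\<And>T x. T \<in> \<T> \<Longrightarrow> x \<in> T \<Longrightarrow> g T x = 0) \<Longrightarrow> L2_inner \<T> f g = 0"
  unfolding L2_fi by (rule V.fi_zero_right)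

lemma bd_zero_left: "(\<And>T F x. T \<in> \<T> \<Longrightarrow> F facet_of T \<Longrightarrow> x \<in> F \<Longrightarrow> f T F x = 0) \<Longrightarrow> bdry_inner \<T> f g = 0"
  unfolding bd_fi by (rule S.fi_zero_left) (auto simp: BF_def)

lemma bd_zero_right: "(\<And>T F x. T \<in> \<T> \<Longrightarrow> F facet_of T \<Longrightarrow> x \<in> F \<Longrightarrow> g T F x = 0) \<Longrightarrow> bdry_inner \<T> f g = 0"
  unfolding bd_fi by (rule S.fi_zero_right) (auto simp: BF_def)

text \<open>The weight \<open>W\<close> turns the face terms of form and norm into plain inner
  products; \<open>W'\<close> carries the inverse weight and is its partner in
  Cauchy-Schwarz.\<close>

definition W :: "((real^3) set \<Rightarrow> ('b::real_inner) family) \<Rightarrow> (real^3) set \<Rightarrow> 'b family" where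
  "W f T F x = inverse (sqrt (diameter F)) *\<^sub>R f T F x"

definition W' :: "((real^3) set \<Rightarrow> ('b::real_inner) family) \<Rightarrow> (real^3) set \<Rightarrow> 'b family" where
  "W' f T F x = sqrt (diameter F) *\<^sub>R f T F x"

lemma cB_W: "cB f \<Longrightarrow> cB (W f)"
  by (auto simp: cB_def W_def[abs_def] intro!: continuous_intros)

lemma cB_W': "cB f \<Longrightarrow> cB (W' f)"
  by (auto simp: cB_def W'_def[abs_def] intro!: continuous_intros)

lemma W_uminus: "W (\<lambda>T F x. - f T F x) = (\<lambda>T F x. - W f T F x)"
  by (auto simp: W_def fun_eq_iff)

lemma facet_pos: "T \<in> \<T> \<Longrightarrow> F facet_of T \<Longrightarrow> 0 < diameter F"
  by (rule diameter_facet(3)[OF R])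

lemma bd_inverse_W:
  "bdry_inner \<T> (\<lambda>T F x. inverse (diameter F) *\<^sub>R f T F x) g = bdry_inner \<T> (W f) (W g)"
  unfolding bd_fi S.fi_def
proof (intro sum.cong refl pos_lin_cong[OF S.pl])
  fix i x assume "i \<in> BF"
  then have "0 < diameter (snd i)" using facet_pos by (auto simp: BF_def)
  then have "inverse (sqrt (diameter (snd i))) * inverse (sqrt (diameter (snd i))) = inverse (diameter (snd i))"
    by (simp flip: inverse_mult_distrib)
  then show "inverse (diameter (snd i)) *\<^sub>R f (fst i) (snd i) x \<bullet> g (fst i) (snd i) x = W f (fst i) (snd i) x \<bullet> W g (fst i) (snd i) x"
    by (simp add: W_def mult.assoc[symmetric])
qed

lemma bd_W_W': "bdry_inner \<T> f g = bdry_inner \<T> (W f) (W' g)"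
  unfolding bd_fi S.fi_def
proof (intro sum.cong refl pos_lin_cong[OF S.pl])
  fix i x assume "i \<in> BF"
  then have "0 < diameter (snd i)" using facet_pos by (auto simp: BF_def)
  then show "f (fst i) (snd i) x \<bullet> g (fst i) (snd i) x = W f (fst i) (snd i) x \<bullet> W' g (fst i) (snd i) x"
    by (simp add: W_def W'_def)
qed

lemma cV_vbroken: "f \<in> broken_space (vpolys j) \<T> \<Longrightarrow> cV f"
  by (auto simp: cV_def broken_space_def intro: continuous_on_vpolys)

lemma cB_broken: "f \<in> broken_space (polys j) \<T> \<Longrightarrow> cB (\<lambda>T F. f T)"
  by (auto simp: cB_def broken_space_def intro: continuous_on_polys)

lemma cB_vbroken: "f \<in> broken_space (vpolys j) \<T> \<Longrightarrow> cB (\<lambda>T F. f T)"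
  by (auto simp: cB_def broken_space_def intro: continuous_on_vpolys)

lemma mesh_facesI: "T \<in> \<T> \<Longrightarrow> F facet_of T \<Longrightarrow> F \<in> mesh_faces \<T>"
  by (auto simp: mesh_faces_def)

lemma cB_skeleton:
  assumes w: "w \<in> skeleton_space P \<T>" and P: "\<And>g S. g \<in> P \<Longrightarrow> continuous_on S g"
  shows "cB (\<lambda>T F. w F)"
  unfolding cB_def
proof (intro ballI allI impI)
  fix T F assume "T \<in> \<T>" "F facet_of T"
  then have "F \<in> mesh_faces \<T>" by (rule mesh_facesI)
  then obtain g where "g \<in> P" "w F = (\<lambda>x. if x \<in> F then g x else 0)"
    using w by (auto simp: skeleton_space_def)
  then show "continuous_on F (w F)" using P[of g F] by (simp cong: continuous_on_cong)
qed

lemma cB_gap: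
  assumes "cB (\<lambda>T F. u T)" "cB (\<lambda>T F. uF F)" shows "cB (tangential_gap u uF)"
  using assms unfolding cB_def by (auto intro!: continuous_on_cross continuous_intros)

lemma cB_diff: "cB f \<Longrightarrow> cB g \<Longrightarrow> cB (\<lambda>T F x. f T F x - g T F x)"
  by (auto simp: cB_def intro!: continuous_intros)

lemma cB_normal: "cB (\<lambda>T F. u T) \<Longrightarrow> cB (\<lambda>T F x. outward_normal T F \<bullet> u T x)"
  by (auto simp: cB_def intro!: continuous_intros)

lemma cV_curl: "u \<in> broken_space (vpolys j) \<T> \<Longrightarrow> cV (\<lambda>T. curl (u T))"
  by (auto simp: cV_def broken_space_def intro!: continuous_on_vpolys vpolys_curl)

lemma cV_grad: "p \<in> broken_space (polys j) \<T> \<Longrightarrow> cV (\<lambda>T. grad (p T))"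
  by (auto simp: cV_def broken_space_def intro!: continuous_on_vpolys vpolys_grad)

lemma cV_div: "u \<in> broken_space (vpolys j) \<T> \<Longrightarrow> cV (\<lambda>T x. diameter T * divergence (u T) x)"
  by (auto simp: cV_def broken_space_def intro!: continuous_on_polys[OF polys_cmult[OF polys_divergence]])

section \<open>Continuity and symmetry of the bilinear form\<close>

lemma B_plus_eq:
  "B_plus k \<T> (r, u, uF, p, pF) (s, v, vF, q, qF) =
       L2_inner \<T> r s
     - L2_inner \<T> (\<lambda>T. curl (u T)) s
     + bdry_inner \<T> (tangential_gap u uF) (\<lambda>T F. s T)
     - L2_inner \<T> (\<lambda>T. curl (v T)) r
     + bdry_inner \<T> (tangential_gap v vF) (\<lambda>T F. r T)
     - (k\<^sup>2 + 1) * (L2_inner \<T> v (\<lambda>T. grad (p T))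
         - bdry_inner \<T> (\<lambda>T F x. outward_normal T F \<bullet> v T x) (\<lambda>T F x. p T x - pF F x))
     - (k\<^sup>2 + 1) * (L2_inner \<T> u (\<lambda>T. grad (q T))
         - bdry_inner \<T> (\<lambda>T F x. outward_normal T F \<bullet> u T x) (\<lambda>T F x. q T x - qF F x))
     - k\<^sup>2 * L2_inner \<T> u v
     - bdry_inner \<T> (W (tangential_gap u uF)) (W (tangential_gap v vF))
     + (k\<^sup>2 + 1) * bdry_inner \<T> (W (\<lambda>T F x. p T x - pF F x)) (W (\<lambda>T F x. q T x - qF F x))"
  unfolding B_plus_def using bd_inverse_W[of "\<lambda>T F x. p T x - pF F x"] by (simp add: bd_inverse_W)

text \<open>The unsymmetric terms come in pairs that are interchanged with the arguments; the
  remaining ones are inner products.\<close>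

lemma B_plus_commute: "B_plus k \<T> \<sigma> \<tau> = B_plus k \<T> \<tau> \<sigma>"
proof -
  obtain r u uF p pF where \<sigma>: "\<sigma> = (r, u, uF, p, pF)" by (metis prod_cases5)
  obtain s v vF q qF where \<tau>: "\<tau> = (s, v, vF, q, qF)" by (metis prod_cases5)
  show ?thesis
    unfolding \<sigma> \<tau> B_plus_eq
    using L2_commute[of r s] L2_commute[of u v]
      bd_commute[of "W (tangential_gap u uF)" "W (tangential_gap v vF)"]
      bd_commute[of "W (\<lambda>T F x. p T x - pF F x)" "W (\<lambda>T F x. q T x - qF F x)"]
    by simp
qed

definition Jsq :: "(real^3) family \<Rightarrow> real" where
  "Jsq v = (\<Sum>F\<in>interior_faces \<T>. face_integral F (\<lambda>x. (sqrt (diameter F) * normal_jump \<T> v F x)\<^sup>2))"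

definition Dsq :: "(real^3) family \<Rightarrow> real" where
  "Dsq v = L2_sq \<T> (\<lambda>T x. diameter T * divergence (v T) x)"

lemma Sigma_norm_eq:
  "Sigma_norm k \<T> (s, v, vF, q, qF) = sqrt (
       L2_sq \<T> s + L2_sq \<T> (\<lambda>T. curl (v T)) + bdry_sq \<T> (W (tangential_gap v vF)) + k\<^sup>2 * L2_sq \<T> v
     + (k\<^sup>2 + 1) * (Dsq v + Jsq v + L2_sq \<T> (\<lambda>T. grad (q T)) + bdry_sq \<T> (W (\<lambda>T F x. q T x - qF F x))))"
proof -
  have "(\<lambda>T F x. inverse (sqrt (diameter F)) * (q T x - qF F x)) = W (\<lambda>T F x. q T x - qF F x)"
    "(\<lambda>T F x. inverse (sqrt (diameter F)) *\<^sub>R tangential_gap v vF T F x) = W (tangential_gap v vF)"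
    by (auto simp: W_def fun_eq_iff)
  then show ?thesis by (simp add: Sigma_norm_def Dsq_def Jsq_def)
qed

end

section \<open>Interior faces, admissible functions and the sign change test\<close>

context hdg
begin

lemma Sigma_hD:
  assumes "(r, u, uF, p, pF) \<in> Sigma_h l m \<Omega> \<T>"
  shows "r \<in> broken_space (vpolys m) \<T>" "u \<in> broken_space (vpolys l) \<T>" "uF \<in> Uhat_space l \<Omega> \<T>"
    "p \<in> broken_space (polys (l + 1)) \<T>" "pF \<in> Mhat_space l \<Omega> \<T>"
  using assms by (auto simp: Sigma_h_def)

lemma Sigma_h_cont:
  assumes "(r, u, uF, p, pF) \<in> Sigma_h l m \<Omega> \<T>"
  shows "cV r" "cB (\<lambda>T F. r T)" "cV u" "cB (\<lambda>T F. u T)" "cV (\<lambda>T. curl (u T))" "cB (tangential_gap u uF)"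
    "cV (\<lambda>T. grad (p T))" "cB (\<lambda>T F. p T)" "cB (\<lambda>T F. pF F)" "cB (\<lambda>T F x. p T x - pF F x)"
    "cB (\<lambda>T F x. outward_normal T F \<bullet> u T x)" "cV (\<lambda>T x. diameter T * divergence (u T) x)"
proof -
  note D = Sigma_hD[OF assms]
  show "cV r" "cB (\<lambda>T F. r T)" using D(1) by (rule cV_vbroken cB_vbroken)+
  show "cV u" and u: "cB (\<lambda>T F. u T)" using D(2) by (rule cV_vbroken cB_vbroken)+
  show "cV (\<lambda>T. curl (u T))" by (rule cV_curl[OF D(2)])
  have "cB (\<lambda>T F. uF F)"
    using D(3) by (intro cB_skeleton[of uF "vpolys l"]) (auto simp: Uhat_space_def intro: continuous_on_vpolys)
  then show "cB (tangential_gap u uF)" by (rule cB_gap[OF u])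
  show "cV (\<lambda>T. grad (p T))" by (rule cV_grad[OF D(4)])
  show p: "cB (\<lambda>T F. p T)" by (rule cB_broken[OF D(4)])
  show pF: "cB (\<lambda>T F. pF F)"
    using D(5) by (intro cB_skeleton[of pF "polys (l + 1)"]) (auto simp: Mhat_space_def intro: continuous_on_polys)
  show "cB (\<lambda>T F x. p T x - pF F x)" by (rule cB_diff[OF p pF])
  show "cB (\<lambda>T F x. outward_normal T F \<bullet> u T x)" by (rule cB_normal[OF u])
  show "cV (\<lambda>T x. diameter T * divergence (u T) x)" by (rule cV_div[OF D(2)])
qed

lemma faces: "S \<in> \<T> \<Longrightarrow> S' \<in> \<T> \<Longrightarrow> S \<inter> S' face_of S \<and> S \<inter> S' face_of S'"
  by (rule mesh_faces_of[OF M])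

lemma normal_opposite:
  assumes "S \<in> \<T>" "S' \<in> \<T>" "S \<noteq> S'" "F facet_of S" "F facet_of S'"
  shows "outward_normal S' F = - outward_normal S F"
  by (rule outward_normal_neighbour[OF T[OF assms(1)] T[OF assms(2)] assms(3-5)
        conjunct1[OF faces[OF assms(1,2)]] conjunct2[OF faces[OF assms(1,2)]]])

text \<open>A third element at the face would have a normal opposite to two vectors that are already
  opposite to each other. The pair is the one selected inside \<open>normal_jump\<close>, which
  gives an explicit formula for the jump.\<close>

lemma interior_face_pair:
  assumes "F \<in> interior_faces \<T>"
  obtains S S' where "S \<in> \<T>" "S' \<in> \<T>" "S \<noteq> S'" "F facet_of S" "F facet_of S'"
    "\<And>v x. normal_jump \<T> v F x = outward_normal S F \<bullet> (v S x - v S' x)"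
    "{S \<in> \<T>. F facet_of S} = {S, S'}" "outward_normal S' F = - outward_normal S F"
proof -
  let ?P = "\<lambda>(S, S'). S \<in> \<T> \<and> S' \<in> \<T> \<and> S \<noteq> S' \<and> F facet_of S \<and> F facet_of S'"
  obtain S S' where SS: "(SOME p. ?P p) = (S, S')" by (rule prod.exhaust)
  have "\<exists>p. ?P p" using assms by (auto simp: interior_faces_def)
  then have "?P (SOME p. ?P p)" by (rule someI_ex)
  then have P: "S \<in> \<T>" "S' \<in> \<T>" "S \<noteq> S'" "F facet_of S" "F facet_of S'" unfolding SS by auto
  have J: "normal_jump \<T> v F x = outward_normal S F \<bullet> (v S x - v S' x)" for v x
    unfolding normal_jump_def SS by simp
  have opp: "outward_normal S' F = - outward_normal S F" by (rule normal_opposite[OF P])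
  have "S'' \<in> {S, S'}" if "S'' \<in> \<T>" "F facet_of S''" for S''
  proof (rule ccontr)
    assume n: "S'' \<notin> {S, S'}"
    have "outward_normal S'' F = - outward_normal S F" "outward_normal S'' F = - outward_normal S' F"
      using normal_opposite[OF P(1) that(1) _ P(4) that(2)] normal_opposite[OF P(2) that(1) _ P(5) that(2)] n by auto
    then have "outward_normal S F = - outward_normal S F" using opp by simp
    then have "outward_normal S F \<bullet> outward_normal S F = - (outward_normal S F \<bullet> outward_normal S F)"
      by (metis inner_minus_left)
    then show False using norm_outward_normal[OF T[OF P(1)] P(4)] by (simp add: dot_square_norm)
  qed
  then have "{S \<in> \<T>. F facet_of S} = {S, S'}" using P by auto
  from that[OF P J this opp] show ?thesis .
qed

lemma finite_mesh_faces: "finite (mesh_faces \<T>)"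
proof -
  have "mesh_faces \<T> = (\<Union>T\<in>\<T>. {F. F facet_of T})" by (auto simp: mesh_faces_def)
  then show ?thesis using fin finite_facets[OF T] by simp
qed

lemma interior_subset_mesh: "interior_faces \<T> \<subseteq> mesh_faces \<T>"
  by (auto simp: interior_faces_def mesh_faces_def)

lemma sum_element_faces:
  "(\<Sum>T\<in>\<T>. \<Sum>F | F facet_of T. g T F) = (\<Sum>F\<in>mesh_faces \<T>. \<Sum>T | T \<in> \<T> \<and> F facet_of T. g T F)"
  for g :: "(real^3) set \<Rightarrow> (real^3) set \<Rightarrow> real"
proof -
  have "(\<Sum>T\<in>\<T>. \<Sum>F | F facet_of T. g T F) = (\<Sum>T\<in>\<T>. \<Sum>F | F \<in> mesh_faces \<T> \<and> F facet_of T. g T F)"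
    by (intro sum.cong refl) (auto simp: mesh_faces_def)
  also have "\<dots> = (\<Sum>F\<in>mesh_faces \<T>. \<Sum>T | T \<in> \<T> \<and> F facet_of T. g T F)"
    by (rule sum.swap_restrict[OF fin finite_mesh_faces])
  finally show ?thesis .
qed

lemma sum_interior_faces:
  fixes g :: "(real^3) set \<Rightarrow> (real^3) set \<Rightarrow> real"
  assumes "\<And>T F. T \<in> \<T> \<Longrightarrow> F facet_of T \<Longrightarrow> F \<notin> interior_faces \<T> \<Longrightarrow> g T F = 0"
  shows "(\<Sum>T\<in>\<T>. \<Sum>F | F facet_of T. g T F) = (\<Sum>F\<in>interior_faces \<T>. \<Sum>T | T \<in> \<T> \<and> F facet_of T. g T F)"
  unfolding sum_element_faces using assms
  by (intro sum.mono_neutral_right finite_mesh_faces interior_subset_mesh) (auto intro!: sum.neutral)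

lemma pos_lin_interior: 
  assumes "F \<in> interior_faces \<T>" shows "pos_lin F (face_integral F)"
proof -
  from assms obtain S where "S \<in> \<T>" "F facet_of S" by (auto simp: interior_faces_def)
  then show ?thesis using pos_lin_facet[OF T] by blast
qed

lemma cont_jump:
  assumes "cB (\<lambda>T F. v T)" "F \<in> interior_faces \<T>" shows "continuous_on F (normal_jump \<T> v F)"
proof (rule interior_face_pair[OF assms(2)])
  fix S S'
  assume P: "S \<in> \<T>" "S' \<in> \<T>" "F facet_of S" "F facet_of S'"
    and J: "\<And>v x. normal_jump \<T> v F x = outward_normal S F \<bullet> (v S x - v S' x)"
  have "normal_jump \<T> v F = (\<lambda>x. outward_normal S F \<bullet> (v S x - v S' x))" by (rule ext) (rule J)
  then show ?thesis using assms(1) P by (auto simp: cB_def intro!: continuous_intros)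
qed

lemma Jsq_nonneg:
  assumes "cB (\<lambda>T F. v T)" shows "0 \<le> Jsq v"
  unfolding Jsq_def
  by (intro sum_nonneg pos_lin_nonneg[OF pos_lin_interior] continuous_intros cont_jump[OF assms]) auto

lemma Sigma_norm_sq:
  assumes "(s, v, vF, q, qF) \<in> Sigma_h l m \<Omega> \<T>"
  shows "(Sigma_norm k \<T> (s, v, vF, q, qF))\<^sup>2 =
       L2_sq \<T> s + L2_sq \<T> (\<lambda>T. curl (v T)) + bdry_sq \<T> (W (tangential_gap v vF)) + k\<^sup>2 * L2_sq \<T> v
     + (k\<^sup>2 + 1) * (Dsq v + Jsq v + L2_sq \<T> (\<lambda>T. grad (q T)) + bdry_sq \<T> (W (\<lambda>T F x. q T x - qF F x)))"
    and "0 \<le> L2_sq \<T> s" "0 \<le> L2_sq \<T> (\<lambda>T. curl (v T))" "0 \<le> bdry_sq \<T> (W (tangential_gap v vF))"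
    "0 \<le> L2_sq \<T> v" "0 \<le> Dsq v" "0 \<le> Jsq v" "0 \<le> L2_sq \<T> (\<lambda>T. grad (q T))"
    "0 \<le> bdry_sq \<T> (W (\<lambda>T F x. q T x - qF F x))"
proof -
  note c = Sigma_h_cont[OF assms]
  show nn: "0 \<le> L2_sq \<T> s" "0 \<le> L2_sq \<T> (\<lambda>T. curl (v T))" "0 \<le> bdry_sq \<T> (W (tangential_gap v vF))"
    "0 \<le> L2_sq \<T> v" "0 \<le> Dsq v" "0 \<le> Jsq v" "0 \<le> L2_sq \<T> (\<lambda>T. grad (q T))"
    "0 \<le> bdry_sq \<T> (W (\<lambda>T F x. q T x - qF F x))"
    unfolding Dsq_def by (intro L2_nonneg bd_nonneg cB_W Jsq_nonneg c)+
  show "(Sigma_norm k \<T> (s, v, vF, q, qF))\<^sup>2 =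
       L2_sq \<T> s + L2_sq \<T> (\<lambda>T. curl (v T)) + bdry_sq \<T> (W (tangential_gap v vF)) + k\<^sup>2 * L2_sq \<T> v
     + (k\<^sup>2 + 1) * (Dsq v + Jsq v + L2_sq \<T> (\<lambda>T. grad (q T)) + bdry_sq \<T> (W (\<lambda>T F x. q T x - qF F x)))"
    unfolding Sigma_norm_eq using nn
    by (intro real_sqrt_pow2 add_nonneg_nonneg mult_nonneg_nonneg) auto
qed

lemma Sigma_norm_nonneg: "\<tau> \<in> Sigma_h l m \<Omega> \<T> \<Longrightarrow> 0 \<le> Sigma_norm k \<T> \<tau>"
proof -
  assume "\<tau> \<in> Sigma_h l m \<Omega> \<T>"
  moreover obtain s v vF q qF where \<tau>: "\<tau> = (s, v, vF, q, qF)" by (metis prod_cases5)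
  ultimately have t: "(s, v, vF, q, qF) \<in> Sigma_h l m \<Omega> \<T>" by simp
  show ?thesis
    unfolding \<tau> Sigma_norm_eq using Sigma_norm_sq(2-)[OF t]
    by (intro real_sqrt_ge_zero add_nonneg_nonneg mult_nonneg_nonneg) auto
qed

lemma W_zero: "W (\<lambda>_ _ _. 0) = (\<lambda>_ _ _. 0)"
  by (auto simp: W_def fun_eq_iff)

lemma Uhat_normal: "uF \<in> Uhat_space l \<Omega> \<T> \<Longrightarrow> uF \<in> skeleton_space (vpolys l) \<T>"
  by (simp add: Uhat_space_def)

lemma skeleton_uminus:
  fixes w :: "('b::real_normed_vector) family"
  assumes w: "w \<in> skeleton_space P \<T>" and P: "\<And>g. g \<in> P \<Longrightarrow> (\<lambda>x. - g x) \<in> P"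
  shows "(\<lambda>F x. - w F x) \<in> skeleton_space P \<T>"
  unfolding skeleton_space_def
proof (intro CollectI conjI ballI allI impI)
  fix F assume "F \<in> mesh_faces \<T>"
  then obtain g where "g \<in> P" "w F = (\<lambda>x. if x \<in> F then g x else 0)"
    using w by (auto simp: skeleton_space_def)
  then show "\<exists>g\<in>P. (\<lambda>x. - w F x) = (\<lambda>x. if x \<in> F then g x else 0)"
    by (intro bexI[of _ "\<lambda>x. - g x"] P) auto
next
  fix F assume "F \<notin> mesh_faces \<T>"
  then show "(\<lambda>x. - w F x) = (\<lambda>_. 0)" using w by (simp add: skeleton_space_def)
qed

lemma zero_spaces:
  "(\<lambda>_ _. 0) \<in> broken_space (vpolys j) \<T>" "(\<lambda>_ _. 0) \<in> broken_space (polys j) \<T>"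
  "(\<lambda>_ _. 0) \<in> Uhat_space l \<Omega> \<T>" "(\<lambda>_ _. 0) \<in> Mhat_space l \<Omega> \<T>"
  by (auto simp: broken_space_def Uhat_space_def Mhat_space_def skeleton_space_def vpolys_zero polys_zero
      intro!: bexI[of _ "\<lambda>_. 0"])

lemma m_le: "m \<le> l + 1" "l - 1 \<le> m" using m by auto

lemma Jsq_uminus: "Jsq (\<lambda>T x. - v T x) = Jsq v"
proof -
  have "normal_jump \<T> (\<lambda>T x. - v T x) F x = - normal_jump \<T> v F x" for F x
    unfolding normal_jump_def by (auto simp: Let_def case_prod_unfold inner_diff_right)
  then show ?thesis by (simp add: Jsq_def)
qed

text \<open>After the sign change every mixed term cancels against its transposed partner, while the
  two negative squares of the form become positive.\<close>

lemma sign_flip_test: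
  assumes \<sigma>: "(r, u, uF, p, pF) \<in> Sigma_h l m \<Omega> \<T>"
  defines "\<tau> \<equiv> (r, \<lambda>T x. - u T x, \<lambda>F x. - uF F x, p, pF)"
  shows "\<tau> \<in> Sigma_h l m \<Omega> \<T>"
    and "B_plus k \<T> (r, u, uF, p, pF) \<tau> = L2_sq \<T> r + k\<^sup>2 * L2_sq \<T> u
      + bdry_sq \<T> (W (tangential_gap u uF)) + (k\<^sup>2 + 1) * bdry_sq \<T> (W (\<lambda>T F x. p T x - pF F x))"
    and "Sigma_norm k \<T> \<tau> = Sigma_norm k \<T> (r, u, uF, p, pF)"
proof -
  note D = Sigma_hD[OF \<sigma>] and c = Sigma_h_cont[OF \<sigma>]
  have "(\<lambda>F x. - uF F x) \<in> Uhat_space l \<Omega> \<T>"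
    using D(3) skeleton_uminus[OF Uhat_normal[OF D(3)]]
    by (auto simp: Uhat_space_def vpolys_uminus cross_minus_right)
  then show "\<tau> \<in> Sigma_h l m \<Omega> \<T>"
    using D by (auto simp: \<tau>_def Sigma_h_def broken_space_def vpolys_uminus)
  have u: "u T \<in> vpolys l" if "T \<in> \<T>" for T using D(2) that by (simp add: broken_space_def)
  have cu: "L2_inner \<T> (\<lambda>T. curl (\<lambda>x. - u T x)) f = L2_inner \<T> (\<lambda>T x. - curl (u T) x) f" for f
    by (rule L2_cong) (simp_all add: curl_uminus[OF u])
  have gap: "tangential_gap (\<lambda>T x. - u T x) (\<lambda>F x. - uF F x) = (\<lambda>T F x. - tangential_gap u uF T F x)"
  proof (intro ext)
    fix T F x
    have "- u T x - (- uF F x) = - (u T x - uF F x)" by simp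
    then show "tangential_gap (\<lambda>T x. - u T x) (\<lambda>F x. - uF F x) T F x = - tangential_gap u uF T F x"
      by (simp only: cross_minus_right)
  qed
  have n: "bdry_inner \<T> (\<lambda>T F x. outward_normal T F \<bullet> - u T x) f = bdry_inner \<T> (\<lambda>T F x. - (outward_normal T F \<bullet> u T x)) f" for f
    by simp
  show "B_plus k \<T> (r, u, uF, p, pF) \<tau> = L2_sq \<T> r + k\<^sup>2 * L2_sq \<T> u
      + bdry_sq \<T> (W (tangential_gap u uF)) + (k\<^sup>2 + 1) * bdry_sq \<T> (W (\<lambda>T F x. p T x - pF F x))"
    unfolding \<tau>_def B_plus_eq cu gap n W_uminus
    by (simp add: L2_uminus[OF c(5,1)] bd_uminus[OF c(6,2)] L2_uminus[OF c(3,7)] bd_uminus[OF c(11,10)]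
        L2_uminus_right[OF c(3,3)] bd_uminus_right[OF cB_W[OF c(6)] cB_W[OF c(6)]])
      (simp add: algebra_simps)
  have c2: "L2_sq \<T> (\<lambda>T. curl (\<lambda>x. - u T x)) = L2_sq \<T> (\<lambda>T. curl (u T))"
  proof -
    have "L2_sq \<T> (\<lambda>T. curl (\<lambda>x. - u T x)) = L2_sq \<T> (\<lambda>T x. - curl (u T) x)"
      by (rule L2_cong) (simp_all add: curl_uminus[OF u])
    then show ?thesis by (simp add: L2_inner_def)
  qed
  have d2: "Dsq (\<lambda>T x. - u T x) = Dsq u"
  proof -
    have "Dsq (\<lambda>T x. - u T x) = L2_sq \<T> (\<lambda>T x. - (diameter T * divergence (u T) x))"
      unfolding Dsq_def by (rule L2_cong) (simp_all add: divergence_uminus[OF u])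
    then show ?thesis by (simp add: Dsq_def L2_inner_def)
  qed
  show "Sigma_norm k \<T> \<tau> = Sigma_norm k \<T> (r, u, uF, p, pF)"
    unfolding \<tau>_def Sigma_norm_eq gap W_uminus c2 d2 Jsq_uminus by (simp add: L2_inner_def bdry_inner_def)
qed

end

section \<open>Inverse estimates on the mesh and the curl test\<close>

locale hdg_const = hdg +
  fixes C :: real
  assumes C1: "1 \<le> C"
    and inv_trace: "\<And>T p F. reg \<kappa> T \<Longrightarrow> p \<in> polys (l + 1) \<Longrightarrow> F facet_of T \<Longrightarrow>
      diameter T * face_integral F (\<lambda>x. (p x)\<^sup>2) \<le> C * tint T (\<lambda>x. (p x)\<^sup>2)"
    and inv_grad: "\<And>T p. reg \<kappa> T \<Longrightarrow> p \<in> polys (l + 1) \<Longrightarrow>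
      (diameter T)\<^sup>2 * tint T (\<lambda>x. grad p x \<bullet> grad p x) \<le> C * tint T (\<lambda>x. (p x)\<^sup>2)"
begin

lemma tint_vector: "v \<in> vpolys j \<Longrightarrow> S \<in> \<T> \<Longrightarrow> tint S (\<lambda>x. v x \<bullet> v x) = (\<Sum>i\<in>UNIV. tint S (\<lambda>x. (v x $ i)\<^sup>2))"
  unfolding inner_vec_def inner_real_def power2_eq_square
  by (rule pos_lin_sum[OF pos_lin_tint[OF T]]) (assumption | intro continuous_on_mult continuous_on_polys[OF vpolysD])+

text \<open>The scalar trace inequality in each component, with the face diameter bounded by that of
  the element; the factor 4 counts the facets.\<close>

lemma trace_le:
  assumes v: "v \<in> broken_space (vpolys j) \<T>" and j: "j \<le> l + 1"
  shows "bdry_sq \<T> (W' (\<lambda>T F. v T)) \<le> 4 * C * L2_sq \<T> v"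
proof -
  have "(\<Sum>F | F facet_of S. face_integral F (\<lambda>x. W' (\<lambda>T F. v T) S F x \<bullet> W' (\<lambda>T F. v T) S F x))
      \<le> 4 * C * tint S (\<lambda>x. v S x \<bullet> v S x)" if S: "S \<in> \<T>" for S
  proof -
    have vS: "v S \<in> vpolys j" using v S by (simp add: broken_space_def)
    have vi: "(\<lambda>x. v S x $ i) \<in> polys (l + 1)" for i using vpolysD[OF vS] polys_mono[OF j] by blast
    have "face_integral F (\<lambda>x. W' (\<lambda>T F. v T) S F x \<bullet> W' (\<lambda>T F. v T) S F x) \<le> C * tint S (\<lambda>x. v S x \<bullet> v S x)"
      if F: "F facet_of S" for F
    proof -
      have pl: "pos_lin F (face_integral F)" by (rule pos_lin_facet[OF T[OF S] F])
      have dF: "0 < diameter F" by (rule facet_pos[OF S F])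
      have nn: "0 \<le> face_integral F (\<lambda>x. (v S x $ i)\<^sup>2)" for i
        by (intro pos_lin_nonneg[OF pl] continuous_intros continuous_on_polys[OF vi]) simp
      have "face_integral F (\<lambda>x. W' (\<lambda>T F. v T) S F x \<bullet> W' (\<lambda>T F. v T) S F x)
          = face_integral F (\<lambda>x. \<Sum>i\<in>UNIV. diameter F * (v S x $ i)\<^sup>2)"
      proof (rule pos_lin_cong[OF pl])
        fix x
        have "W' (\<lambda>T F. v T) S F x \<bullet> W' (\<lambda>T F. v T) S F x = diameter F * (v S x \<bullet> v S x)"
          using dF by (simp add: W'_def mult.assoc[symmetric])
        then show "W' (\<lambda>T F. v T) S F x \<bullet> W' (\<lambda>T F. v T) S F x = (\<Sum>i\<in>UNIV. diameter F * (v S x $ i)\<^sup>2)"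
          by (simp add: inner_vec_def power2_eq_square sum_distrib_left)
      qed
      also have "\<dots> = (\<Sum>i\<in>UNIV. diameter F * face_integral F (\<lambda>x. (v S x $ i)\<^sup>2))"
        by (subst pos_lin_sum[OF pl])
          (auto intro!: sum.cong pos_lin_cmult[OF pl] continuous_intros continuous_on_polys[OF vi])
      also have "\<dots> \<le> (\<Sum>i\<in>UNIV. C * tint S (\<lambda>x. (v S x $ i)\<^sup>2))"
      proof (rule sum_mono)
        fix i
        have "diameter F * face_integral F (\<lambda>x. (v S x $ i)\<^sup>2) \<le> diameter S * face_integral F (\<lambda>x. (v S x $ i)\<^sup>2)"
          by (intro mult_right_mono diameter_facet(1)[OF R[OF S] F] nn)
        also have "\<dots> \<le> C * tint S (\<lambda>x. (v S x $ i)\<^sup>2)" by (rule inv_trace[OF R[OF S] vi F])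
        finally show "diameter F * face_integral F (\<lambda>x. (v S x $ i)\<^sup>2) \<le> C * tint S (\<lambda>x. (v S x $ i)\<^sup>2)" .
      qed
      also have "\<dots> = C * tint S (\<lambda>x. v S x \<bullet> v S x)" by (simp add: tint_vector[OF vS S] sum_distrib_left)
      finally show ?thesis .
    qed
    then have "(\<Sum>F | F facet_of S. face_integral F (\<lambda>x. W' (\<lambda>T F. v T) S F x \<bullet> W' (\<lambda>T F. v T) S F x))
       \<le> (\<Sum>F | F facet_of S. C * tint S (\<lambda>x. v S x \<bullet> v S x))"
      by (intro sum_mono) auto
    also have "\<dots> = (\<Sum>w\<in>verts S. C * tint S (\<lambda>x. v S x \<bullet> v S x))" by (rule sum_facets[OF T[OF S]])
    finally show ?thesis by (simp add: card_verts[OF T[OF S]])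
  qed
  then have "bdry_sq \<T> (W' (\<lambda>T F. v T)) \<le> (\<Sum>S\<in>\<T>. 4 * C * tint S (\<lambda>x. v S x \<bullet> v S x))"
    unfolding bdry_inner_def by (rule sum_mono)
  then show ?thesis by (simp add: L2_inner_def tint_def sum_distrib_left)
qed

lemma trace_normal_le:
  assumes v: "v \<in> broken_space (vpolys j) \<T>" and j: "j \<le> l + 1"
  shows "bdry_sq \<T> (W' (\<lambda>T F x. outward_normal T F \<bullet> v T x)) \<le> 4 * C * L2_sq \<T> v"
proof -
  have c: "cB (\<lambda>T F. v T)" by (rule cB_vbroken[OF v])
  have "bdry_sq \<T> (W' (\<lambda>T F x. outward_normal T F \<bullet> v T x)) \<le> bdry_sq \<T> (W' (\<lambda>T F. v T))"
  proof (rule bd_le)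
    fix S F x assume S: "S \<in> \<T>" "F facet_of S"
    have "\<bar>outward_normal S F \<bullet> v S x\<bar> \<le> norm (v S x)"
      using Cauchy_Schwarz_ineq2[of "outward_normal S F" "v S x"] norm_outward_normal[OF T[OF S(1)] S(2)] by simp
    then have "(outward_normal S F \<bullet> v S x)\<^sup>2 \<le> v S x \<bullet> v S x"
      unfolding power2_norm_eq_inner[symmetric] by (metis abs_ge_zero power2_abs power_mono)
    then have "diameter F * (outward_normal S F \<bullet> v S x)\<^sup>2 \<le> diameter F * (v S x \<bullet> v S x)"
      using facet_pos[OF S] by (intro mult_left_mono) auto
    then show "W' (\<lambda>T F x. outward_normal T F \<bullet> v T x) S F x \<bullet> W' (\<lambda>T F x. outward_normal T F \<bullet> v T x) S F x
        \<le> W' (\<lambda>T F. v T) S F x \<bullet> W' (\<lambda>T F. v T) S F x"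
      using facet_pos[OF S] by (simp add: W'_def power2_eq_square mult_ac)
  qed (intro cB_W' cB_normal c)+
  also have "\<dots> \<le> 4 * C * L2_sq \<T> v" by (rule trace_le[OF v j])
  finally show ?thesis .
qed

text \<open>The weight is split: the negative half power goes to \<open>f\<close>, the positive one
  to the trace of \<open>s\<close>, where the trace inequality applies.\<close>

lemma bd_trace_abs_le:
  assumes "cB f" and s: "s \<in> broken_space (vpolys j) \<T>" "j \<le> l + 1"
  shows "\<bar>bdry_inner \<T> f (\<lambda>T F. s T)\<bar> \<le> sqrt (bdry_sq \<T> (W f)) * sqrt (4 * C * L2_sq \<T> s)"
proof -
  have "\<bar>bdry_inner \<T> f (\<lambda>T F. s T)\<bar> \<le> sqrt (bdry_sq \<T> (W f)) * sqrt (bdry_sq \<T> (W' (\<lambda>T F. s T)))"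
    unfolding bd_W_W'[of f] by (intro bd_abs_le cB_W cB_W' assms(1) cB_vbroken[OF s(1)])
  also have "\<dots> \<le> sqrt (bdry_sq \<T> (W f)) * sqrt (4 * C * L2_sq \<T> s)"
    by (intro mult_left_mono real_sqrt_le_mono trace_le[OF s] real_sqrt_ge_zero bd_nonneg cB_W assms(1))
  finally show ?thesis .
qed

lemma bd_normal_abs_le:
  assumes "cB f" and v: "v \<in> broken_space (vpolys j) \<T>" "j \<le> l + 1"
  shows "\<bar>bdry_inner \<T> (\<lambda>T F x. outward_normal T F \<bullet> v T x) f\<bar> \<le> sqrt (bdry_sq \<T> (W f)) * sqrt (4 * C * L2_sq \<T> v)"
proof -
  have "\<bar>bdry_inner \<T> (\<lambda>T F x. outward_normal T F \<bullet> v T x) f\<bar>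
     \<le> sqrt (bdry_sq \<T> (W f)) * sqrt (bdry_sq \<T> (W' (\<lambda>T F x. outward_normal T F \<bullet> v T x)))"
    unfolding bd_commute[of _ f] bd_W_W'[of f] by (intro bd_abs_le cB_W cB_W' assms(1) cB_normal cB_vbroken[OF v(1)])
  also have "\<dots> \<le> sqrt (bdry_sq \<T> (W f)) * sqrt (4 * C * L2_sq \<T> v)"
    by (intro mult_left_mono real_sqrt_le_mono trace_normal_le[OF v] real_sqrt_ge_zero bd_nonneg cB_W assms(1))
  finally show ?thesis .
qed

text \<open>For a test function of norm 0, division by zero makes the quotient 0 and hides the value
  of the form. By Cauchy-Schwarz and the trace inequality each term of the form contains a factor
  that vanishes with the norm of \<open>\<tau>\<close>; the factor \<open>v\<close> is reached
  through \<open>0 < k\<close>.\<close>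

lemma B_plus_zero:
  assumes \<sigma>: "\<sigma> \<in> Sigma_h l m \<Omega> \<T>" and \<tau>: "\<tau> \<in> Sigma_h l m \<Omega> \<T>" and z: "Sigma_norm k \<T> \<tau> = 0"
  shows "B_plus k \<T> \<sigma> \<tau> = 0"
proof -
  obtain r u uF p pF where \<sigma>_eq: "\<sigma> = (r, u, uF, p, pF)" by (metis prod_cases5)
  obtain s v vF q qF where \<tau>_eq: "\<tau> = (s, v, vF, q, qF)" by (metis prod_cases5)
  note c = Sigma_h_cont[OF \<sigma>[unfolded \<sigma>_eq]] and c' = Sigma_h_cont[OF \<tau>[unfolded \<tau>_eq]]
  note D = Sigma_hD[OF \<sigma>[unfolded \<sigma>_eq]] and D' = Sigma_hD[OF \<tau>[unfolded \<tau>_eq]]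
  note nn = Sigma_norm_sq[OF \<tau>[unfolded \<tau>_eq]]
  have k2: "0 < k\<^sup>2" "0 < k\<^sup>2 + 1" using k by (auto intro: add_pos_pos)
  have "0 \<le> (k\<^sup>2 + 1) * Dsq v" "0 \<le> (k\<^sup>2 + 1) * Jsq v" "0 \<le> (k\<^sup>2 + 1) * L2_sq \<T> (\<lambda>T. grad (q T))"
    "0 \<le> (k\<^sup>2 + 1) * bdry_sq \<T> (W (\<lambda>T F x. q T x - qF F x))" "0 \<le> k\<^sup>2 * L2_sq \<T> v"
    using nn k2 by (intro mult_nonneg_nonneg; simp)+
  moreover have "0 = L2_sq \<T> s + L2_sq \<T> (\<lambda>T. curl (v T)) + bdry_sq \<T> (W (tangential_gap v vF)) + k\<^sup>2 * L2_sq \<T> v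
     + ((k\<^sup>2 + 1) * Dsq v + (k\<^sup>2 + 1) * Jsq v + (k\<^sup>2 + 1) * L2_sq \<T> (\<lambda>T. grad (q T)) + (k\<^sup>2 + 1) * bdry_sq \<T> (W (\<lambda>T F x. q T x - qF F x)))"
    using nn(1) z \<tau>_eq by (simp add: distrib_left)
  ultimately have "L2_sq \<T> s = 0" "L2_sq \<T> (\<lambda>T. curl (v T)) = 0" "bdry_sq \<T> (W (tangential_gap v vF)) = 0"
    "k\<^sup>2 * L2_sq \<T> v = 0" "(k\<^sup>2 + 1) * L2_sq \<T> (\<lambda>T. grad (q T)) = 0"
    "(k\<^sup>2 + 1) * bdry_sq \<T> (W (\<lambda>T F x. q T x - qF F x)) = 0"
    using nn(2-) by linarith+
  then have z: "L2_sq \<T> s = 0" "L2_sq \<T> (\<lambda>T. curl (v T)) = 0" "bdry_sq \<T> (W (tangential_gap v vF)) = 0"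
    "L2_sq \<T> v = 0" "L2_sq \<T> (\<lambda>T. grad (q T)) = 0" "bdry_sq \<T> (W (\<lambda>T F x. q T x - qF F x)) = 0"
    using k2 by simp_all
  have "L2_inner \<T> r s = 0" "L2_inner \<T> (\<lambda>T. curl (u T)) s = 0" "L2_inner \<T> (\<lambda>T. curl (v T)) r = 0"
    "L2_inner \<T> v (\<lambda>T. grad (p T)) = 0" "L2_inner \<T> u (\<lambda>T. grad (q T)) = 0" "L2_inner \<T> u v = 0"
    using L2_abs_le[OF c(1) c'(1)] L2_abs_le[OF c(5) c'(1)] L2_abs_le[OF c'(5) c(1)] L2_abs_le[OF c'(3) c(7)]
      L2_abs_le[OF c(3) c'(7)] L2_abs_le[OF c(3) c'(3)] by (simp_all add: z)
  moreover have "bdry_inner \<T> (W (tangential_gap u uF)) (W (tangential_gap v vF)) = 0"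
    "bdry_inner \<T> (W (\<lambda>T F x. p T x - pF F x)) (W (\<lambda>T F x. q T x - qF F x)) = 0"
    using bd_abs_le[OF cB_W[OF c(6)] cB_W[OF c'(6)]] bd_abs_le[OF cB_W[OF c(10)] cB_W[OF c'(10)]] by (simp_all add: z)
  moreover have "bdry_inner \<T> (tangential_gap u uF) (\<lambda>T F. s T) = 0" "bdry_inner \<T> (tangential_gap v vF) (\<lambda>T F. r T) = 0"
    using bd_trace_abs_le[OF c(6) D'(1) m_le(1)] bd_trace_abs_le[OF c'(6) D(1) m_le(1)] by (simp_all add: z)
  moreover have "bdry_inner \<T> (\<lambda>T F x. outward_normal T F \<bullet> v T x) (\<lambda>T F x. p T x - pF F x) = 0"
    "bdry_inner \<T> (\<lambda>T F x. outward_normal T F \<bullet> u T x) (\<lambda>T F x. q T x - qF F x) = 0"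
    using bd_normal_abs_le[OF c(10) D'(2)] bd_normal_abs_le[OF c'(10) D(2)] by (simp_all add: z)
  ultimately show ?thesis
    unfolding \<sigma>_eq \<tau>_eq B_plus_eq by simp
qed

text \<open>The curl has degree \<open>l - 1\<close>, and \<open>l - 1 \<le> m\<close> makes it
  admissible as first component. The form returns the squared curl with two errors, which contain
  only \<open>r\<close> and the tangential gap; the latter is estimated by the trace
  inequality.\<close>

lemma curl_test:
  assumes \<sigma>: "(r, u, uF, p, pF) \<in> Sigma_h l m \<Omega> \<T>"
  defines "cu \<equiv> L2_sq \<T> (\<lambda>T. curl (u T))"
  shows "\<exists>\<tau>\<in>Sigma_h l m \<Omega> \<T>. (Sigma_norm k \<T> \<tau>)\<^sup>2 = cu \<and>
    cu - (sqrt (L2_sq \<T> r) + sqrt (4 * C * bdry_sq \<T> (W (tangential_gap u uF)))) * sqrt cu \<le> B_plus k \<T> (r, u, uF, p, pF) \<tau>"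
proof -
  note D = Sigma_hD[OF \<sigma>] and c = Sigma_h_cont[OF \<sigma>]
  define s where "s T = (if T \<in> \<T> then (\<lambda>x. - curl (u T) x) else (\<lambda>_. 0))" for T
  define \<tau> :: dofs where "\<tau> = (s, \<lambda>_ _. 0, \<lambda>_ _. 0, \<lambda>_ _. 0, \<lambda>_ _. 0)"
  have s: "s \<in> broken_space (vpolys (l - 1)) \<T>"
    using D(2) by (auto simp: s_def broken_space_def intro!: vpolys_uminus vpolys_curl[unfolded One_nat_def])
  then have sm: "s \<in> broken_space (vpolys m) \<T>"
    using vpolys_mono[OF m_le(2)] by (auto simp: broken_space_def)
  have \<tau>: "\<tau> \<in> Sigma_h l m \<Omega> \<T>" using sm zero_spaces by (auto simp: \<tau>_def Sigma_h_def)
  have ss: "L2_inner \<T> f s = - L2_inner \<T> f (\<lambda>T. curl (u T))" if "cV f" for f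
  proof -
    have "L2_inner \<T> f s = L2_inner \<T> f (\<lambda>T x. - curl (u T) x)" by (rule L2_cong) (auto simp: s_def)
    then show ?thesis by (simp add: L2_uminus_right[OF that c(5)])
  qed
  have cs: "cV s" by (rule cV_vbroken[OF s])
  have sq: "L2_sq \<T> s = cu"
    using ss[OF cs] ss[OF c(5)] L2_commute[of s "\<lambda>T. curl (u T)"] unfolding cu_def by linarith
  have cu0: "0 \<le> cu" unfolding cu_def by (rule L2_nonneg[OF c(5)])
  have zeros: "tangential_gap (\<lambda>_ _. 0) (\<lambda>_ _. 0) = (\<lambda>_ _ _. 0)" "curl (\<lambda>_. 0) = (\<lambda>_. 0)" "grad (\<lambda>_. 0) = (\<lambda>_. 0)"
    by (auto simp: fun_eq_iff curl_zero grad_const)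
  have "(Sigma_norm k \<T> \<tau>)\<^sup>2 = cu"
  proof -
    have "Dsq (\<lambda>_ _. 0) = 0" "Jsq (\<lambda>_ _. 0) = 0"
      by (simp_all add: Dsq_def Jsq_def divergence_zero normal_jump_def L2_zero_left case_prod_unfold Let_def pos_lin_zero[OF pos_lin_interior])
    then show ?thesis
      unfolding \<tau>_def Sigma_norm_sq(1)[OF \<tau>[unfolded \<tau>_def]] zeros
      by (simp add: sq W_zero L2_zero_left bd_zero_left)
  qed
  moreover have "cu - (sqrt (L2_sq \<T> r) + sqrt (4 * C * bdry_sq \<T> (W (tangential_gap u uF)))) * sqrt cu \<le> B_plus k \<T> (r, u, uF, p, pF) \<tau>"
  proof -
    have "B_plus k \<T> (r, u, uF, p, pF) \<tau> = L2_inner \<T> r s - L2_inner \<T> (\<lambda>T. curl (u T)) s + bdry_inner \<T> (tangential_gap u uF) (\<lambda>T F. s T)"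
      unfolding \<tau>_def B_plus_eq zeros by (simp add: W_zero L2_zero_left L2_zero_right bd_zero_left bd_zero_right)
    moreover have "L2_inner \<T> (\<lambda>T. curl (u T)) s = - cu" by (simp add: ss[OF c(5)] cu_def)
    moreover have "\<bar>L2_inner \<T> r s\<bar> \<le> sqrt (L2_sq \<T> r) * sqrt cu" using L2_abs_le[OF c(1) cs] by (simp add: sq)
    moreover have "\<bar>bdry_inner \<T> (tangential_gap u uF) (\<lambda>T F. s T)\<bar> \<le> sqrt (4 * C * bdry_sq \<T> (W (tangential_gap u uF))) * sqrt cu"
      using bd_trace_abs_le[OF c(6) sm m_le(1)] by (simp add: sq real_sqrt_mult mult_ac)
    ultimately show ?thesis by (simp add: distrib_right)
  qed
  ultimately show ?thesis using \<tau> by blast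
qed

end

section \<open>The test for divergence and normal jump\<close>

context hdg_const
begin

lemma Dsq_eq: "Dsq v = (\<Sum>S\<in>\<T>. (diameter S)\<^sup>2 * tint S (\<lambda>x. (divergence (v S) x)\<^sup>2))"
  if "v \<in> broken_space (vpolys j) \<T>"
proof -
  have "tint S (\<lambda>x. (diameter S * divergence (v S) x) \<bullet> (diameter S * divergence (v S) x))
      = (diameter S)\<^sup>2 * tint S (\<lambda>x. (divergence (v S) x)\<^sup>2)" if S: "S \<in> \<T>" for S
  proof -
    have "v S \<in> vpolys j" using S \<open>v \<in> broken_space (vpolys j) \<T>\<close> by (simp add: broken_space_def)
    then have "continuous_on S (\<lambda>x. (divergence (v S) x)\<^sup>2)"
      by (intro continuous_intros continuous_on_polys[OF polys_divergence])
    from pos_lin_cmult[OF pos_lin_tint[OF T[OF S]] this, of "(diameter S)\<^sup>2"] show ?thesis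
      by (simp add: power2_eq_square mult_ac)
  qed
  then show ?thesis by (simp add: Dsq_def L2_inner_def tint_def)
qed

text \<open>The inverse estimate for each component; the factor 3 comes from Cauchy-Schwarz over the
  three terms of the divergence.\<close>

lemma Dsq_le:
  assumes v: "v \<in> broken_space (vpolys j) \<T>" and j: "j \<le> l + 1"
  shows "Dsq v \<le> 3 * C * L2_sq \<T> v"
proof -
  have "(diameter S)\<^sup>2 * tint S (\<lambda>x. (divergence (v S) x)\<^sup>2) \<le> 3 * C * tint S (\<lambda>x. v S x \<bullet> v S x)"
    if S: "S \<in> \<T>" for S
  proof -
    have vS: "v S \<in> vpolys j" using v S by (simp add: broken_space_def)
    have vi: "(\<lambda>x. v S x $ i) \<in> polys (l + 1)" for i using vpolysD[OF vS] polys_mono[OF j] by blast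
    have pl: "pos_lin S (tint S)" by (rule pos_lin_tint[OF T[OF S]])
    have cg: "continuous_on S (\<lambda>x. grad (\<lambda>y. v S y $ i) x \<bullet> grad (\<lambda>y. v S y $ i) x)" for i
      by (intro continuous_intros continuous_on_vpolys[OF vpolys_grad[OF vi]])
    have "tint S (\<lambda>x. (divergence (v S) x)\<^sup>2)
       \<le> tint S (\<lambda>x. 3 * (\<Sum>i\<in>UNIV. grad (\<lambda>y. v S y $ i) x \<bullet> grad (\<lambda>y. v S y $ i) x))"
      by (intro pos_lin_mono[OF pl] continuous_on_power continuous_on_polys[OF polys_divergence[OF vS]] continuous_on_mult
          continuous_on_const continuous_on_sum cg divergence_sq_le)
    also have "\<dots> = 3 * (\<Sum>i\<in>UNIV. tint S (\<lambda>x. grad (\<lambda>y. v S y $ i) x \<bullet> grad (\<lambda>y. v S y $ i) x))"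
      by (simp add: pos_lin_cmult[OF pl] pos_lin_sum[OF pl] continuous_on_sum cg)
    finally have "(diameter S)\<^sup>2 * tint S (\<lambda>x. (divergence (v S) x)\<^sup>2)
       \<le> (diameter S)\<^sup>2 * (3 * (\<Sum>i\<in>UNIV. tint S (\<lambda>x. grad (\<lambda>y. v S y $ i) x \<bullet> grad (\<lambda>y. v S y $ i) x)))"
      by (rule mult_left_mono) simp
    also have "\<dots> = 3 * (\<Sum>i\<in>UNIV. (diameter S)\<^sup>2 * tint S (\<lambda>x. grad (\<lambda>y. v S y $ i) x \<bullet> grad (\<lambda>y. v S y $ i) x))"
      by (simp add: sum_distrib_left mult_ac)
    also have "\<dots> \<le> 3 * (\<Sum>i\<in>UNIV. C * tint S (\<lambda>x. (v S x $ i)\<^sup>2))"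
      by (intro mult_left_mono sum_mono inv_grad[OF R[OF S] vi]) simp
    also have "\<dots> = 3 * C * tint S (\<lambda>x. v S x \<bullet> v S x)"
      by (simp add: tint_vector[OF vS S] sum_distrib_left mult.assoc)
    finally show ?thesis .
  qed
  then have "Dsq v \<le> (\<Sum>S\<in>\<T>. 3 * C * tint S (\<lambda>x. v S x \<bullet> v S x))"
    unfolding Dsq_eq[OF v] by (rule sum_mono)
  then show ?thesis by (simp add: L2_inner_def tint_def sum_distrib_left)
qed

text \<open>The normals of the neighbours are opposite, so the jump is the sum of the two outward
  normal traces.\<close>

lemma Jsq_le:
  assumes c: "cB (\<lambda>T F. v T)"
  shows "Jsq v \<le> 2 * bdry_sq \<T> (W' (\<lambda>T F x. outward_normal T F \<bullet> v T x))"
proof -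
  define g where "g S F = face_integral F (\<lambda>x. W' (\<lambda>T F x. outward_normal T F \<bullet> v T x) S F x \<bullet> W' (\<lambda>T F x. outward_normal T F \<bullet> v T x) S F x)" for S F
  have cW: "continuous_on F (W' (\<lambda>T F x. outward_normal T F \<bullet> v T x) S F)" if "S \<in> \<T>" "F facet_of S" for S F
    using cB_W'[OF cB_normal[OF c]] that by (auto simp: cB_def)
  have g0: "0 \<le> g S F" if "S \<in> \<T>" "F facet_of S" for S F
    unfolding g_def by (intro pos_lin_nonneg[OF pos_lin_facet[OF T[OF that(1)] that(2)]] continuous_on_inner cW that) simp
  have "face_integral F (\<lambda>x. (sqrt (diameter F) * normal_jump \<T> v F x)\<^sup>2) \<le> (\<Sum>S | S \<in> \<T> \<and> F facet_of S. 2 * g S F)"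
    if F: "F \<in> interior_faces \<T>" for F
  proof (rule interior_face_pair[OF F])
    fix S S' assume P: "S \<in> \<T>" "S' \<in> \<T>" "S \<noteq> S'" "F facet_of S" "F facet_of S'"
      and J: "\<And>v x. normal_jump \<T> v F x = outward_normal S F \<bullet> (v S x - v S' x)"
      and SS: "{S \<in> \<T>. F facet_of S} = {S, S'}" and opp: "outward_normal S' F = - outward_normal S F"
    have pl: "pos_lin F (face_integral F)" by (rule pos_lin_interior[OF F])
    let ?w = "W' (\<lambda>T F x. outward_normal T F \<bullet> v T x)"
    have "face_integral F (\<lambda>x. (sqrt (diameter F) * normal_jump \<T> v F x)\<^sup>2)
       \<le> face_integral F (\<lambda>x. 2 * (?w S F x \<bullet> ?w S F x) + 2 * (?w S' F x \<bullet> ?w S' F x))"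
    proof (rule pos_lin_mono[OF pl])
      fix x
      have "sqrt (diameter F) * normal_jump \<T> v F x = ?w S F x + ?w S' F x"
        by (simp add: J W'_def opp inner_diff_right algebra_simps)
      moreover have "0 \<le> (?w S F x - ?w S' F x)\<^sup>2" by simp
      ultimately show "(sqrt (diameter F) * normal_jump \<T> v F x)\<^sup>2 \<le> 2 * (?w S F x \<bullet> ?w S F x) + 2 * (?w S' F x \<bullet> ?w S' F x)"
        by (simp add: power2_eq_square algebra_simps)
    qed (intro continuous_intros cW cont_jump[OF c F] P)+
    also have "\<dots> = 2 * g S F + 2 * g S' F"
      unfolding g_def
      by (subst pos_lin_add[OF pl]; (subst pos_lin_cmult[OF pl])?) (intro continuous_intros cW P | simp add: pos_lin_cmult[OF pl] cW P continuous_on_mult continuous_on_inner)+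
    also have "\<dots> = (\<Sum>S | S \<in> \<T> \<and> F facet_of S. 2 * g S F)"
      unfolding SS using P(3) by simp
    finally show ?thesis .
  qed
  then have "Jsq v \<le> (\<Sum>F\<in>interior_faces \<T>. \<Sum>S | S \<in> \<T> \<and> F facet_of S. 2 * g S F)"
    unfolding Jsq_def by (rule sum_mono)
  also have "\<dots> \<le> (\<Sum>F\<in>mesh_faces \<T>. \<Sum>S | S \<in> \<T> \<and> F facet_of S. 2 * g S F)"
    by (intro sum_mono2 finite_mesh_faces interior_subset_mesh sum_nonneg) (auto intro: g0)
  also have "\<dots> = (\<Sum>S\<in>\<T>. \<Sum>F | F facet_of S. 2 * g S F)" by (rule sum_element_faces[symmetric])
  also have "\<dots> = 2 * bdry_sq \<T> (W' (\<lambda>T F x. outward_normal T F \<bullet> v T x))"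
    by (simp add: bdry_inner_def g_def sum_distrib_left)
  finally show ?thesis .
qed

text \<open>Integration by parts cancels the traces of \<open>q\<close> in the coupling term; what
  is left is \<open>- Dsq u\<close> from \<open>q\<close> and \<open>- Jsq u\<close> from
  \<open>qF\<close>. In \<open>c\<close> the part \<open>9 * \<kappa>\<^sup>2 * C\<close> covers the
  gradient of \<open>q\<close> and twice its face norm, and 4 covers twice the face norm of
  \<open>qF\<close>.\<close>

lemma divergence_test:
  assumes \<sigma>: "(r, u, uF, p, pF) \<in> Sigma_h l m \<Omega> \<T>"
  defines "X \<equiv> Dsq u + Jsq u" and "E \<equiv> bdry_sq \<T> (W (\<lambda>T F x. p T x - pF F x))" and "c \<equiv> 9 * \<kappa>\<^sup>2 * C + 4"
  shows "\<exists>\<tau>\<in>Sigma_h l m \<Omega> \<T>. (Sigma_norm k \<T> \<tau>)\<^sup>2 \<le> (k\<^sup>2 + 1) * c * X \<and>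
    (k\<^sup>2 + 1) * X - (k\<^sup>2 + 1) * sqrt E * sqrt (c * X) \<le> B_plus k \<T> (r, u, uF, p, pF) \<tau>"
proof -
  note D = Sigma_hD[OF \<sigma>] and cc = Sigma_h_cont[OF \<sigma>]
  have uS: "u S \<in> vpolys l" if "S \<in> \<T>" for S using D(2) that by (simp add: broken_space_def)
  \<comment> \<open>The weights are chosen so that pairing with \<open>u\<close> yields exactly the
    two squares of the norm. \<open>qF\<close> is 0 off the interior faces, as the boundary
    condition requires.\<close>
  define q where "q S = (if S \<in> \<T> then (\<lambda>x. (diameter S)\<^sup>2 * divergence (u S) x) else (\<lambda>_. 0))" for S
  define qF where "qF F = (if F \<in> interior_faces \<T> then (\<lambda>x. if x \<in> F then - (diameter F * normal_jump \<T> u F x) else 0) else (\<lambda>_. 0))" for F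
  define \<tau> :: dofs where "\<tau> = (\<lambda>_ _. 0, \<lambda>_ _. 0, \<lambda>_ _. 0, q, qF)"
  have qS: "q S = (\<lambda>x. (diameter S)\<^sup>2 * divergence (u S) x)" if "S \<in> \<T>" for S using that by (simp add: q_def)
  have "polys (l - 1) \<subseteq> polys (l + 1)" by (rule polys_mono) simp
  then have qP: "q S \<in> polys (l + 1)" if "S \<in> \<T>" for S
    unfolding qS[OF that] using polys_cmult[OF polys_divergence[OF uS[OF that]]] by (rule subsetD)
  have q: "q \<in> broken_space (polys (l + 1)) \<T>" using qP by (simp add: broken_space_def q_def)
  have qF: "qF \<in> Mhat_space l \<Omega> \<T>"
  proof -
    have "\<exists>g\<in>polys (l + 1). qF F = (\<lambda>x. if x \<in> F then g x else 0)" for F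
    proof (cases "F \<in> interior_faces \<T>")
      case True
      show ?thesis
      proof (rule interior_face_pair[OF True])
        fix S S' assume P: "S \<in> \<T>" "S' \<in> \<T>"
          and J: "\<And>v x. normal_jump \<T> v F x = outward_normal S F \<bullet> (v S x - v S' x)"
        have "(\<lambda>x. - (diameter F * (outward_normal S F \<bullet> (u S x - u S' x)))) \<in> polys l"
          by (intro polys_uminus polys_cmult polys_inner_const vpolys_diff uS P)
        then have "(\<lambda>x. - (diameter F * (outward_normal S F \<bullet> (u S x - u S' x)))) \<in> polys (l + 1)"
          using polys_mono[of l "l + 1"] by auto
        then show ?thesis using True by (intro bexI[of _ "\<lambda>x. - (diameter F * (outward_normal S F \<bullet> (u S x - u S' x)))"]) (simp_all add: qF_def J fun_eq_iff)
      qed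
    next
      case False
      then show ?thesis using polys_zero by (intro bexI[of _ "\<lambda>_. 0"]) (auto simp: qF_def)
    qed
    moreover have "qF F = (\<lambda>_. 0)" if "F \<notin> mesh_faces \<T>" for F
      using that interior_subset_mesh by (auto simp: qF_def)
    \<comment> \<open>Here the Lipschitz property of the domain enters: no interior face lies in the
      frontier.\<close>
    moreover have "F \<notin> interior_faces \<T>" if "F \<subseteq> frontier \<Omega>" for F
    proof
      assume "F \<in> interior_faces \<T>"
      then obtain S S' where P: "S \<in> \<T>" "S' \<in> \<T>" "S \<noteq> S'" "F facet_of S" "F facet_of S'"
        by (auto simp: interior_faces_def)
      have "S \<union> S' \<subseteq> closure \<Omega>" using sm P by (auto simp: simplicial_mesh_def)
      with that show False
        using interior_facet_not_frontier[OF T[OF P(1)] T[OF P(2)] P(3-5) conjunct1[OF faces[OF P(1,2)]] conjunct2[OF faces[OF P(1,2)]] lip]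
        by blast
    qed
    ultimately show ?thesis by (auto simp: Mhat_space_def skeleton_space_def qF_def)
  qed
  have \<tau>: "\<tau> \<in> Sigma_h l m \<Omega> \<T>" using q qF zero_spaces by (simp add: \<tau>_def Sigma_h_def)
  note c' = Sigma_h_cont[OF \<tau>[unfolded \<tau>_def]]
  have D0: "0 \<le> Dsq u" "0 \<le> Jsq u" using Sigma_norm_sq(6,7)[OF \<sigma>] .
  then have X0: "0 \<le> X" by (simp add: X_def)
  have k2: "2 \<le> \<kappa>" by (rule kappa)
  have k21: "1 \<le> \<kappa>\<^sup>2" using k2 by (simp add: one_le_power)
  have tq: "tint S (\<lambda>x. (q S x)\<^sup>2) = (diameter S)\<^sup>2 * ((diameter S)\<^sup>2 * tint S (\<lambda>x. (divergence (u S) x)\<^sup>2))" if S: "S \<in> \<T>" for S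
  proof -
    have "continuous_on S (\<lambda>x. (divergence (u S) x)\<^sup>2)"
      by (intro continuous_intros continuous_on_polys[OF polys_divergence[OF uS[OF S]]])
    from pos_lin_cmult[OF pos_lin_tint[OF T[OF S]] this, of "(diameter S)\<^sup>2 * (diameter S)\<^sup>2"] show ?thesis
      by (simp add: qS[OF S] power2_eq_square mult_ac)
  qed
  have Qg: "L2_sq \<T> (\<lambda>T. grad (q T)) \<le> C * Dsq u"
  proof -
    have "tint S (\<lambda>x. grad (q S) x \<bullet> grad (q S) x) \<le> C * ((diameter S)\<^sup>2 * tint S (\<lambda>x. (divergence (u S) x)\<^sup>2))" if S: "S \<in> \<T>" for S
    proof -
      have "(diameter S)\<^sup>2 * tint S (\<lambda>x. grad (q S) x \<bullet> grad (q S) x) \<le> (diameter S)\<^sup>2 * (C * ((diameter S)\<^sup>2 * tint S (\<lambda>x. (divergence (u S) x)\<^sup>2)))"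
        using inv_grad[OF R[OF S] qP[OF S]] unfolding tq[OF S] by (simp add: mult_ac)
      then show ?thesis using diameter_pos[OF R[OF S]] by simp
    qed
    then have "(\<Sum>S\<in>\<T>. tint S (\<lambda>x. grad (q S) x \<bullet> grad (q S) x)) \<le> (\<Sum>S\<in>\<T>. C * ((diameter S)\<^sup>2 * tint S (\<lambda>x. (divergence (u S) x)\<^sup>2)))"
      by (rule sum_mono)
    then show ?thesis by (simp add: Dsq_eq[OF D(2)] L2_inner_def tint_def sum_distrib_left)
  qed
  have Wq: "bdry_sq \<T> (W (\<lambda>T F. q T)) \<le> 4 * \<kappa>\<^sup>2 * C * Dsq u"
  proof -
    have "(\<Sum>F | F facet_of S. face_integral F (\<lambda>x. W (\<lambda>T F. q T) S F x \<bullet> W (\<lambda>T F. q T) S F x))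
       \<le> 4 * \<kappa>\<^sup>2 * C * ((diameter S)\<^sup>2 * tint S (\<lambda>x. (divergence (u S) x)\<^sup>2))" if S: "S \<in> \<T>" for S
    proof -
      let ?t = "(diameter S)\<^sup>2 * tint S (\<lambda>x. (divergence (u S) x)\<^sup>2)"
      have hS: "0 < diameter S" by (rule diameter_pos[OF R[OF S]])
      have "face_integral F (\<lambda>x. W (\<lambda>T F. q T) S F x \<bullet> W (\<lambda>T F. q T) S F x) \<le> \<kappa>\<^sup>2 * C * ?t" if F: "F facet_of S" for F
      proof -
        have pl: "pos_lin F (face_integral F)" by (rule pos_lin_facet[OF T[OF S] F])
        have dF: "0 < diameter F" by (rule facet_pos[OF S F])
        have cq: "continuous_on F (\<lambda>x. (q S x)\<^sup>2)" by (intro continuous_intros continuous_on_polys[OF qP[OF S]])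
        have nn: "0 \<le> face_integral F (\<lambda>x. (q S x)\<^sup>2)" by (rule pos_lin_nonneg[OF pl cq]) simp
        have "inverse (sqrt (diameter F)) * inverse (sqrt (diameter F)) = 1 / diameter F"
          using dF by (simp add: inverse_eq_divide)
        then have "W (\<lambda>T F. q T) S F x \<bullet> W (\<lambda>T F. q T) S F x = (1 / diameter F) * (q S x)\<^sup>2" for x
          by (simp add: W_def power2_eq_square mult_ac)
        then have "face_integral F (\<lambda>x. W (\<lambda>T F. q T) S F x \<bullet> W (\<lambda>T F. q T) S F x) = (1 / diameter F) * face_integral F (\<lambda>x. (q S x)\<^sup>2)"
          by (simp only: pos_lin_cmult[OF pl cq])
        also have "\<dots> \<le> (\<kappa>\<^sup>2 / diameter S) * face_integral F (\<lambda>x. (q S x)\<^sup>2)"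
          using diameter_facet(2)[OF R[OF S] F] dF hS nn by (intro mult_right_mono) (auto simp: divide_simps mult.commute)
        also have "\<dots> \<le> (\<kappa>\<^sup>2 / diameter S) * (C * tint S (\<lambda>x. (q S x)\<^sup>2) / diameter S)"
          using inv_trace[OF R[OF S] qP[OF S] F] hS by (intro mult_left_mono) (auto simp: pos_le_divide_eq mult.commute)
        also have "\<dots> = \<kappa>\<^sup>2 * C * ?t" using hS unfolding tq[OF S] by (simp add: power2_eq_square)
        finally show ?thesis .
      qed
      then have "(\<Sum>F | F facet_of S. face_integral F (\<lambda>x. W (\<lambda>T F. q T) S F x \<bullet> W (\<lambda>T F. q T) S F x)) \<le> (\<Sum>F | F facet_of S. \<kappa>\<^sup>2 * C * ?t)"
        by (intro sum_mono) auto
      also have "\<dots> = (\<Sum>w\<in>verts S. \<kappa>\<^sup>2 * C * ?t)" by (rule sum_facets[OF T[OF S]])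
      finally show ?thesis by (simp add: card_verts[OF T[OF S]])
    qed
    then have "bdry_sq \<T> (W (\<lambda>T F. q T)) \<le> (\<Sum>S\<in>\<T>. 4 * \<kappa>\<^sup>2 * C * ((diameter S)\<^sup>2 * tint S (\<lambda>x. (divergence (u S) x)\<^sup>2)))"
      unfolding bdry_inner_def by (rule sum_mono)
    then show ?thesis by (simp add: Dsq_eq[OF D(2)] sum_distrib_left)
  qed
  have jj: "continuous_on F (\<lambda>x. (sqrt (diameter F) * normal_jump \<T> u F x)\<^sup>2)" if "F \<in> interior_faces \<T>" for F
    by (intro continuous_intros cont_jump[OF cc(4) that])
  \<comment> \<open>Each interior face belongs to two element boundaries, hence the factor
    2.\<close>
  have WqF: "bdry_sq \<T> (W (\<lambda>T F. qF F)) = 2 * Jsq u"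
  proof -
    have "bdry_sq \<T> (W (\<lambda>T F. qF F)) = (\<Sum>F\<in>interior_faces \<T>. \<Sum>S | S \<in> \<T> \<and> F facet_of S. face_integral F (\<lambda>x. W (\<lambda>T F. qF F) S F x \<bullet> W (\<lambda>T F. qF F) S F x))"
      unfolding bdry_inner_def
      by (rule sum_interior_faces) (simp add: W_def qF_def pos_lin_zero[OF pos_lin_facet[OF T]])
    also have "\<dots> = (\<Sum>F\<in>interior_faces \<T>. 2 * face_integral F (\<lambda>x. (sqrt (diameter F) * normal_jump \<T> u F x)\<^sup>2))"
    proof (rule sum.cong[OF refl])
      fix F assume F: "F \<in> interior_faces \<T>"
      show "(\<Sum>S | S \<in> \<T> \<and> F facet_of S. face_integral F (\<lambda>x. W (\<lambda>T F. qF F) S F x \<bullet> W (\<lambda>T F. qF F) S F x)) = 2 * face_integral F (\<lambda>x. (sqrt (diameter F) * normal_jump \<T> u F x)\<^sup>2)"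
      proof (rule interior_face_pair[OF F])
        fix S S' assume P: "S \<in> \<T>" "S' \<in> \<T>" "S \<noteq> S'" "F facet_of S" "F facet_of S'"
          and SS: "{S \<in> \<T>. F facet_of S} = {S, S'}"
        have dF: "0 < diameter F" by (rule facet_pos[OF P(1,4)])
        have "face_integral F (\<lambda>x. W (\<lambda>T F. qF F) U F x \<bullet> W (\<lambda>T F. qF F) U F x) = face_integral F (\<lambda>x. (sqrt (diameter F) * normal_jump \<T> u F x)\<^sup>2)" for U
        proof (rule pos_lin_cong[OF pos_lin_interior[OF F]])
          fix x assume x: "x \<in> F"
          have "inverse (sqrt (diameter F)) * diameter F = sqrt (diameter F)"
            using dF by (metis inverse_eq_divide mult.commute mult.right_neutral real_div_sqrt less_imp_le times_divide_eq_right)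
          then have "W (\<lambda>T F. qF F) U F x = - (sqrt (diameter F) * normal_jump \<T> u F x)"
            using F x by (simp add: W_def qF_def mult.assoc[symmetric])
          then show "W (\<lambda>T F. qF F) U F x \<bullet> W (\<lambda>T F. qF F) U F x = (sqrt (diameter F) * normal_jump \<T> u F x)\<^sup>2"
            by (simp add: power2_eq_square)
        qed
        then show ?thesis unfolding SS using P(3) by simp
      qed
    qed
    finally show ?thesis by (simp add: Jsq_def sum_distrib_left)
  qed
  have Q: "bdry_sq \<T> (W (\<lambda>T F x. q T x - qF F x)) \<le> 8 * \<kappa>\<^sup>2 * C * Dsq u + 4 * Jsq u"
  proof -
    have "W (\<lambda>T F x. q T x - qF F x) = (\<lambda>T F x. W (\<lambda>T F. q T) T F x + (- W (\<lambda>T F. qF F) T F x))"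
      by (auto simp: W_def fun_eq_iff algebra_simps)
    then have "bdry_sq \<T> (W (\<lambda>T F x. q T x - qF F x)) \<le> 2 * bdry_sq \<T> (W (\<lambda>T F. q T)) + 2 * bdry_sq \<T> (\<lambda>T F x. - W (\<lambda>T F. qF F) T F x)"
      using bd_add_le[OF cB_W[OF c'(8)], of "\<lambda>T F x. - W (\<lambda>T F. qF F) T F x"] cB_W[OF c'(9)]
      by (simp add: cB_def continuous_on_minus)
    moreover have "bdry_sq \<T> (\<lambda>T F x. - W (\<lambda>T F. qF F) T F x) = bdry_sq \<T> (W (\<lambda>T F. qF F))" by (simp add: bdry_inner_def)
    ultimately show ?thesis using Wq WqF by simp
  qed
  have Q0: "0 \<le> bdry_sq \<T> (W (\<lambda>T F x. q T x - qF F x))" by (intro bd_nonneg cB_W c')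
  have "(1 + 8 * \<kappa>\<^sup>2) * C * Dsq u \<le> 9 * \<kappa>\<^sup>2 * C * Dsq u"
    using k21 C1 D0 by (intro mult_right_mono) auto
  moreover have "0 \<le> 9 * \<kappa>\<^sup>2 * C * Jsq u" "0 \<le> C * Dsq u" using C1 D0 by auto
  ultimately have Qc: "L2_sq \<T> (\<lambda>T. grad (q T)) + bdry_sq \<T> (W (\<lambda>T F x. q T x - qF F x)) \<le> c * X"
    and Qc': "bdry_sq \<T> (W (\<lambda>T F x. q T x - qF F x)) \<le> c * X"
    using Q Qg D0 by (simp_all add: c_def X_def algebra_simps)
  have zeros: "tangential_gap (\<lambda>_ _. 0) (\<lambda>_ _. 0) = (\<lambda>_ _ _. 0)" "curl (\<lambda>_. 0) = (\<lambda>_. 0)"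
    by (auto simp: fun_eq_iff curl_zero)
  have "Dsq (\<lambda>_ _. 0) = 0" "Jsq (\<lambda>_ _. 0) = 0"
    by (simp_all add: Dsq_def Jsq_def divergence_zero normal_jump_def L2_zero_left case_prod_unfold Let_def pos_lin_zero[OF pos_lin_interior])
  then have norm: "(Sigma_norm k \<T> \<tau>)\<^sup>2 = (k\<^sup>2 + 1) * (L2_sq \<T> (\<lambda>T. grad (q T)) + bdry_sq \<T> (W (\<lambda>T F x. q T x - qF F x)))"
    unfolding \<tau>_def Sigma_norm_sq(1)[OF \<tau>[unfolded \<tau>_def]] zeros
    by (simp add: W_zero L2_zero_left bd_zero_left)
  have "(Sigma_norm k \<T> \<tau>)\<^sup>2 \<le> (k\<^sup>2 + 1) * (c * X)"
    unfolding norm by (intro mult_left_mono Qc) simp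
  moreover have "(k\<^sup>2 + 1) * X - (k\<^sup>2 + 1) * sqrt E * sqrt (c * X) \<le> B_plus k \<T> (r, u, uF, p, pF) \<tau>"
  proof -
    have gq: "L2_inner \<T> u (\<lambda>T. grad (q T)) = bdry_inner \<T> (\<lambda>T F x. outward_normal T F \<bullet> u T x) (\<lambda>T F. q T) - Dsq u"
    proof -
      have "L2_inner \<T> u (\<lambda>T. grad (q T)) = (\<Sum>S\<in>\<T>. (\<Sum>F | F facet_of S. face_integral F (\<lambda>x. (outward_normal S F \<bullet> u S x) * q S x)) - tint S (\<lambda>x. divergence (u S) x * q S x))"
        unfolding L2_inner_def tint_def[symmetric]
        by (intro sum.cong refl integration_by_parts[OF T uS qP])
      also have "\<dots> = bdry_inner \<T> (\<lambda>T F x. outward_normal T F \<bullet> u T x) (\<lambda>T F. q T) - (\<Sum>S\<in>\<T>. tint S (\<lambda>x. divergence (u S) x * q S x))"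
        by (simp add: bdry_inner_def sum_subtractf)
      also have "(\<Sum>S\<in>\<T>. tint S (\<lambda>x. divergence (u S) x * q S x)) = Dsq u"
        unfolding Dsq_def L2_inner_def tint_def[symmetric]
        by (intro sum.cong refl arg_cong[where f = "tint _"] ext) (simp add: qS power2_eq_square mult_ac)
      finally show ?thesis .
    qed
    \<comment> \<open>The two outward normals are opposite, so the contributions of the neighbours
      combine to the jump times \<open>qF\<close>.\<close>
    have nqF: "bdry_inner \<T> (\<lambda>T F x. outward_normal T F \<bullet> u T x) (\<lambda>T F. qF F) = - Jsq u"
    proof -
      have "bdry_inner \<T> (\<lambda>T F x. outward_normal T F \<bullet> u T x) (\<lambda>T F. qF F) = (\<Sum>F\<in>interior_faces \<T>. \<Sum>S | S \<in> \<T> \<and> F facet_of S. face_integral F (\<lambda>x. (outward_normal S F \<bullet> u S x) * qF F x))"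
        unfolding bdry_inner_def inner_real_def
        by (rule sum_interior_faces) (simp add: qF_def pos_lin_zero[OF pos_lin_facet[OF T]])
      also have "\<dots> = (\<Sum>F\<in>interior_faces \<T>. - face_integral F (\<lambda>x. (sqrt (diameter F) * normal_jump \<T> u F x)\<^sup>2))"
      proof (rule sum.cong[OF refl])
        fix F assume F: "F \<in> interior_faces \<T>"
        show "(\<Sum>S | S \<in> \<T> \<and> F facet_of S. face_integral F (\<lambda>x. (outward_normal S F \<bullet> u S x) * qF F x)) = - face_integral F (\<lambda>x. (sqrt (diameter F) * normal_jump \<T> u F x)\<^sup>2)"
        proof (rule interior_face_pair[OF F])
          fix S S' assume P: "S \<in> \<T>" "S' \<in> \<T>" "S \<noteq> S'" "F facet_of S" "F facet_of S'"
            and J: "\<And>v x. normal_jump \<T> v F x = outward_normal S F \<bullet> (v S x - v S' x)"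
            and SS: "{S \<in> \<T>. F facet_of S} = {S, S'}" and opp: "outward_normal S' F = - outward_normal S F"
          have pl: "pos_lin F (face_integral F)" by (rule pos_lin_interior[OF F])
          have dF: "0 < diameter F" by (rule facet_pos[OF P(1,4)])
          have cn: "continuous_on F (\<lambda>x. (outward_normal U F \<bullet> u U x) * qF F x)" if "U \<in> \<T>" "F facet_of U" for U
            using cc(11) c'(9) that by (auto simp: cB_def intro!: continuous_on_mult)
          have "(\<Sum>S | S \<in> \<T> \<and> F facet_of S. face_integral F (\<lambda>x. (outward_normal S F \<bullet> u S x) * qF F x))
             = face_integral F (\<lambda>x. (outward_normal S F \<bullet> u S x) * qF F x) + face_integral F (\<lambda>x. (outward_normal S' F \<bullet> u S' x) * qF F x)"
            unfolding SS using P(3) by simp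
          also have "\<dots> = face_integral F (\<lambda>x. (outward_normal S F \<bullet> u S x) * qF F x + (outward_normal S' F \<bullet> u S' x) * qF F x)"
            by (rule pos_lin_add[OF pl, symmetric]) (intro cn P)+
          also have "\<dots> = face_integral F (\<lambda>x. (- 1) * (sqrt (diameter F) * normal_jump \<T> u F x)\<^sup>2)"
          proof (rule pos_lin_cong[OF pl])
            fix x assume "x \<in> F"
            then have "(outward_normal S F \<bullet> u S x) * qF F x + (outward_normal S' F \<bullet> u S' x) * qF F x = - (diameter F * (normal_jump \<T> u F x * normal_jump \<T> u F x))"
              using F by (simp add: qF_def J opp inner_diff_right algebra_simps)
            then show "(outward_normal S F \<bullet> u S x) * qF F x + (outward_normal S' F \<bullet> u S' x) * qF F x = (- 1) * (sqrt (diameter F) * normal_jump \<T> u F x)\<^sup>2"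
              using dF by (simp add: power_mult_distrib) (simp add: power2_eq_square)
          qed
          also have "\<dots> = - face_integral F (\<lambda>x. (sqrt (diameter F) * normal_jump \<T> u F x)\<^sup>2)"
            using pos_lin_cmult[OF pl jj[OF F], of "- 1"] by simp
          finally show ?thesis .
        qed
      qed
      finally show ?thesis by (simp add: Jsq_def sum_negf)
    qed
    have "L2_inner \<T> u (\<lambda>T. grad (q T)) - bdry_inner \<T> (\<lambda>T F x. outward_normal T F \<bullet> u T x) (\<lambda>T F x. q T x - qF F x) = - X"
      using bd_diff_right[OF c'(8) c'(9) cc(11)] by (simp add: gq nqF X_def)
    then have "B_plus k \<T> (r, u, uF, p, pF) \<tau> = (k\<^sup>2 + 1) * X + (k\<^sup>2 + 1) * bdry_inner \<T> (W (\<lambda>T F x. p T x - pF F x)) (W (\<lambda>T F x. q T x - qF F x))"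
      unfolding \<tau>_def B_plus_eq zeros by (simp add: W_zero L2_zero_left L2_zero_right bd_zero_left bd_zero_right)
    moreover have "\<bar>bdry_inner \<T> (W (\<lambda>T F x. p T x - pF F x)) (W (\<lambda>T F x. q T x - qF F x))\<bar> \<le> sqrt E * sqrt (c * X)"
    proof -
      have "\<bar>bdry_inner \<T> (W (\<lambda>T F x. p T x - pF F x)) (W (\<lambda>T F x. q T x - qF F x))\<bar> \<le> sqrt E * sqrt (bdry_sq \<T> (W (\<lambda>T F x. q T x - qF F x)))"
        unfolding E_def by (rule bd_abs_le[OF cB_W[OF cc(10)] cB_W[OF c'(10)]])
      also have "\<dots> \<le> sqrt E * sqrt (c * X)"
        unfolding E_def by (intro mult_left_mono real_sqrt_le_mono Qc' real_sqrt_ge_zero bd_nonneg cB_W cc)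
      finally show ?thesis .
    qed
    then have "(k\<^sup>2 + 1) * (- (sqrt E * sqrt (c * X))) \<le> (k\<^sup>2 + 1) * bdry_inner \<T> (W (\<lambda>T F x. p T x - pF F x)) (W (\<lambda>T F x. q T x - qF F x))"
      by (intro mult_left_mono) auto
    ultimately show ?thesis by (simp add: mult_ac)
  qed
  ultimately show ?thesis using \<tau> by (auto simp: mult.assoc)
qed

end

section \<open>The test for the gradient of \<open>p\<close>, based on the conforming
  reconstruction\<close>

locale hdg_stable = hdg_const +
  assumes reconstruction: "\<And>p pF. (\<forall>T\<in>\<T>. p T \<in> polys (l + 1)) \<Longrightarrow>
    (\<forall>T\<in>\<T>. \<forall>F. F facet_of T \<longrightarrow> continuous_on F (pF F) \<and> (F \<subseteq> frontier \<Omega> \<longrightarrow> (\<forall>x\<in>F. pF F x = 0))) \<Longrightarrow>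
    \<exists>pc. (\<forall>T\<in>\<T>. pc T \<in> polys (l + 1)) \<and>
      (\<forall>T\<in>\<T>. \<forall>T'\<in>\<T>. \<forall>F. F facet_of T \<longrightarrow> F facet_of T' \<longrightarrow> (\<forall>x\<in>affine hull (verts F). pc T x = pc T' x)) \<and>
      (\<forall>T\<in>\<T>. \<forall>F. F facet_of T \<longrightarrow> F \<subseteq> frontier \<Omega> \<longrightarrow> (\<forall>x\<in>affine hull (verts F). pc T x = 0)) \<and>
      (\<Sum>T\<in>\<T>. tint T (\<lambda>x. grad (\<lambda>x. p T x - pc T x) x \<bullet> grad (\<lambda>x. p T x - pc T x) x))
        \<le> C * (\<Sum>T\<in>\<T>. \<Sum>F | F facet_of T. face_integral F (\<lambda>x. (p T x - pF F x)\<^sup>2) / diameter F)"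
begin

text \<open>\<open>Y\<close> is the squared norm of the test field and \<open>Z\<close> the squared
  distance between the gradients of \<open>p\<close> and of its reconstruction. As the field has
  neither curl nor tangential gap, only the coupling with \<open>p\<close> and the zero order term
  survive in the form. The number 11 is 3 from the divergence plus 8 from the normal jump.\<close>

lemma gradient_test:
  assumes \<sigma>: "(r, u, uF, p, pF) \<in> Sigma_h l m \<Omega> \<T>"
  defines "P \<equiv> L2_sq \<T> (\<lambda>T. grad (p T))" and "E \<equiv> bdry_sq \<T> (W (\<lambda>T F x. p T x - pF F x))" and "U \<equiv> L2_sq \<T> u"
  shows "\<exists>\<tau>\<in>Sigma_h l m \<Omega> \<T>. \<exists>Y Z. 0 \<le> Y \<and> 0 \<le> Z \<and> Z \<le> C * E \<and> Y \<le> 2 * P + 2 * Z \<and>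
    (Sigma_norm k \<T> \<tau>)\<^sup>2 \<le> (k\<^sup>2 + 1) * ((1 + 11 * C) * Y) \<and>
    (k\<^sup>2 + 1) * P - (k\<^sup>2 + 1) * (sqrt Z * sqrt P) - (k\<^sup>2 + 1) * (sqrt E * sqrt (4 * C * Y)) - k\<^sup>2 * (sqrt U * sqrt Y)
      \<le> B_plus k \<T> (r, u, uF, p, pF) \<tau>"
proof -
  note D = Sigma_hD[OF \<sigma>] and cc = Sigma_h_cont[OF \<sigma>]
  have pS: "p S \<in> polys (l + 1)" if "S \<in> \<T>" for S using D(4) that by (simp add: broken_space_def)
  have pFc: "continuous_on F (pF F) \<and> (F \<subseteq> frontier \<Omega> \<longrightarrow> (\<forall>x\<in>F. pF F x = 0))" if "S \<in> \<T>" "F facet_of S" for S F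
  proof
    show "continuous_on F (pF F)" using cc(9) that by (simp add: cB_def)
    show "F \<subseteq> frontier \<Omega> \<longrightarrow> (\<forall>x\<in>F. pF F x = 0)" using D(5) mesh_facesI[OF that] by (simp add: Mhat_space_def)
  qed
  obtain pc where pc: "\<And>S. S \<in> \<T> \<Longrightarrow> pc S \<in> polys (l + 1)"
    and glue: "\<And>S S' F x. S \<in> \<T> \<Longrightarrow> S' \<in> \<T> \<Longrightarrow> F facet_of S \<Longrightarrow> F facet_of S' \<Longrightarrow> x \<in> affine hull (verts F) \<Longrightarrow> pc S x = pc S' x"
    and bdz: "\<And>S F x. S \<in> \<T> \<Longrightarrow> F facet_of S \<Longrightarrow> F \<subseteq> frontier \<Omega> \<Longrightarrow> x \<in> affine hull (verts F) \<Longrightarrow> pc S x = 0"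
    and est: "(\<Sum>T\<in>\<T>. tint T (\<lambda>x. grad (\<lambda>x. p T x - pc T x) x \<bullet> grad (\<lambda>x. p T x - pc T x) x))
        \<le> C * (\<Sum>T\<in>\<T>. \<Sum>F | F facet_of T. face_integral F (\<lambda>x. (p T x - pF F x)\<^sup>2) / diameter F)"
  proof -
    have "\<forall>T\<in>\<T>. p T \<in> polys (l + 1)" using pS by blast
    moreover have "\<forall>T\<in>\<T>. \<forall>F. F facet_of T \<longrightarrow> continuous_on F (pF F) \<and> (F \<subseteq> frontier \<Omega> \<longrightarrow> (\<forall>x\<in>F. pF F x = 0))"
      using pFc by blast
    ultimately have "\<exists>pc. (\<forall>T\<in>\<T>. pc T \<in> polys (l + 1)) \<and>
      (\<forall>T\<in>\<T>. \<forall>T'\<in>\<T>. \<forall>F. F facet_of T \<longrightarrow> F facet_of T' \<longrightarrow> (\<forall>x\<in>affine hull (verts F). pc T x = pc T' x)) \<and>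
      (\<forall>T\<in>\<T>. \<forall>F. F facet_of T \<longrightarrow> F \<subseteq> frontier \<Omega> \<longrightarrow> (\<forall>x\<in>affine hull (verts F). pc T x = 0)) \<and>
      (\<Sum>T\<in>\<T>. tint T (\<lambda>x. grad (\<lambda>x. p T x - pc T x) x \<bullet> grad (\<lambda>x. p T x - pc T x) x))
        \<le> C * (\<Sum>T\<in>\<T>. \<Sum>F | F facet_of T. face_integral F (\<lambda>x. (p T x - pF F x)\<^sup>2) / diameter F)"
      by (rule reconstruction)
    then show thesis
      apply (elim exE conjE)
      apply (rule that)
      by (drule (1) bspec, assumption | assumption | (drule bspec, assumption)+, blast | blast)+
  qed
  define v where "v S = (if S \<in> \<T> then (\<lambda>x. - grad (pc S) x) else (\<lambda>_. 0))" for S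
  have vS: "v S = (\<lambda>x. - grad (pc S) x)" if "S \<in> \<T>" for S using that by (simp add: v_def)
  have gpc: "grad (pc S) \<in> vpolys l" if "S \<in> \<T>" for S using vpolys_grad[OF pc[OF that]] by simp
  have v: "v \<in> broken_space (vpolys l) \<T>" using vpolys_uminus[OF gpc] by (simp add: broken_space_def v_def)
  \<comment> \<open>A skeleton field needs one polynomial per face, so an adjacent element is
    selected; the tangential part of the gradient does not depend on the selection.\<close>
  define own where "own F = (SOME S. S \<in> \<T> \<and> F facet_of S)" for F
  have own: "own F \<in> \<T>" "F facet_of own F" if "F \<in> mesh_faces \<T>" for F
  proof -
    have "\<exists>S. S \<in> \<T> \<and> F facet_of S" using that by (auto simp: mesh_faces_def)
    from someI_ex[OF this] show "own F \<in> \<T>" "F facet_of own F" by (simp_all add: own_def)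
  qed
  define n where "n F = outward_normal (own F) F" for F
  define G where "G F x = grad (pc (own F)) x" for F x
  \<comment> \<open>Removing the normal component makes the field tangential, as
    \<open>Uhat_space\<close> requires, and does not change its cross product with the
    normal.\<close>
  define vF where "vF F = (if F \<in> mesh_faces \<T> then (\<lambda>x. if x \<in> F then - (G F x - (n F \<bullet> G F x) *\<^sub>R n F) else 0) else (\<lambda>_. 0))" for F
  have n: "outward_normal S F = n F \<or> outward_normal S F = - n F" if "S \<in> \<T>" "F facet_of S" for S F
    using normal_opposite[of "own F" S F] own[OF mesh_facesI[OF that]] that by (cases "S = own F") (auto simp: n_def)
  have n1: "n F \<bullet> n F = 1" if "F \<in> mesh_faces \<T>" for F
    using norm_outward_normal[OF T[OF own(1)[OF that]] own(2)[OF that]] by (simp add: n_def norm_eq_1)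
  have nn: "cross3 (outward_normal S F) (a *\<^sub>R n F) = 0" if "S \<in> \<T>" "F facet_of S" for S F a
    using n[OF that] by (auto simp: cross_mult_right)
  have tang: "cross3 (outward_normal S F) (vF F x) = - cross3 (outward_normal S F) (G F x)" if "S \<in> \<T>" "F facet_of S" "x \<in> F" for S F x
    using mesh_facesI[OF that(1,2)] that(3) nn[OF that(1,2)] by (simp add: vF_def Cross3.right_diff_distrib)
  have vFN: "vF F x \<bullet> outward_normal S F = 0" if "S \<in> \<T>" "F facet_of S" "x \<in> F" for S F x
    using n[OF that(1,2)] n1[OF mesh_facesI[OF that(1,2)]] mesh_facesI[OF that(1,2)] that(3)
    by (auto simp: vF_def inner_diff_right inner_commute)
  have vF: "vF \<in> Uhat_space l \<Omega> \<T>"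
  proof -
    have "\<exists>g\<in>vpolys l. vF F = (\<lambda>x. if x \<in> F then g x else 0)" if "F \<in> mesh_faces \<T>" for F
    proof
      have "G F \<in> vpolys l" using gpc[OF own(1)[OF that]] unfolding G_def[abs_def] by simp
      then show "(\<lambda>x. - (G F x - (n F \<bullet> G F x) *\<^sub>R n F)) \<in> vpolys l"
        by (intro vpolys_uminus vpolys_diff vpolys_const_scale polys_inner_const)
      show "vF F = (\<lambda>x. if x \<in> F then - (G F x - (n F \<bullet> G F x) *\<^sub>R n F) else 0)"
        using that by (simp add: vF_def)
    qed
    \<comment> \<open>On a boundary face the reconstruction vanishes on the whole plane, so its
      gradient is normal.\<close>
    moreover have "cross3 (outward_normal S F) (vF F x) = 0" if S: "S \<in> \<T>" "F facet_of S" "F \<subseteq> frontier \<Omega>" "x \<in> F" for S F x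
    proof -
      note o = own[OF mesh_facesI[OF S(1,2)]]
      have "cross3 (n F) (G F x) = 0"
        unfolding n_def G_def by (rule cross3_grad_vanishing[OF T[OF o(1)] o(2) pc[OF o(1)] bdz[OF o S(3)] S(4)])
      then have "cross3 (outward_normal S F) (G F x) = 0" using n[OF S(1,2)] by auto
      then show ?thesis by (simp add: tang[OF S(1,2,4)])
    qed
    moreover have "vF F = (\<lambda>_. 0)" if "F \<notin> mesh_faces \<T>" for F using that by (simp add: vF_def)
    ultimately show ?thesis using vFN by (simp add: Uhat_space_def skeleton_space_def)
  qed
  have gap: "tangential_gap v vF S F x = 0" if S: "S \<in> \<T>" "F facet_of S" "x \<in> F" for S F x
  proof -
    note o = own[OF mesh_facesI[OF S(1,2)]]
    \<comment> \<open>The two reconstructions agree on the plane of the face, so their gradients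
      differ by a normal vector.\<close>
    have "cross3 (outward_normal S F) (grad (\<lambda>x. pc S x - pc (own F) x) x) = 0"
    proof (rule cross3_grad_vanishing[OF T[OF S(1)] S(2) polys_diff[OF pc[OF S(1)] pc[OF o(1)]] _ S(3)])
      fix y assume "y \<in> affine hull (verts F)"
      then show "pc S y - pc (own F) y = 0" using glue[OF S(1) o(1) S(2) o(2)] by simp
    qed
    then have "cross3 (outward_normal S F) (grad (pc S) x) = cross3 (outward_normal S F) (G F x)"
      using grad_diff[OF differentiable_polys[OF pc[OF S(1)]] differentiable_polys[OF pc[OF o(1)]]]
      by (simp add: G_def Cross3.right_diff_distrib)
    then show ?thesis using tang[OF S] by (simp add: vS[OF S(1)] Cross3.right_diff_distrib)
  qed
  have curl0: "curl (v S) x = 0" if "S \<in> \<T>" for S x using curl_grad[OF pc[OF that]] by (simp add: vS[OF that])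
  define \<tau> :: dofs where "\<tau> = (\<lambda>_ _. 0, v, vF, \<lambda>_ _. 0, \<lambda>_ _. 0)"
  have \<tau>: "\<tau> \<in> Sigma_h l m \<Omega> \<T>" using v vF zero_spaces by (simp add: \<tau>_def Sigma_h_def)
  note c' = Sigma_h_cont[OF \<tau>[unfolded \<tau>_def]]
  define Y where "Y = L2_sq \<T> v"
  define Z where "Z = L2_sq \<T> (\<lambda>T x. grad (p T) x + v T x)"
  have cs: "cV (\<lambda>T x. grad (p T) x + v T x)" "cV (\<lambda>T x. - grad (p T) x)"
    using cc(7) c'(3) by (auto simp: cV_def intro: continuous_on_add continuous_on_minus)
  have Y0: "0 \<le> Y" and Z0: "0 \<le> Z" and E0: "0 \<le> E"
    unfolding Y_def Z_def E_def by (intro L2_nonneg bd_nonneg cB_W cs cc c')+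
  have YPZ: "Y \<le> 2 * P + 2 * Z"
  proof -
    have "L2_sq \<T> (\<lambda>T x. - grad (p T) x) = P" by (simp add: P_def L2_inner_def)
    then show ?thesis using L2_add_le[OF cs] by (simp add: Y_def Z_def)
  qed
  have ZE: "Z \<le> C * E"
  proof -
    have "Z = (\<Sum>T\<in>\<T>. tint T (\<lambda>x. grad (\<lambda>x. p T x - pc T x) x \<bullet> grad (\<lambda>x. p T x - pc T x) x))"
      unfolding Z_def L2_inner_def tint_def[symmetric]
      by (intro sum.cong refl arg_cong[where f = "tint _"] ext)
        (simp add: vS grad_diff[OF differentiable_polys[OF pS] differentiable_polys[OF pc]])
    moreover have "E = (\<Sum>T\<in>\<T>. \<Sum>F | F facet_of T. face_integral F (\<lambda>x. (p T x - pF F x)\<^sup>2) / diameter F)"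
      unfolding E_def bdry_inner_def
    proof (intro sum.cong refl)
      fix S F assume S: "S \<in> \<T>" and "F \<in> {F. F facet_of S}"
      then have F: "F facet_of S" by simp
      have "inverse (sqrt (diameter F)) * inverse (sqrt (diameter F)) = 1 / diameter F"
        using facet_pos[OF S F] by (simp add: inverse_eq_divide)
      then have "W (\<lambda>T F x. p T x - pF F x) S F x \<bullet> W (\<lambda>T F x. p T x - pF F x) S F x = (1 / diameter F) * (p S x - pF F x)\<^sup>2" for x
        using facet_pos[OF S F] by (simp add: W_def power2_eq_square[symmetric] power_divide inverse_eq_divide)
      moreover have "continuous_on F (\<lambda>x. (p S x - pF F x)\<^sup>2)"
        using cc(10) S F by (auto simp: cB_def intro: continuous_on_power)
      ultimately show "face_integral F (\<lambda>x. W (\<lambda>T F x. p T x - pF F x) S F x \<bullet> W (\<lambda>T F x. p T x - pF F x) S F x)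
          = face_integral F (\<lambda>x. (p S x - pF F x)\<^sup>2) / diameter F"
        by (simp only: pos_lin_cmult[OF pos_lin_facet[OF T[OF S] F]]) simp
    qed
    ultimately show ?thesis using est by simp
  qed
  have gap0: "bdry_sq \<T> (W (tangential_gap v vF)) = 0"
    by (rule bd_zero_left) (simp only: W_def gap scaleR_zero_right)
  have grad0: "grad (\<lambda>_. 0) = (\<lambda>_. 0)" by (auto simp: fun_eq_iff grad_const)
  have "(Sigma_norm k \<T> \<tau>)\<^sup>2 = k\<^sup>2 * Y + (k\<^sup>2 + 1) * (Dsq v + Jsq v)"
    unfolding \<tau>_def Sigma_norm_sq(1)[OF \<tau>[unfolded \<tau>_def]] gap0 grad0
    by (simp add: W_zero L2_zero_left bd_zero_left curl0 Y_def)
  also have "\<dots> \<le> (k\<^sup>2 + 1) * Y + (k\<^sup>2 + 1) * (3 * C * Y + 2 * (4 * C * Y))"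
    unfolding Y_def using Dsq_le[OF v] Jsq_le[OF c'(4)] trace_normal_le[OF v] Y0
    by (intro add_mono mult_left_mono mult_right_mono) (auto simp: Y_def)
  also have "\<dots> = (k\<^sup>2 + 1) * ((1 + 11 * C) * Y)" by (simp add: algebra_simps)
  finally have norm: "(Sigma_norm k \<T> \<tau>)\<^sup>2 \<le> (k\<^sup>2 + 1) * ((1 + 11 * C) * Y)" .
  have B: "B_plus k \<T> (r, u, uF, p, pF) \<tau> = - ((k\<^sup>2 + 1) * (L2_inner \<T> v (\<lambda>T. grad (p T))
      - bdry_inner \<T> (\<lambda>T F x. outward_normal T F \<bullet> v T x) (\<lambda>T F x. p T x - pF F x))) - k\<^sup>2 * L2_inner \<T> u v"
  proof -
    have z: "bdry_inner \<T> (tangential_gap v vF) (\<lambda>T F. r T) = 0" by (rule bd_zero_left) (rule gap)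
    have z': "bdry_inner \<T> (W (tangential_gap u uF)) (W (tangential_gap v vF)) = 0"
      by (rule bd_zero_right) (simp only: W_def gap scaleR_zero_right)
    show ?thesis
      unfolding \<tau>_def B_plus_eq z z' grad0 by (simp add: W_zero curl0 L2_zero_left L2_zero_right bd_zero_right)
  qed
  \<comment> \<open>The test field is written as \<open>(grad p + v) - grad p\<close>, that is, as
    minus the gradient of \<open>p\<close> plus an error of squared norm \<open>Z\<close>.\<close>
  have "P - sqrt Z * sqrt P \<le> - L2_inner \<T> v (\<lambda>T. grad (p T))"
  proof -
    have "L2_inner \<T> (\<lambda>T x. (grad (p T) x + v T x) - grad (p T) x) (\<lambda>T. grad (p T)) = L2_inner \<T> (\<lambda>T x. grad (p T) x + v T x) (\<lambda>T. grad (p T)) - P"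
      unfolding P_def by (rule L2_diff[OF cs(1) cc(7) cc(7)])
    moreover have "\<bar>L2_inner \<T> (\<lambda>T x. grad (p T) x + v T x) (\<lambda>T. grad (p T))\<bar> \<le> sqrt Z * sqrt P"
      unfolding P_def Z_def by (rule L2_abs_le[OF cs(1) cc(7)])
    ultimately show ?thesis by simp
  qed
  moreover have "\<bar>bdry_inner \<T> (\<lambda>T F x. outward_normal T F \<bullet> v T x) (\<lambda>T F x. p T x - pF F x)\<bar> \<le> sqrt E * sqrt (4 * C * Y)"
    unfolding E_def Y_def by (rule bd_normal_abs_le[OF cc(10) v]) simp
  ultimately have "(k\<^sup>2 + 1) * (P - sqrt Z * sqrt P - sqrt E * sqrt (4 * C * Y))
     \<le> (k\<^sup>2 + 1) * (- L2_inner \<T> v (\<lambda>T. grad (p T)) + bdry_inner \<T> (\<lambda>T F x. outward_normal T F \<bullet> v T x) (\<lambda>T F x. p T x - pF F x))"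
    by (intro mult_left_mono) auto
  moreover have "k\<^sup>2 * L2_inner \<T> u v \<le> k\<^sup>2 * (sqrt U * sqrt Y)"
    using L2_abs_le[OF cc(3) c'(3)] unfolding U_def Y_def by (intro mult_left_mono) auto
  ultimately have "(k\<^sup>2 + 1) * P - (k\<^sup>2 + 1) * (sqrt Z * sqrt P) - (k\<^sup>2 + 1) * (sqrt E * sqrt (4 * C * Y)) - k\<^sup>2 * (sqrt U * sqrt Y)
      \<le> B_plus k \<T> (r, u, uF, p, pF) \<tau>"
    unfolding B by (simp add: algebra_simps)
  with \<tau> Y0 Z0 ZE YPZ norm show ?thesis by blast
qed

end

section \<open>Combination of the four tests\<close>

lemma le_of_sq_le_mult: "0 \<le> a \<Longrightarrow> x\<^sup>2 \<le> a * x \<Longrightarrow> x \<le> a" for x a :: real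
  by (cases "0 < x") (auto simp: power2_eq_square)

text \<open>
  In units of \<open>c * \<beta> * N\<^sup>2\<close>, the terms in \<open>h1\<close> are at most 1; this bounds \<open>cu\<close> by 9 and
  \<open>K * X\<close> by 4, and then \<open>K * P\<close> by 64.  The sum 78 is less than 79.
\<close>

lemma four_tests_contradiction:
  fixes k c N a cu G U D J P E Y Z :: real
  assumes c: "1 \<le> c" and N: "0 < N" and nn: "0 \<le> a" "0 \<le> cu" "0 \<le> G" "0 \<le> U" "0 \<le> X" "0 \<le> P" "0 \<le> E" "0 \<le> Y" "0 \<le> Z"
    and k: "0 < k" and K: "K = k\<^sup>2 + 1" and \<beta>: "\<beta> = 1 / (79 * c)"
    and N2: "N\<^sup>2 = a + cu + G + k\<^sup>2 * U + K * (X + P + E)"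
    and h1: "a + k\<^sup>2 * U + G + K * E \<le> \<beta> * N * N"
    and h2: "cu - (sqrt a + sqrt (c * G)) * sqrt cu \<le> \<beta> * N * sqrt cu"
    and h4: "K * X - K * (sqrt E * sqrt (c * X)) \<le> \<beta> * N * sqrt (K * (c * X))"
    and h3: "K * P - K * (sqrt Z * sqrt P) - K * (sqrt E * sqrt (c * Y)) - k\<^sup>2 * (sqrt U * sqrt Y) \<le> \<beta> * N * sqrt (K * (c * Y))"
    and ZE: "Z \<le> c * E" and YPZ: "Y \<le> 2 * P + 2 * Z"
  shows False
proof -
  define s where "s = sqrt c"
  have s: "1 \<le> s" "s\<^sup>2 = c" using c by (auto simp: s_def)
  define \<kappa> where "\<kappa> = sqrt K"
  have K1: "1 \<le> K" "k\<^sup>2 \<le> K" "0 \<le> K" using K by auto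
  have \<kappa>: "0 < \<kappa>" "\<kappa>\<^sup>2 = K" using K1 by (auto simp: \<kappa>_def)
  have k\<kappa>: "k \<le> \<kappa>" using K1 k by (simp add: \<kappa>_def real_le_rsqrt)
  have \<beta>0: "0 < \<beta>" "\<beta> \<le> 1" "79 * c * \<beta> = 1" using c by (auto simp: \<beta>)
  \<comment> \<open>\<open>q\<^sup>2\<close> is the right-hand side of \<open>h1\<close>, so
    \<open>q\<close> bounds the root of every quantity controlled by the sign change;
    \<open>s * q\<close> is the unit for all further bounds.\<close>
  define q where "q = sqrt \<beta> * N"
  have q: "0 \<le> q" "q\<^sup>2 = \<beta> * N * N" using \<beta>0 N by (auto simp: q_def power_mult_distrib power2_eq_square)
  \<comment> \<open>The right-hand sides of the other tests carry \<open>\<beta> * N\<close>; since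
    \<open>\<beta> \<le> 1\<close>, this is at most \<open>q\<close>.\<close>
  have bq: "\<beta> * N \<le> q"
  proof -
    have "\<beta> * \<beta> \<le> \<beta>" using \<beta>0 by (simp add: mult_left_le)
    then have "\<beta> \<le> sqrt \<beta>" by (simp add: real_le_rsqrt power2_eq_square)
    then show ?thesis using N by (simp add: q_def)
  qed
  have pos: "0 \<le> k\<^sup>2 * U" "0 \<le> K * E" using nn K1 by auto
  have le_q: "sqrt y \<le> q" if "y \<le> \<beta> * N * N" for y
    using that q by (simp add: real_le_lsqrt real_sqrt_le_iff)
  have qa: "sqrt a \<le> q" and qG: "sqrt G \<le> q" and qU': "sqrt (k\<^sup>2 * U) \<le> q" and qE': "sqrt (K * E) \<le> q"
    by (rule le_q, use h1 nn pos in linarith)+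
  have qU: "k * sqrt U \<le> q" and qE: "\<kappa> * sqrt E \<le> q"
    using qU' qE' k by (simp_all add: real_sqrt_mult \<kappa>_def)
  have qs: "q \<le> s * q" using s q by (simp add: mult_le_cancel_right1)
  have rc: "sqrt (c * y) = s * sqrt y" and rK: "sqrt (K * (c * y)) = \<kappa> * (s * sqrt y)" for y
    by (simp_all add: s_def \<kappa>_def real_sqrt_mult)
  have K_eq: "K = \<kappa> * \<kappa>" using \<kappa>(2) by (simp add: power2_eq_square)
  \<comment> \<open>The three summands that multiply \<open>sqrt cu\<close> are at most one unit
    each.\<close>
  have x2: "sqrt cu \<le> 3 * (s * q)"
  proof (rule le_of_sq_le_mult)
    have "cu \<le> (sqrt a + s * sqrt G + \<beta> * N) * sqrt cu"
      using h2 unfolding rc by (simp add: algebra_simps)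
    also have "\<dots> \<le> (3 * (s * q)) * sqrt cu"
    proof (rule mult_right_mono)
      have "s * sqrt G \<le> s * q" using qG s by (intro mult_left_mono) auto
      then show "sqrt a + s * sqrt G + \<beta> * N \<le> 3 * (s * q)" using qa bq qs by linarith
    qed (use nn in simp)
    finally show "(sqrt cu)\<^sup>2 \<le> 3 * (s * q) * sqrt cu" using nn by simp
  qed (use s q in simp)
  have x4: "\<kappa> * sqrt X \<le> 2 * (s * q)"
  proof (rule le_of_sq_le_mult)
    have "K * X \<le> (s * (\<kappa> * sqrt E) + \<beta> * N * s) * (\<kappa> * sqrt X)"
      using h4 unfolding rK unfolding rc K_eq by (simp add: algebra_simps)
    also have "\<dots> \<le> (2 * (s * q)) * (\<kappa> * sqrt X)"
    proof (rule mult_right_mono)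
      have "s * (\<kappa> * sqrt E) \<le> s * q" "s * (\<beta> * N) \<le> s * q" using qE bq s by (auto intro!: mult_left_mono)
      then show "s * (\<kappa> * sqrt E) + \<beta> * N * s \<le> 2 * (s * q)" by (simp add: mult.commute)
    qed (use nn \<kappa> in simp)
    finally show "(\<kappa> * sqrt X)\<^sup>2 \<le> 2 * (s * q) * (\<kappa> * sqrt X)" using nn \<kappa> by (simp add: power_mult_distrib)
  qed (use s q in simp)
  have z: "\<kappa> * sqrt Z \<le> s * q"
  proof -
    have "sqrt Z \<le> s * sqrt E" using real_sqrt_le_mono[OF ZE] by (simp add: s_def real_sqrt_mult)
    then have "\<kappa> * sqrt Z \<le> \<kappa> * (s * sqrt E)" using \<kappa> by (intro mult_left_mono) auto
    also have "\<dots> = s * (\<kappa> * sqrt E)" by simp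
    also have "\<dots> \<le> s * q" using qE s by (intro mult_left_mono) auto
    finally show ?thesis .
  qed
  define t where "t = \<kappa> * sqrt P"
  have t0: "0 \<le> t" and t2: "t\<^sup>2 = K * P" using nn \<kappa> by (auto simp: t_def power_mult_distrib)
  \<comment> \<open>The factor 3/2 is a convenient upper bound for the square root of 2.\<close>
  have y: "\<kappa> * sqrt Y \<le> 3/2 * (t + s * q)"
  proof -
    have "sqrt Y \<le> sqrt (2 * P + 2 * Z)" by (rule real_sqrt_le_mono[OF YPZ])
    also have "\<dots> \<le> sqrt ((3/2 * (sqrt P + sqrt Z))\<^sup>2)"
    proof (rule real_sqrt_le_mono)
      have eq: "(3/2 * (sqrt P + sqrt Z))\<^sup>2 = 9/4 * (P + Z) + 9/2 * (sqrt P * sqrt Z)"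
        using nn by (simp add: power2_sum power_mult_distrib power_divide distrib_left)
      have "0 \<le> sqrt P * sqrt Z" using nn by simp
      then show "2 * P + 2 * Z \<le> (3/2 * (sqrt P + sqrt Z))\<^sup>2" unfolding eq using nn by (simp add: field_simps)
    qed
    also have "\<dots> = 3/2 * (sqrt P + sqrt Z)" using nn by simp
    finally have "\<kappa> * sqrt Y \<le> \<kappa> * (3/2 * (sqrt P + sqrt Z))" using \<kappa> by (intro mult_left_mono) auto
    then show ?thesis using z by (simp add: t_def algebra_simps)
  qed
  have "K * P \<le> (\<kappa> * sqrt Z) * t + (s * (\<kappa> * sqrt E) + s * (\<beta> * N)) * (\<kappa> * sqrt Y) + k * (k * sqrt U) * sqrt Y"
    using h3 unfolding rK unfolding rc K_eq by (simp add: t_def algebra_simps power2_eq_square)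
  also have "\<dots> \<le> (s * q) * t + (s * q + s * q) * (\<kappa> * sqrt Y) + \<kappa> * (s * q) * sqrt Y"
  proof -
    have "(\<kappa> * sqrt Z) * t \<le> (s * q) * t" using z t0 by (rule mult_right_mono)
    moreover have "s * (\<kappa> * sqrt E) \<le> s * q" "s * (\<beta> * N) \<le> s * q" using qE bq s by (auto intro!: mult_left_mono)
    then have "(s * (\<kappa> * sqrt E) + s * (\<beta> * N)) * (\<kappa> * sqrt Y) \<le> (s * q + s * q) * (\<kappa> * sqrt Y)"
      using \<kappa> nn by (intro mult_right_mono add_mono) auto
    moreover have "k * (k * sqrt U) \<le> \<kappa> * (s * q)" using qU qs k k\<kappa> nn \<kappa> by (intro mult_mono[OF k\<kappa>]) auto
    then have "k * (k * sqrt U) * sqrt Y \<le> \<kappa> * (s * q) * sqrt Y" using nn by (intro mult_right_mono) auto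
    ultimately show ?thesis by linarith
  qed
  also have "\<dots> = (s * q) * t + 3 * (s * q) * (\<kappa> * sqrt Y)" by (simp add: algebra_simps)
  also have "\<dots> \<le> (s * q) * t + 3 * (s * q) * (3/2 * (t + s * q))"
    using y s q by (intro add_left_mono mult_left_mono) auto
  finally have *: "t\<^sup>2 \<le> (s * q) * t + 3 * (s * q) * (3/2 * (t + s * q))" unfolding t2 .
  \<comment> \<open>Put \<open>w = s * q\<close>. If \<open>8 * w < t\<close>, then
    \<open>t\<^sup>2\<close> exceeds \<open>8 * w * t\<close>, while the quadratic inequality gives
    at most \<open>(11/2 + 9/16) * w * t\<close>.\<close>
  have t8: "t \<le> 8 * (s * q)"
  proof (rule ccontr)
    define w where "w = s * q"
    assume "\<not> t \<le> 8 * (s * q)"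
    then have t: "8 * w < t" by (simp add: w_def)
    have w: "0 \<le> w" using s q by (simp add: w_def)
    have contra: False if "8 * A < B" "8 * D \<le> A" "B \<le> 11/2 * A + 9/2 * D" "0 \<le> D" for A B D :: real
      using that by linarith
    show False
    proof (rule contra)
      have "8 * w * t < t * t" using t w by (intro mult_strict_right_mono) auto
      then show "8 * (w * t) < t\<^sup>2" by (simp add: power2_eq_square mult.assoc)
      have "w * (8 * w) \<le> w * t" using w t by (intro mult_left_mono) auto
      then show "8 * (w * w) \<le> w * t" by (simp add: mult_ac)
      show "t\<^sup>2 \<le> 11/2 * (w * t) + 9/2 * (w * w)"
        using *[folded w_def] by (simp add: field_simps)
      show "0 \<le> w * w" by simp
    qed
  qed
  have sq: "x\<^sup>2 \<le> (n * (s * q))\<^sup>2" if "0 \<le> x" "x \<le> n * (s * q)" for x n using that by (simp add: power_mono)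
  have w2: "(s * q)\<^sup>2 = c * (\<beta> * N * N)" using s q by (simp add: power_mult_distrib)
  have "cu \<le> 9 * (c * (\<beta> * N * N))"
    using sq[OF _ x2] nn unfolding power_mult_distrib[of _ "s * q"] w2 by simp
  moreover have "K * X \<le> 4 * (c * (\<beta> * N * N))"
    using sq[OF _ x4] nn \<kappa> unfolding power_mult_distrib[of _ "s * q"] w2 by (simp add: power_mult_distrib)
  moreover have "K * P \<le> 64 * (c * (\<beta> * N * N))"
    using sq[OF t0 t8] unfolding power_mult_distrib[of _ "s * q"] w2 t2 by simp
  moreover have "\<beta> * N * N \<le> c * (\<beta> * N * N)" using c \<beta>0 N by simp
  \<comment> \<open>78 = 1 + 9 + 4 + 64, where the 1 comes from \<open>h1\<close>.\<close>
  ultimately have "N\<^sup>2 \<le> 78 * (c * (\<beta> * N * N))"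
    using h1 N2 by (simp add: distrib_left)
  also have "\<dots> = 78 / 79 * N\<^sup>2" using \<beta> c by (simp add: power2_eq_square)
  finally show False using N by simp
qed

context hdg_stable
begin

text \<open>\<open>c\<close> dominates the constants of the curl, divergence and gradient tests. If
  the bound failed, the form would be at most \<open>1 / (79 * c)\<close> times the product of the
  norms for every test function, and the four tests contradict this.\<close>

lemma sup_ge:
  assumes \<sigma>: "\<sigma> \<in> Sigma_h l m \<Omega> \<T>"
  defines "c \<equiv> 9 * \<kappa>\<^sup>2 * C + 12 * C + 4"
  shows "ereal (1 / (79 * c) * Sigma_norm k \<T> \<sigma>)
    \<le> (SUP \<tau>\<in>Sigma_h l m \<Omega> \<T> - {zero_h}. ereal (B_plus k \<T> \<sigma> \<tau> / Sigma_norm k \<T> \<tau>))"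
    (is "ereal (?\<beta> * ?N) \<le> ?S")
proof (rule ccontr)
  assume "\<not> ?thesis"
  then have less: "?S < ereal (?\<beta> * ?N)" by simp
  obtain r u uF p pF where \<sigma>_eq: "\<sigma> = (r, u, uF, p, pF)" by (metis prod_cases5)
  note \<sigma>' = \<sigma>[unfolded \<sigma>_eq]
  have c: "1 \<le> c" "9 * \<kappa>\<^sup>2 * C + 4 \<le> c" "1 + 11 * C \<le> c" "4 * C \<le> c"
    using C1 by (auto simp: c_def)
  have N0: "0 \<le> ?N" by (rule Sigma_norm_nonneg[OF \<sigma>])
  have zero_norm: "Sigma_norm k \<T> zero_h = 0"
  proof -
    have "curl (\<lambda>_. 0) = (\<lambda>_. 0)" "grad (\<lambda>_. 0) = (\<lambda>_. 0)" by (auto simp: fun_eq_iff curl_zero grad_const)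
    moreover have "Dsq (\<lambda>_ _. 0) = 0" "Jsq (\<lambda>_ _. 0) = 0"
      by (simp_all add: Dsq_def Jsq_def divergence_zero normal_jump_def L2_zero_left case_prod_unfold Let_def pos_lin_zero[OF pos_lin_interior])
    ultimately show ?thesis
      unfolding zero_h_def Sigma_norm_eq by (simp add: W_zero L2_zero_left bd_zero_left W_def)
  qed
  \<comment> \<open>Test functions of norm 0 are treated separately: for them the quotient is 0 and
    carries no information on the form.\<close>
  have le: "B_plus k \<T> \<sigma> \<tau> \<le> ?\<beta> * ?N * Sigma_norm k \<T> \<tau>" if \<tau>: "\<tau> \<in> Sigma_h l m \<Omega> \<T>" for \<tau>
  proof (cases "Sigma_norm k \<T> \<tau> = 0")
    case True
    then show ?thesis using B_plus_zero[OF \<sigma> \<tau>] by simp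
  next
    case False
    then have "0 < Sigma_norm k \<T> \<tau>" using Sigma_norm_nonneg[OF \<tau>] by simp
    moreover have "\<tau> \<noteq> zero_h" using False zero_norm by auto
    then have "ereal (B_plus k \<T> \<sigma> \<tau> / Sigma_norm k \<T> \<tau>) \<le> ?S" using \<tau> by (intro SUP_upper) auto
    then have "B_plus k \<T> \<sigma> \<tau> / Sigma_norm k \<T> \<tau> \<le> ?\<beta> * ?N" using less by (meson ereal_less_eq(3) le_less_trans less_imp_le)
    ultimately show ?thesis by (simp add: pos_divide_le_eq)
  qed
  have le': "B_plus k \<T> \<sigma> \<tau> \<le> ?\<beta> * ?N * sqrt b" if "\<tau> \<in> Sigma_h l m \<Omega> \<T>" "(Sigma_norm k \<T> \<tau>)\<^sup>2 \<le> b" for \<tau> b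
  proof -
    have "Sigma_norm k \<T> \<tau> \<le> sqrt b" using that(2) by (rule real_le_rsqrt)
    then have "?\<beta> * ?N * Sigma_norm k \<T> \<tau> \<le> ?\<beta> * ?N * sqrt b" using N0 c by (intro mult_left_mono) auto
    with le[OF that(1)] show ?thesis by simp
  qed
  show False
  proof (cases "?N = 0")
    case True
    \<comment> \<open>Here the claim is that the supremum is nonnegative. Over an empty set it would
      be minus infinity, so a nonzero test function is exhibited, at which the form is 0.\<close>
    define s :: "(real^3) family" where "s S = (if S \<in> \<T> then (\<lambda>_. axis 1 1) else (\<lambda>_. 0))" for S
    define \<tau> :: dofs where "\<tau> = (s, \<lambda>_ _. 0, \<lambda>_ _. 0, \<lambda>_ _. 0, \<lambda>_ _. 0)"
    have "s \<in> broken_space (vpolys m) \<T>" by (simp add: broken_space_def s_def vpolys_def polys_const)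
    then have \<tau>: "\<tau> \<in> Sigma_h l m \<Omega> \<T>" using zero_spaces by (simp add: \<tau>_def Sigma_h_def)
    obtain S where S: "S \<in> \<T>" using nonempty by blast
    have "s \<noteq> (\<lambda>_ _. 0)"
    proof
      assume "s = (\<lambda>_ _. 0)"
      then have "s S 0 = 0" by simp
      then show False using S by (simp add: s_def axis_eq_0_iff)
    qed
    then have "\<tau> \<noteq> zero_h" by (simp add: \<tau>_def zero_h_def)
    then have "ereal (B_plus k \<T> \<sigma> \<tau> / Sigma_norm k \<T> \<tau>) \<le> ?S" using \<tau> by (intro SUP_upper) auto
    moreover have "B_plus k \<T> \<sigma> \<tau> = 0" using B_plus_zero[OF \<tau> \<sigma> True] B_plus_commute by simp
    ultimately show False using less True by simp
  next
    case False
    then have N: "0 < ?N" using N0 by simp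
    note sq = Sigma_norm_sq[OF \<sigma>']
    let ?X = "Dsq u + Jsq u" and ?E = "bdry_sq \<T> (W (\<lambda>T F x. p T x - pF F x))" and ?G = "bdry_sq \<T> (W (tangential_gap u uF))"
    let ?cu = "L2_sq \<T> (\<lambda>T. curl (u T))" and ?P = "L2_sq \<T> (\<lambda>T. grad (p T))" and ?U = "L2_sq \<T> u" and ?a = "L2_sq \<T> r"
    have X0: "0 \<le> ?X" using sq(6,7) by simp
    have cm: "sqrt E * sqrt (b * Y) \<le> sqrt E * sqrt (c * Y)" if "b \<le> c" "0 \<le> Y" "0 \<le> E" for b E Y
      using that by (intro mult_left_mono real_sqrt_le_mono mult_right_mono) auto
    from gradient_test[OF \<sigma>'] obtain \<tau>3 Y Z where t3: "\<tau>3 \<in> Sigma_h l m \<Omega> \<T>" "0 \<le> Y" "0 \<le> Z" "Z \<le> C * ?E" "Y \<le> 2 * ?P + 2 * Z"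
      "(Sigma_norm k \<T> \<tau>3)\<^sup>2 \<le> (k\<^sup>2 + 1) * ((1 + 11 * C) * Y)"
      "(k\<^sup>2 + 1) * ?P - (k\<^sup>2 + 1) * (sqrt Z * sqrt ?P) - (k\<^sup>2 + 1) * (sqrt ?E * sqrt (4 * C * Y)) - k\<^sup>2 * (sqrt ?U * sqrt Y)
      \<le> B_plus k \<T> \<sigma> \<tau>3" unfolding \<sigma>_eq by blast
    from divergence_test[OF \<sigma>'] obtain \<tau>4 where t4: "\<tau>4 \<in> Sigma_h l m \<Omega> \<T>"
      "(Sigma_norm k \<T> \<tau>4)\<^sup>2 \<le> (k\<^sup>2 + 1) * (9 * \<kappa>\<^sup>2 * C + 4) * ?X"
      "(k\<^sup>2 + 1) * ?X - (k\<^sup>2 + 1) * sqrt ?E * sqrt ((9 * \<kappa>\<^sup>2 * C + 4) * ?X) \<le> B_plus k \<T> \<sigma> \<tau>4" unfolding \<sigma>_eq by blast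
    from curl_test[OF \<sigma>'] obtain \<tau>2 where t2: "\<tau>2 \<in> Sigma_h l m \<Omega> \<T>" "(Sigma_norm k \<T> \<tau>2)\<^sup>2 = ?cu"
      "?cu - (sqrt ?a + sqrt (4 * C * ?G)) * sqrt ?cu \<le> B_plus k \<T> \<sigma> \<tau>2" unfolding \<sigma>_eq by blast
    show False
    proof (rule four_tests_contradiction[OF c(1) N sq(2,3,4,5) X0 sq(8,9) t3(2,3) k refl refl])
      show "?N\<^sup>2 = ?a + ?cu + ?G + k\<^sup>2 * ?U + (k\<^sup>2 + 1) * (?X + ?P + ?E)"
        unfolding \<sigma>_eq sq(1) by simp
      show "?a + k\<^sup>2 * ?U + ?G + (k\<^sup>2 + 1) * ?E \<le> 1 / (79 * c) * ?N * ?N"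
        using le[OF sign_flip_test(1)[OF \<sigma>']] unfolding \<sigma>_eq sign_flip_test(2,3)[OF \<sigma>'] .
      have "sqrt (4 * C * ?G) * sqrt ?cu \<le> sqrt (c * ?G) * sqrt ?cu"
        using c(4) sq(3,4) by (intro mult_right_mono real_sqrt_le_mono) auto
      then show "?cu - (sqrt ?a + sqrt (c * ?G)) * sqrt ?cu \<le> 1 / (79 * c) * ?N * sqrt ?cu"
        using le'[OF t2(1) eq_refl[OF t2(2)]] t2(3) by (simp only: distrib_right)
      have "(k\<^sup>2 + 1) * (sqrt ?E * sqrt ((9 * \<kappa>\<^sup>2 * C + 4) * ?X)) \<le> (k\<^sup>2 + 1) * (sqrt ?E * sqrt (c * ?X))"
        by (intro mult_left_mono cm c X0 sq) simp
      moreover have "(Sigma_norm k \<T> \<tau>4)\<^sup>2 \<le> (k\<^sup>2 + 1) * (c * ?X)"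
        by (rule order_trans[OF t4(2)], unfold mult.assoc[of "k\<^sup>2 + 1"], intro mult_left_mono mult_right_mono c X0) simp
      from le'[OF t4(1) this]
      have "B_plus k \<T> \<sigma> \<tau>4 \<le> 1 / (79 * c) * ?N * sqrt ((k\<^sup>2 + 1) * (c * ?X))" .
      ultimately show "(k\<^sup>2 + 1) * ?X - (k\<^sup>2 + 1) * (sqrt ?E * sqrt (c * ?X)) \<le> 1 / (79 * c) * ?N * sqrt ((k\<^sup>2 + 1) * (c * ?X))"
        using t4(3) unfolding mult.assoc[of "k\<^sup>2 + 1" "sqrt ?E"] by linarith
      have "(k\<^sup>2 + 1) * (sqrt ?E * sqrt (4 * C * Y)) \<le> (k\<^sup>2 + 1) * (sqrt ?E * sqrt (c * Y))"
        by (intro mult_left_mono cm c t3 sq) simp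
      moreover have "(Sigma_norm k \<T> \<tau>3)\<^sup>2 \<le> (k\<^sup>2 + 1) * (c * Y)"
        by (rule order_trans[OF t3(6)], intro mult_left_mono mult_right_mono c t3) simp
      from le'[OF t3(1) this]
      have "B_plus k \<T> \<sigma> \<tau>3 \<le> 1 / (79 * c) * ?N * sqrt ((k\<^sup>2 + 1) * (c * Y))" .
      ultimately show "(k\<^sup>2 + 1) * ?P - (k\<^sup>2 + 1) * (sqrt Z * sqrt ?P) - (k\<^sup>2 + 1) * (sqrt ?E * sqrt (c * Y)) - k\<^sup>2 * (sqrt ?U * sqrt Y)
          \<le> 1 / (79 * c) * ?N * sqrt ((k\<^sup>2 + 1) * (c * Y))"
        using t3(7) by linarith
      have "C * ?E \<le> c * ?E" using c C1 sq(9) by (intro mult_right_mono) auto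
      then show "Z \<le> c * ?E" using t3(4) by simp
    qed (rule t3(5))
  qed
qed

end

theorem theorem4p1:
  fixes \<Omega> :: "(real^3) set" and l m :: nat and \<kappa> :: real
  assumes "bounded \<Omega>" and "lipschitz_polyhedron \<Omega>"
    and "simply_connected \<Omega>" and "connected (frontier \<Omega>)"
    and "1 \<le> l" and "m \<in> {l - 1, l}"
  shows "\<exists>\<beta>>0. \<forall>k>0. \<forall>\<T>. simplicial_mesh \<Omega> \<T> \<and> shape_regular \<kappa> \<T> \<longrightarrow>
    (\<forall>\<sigma>\<in>Sigma_h l m \<Omega> \<T>.
       (SUP \<tau>\<in>Sigma_h l m \<Omega> \<T> - {zero_h}. ereal (B_plus k \<T> \<sigma> \<tau> / Sigma_norm k \<T> \<tau>))
         = (SUP \<tau>\<in>Sigma_h l m \<Omega> \<T> - {zero_h}. ereal (B_plus k \<T> \<tau> \<sigma> / Sigma_norm k \<T> \<tau>)) \<and>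
       (SUP \<tau>\<in>Sigma_h l m \<Omega> \<T> - {zero_h}. ereal (B_plus k \<T> \<tau> \<sigma> / Sigma_norm k \<T> \<tau>))
         \<ge> ereal (\<beta> * Sigma_norm k \<T> \<sigma>))"
proof (cases "0 < \<kappa>")
  case False
  \<comment> \<open>Any element forces \<open>\<kappa> \<ge> 2\<close>, so a nonpositive
    \<open>\<kappa>\<close> admits no mesh of the nonempty domain, and every \<open>\<beta>\<close>
    will do.\<close>
  have no_mesh: "\<not> (simplicial_mesh \<Omega> \<T> \<and> shape_regular \<kappa> \<T>)" for \<T>
  proof
    assume "simplicial_mesh \<Omega> \<T> \<and> shape_regular \<kappa> \<T>"
    then interpret hdg \<Omega> \<kappa> 1 l m \<T>
      using assms(2,5,6) by unfold_locales (simp_all add: lipschitz_polyhedron_def)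
    show False using kappa False by simp
  qed
  show ?thesis
    by (rule exI[of _ 1], rule conjI[OF zero_less_one], intro allI impI, erule notE[OF no_mesh])
next
  case True
  \<comment> \<open>This constant and the next depend on \<open>\<kappa>\<close> and
    \<open>l\<close> only. They are obtained before \<open>k\<close> and the mesh are introduced,
    which makes \<open>\<beta>\<close> uniform in both.\<close>
  obtain C1 where "0 < C1" and C1: "\<forall>T p. reg \<kappa> T \<longrightarrow> p \<in> polys (l + 1) \<longrightarrow>
    (\<forall>F. F facet_of T \<longrightarrow> diameter T * face_integral F (\<lambda>x. (p x)\<^sup>2) \<le> C1 * tint T (\<lambda>x. (p x)\<^sup>2)) \<and>
    (diameter T)\<^sup>2 * tint T (\<lambda>x. grad p x \<bullet> grad p x) \<le> C1 * tint T (\<lambda>x. (p x)\<^sup>2)"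
    using inverse_estimate_polys[OF True, of "l + 1"] by (elim exE conjE) (rule that)
  have "1 \<le> l + 1" by simp
  from conforming_reconstruction[OF True this] obtain C2 where "0 < C2" and C2: "\<forall>\<T> bd p pF. mesh \<kappa> \<T> \<longrightarrow> (\<forall>T\<in>\<T>. p T \<in> polys (l + 1)) \<longrightarrow>
    (\<forall>T\<in>\<T>. \<forall>F. F facet_of T \<longrightarrow> continuous_on F (pF F) \<and> (bd F \<longrightarrow> (\<forall>x\<in>F. pF F x = 0))) \<longrightarrow>
    (\<exists>pc. (\<forall>T\<in>\<T>. pc T \<in> polys (l + 1)) \<and>
      (\<forall>T\<in>\<T>. \<forall>T'\<in>\<T>. \<forall>F. F facet_of T \<longrightarrow> F facet_of T' \<longrightarrow> (\<forall>x\<in>affine hull (verts F). pc T x = pc T' x)) \<and>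
      (\<forall>T\<in>\<T>. \<forall>F. F facet_of T \<longrightarrow> bd F \<longrightarrow> (\<forall>x\<in>affine hull (verts F). pc T x = 0)) \<and>
      (\<Sum>T\<in>\<T>. tint T (\<lambda>x. grad (\<lambda>x. p T x - pc T x) x \<bullet> grad (\<lambda>x. p T x - pc T x) x))
        \<le> C2 * (\<Sum>T\<in>\<T>. \<Sum>F | F facet_of T. face_integral F (\<lambda>x. (p T x - pF F x)\<^sup>2) / diameter F))"
    by (elim exE conjE) (rule that)
  \<comment> \<open>A single constant, at least 1, for the inverse estimates and the
    reconstruction.\<close>
  define C where "C = 1 + C1 + C2"
  have C: "1 \<le> C" "C1 \<le> C" "C2 \<le> C" using \<open>0 < C1\<close> \<open>0 < C2\<close> by (simp_all add: C_def)
  define \<beta> where "\<beta> = 1 / (79 * (9 * \<kappa>\<^sup>2 * C + 12 * C + 4))"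
  have "0 < \<beta>" using C True unfolding \<beta>_def by (intro divide_pos_pos mult_pos_pos add_nonneg_pos) auto
  moreover have "(SUP \<tau>\<in>Sigma_h l m \<Omega> \<T> - {zero_h}. ereal (B_plus k \<T> \<sigma> \<tau> / Sigma_norm k \<T> \<tau>))
         = (SUP \<tau>\<in>Sigma_h l m \<Omega> \<T> - {zero_h}. ereal (B_plus k \<T> \<tau> \<sigma> / Sigma_norm k \<T> \<tau>)) \<and>
       (SUP \<tau>\<in>Sigma_h l m \<Omega> \<T> - {zero_h}. ereal (B_plus k \<T> \<tau> \<sigma> / Sigma_norm k \<T> \<tau>))
         \<ge> ereal (\<beta> * Sigma_norm k \<T> \<sigma>)"
    if k: "0 < k" and sm: "simplicial_mesh \<Omega> \<T> \<and> shape_regular \<kappa> \<T>" and \<sigma>: "\<sigma> \<in> Sigma_h l m \<Omega> \<T>" for k \<T> \<sigma>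
  proof -
    interpret hdg \<Omega> \<kappa> k l m \<T>
      using assms(2,5,6) sm k by unfold_locales (simp_all add: lipschitz_polyhedron_def)
    have C1_le: "C1 * tint S (\<lambda>x. (f x)\<^sup>2) \<le> C * tint S (\<lambda>x. (f x)\<^sup>2)" if "reg \<kappa> S" "f \<in> polys j" for S f j
      by (intro mult_right_mono C pos_lin_nonneg[OF pos_lin_tint[OF reg_simplex[OF that(1)]]] continuous_on_power
          continuous_on_polys[OF that(2)]) simp
    interpret hdg_const \<Omega> \<kappa> k l m \<T> C
    proof
      show "1 \<le> C" by (rule C)
      fix S p assume S: "reg \<kappa> S" "p \<in> polys (l + 1)"
      note est = C1[rule_format, OF S]
      show "diameter S * face_integral F (\<lambda>x. (p x)\<^sup>2) \<le> C * tint S (\<lambda>x. (p x)\<^sup>2)" if F: "F facet_of S" for F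
        by (rule order_trans[OF conjunct1[OF est, rule_format, OF F] C1_le[OF S]])
      show "(diameter S)\<^sup>2 * tint S (\<lambda>x. grad p x \<bullet> grad p x) \<le> C * tint S (\<lambda>x. (p x)\<^sup>2)"
        by (rule order_trans[OF conjunct2[OF est] C1_le[OF S]])
    qed
    interpret hdg_stable \<Omega> \<kappa> k l m \<T> C
    proof
      fix p pF :: "real family"
      assume p: "\<forall>T\<in>\<T>. p T \<in> polys (l + 1)"
        and pF: "\<forall>T\<in>\<T>. \<forall>F. F facet_of T \<longrightarrow> continuous_on F (pF F) \<and> (F \<subseteq> frontier \<Omega> \<longrightarrow> (\<forall>x\<in>F. pF F x = 0))"
      have "0 \<le> face_integral F (\<lambda>x. (p S x - pF F x)\<^sup>2) / diameter F" if S: "S \<in> \<T>" "F facet_of S" for S F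
      proof -
        have "continuous_on F (p S)" "continuous_on F (pF F)"
          using p pF S by (auto intro: continuous_on_polys)
        then have "0 \<le> face_integral F (\<lambda>x. (p S x - pF F x)\<^sup>2)"
          by (intro pos_lin_nonneg[OF pos_lin_facet[OF T[OF S(1)] S(2)]] continuous_intros) simp_all
        then show ?thesis using facet_pos[OF S] by simp
      qed
      then have "C2 * (\<Sum>T\<in>\<T>. \<Sum>F | F facet_of T. face_integral F (\<lambda>x. (p T x - pF F x)\<^sup>2) / diameter F)
         \<le> C * (\<Sum>T\<in>\<T>. \<Sum>F | F facet_of T. face_integral F (\<lambda>x. (p T x - pF F x)\<^sup>2) / diameter F)"
        by (intro mult_right_mono C sum_nonneg) auto
      note final = order_trans[OF _ this]
      \<comment> \<open>The abstract boundary predicate becomes inclusion in the frontier of the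
        domain.\<close>
      from C2[THEN spec, THEN spec[of _ "\<lambda>F. F \<subseteq> frontier \<Omega>"], THEN spec, THEN spec, THEN mp, OF M, THEN mp, OF p, THEN mp, OF pF]
      show "\<exists>pc. (\<forall>T\<in>\<T>. pc T \<in> polys (l + 1)) \<and>
        (\<forall>T\<in>\<T>. \<forall>T'\<in>\<T>. \<forall>F. F facet_of T \<longrightarrow> F facet_of T' \<longrightarrow> (\<forall>x\<in>affine hull (verts F). pc T x = pc T' x)) \<and>
        (\<forall>T\<in>\<T>. \<forall>F. F facet_of T \<longrightarrow> F \<subseteq> frontier \<Omega> \<longrightarrow> (\<forall>x\<in>affine hull (verts F). pc T x = 0)) \<and>
        (\<Sum>T\<in>\<T>. tint T (\<lambda>x. grad (\<lambda>x. p T x - pc T x) x \<bullet> grad (\<lambda>x. p T x - pc T x) x))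
          \<le> C * (\<Sum>T\<in>\<T>. \<Sum>F | F facet_of T. face_integral F (\<lambda>x. (p T x - pF F x)\<^sup>2) / diameter F)"
        by (elim exE conjE) (intro exI conjI, assumption+, rule final)
    qed
    \<comment> \<open>By symmetry of the form both suprema are taken over the same
      quotients.\<close>
    have comm: "B_plus k \<T> \<tau> \<sigma> = B_plus k \<T> \<sigma> \<tau>" for \<tau> by (rule B_plus_commute)
    show ?thesis using sup_ge[OF \<sigma>] unfolding comm \<beta>_def by simp
  qed
  ultimately show ?thesis by blast
qed

end
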